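(* Let $P_0>0$ and $$D_0=\Big\{f(\lambda)\ \Big|\ \frac1{2\pi}\int_{-\pi}^\pi f(\lambda)d\lambda\le P_0\Big\}.$$ Consider the equations for $\varphi_N=(\varphi(0),\ldots,\varphi(N))$ $$D_N^\mu A_NW_N^\mu\varphi_N=\alpha\overline{\varphi}_N,\quad\alpha\in\mathbb C,\qquad(\mathrm E_1)$$ $$\hat D_N^\mu A_NW_N^\mu\varphi_N=\beta\overline{\varphi}_N,\quad\beta\in\mathbb C,\qquad(\mathrm E_2)$$ and densities of the form $$f^0(\lambda)=\Big|c\sum_{k=0}^N(D_N^\mu A_N\varphi_{\mu,N})_ke^{i\lambda k}\Big|^2,\qquad\varphi_{\mu,N}=W_N^\mu\varphi_N,\ c\text{ a constant}.\qquad(\mathrm F)$$ Let $\nu_0^NP_0$ be the maximum value of $\|D_N^\mu A_NW_N^\mu\varphi_N\|^2=\|\hat D_N^\mu A_NW_N^\mu\varphi_N\|^2$ on the set of solutions $\varphi_N$ of $(\mathrm E_1)$ or $(\mathrm E_2)$ which satisfy $\|\varphi_N\|^2=P_0$ and determine the canonical factorization of the spectral density $f^0(\lambda)=|\sum_{k=0}^N\varphi(k)e^{-i\lambda k}|^2\in D_0$. Let $\nu_0^{N+}P_0$ be the maximum value of $\|D_N^\mu A_NW_N^\mu\varphi_N\|^2$ on the set of those $\varphi_N$ which satisfy $\|\varphi_N\|^2=P_0$ and determine the canonical factorization of the spectral density $f^0(\lambda)$ given by (F). 1. If there exists a solution $\varphi_N^0=\{\varphi^0(m):m=0,\ldots,N\}$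 of $(\mathrm E_1)$ or $(\mathrm E_2)$ which satisfies $\|\varphi_N^0\|^2=P_0$ and $\nu_0^NP_0=\nu_0^{N+}P_0=\|D_N^\mu A_NW_N^\mu\varphi_N^0\|^2$, then the spectral density $$f^0(\lambda)=\Big|\sum_{k=0}^N\varphi^0(k)e^{-i\lambda k}\Big|^2$$ is least favorable in the class $D_0$ for the optimal estimation of the functional $A_N\xi=\sum_{k=0}^Na(k)\xi(k)$ of the unknown values $\xi(k)$, $k=0,\ldots,N$, of the stochastic sequence with stationary $n$th increments, and the increment sequence $\xi^{(n)}(m,\mu)$ admits a one-sided moving average representation of order $N$. 2. If $\nu_0^N<\nu_0^{N+}$, the density (F) which admits the canonical factorization is least favorable in the class $D_0$. Here the sequence $c\varphi_{\mu,N}=\{c\varphi_\mu(k):k=0,\ldots,N\}$ is determined by the equation $\varphi_{\mu,N}=W_N^\mu\varphi_N$, by the conditional extremum problem $$\|D_N^\mu A_N\varphi_{\mu,N}\|^2\to\max,\qquad f(\lambda)=\Big|\sum_{k=0}^N\varphi(k)e^{-i\lambda k}\Big|^2\in D_0,$$ and by the condition $\int_{-\pi}^\pi f(\lambda)d\lambda=2\pi P_0$.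
   Context: Let $n\ge 1$, $\mu>0$, $N\ge0$ be integers. For a stochastic sequence $\{\xi(m),m\in\mathbb Z\}$ put $\xi^{(n)}(m,\mu)=\sum_{l=0}^n(-1)^l\binom nl\xi(m-l\mu)$. The sequence has stationary $n$th increments if $\mathrm E\xi^{(n)}(m_0,\mu)$ and $\mathrm E\xi^{(n)}(m_0+m,\mu_1)\overline{\xi^{(n)}(m_0,\mu_2)}$ exist for all integers $m_0,m,\mu,\mu_1,\mu_2$ and do not depend on $m_0$; the mean of the increments is assumed to be $0$. It has spectral density $f$ if $\xi^{(n)}(m,\mu)=\int_{-\pi}^{\pi}e^{i\lambda m}(1-e^{-i\mu\lambda})^n(i\lambda)^{-n}dZ(\lambda)$ with an orthogonal stochastic measure $Z$, $\mathrm E|Z(d\lambda)|^2=\frac1{2\pi}f(\lambda)d\lambda$. A one-sided moving average representation of order $N$ is $\xi^{(n)}(m,\mu)=\sum_{k=0}^N\varphi^{(n)}(k,\mu)\varepsilon_{m-k}$ with $\varepsilon$ uncorrelated, mean $0$, variance $1$. Canonical factorization of $f$: $f(\lambda)=|\Phi(e^{-i\lambda})|^2$, $\Phi(z)=\sum_{k\ge0}\varphi(k)z^k$, with convergence radius $>1$ and no zeros of $\Phi$ in $\{|z|\le1\}$; a finite vector $\varphi_N$ determines the factorization if this holds with $\varphi(k)=0$ for $k>N$. Let $w_\mu(z)=\sum_{k\ge0}w_\mu(k)z^k=\exp\{\frac1{4\pi}\int_{-\pi}^{\pi}\frac{e^{i\lambda}+z}{e^{i\lambda}-z}\ln\frac{|1-e^{-i\lambda\mu}|^{2n}}{\lambda^{2n}}d\lambda\}$,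 so $|w_\mu(e^{-i\lambda})|^2=|1-e^{-i\lambda\mu}|^{2n}\lambda^{-2n}$; $\Phi_\mu(z)=\sum_k\varphi_\mu(k)z^k=w_\mu(z)\Phi(z)$. $W_N^\mu$ is the $(N+1)\times(N+1)$ matrix with elements $W^\mu_{j,k}=w_\mu(j-k)$ for $0\le k\le j\le N$, $0$ for $j<k$; $\varphi_{\mu,N}=(\varphi_\mu(0),\ldots,\varphi_\mu(N))=W_N^\mu\varphi_N$. The numbers $d_\mu(k)$ are defined by $\sum_{k\ge0}d_\mu(k)x^k=(\sum_{j\ge0}x^{\mu j})^n$. $D_N^\mu$ is the $(N+1)\times(N+1)$ matrix with entries $d_\mu(j-k)$ for $0\le k\le j\le N$, $0$ for $j<k$. $A_N$ has entries $(A_N)_{k,j}=a(k+j)$ if $k+j\le N$, $0$ otherwise, $0\le k,j\le N$. $\hat D_N^\mu$ is the matrix such that $(\hat D_N^\mu A_N\varphi_{\mu,N})_k=\sum_{m=0}^N\sum_{l=N-k}^N\varphi_\mu(m)a(m+l)d_\mu(l+k-N)$, $k=0,\ldots,N$, with $a(p)=0$ for $p>N$; i.e. its $(k,l)$ entry is $d_\mu(l+k-N)$ for $l\ge N-k$ and $0$ otherwise. Norms are Euclidean; the bar is coordinatewise conjugation. Estimation: $A_N\xi=\sum_{k=0}^Nb_{\mu,N}(k)\xi^{(n)}(k,\mu)-V_N\xi$, where $b_{\mu,N}(k)=\sum_{m=k}^Na(m)d_\mu(m-k)$, $V_N\xi=\sum_{k=-\mu n}^{-1}v_{\mu,N}(k)\xi(k)$,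 $v_{\mu,N}(k)=\sum_{l=\lceil-k/\mu\rceil}^{\min\{\lfloor(N-k)/\mu\rfloor,n\}}(-1)^l\binom nlb_{\mu,N}(l\mu+k)$. The observations are $\xi(m)$, $m\le-1$. $L_2^{0-}(f)$ is the closed subspace of $L_2(f)$ generated by $e^{i\lambda k}(1-e^{-i\lambda\mu})^n(i\lambda)^{-n}$, $k\le-1$. A linear estimate with spectral characteristic $h$ is $\hat A_N\xi=-V_N\xi+\int h(\lambda)(1-e^{-i\lambda\mu})^n(i\lambda)^{-n}dZ(\lambda)$ with $h(\lambda)(1-e^{-i\lambda\mu})^n(i\lambda)^{-n}\in L_2^{0-}(f)$; $\Delta(h;f)=\mathrm E|A_N\xi-\hat A_N\xi|^2$, and $h^{(a)}_{\mu,N}(f)$ is the spectral characteristic minimizing it. If $f$ admits the canonical factorization, $\Delta(h^{(a)}_{\mu,N}(f);f)=\|D_N^\mu A_N\varphi_{\mu,N}\|^2$. A density $f^0\in D$ is least favorable in a class $D$ for the optimal linear estimation of $A_N\xi$ if $\Delta(h^{(a)}_{\mu,N}(f^0);f^0)=\max_{f\in D}\Delta(h^{(a)}_{\mu,N}(f);f)$.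
   Formalization: The order-N moving average of white noise is false as stated (e.g. N=0, n=μ=1, a(0)=1: increment density is not constant). It is replaced by an (N+1)-term moving average of white noise ε passed through the fixed filter w_μ, i.e. Φ_μ = w_μΦ with deg Φ ≤ N. *)

theory Defs
  imports
    "HOL-Probability.Probability"
    "HOL-Computational_Algebra.Formal_Power_Series"
    "Jordan_Normal_Form.Conjugate"
    "Jordan_Normal_Form.Matrix"
begin

unbundle no vec_syntax
hide_const (open) Finite_Cartesian_Product.vec Finite_Cartesian_Product.mat
hide_type (open) Finite_Cartesian_Product.vec

definition increment :: "nat \<Rightarrow> (int \<Rightarrow> 'w \<Rightarrow> complex) \<Rightarrow> int \<Rightarrow> int \<Rightarrow> 'w \<Rightarrow> complex" where
  "increment n \<xi> m \<mu> \<omega> = (\<Sum>l\<le>n. (-1) ^ l * of_nat (n choose l) * \<xi> (m - int l * \<mu>) \<omega>)"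

definition stationary_increments ::
    "'w measure \<Rightarrow> nat \<Rightarrow> (int \<Rightarrow> 'w \<Rightarrow> complex) \<Rightarrow> bool" where
  "stationary_increments M n \<xi> \<longleftrightarrow>
     (\<forall>m. \<xi> m \<in> borel_measurable M) \<and>
     (\<forall>m \<mu>. integrable M (increment n \<xi> m \<mu>) \<and>
        prob_space.expectation M (increment n \<xi> m \<mu>) = 0) \<and>
     (\<forall>m \<mu>1 \<mu>2.
        (\<forall>m0. integrable M (\<lambda>\<omega>. increment n \<xi> (m0 + m) \<mu>1 \<omega> * cnj (increment n \<xi> m0 \<mu>2 \<omega>))) \<and>
        (\<exists>C. \<forall>m0. prob_space.expectation M
           (\<lambda>\<omega>. increment n \<xi> (m0 + m) \<mu>1 \<omega> * cnj (increment n \<xi> m0 \<mu>2 \<omega>)) = C))"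

definition density_fun :: "(real \<Rightarrow> real) \<Rightarrow> bool" where
  "density_fun f \<longleftrightarrow> (\<forall>t\<in>{-pi..pi}. 0 \<le> f t) \<and> set_integrable lborel {-pi..pi} f"

text \<open>A centred random set function on the Borel subsets of \<open>[-\<pi>, \<pi>]\<close> with
  \<open>E Z(A) (Z(B))\<^sup>* = (1/2\<pi>) \<integral>\<^bsub>A \<inter> B\<^esub> f\<close>;
  additivity of \<open>Z\<close> in mean square follows from this identity.\<close>

definition orthogonal_stochastic_measure ::
    "'w measure \<Rightarrow> (real \<Rightarrow> real) \<Rightarrow> (real set \<Rightarrow> 'w \<Rightarrow> complex) \<Rightarrow> bool" where
  "orthogonal_stochastic_measure M f Z \<longleftrightarrow>
     (\<forall>A\<in>sets borel. A \<subseteq> {-pi..pi} \<longrightarrow>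
        Z A \<in> borel_measurable M \<and>
        integrable M (\<lambda>\<omega>. (cmod (Z A \<omega>))\<^sup>2) \<and>
        prob_space.expectation M (Z A) = 0) \<and>
     (\<forall>A\<in>sets borel. \<forall>B\<in>sets borel. A \<subseteq> {-pi..pi} \<longrightarrow> B \<subseteq> {-pi..pi} \<longrightarrow>
        prob_space.expectation M (\<lambda>\<omega>. Z A \<omega> * cnj (Z B \<omega>)) =
          complex_of_real (1 / (2 * pi) * (LINT t:A \<inter> B|lborel. f t)))"

definition spectral_sqdist ::
    "(real \<Rightarrow> real) \<Rightarrow> (real \<Rightarrow> complex) \<Rightarrow> (real \<Rightarrow> complex) \<Rightarrow> ennreal" where
  "spectral_sqdist f g h =
     (\<integral>\<^sup>+t\<in>{-pi..pi}. ennreal ((cmod (g t - h t))\<^sup>2 * f t) \<partial>lborel)"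

definition mean_sqdist ::
    "'w measure \<Rightarrow> ('w \<Rightarrow> complex) \<Rightarrow> ('w \<Rightarrow> complex) \<Rightarrow> ennreal" where
  "mean_sqdist M X Y = (\<integral>\<^sup>+\<omega>. ennreal ((cmod (X \<omega> - Y \<omega>))\<^sup>2) \<partial>M)"

definition simple_stochastic_integral ::
    "(real set \<Rightarrow> 'w \<Rightarrow> complex) \<Rightarrow> (real \<Rightarrow> complex) \<Rightarrow> 'w \<Rightarrow> complex" where
  "simple_stochastic_integral Z s \<omega> =
     (\<Sum>y\<in>s ` {-pi..pi}. y * Z {t\<in>{-pi..pi}. s t = y} \<omega>)"

text \<open>\<open>X = \<integral> g dZ\<close> (almost surely): the mean-square limit of integrals of simple functions
  that converge to \<open>g\<close> in \<open>L\<^sub>2(f)\<close>.\<close>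

definition has_stochastic_integral ::
    "'w measure \<Rightarrow> (real \<Rightarrow> real) \<Rightarrow> (real set \<Rightarrow> 'w \<Rightarrow> complex) \<Rightarrow>
     (real \<Rightarrow> complex) \<Rightarrow> ('w \<Rightarrow> complex) \<Rightarrow> bool" where
  "has_stochastic_integral M f Z g X \<longleftrightarrow>
     g \<in> borel_measurable borel \<and> X \<in> borel_measurable M \<and>
     (\<exists>s. (\<forall>j. simple_function borel (s j)) \<and>
        (\<lambda>j. spectral_sqdist f g (s j)) \<longlonglongrightarrow> 0 \<and>
        (\<lambda>j::nat. mean_sqdist M X (simple_stochastic_integral Z (s j))) \<longlonglongrightarrow> 0)"

definition increment_kernel :: "nat \<Rightarrow> int \<Rightarrow> real \<Rightarrow> complex" where
  "increment_kernel n \<mu> t = (1 - cis (- (of_int \<mu> * t))) ^ n / (\<i> * of_real t) ^ n"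

text \<open>One measure \<open>Z\<close> represents the increments with all steps \<open>\<mu>\<close>.\<close>

definition spectral_representation ::
    "'w measure \<Rightarrow> nat \<Rightarrow> (int \<Rightarrow> 'w \<Rightarrow> complex) \<Rightarrow> (real \<Rightarrow> real) \<Rightarrow>
     (real set \<Rightarrow> 'w \<Rightarrow> complex) \<Rightarrow> bool" where
  "spectral_representation M n \<xi> f Z \<longleftrightarrow>
     stationary_increments M n \<xi> \<and> density_fun f \<and> orthogonal_stochastic_measure M f Z \<and>
     (\<forall>m \<mu>. has_stochastic_integral M f Z
        (\<lambda>t. cis (of_int m * t) * increment_kernel n \<mu> t) (increment n \<xi> m \<mu>))"

definition has_spectral_density ::
    "'w measure \<Rightarrow> nat \<Rightarrow> (int \<Rightarrow> 'w \<Rightarrow> complex) \<Rightarrow> (real \<Rightarrow> real) \<Rightarrow> bool" where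
  "has_spectral_density M n \<xi> f \<longleftrightarrow> (\<exists>Z. spectral_representation M n \<xi> f Z)"

definition canonical_factorization :: "(real \<Rightarrow> real) \<Rightarrow> (nat \<Rightarrow> complex) \<Rightarrow> bool" where
  "canonical_factorization f \<phi> \<longleftrightarrow>
     conv_radius \<phi> > 1 \<and>
     (\<forall>z. cmod z \<le> 1 \<longrightarrow> (\<Sum>k. \<phi> k * z ^ k) \<noteq> 0) \<and>
     (\<forall>t\<in>{-pi..pi}. f t = (cmod (\<Sum>k. \<phi> k * cis (- t) ^ k))\<^sup>2)"

definition admits_canonical_factorization :: "(real \<Rightarrow> real) \<Rightarrow> bool" where
  "admits_canonical_factorization f \<longleftrightarrow> (\<exists>\<phi>. canonical_factorization f \<phi>)"

definition determines_factorization :: "complex vec \<Rightarrow> (real \<Rightarrow> real) \<Rightarrow> bool" where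
  "determines_factorization \<phi> f \<longleftrightarrow>
     canonical_factorization f (\<lambda>k. if k < dim_vec \<phi> then \<phi> $ k else 0)"

definition w_fun :: "nat \<Rightarrow> nat \<Rightarrow> complex \<Rightarrow> complex" where
  "w_fun n \<mu> z = exp (complex_of_real (1 / (4 * pi)) *
     (LINT t:{-pi..pi}|lborel. (cis t + z) / (cis t - z) *
        complex_of_real (ln ((cmod (1 - cis (- (t * real \<mu>)))) ^ (2 * n) / t ^ (2 * n)))))"

definition w_coeff :: "nat \<Rightarrow> nat \<Rightarrow> nat \<Rightarrow> complex" where
  "w_coeff n \<mu> k = (deriv ^^ k) (w_fun n \<mu>) 0 / fact k"

definition d_coeff :: "nat \<Rightarrow> nat \<Rightarrow> nat \<Rightarrow> nat" where
  "d_coeff n \<mu> k = fps_nth (Abs_fps (\<lambda>i. if \<mu> dvd i then 1 else 0) ^ n) k"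

definition W_mat :: "nat \<Rightarrow> nat \<Rightarrow> nat \<Rightarrow> complex mat" where
  "W_mat n \<mu> N = mat (N + 1) (N + 1) (\<lambda>(j, k). if k \<le> j then w_coeff n \<mu> (j - k) else 0)"

text \<open>Row \<open>k\<close>, column \<open>j\<close> (upper triangular): so that the mean square error is
  \<open>\<parallel>D A \<phi>\<parallel>\<^sup>2\<close>, \<open>b = D a\<close>, and \<open>D_hat\<close> below is \<open>D\<close> with the order of its rows reversed.\<close>

definition D_mat :: "nat \<Rightarrow> nat \<Rightarrow> nat \<Rightarrow> complex mat" where
  "D_mat n \<mu> N = mat (N + 1) (N + 1)
     (\<lambda>(k, j). if k \<le> j then of_nat (d_coeff n \<mu> (j - k)) else 0)"

definition D_hat :: "nat \<Rightarrow> nat \<Rightarrow> nat \<Rightarrow> complex mat" where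
  "D_hat n \<mu> N = mat (N + 1) (N + 1)
     (\<lambda>(k, l). if N - k \<le> l then of_nat (d_coeff n \<mu> (l + k - N)) else 0)"

definition A_mat :: "nat \<Rightarrow> (nat \<Rightarrow> complex) \<Rightarrow> complex mat" where
  "A_mat N a = mat (N + 1) (N + 1) (\<lambda>(k, j). if k + j \<le> N then a (k + j) else 0)"

definition euclidean_norm :: "complex vec \<Rightarrow> real" where
  "euclidean_norm v = L2_set (\<lambda>i. cmod (v $ i)) {..<dim_vec v}"

definition white_noise :: "'w measure \<Rightarrow> (int \<Rightarrow> 'w \<Rightarrow> complex) \<Rightarrow> bool" where
  "white_noise M \<epsilon> \<longleftrightarrow>
     (\<forall>m. \<epsilon> m \<in> borel_measurable M \<and> integrable M (\<lambda>\<omega>. (cmod (\<epsilon> m \<omega>))\<^sup>2) \<and>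
        prob_space.expectation M (\<epsilon> m) = 0) \<and>
     (\<forall>m k. prob_space.expectation M (\<lambda>\<omega>. \<epsilon> m \<omega> * cnj (\<epsilon> k \<omega>)) = (if m = k then 1 else 0))"

text \<open>The innovations of an increment sequence whose spectral density is \<open>1\<close> are filtered by
  \<open>w\<^sub>\<mu>\<close>, since the kernel \<open>(1 - e\<^bsup>-i\<mu>t\<^esup>)\<^sup>n (it)\<^bsup>-n\<^esup>\<close> has modulus \<open>|w\<^sub>\<mu>(e\<^bsup>-it\<^esup>)|\<close>.
  The filter must stay in the definition: the density of the increments is
  \<open>|w\<^sub>\<mu>(e\<^bsup>-it\<^esup>)|\<^sup>2 f(t)\<close>, which is not a trigonometric polynomial when \<open>f \<noteq> 0\<close> is one, so the
  increments themselves are then not a finite moving average of white noise.  The order \<open>N\<close>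
  refers to the factor \<open>\<Phi>\<close> in \<open>\<Phi>\<^sub>\<mu> = w\<^sub>\<mu> \<Phi>\<close>.\<close>

definition moving_average_increments ::
    "'w measure \<Rightarrow> nat \<Rightarrow> nat \<Rightarrow> nat \<Rightarrow> (int \<Rightarrow> 'w \<Rightarrow> complex) \<Rightarrow> bool" where
  "moving_average_increments M n \<mu> N \<xi> \<longleftrightarrow>
     (\<exists>\<phi>\<in>carrier_vec (N + 1). \<exists>\<epsilon> \<eta>. white_noise M \<epsilon> \<and>
        (\<forall>m. \<eta> m \<in> borel_measurable M \<and>
           (\<lambda>K. mean_sqdist M (\<eta> m) (\<lambda>\<omega>. \<Sum>j<K. w_coeff n \<mu> j * \<epsilon> (m - int j) \<omega>)) \<longlonglongrightarrow> 0) \<and>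
        (\<forall>m. AE \<omega> in M. increment n \<xi> m (int \<mu>) \<omega> = (\<Sum>k\<le>N. \<phi> $ k * \<eta> (m - int k) \<omega>)))"

definition A_functional :: "nat \<Rightarrow> (nat \<Rightarrow> complex) \<Rightarrow> (int \<Rightarrow> 'w \<Rightarrow> complex) \<Rightarrow> 'w \<Rightarrow> complex" where
  "A_functional N a \<xi> \<omega> = (\<Sum>k\<le>N. a k * \<xi> (int k) \<omega>)"

definition b_coeff :: "nat \<Rightarrow> nat \<Rightarrow> nat \<Rightarrow> (nat \<Rightarrow> complex) \<Rightarrow> nat \<Rightarrow> complex" where
  "b_coeff n \<mu> N a k = (\<Sum>m=k..N. a m * of_nat (d_coeff n \<mu> (m - k)))"

definition v_coeff :: "nat \<Rightarrow> nat \<Rightarrow> nat \<Rightarrow> (nat \<Rightarrow> complex) \<Rightarrow> int \<Rightarrow> complex" where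
  "v_coeff n \<mu> N a k =
     (\<Sum>l = nat \<lceil>real_of_int (- k) / real \<mu>\<rceil> .. min (nat \<lfloor>real_of_int (int N - k) / real \<mu>\<rfloor>) n.
        (-1) ^ l * of_nat (n choose l) * b_coeff n \<mu> N a (nat (int (l * \<mu>) + k)))"

definition V_functional ::
    "nat \<Rightarrow> nat \<Rightarrow> nat \<Rightarrow> (nat \<Rightarrow> complex) \<Rightarrow> (int \<Rightarrow> 'w \<Rightarrow> complex) \<Rightarrow> 'w \<Rightarrow> complex" where
  "V_functional n \<mu> N a \<xi> \<omega> = (\<Sum>k = - int (\<mu> * n) .. -1. v_coeff n \<mu> N a k * \<xi> k \<omega>)"

definition L2_minus :: "nat \<Rightarrow> nat \<Rightarrow> (real \<Rightarrow> real) \<Rightarrow> (real \<Rightarrow> complex) set" where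
  "L2_minus n \<mu> f = {g \<in> borel_measurable borel.
     \<forall>e>0. \<exists>(K :: int set) c. finite K \<and> K \<subseteq> {..-1} \<and>
       spectral_sqdist f g
         (\<lambda>t. \<Sum>k\<in>K. c k * (cis (of_int k * t) * increment_kernel n (int \<mu>) t)) < e}"

definition spectral_characteristic ::
    "nat \<Rightarrow> nat \<Rightarrow> (real \<Rightarrow> real) \<Rightarrow> (real \<Rightarrow> complex) \<Rightarrow> bool" where
  "spectral_characteristic n \<mu> f h \<longleftrightarrow>
     (\<lambda>t. h t * increment_kernel n (int \<mu>) t) \<in> L2_minus n \<mu> f"

text \<open>The error \<open>\<Delta>(h;f) = E|error|\<^sup>2\<close> is the same for all sequences \<open>\<xi>\<close> with
  spectral density \<open>f\<close>.  The sample space is taken to be the real line (with an arbitrary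
  probability measure), which is rich enough to carry a sequence with any given density.\<close>

definition mean_square_error ::
    "nat \<Rightarrow> nat \<Rightarrow> nat \<Rightarrow> (nat \<Rightarrow> complex) \<Rightarrow> (real \<Rightarrow> complex) \<Rightarrow> (real \<Rightarrow> real) \<Rightarrow> real" where
  "mean_square_error n \<mu> N a h f = (THE v. \<exists>(M :: real measure) \<xi> Z Y.
     prob_space M \<and> spectral_representation M n \<xi> f Z \<and>
     has_stochastic_integral M f Z (\<lambda>t. h t * increment_kernel n (int \<mu>) t) Y \<and>
     v = prob_space.expectation M
       (\<lambda>\<omega>. (cmod (A_functional N a \<xi> \<omega> - (- V_functional n \<mu> N a \<xi> \<omega> + Y \<omega>)))\<^sup>2))"

definition optimal_characteristic ::
    "nat \<Rightarrow> nat \<Rightarrow> nat \<Rightarrow> (nat \<Rightarrow> complex) \<Rightarrow> (real \<Rightarrow> real) \<Rightarrow> (real \<Rightarrow> complex) \<Rightarrow> bool" where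
  "optimal_characteristic n \<mu> N a f h \<longleftrightarrow>
     spectral_characteristic n \<mu> f h \<and>
     (\<forall>h'. spectral_characteristic n \<mu> f h' \<longrightarrow>
        mean_square_error n \<mu> N a h f \<le> mean_square_error n \<mu> N a h' f)"

definition least_favorable ::
    "nat \<Rightarrow> nat \<Rightarrow> nat \<Rightarrow> (nat \<Rightarrow> complex) \<Rightarrow> (real \<Rightarrow> real) set \<Rightarrow> (real \<Rightarrow> real) \<Rightarrow> bool" where
  "least_favorable n \<mu> N a D f0 \<longleftrightarrow> f0 \<in> D \<and>
     (\<exists>h0. optimal_characteristic n \<mu> N a f0 h0 \<and>
        (\<forall>f\<in>D. \<forall>h. optimal_characteristic n \<mu> N a f h \<longrightarrow>
           mean_square_error n \<mu> N a h f \<le> mean_square_error n \<mu> N a h0 f0))"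

definition D0 :: "real \<Rightarrow> (real \<Rightarrow> real) set" where
  "D0 P0 = {f. density_fun f \<and> 1 / (2 * pi) * (LINT t:{-pi..pi}|lborel. f t) \<le> P0}"

definition ma_density :: "complex vec \<Rightarrow> real \<Rightarrow> real" where
  "ma_density \<phi> t = (cmod (\<Sum>k<dim_vec \<phi>. \<phi> $ k * cis (- (t * real k))))\<^sup>2"

definition error_vec :: "nat \<Rightarrow> nat \<Rightarrow> nat \<Rightarrow> (nat \<Rightarrow> complex) \<Rightarrow> complex vec \<Rightarrow> complex vec" where
  "error_vec n \<mu> N a \<phi> = D_mat n \<mu> N *\<^sub>v (A_mat N a *\<^sub>v (W_mat n \<mu> N *\<^sub>v \<phi>))"

definition solves_E1 :: "nat \<Rightarrow> nat \<Rightarrow> nat \<Rightarrow> (nat \<Rightarrow> complex) \<Rightarrow> complex vec \<Rightarrow> bool" where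
  "solves_E1 n \<mu> N a \<phi> \<longleftrightarrow> \<phi> \<in> carrier_vec (N + 1) \<and>
     (\<exists>\<alpha>. D_mat n \<mu> N *\<^sub>v (A_mat N a *\<^sub>v (W_mat n \<mu> N *\<^sub>v \<phi>)) = \<alpha> \<cdot>\<^sub>v conjugate \<phi>)"

definition solves_E2 :: "nat \<Rightarrow> nat \<Rightarrow> nat \<Rightarrow> (nat \<Rightarrow> complex) \<Rightarrow> complex vec \<Rightarrow> bool" where
  "solves_E2 n \<mu> N a \<phi> \<longleftrightarrow> \<phi> \<in> carrier_vec (N + 1) \<and>
     (\<exists>\<beta>. D_hat n \<mu> N *\<^sub>v (A_mat N a *\<^sub>v (W_mat n \<mu> N *\<^sub>v \<phi>)) = \<beta> \<cdot>\<^sub>v conjugate \<phi>)"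

definition F_density ::
    "nat \<Rightarrow> nat \<Rightarrow> nat \<Rightarrow> (nat \<Rightarrow> complex) \<Rightarrow> complex \<Rightarrow> complex vec \<Rightarrow> real \<Rightarrow> real" where
  "F_density n \<mu> N a c \<phi> t =
     (cmod (c * (\<Sum>k\<le>N. error_vec n \<mu> N a \<phi> $ k * cis (t * real k))))\<^sup>2"

text \<open>Maxima are written as suprema in the extended reals, so that the maximum over the empty
  set is \<open>-\<infinity>\<close>; for nonempty sets the suprema are attained.\<close>

definition nu :: "nat \<Rightarrow> nat \<Rightarrow> nat \<Rightarrow> (nat \<Rightarrow> complex) \<Rightarrow> real \<Rightarrow> ereal" where
  "nu n \<mu> N a P0 = (SUP \<phi> \<in> {\<phi>. (solves_E1 n \<mu> N a \<phi> \<or> solves_E2 n \<mu> N a \<phi>) \<and>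
       (euclidean_norm \<phi>)\<^sup>2 = P0 \<and>
       ma_density \<phi> \<in> D0 P0 \<and> determines_factorization \<phi> (ma_density \<phi>)}.
     ereal ((euclidean_norm (error_vec n \<mu> N a \<phi>))\<^sup>2 / P0))"

definition nu_plus :: "nat \<Rightarrow> nat \<Rightarrow> nat \<Rightarrow> (nat \<Rightarrow> complex) \<Rightarrow> real \<Rightarrow> ereal" where
  "nu_plus n \<mu> N a P0 = (SUP \<phi> \<in> {\<phi> \<in> carrier_vec (N + 1).
       (euclidean_norm \<phi>)\<^sup>2 = P0 \<and>
       (\<exists>c. determines_factorization \<phi> (F_density n \<mu> N a c \<phi>))}.
     ereal ((euclidean_norm (error_vec n \<mu> N a \<phi>))\<^sup>2 / P0))"

definition extremal_vec ::
    "nat \<Rightarrow> nat \<Rightarrow> nat \<Rightarrow> (nat \<Rightarrow> complex) \<Rightarrow> real \<Rightarrow> complex vec \<Rightarrow> bool" where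
  "extremal_vec n \<mu> N a P0 \<phi> \<longleftrightarrow>
     \<phi> \<in> carrier_vec (N + 1) \<and> ma_density \<phi> \<in> D0 P0 \<and>
     (\<forall>\<psi>\<in>carrier_vec (N + 1). ma_density \<psi> \<in> D0 P0 \<longrightarrow>
        (euclidean_norm (error_vec n \<mu> N a \<psi>))\<^sup>2 \<le> (euclidean_norm (error_vec n \<mu> N a \<phi>))\<^sup>2)"

end

theory Submission
  imports Defs "HOL-Complex_Analysis.Complex_Analysis"
begin

unbundle no vec_syntax and no fps_syntax
hide_const (open) Finite_Cartesian_Product.vec Finite_Cartesian_Product.mat
hide_type (open) Finite_Cartesian_Product.vec

text \<open>
  The proof rests on the Hankel structure of one matrix and on two bounds for the error that this
  structure makes equal.

  Put \<open>b = b_coeff\<close>, \<open>w = w_coeff\<close>.  The product \<open>D A W\<close> is the Hankel matrix \<open>H\<close> with entries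
  \<open>e(k + j)\<close>, where \<open>e(p) = \<Sum>\<^sub>i b(p + i) w(i)\<close> vanishes for \<open>p > N\<close> (\<open>error_vec_eq_hankel\<close>).
  Let \<open>\<sigma>\<close> be the largest value of \<open>\<parallel>Hx\<parallel>\<^sup>2 / \<parallel>x\<parallel>\<^sup>2\<close>, and call \<open>x\<close> extremal if it is attained at \<open>x\<close>.
  A Hankel matrix turns the forward shift of \<open>x\<close> into the backward shift of \<open>Hx\<close>; together with
  the variational identity at a maximum this gives, for extremal \<open>x\<close>,
  \<open>|\<Sum> (Hx)\<^sub>k e\<^bsup>ikt\<^esup>|\<^sup>2 = \<sigma> |\<Sum> x\<^sub>k e\<^bsup>-ikt\<^esup>|\<^sup>2\<close> for all \<open>t\<close> (\<open>extremal_cmod_eq\<close>), and a root in the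
  closed disc can be divided out of an extremal polynomial without leaving the extremal ones
  (\<open>extremal_remove_root\<close>).  An extremal polynomial of least degree therefore has no zero in the
  closed disc (\<open>extremal_zero_free\<close>).  It determines a canonical factorization of the density
  built from \<open>H x\<close>, so that \<open>nu_plus \<ge> \<sigma>\<close> whenever \<open>\<sigma> > 0\<close>.

  The error of an estimate with spectral characteristic \<open>h\<close> is the integral
  \<open>(1/2\<pi>) \<integral> |B - h|\<^sup>2 |\<kappa>|\<^sup>2 f dt\<close> with \<open>B = \<Sum> b(k) e\<^bsup>ikt\<^esup>\<close> and the kernel \<open>\<kappa>\<close> of the increments
  (\<open>mean_square_error_eq\<close>), because \<open>A + V\<close> is a combination of increments
  (\<open>A_plus_V_functional\<close>) and the stochastic integral is an isometry.
  It obeys two bounds.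

  For every density \<open>f\<close> the optimal error is at most \<open>\<sigma>\<close> times the mean \<open>(1/2\<pi>) \<integral> f\<close>
  (\<open>optimal_error_le\<close>), hence at most \<open>\<sigma> P0\<close> in the class \<open>D0\<close>.
  With a zero-free extremal \<open>\<phi>\<close> and \<open>\<Psi> = \<Sum> (H\<phi>)\<^sub>k z\<^sup>k\<close>, the function
  \<open>B(1/z) - \<Psi>(1/z) / (\<phi>(z) w(z))\<close> is analytic in the disc and vanishes at \<open>0\<close>, so it is an
  estimate by the past; since \<open>|w| = |\<kappa>|\<close> on the circle, its weighted error
  \<open>|B - h|\<^sup>2 |\<kappa>|\<^sup>2 = |\<Psi>|\<^sup>2 / |\<phi>|\<^sup>2\<close> is the constant \<open>\<sigma>\<close>, whatever \<open>f\<close> is.  As \<open>1/w\<close> need not be bounded, this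
  is carried out for the outer functions of \<open>max (ln |\<kappa>|\<^sup>2) (-k)\<close>, with \<open>k\<close> tending to infinity.

  For \<open>f = |\<phi>|\<^sup>2\<close> every error is at least \<open>\<parallel>H\<phi>\<parallel>\<^sup>2\<close> (\<open>mean_square_error_lower_bound\<close>): the
  coefficients of \<open>(B - p) \<phi> w\<close> at the frequencies \<open>0,\<dots>,N\<close> are those of \<open>H\<phi>\<close> for every
  trigonometric polynomial \<open>p\<close> of negative frequencies, and Bessel's inequality applies.

  For extremal \<open>\<phi>\<close> with \<open>\<parallel>\<phi>\<parallel>\<^sup>2 = P0\<close> both bounds equal \<open>\<sigma> P0\<close>, so \<open>|\<phi>|\<^sup>2\<close> is least favorable
  (\<open>extremal_least_favorable\<close>).  The conditions of both parts of the theorem force extremality: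
  in the first part \<open>\<parallel>H\<phi>\<parallel>\<^sup>2 = nu_plus P0 \<ge> \<sigma> P0\<close> if \<open>\<sigma> > 0\<close>; in the second part the extremum problem has the
  extremal vectors of norm \<open>P0\<close> as its solutions, and the density built from \<open>H\<phi>\<close> is \<open>|c|\<^sup>2 \<sigma> |\<phi>|\<^sup>2\<close>,
  which is \<open>|\<phi>|\<^sup>2\<close> once it has mean \<open>P0\<close> (\<open>F_density_eq\<close>).

  The moving average representation is read off the spectral representation: \<open>\<kappa>\<close> and the boundary
  values of \<open>w\<close> differ by a phase \<open>u\<close>, and \<open>\<integral> e\<^bsup>imt\<^esup> u/\<phi> dZ\<close> is white noise
  (\<open>moving_average_poly_density\<close>).
\<close>

section \<open>Square integrable random variables and functions\<close>

definition square_integrable :: "'a measure \<Rightarrow> ('a \<Rightarrow> complex) \<Rightarrow> bool" where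
  "square_integrable M X \<longleftrightarrow>
     X \<in> borel_measurable M \<and> integrable M (\<lambda>\<omega>. (cmod (X \<omega>))\<^sup>2)"

lemma borel_measurable_cnj [measurable (raw)]:
  "f \<in> borel_measurable M \<Longrightarrow> (\<lambda>x. cnj (f x)) \<in> borel_measurable M"
  by (rule borel_measurable_continuous_on[OF continuous_on_cnj[OF continuous_on_id]])

lemma cmod_add_sq_le: "(cmod (x + y))\<^sup>2 \<le> 2 * (cmod x)\<^sup>2 + 2 * (cmod y)\<^sup>2"
proof -
  have "(cmod (x + y))\<^sup>2 \<le> (cmod x + cmod y)\<^sup>2"
    by (intro power_mono norm_triangle_ineq) auto
  also have "\<dots> \<le> 2 * (cmod x)\<^sup>2 + 2 * (cmod y)\<^sup>2"
    using zero_le_power2[of "cmod x - cmod y"] by (simp add: power2_eq_square algebra_simps)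
  finally show ?thesis .
qed

lemma cmod_diff_sq_le: "(cmod (x - z))\<^sup>2 \<le> 2 * (cmod (x - y))\<^sup>2 + 2 * (cmod (y - z))\<^sup>2"
  using cmod_add_sq_le[of "x - y" "y - z"] by simp

lemma square_integrable_measurable [measurable_dest]:
  "square_integrable M X \<Longrightarrow> X \<in> borel_measurable M"
  by (simp add: square_integrable_def)

lemma square_integrable_zero [simp]: "square_integrable M (\<lambda>_. 0)"
  by (simp add: square_integrable_def)

lemma square_integrable_add:
  assumes "square_integrable M X" "square_integrable M Y"
  shows "square_integrable M (\<lambda>\<omega>. X \<omega> + Y \<omega>)"
proof -
  have [measurable]: "X \<in> borel_measurable M" "Y \<in> borel_measurable M"
    using assms by (auto simp: square_integrable_def)
  have "integrable M (\<lambda>\<omega>. 2 * (cmod (X \<omega>))\<^sup>2 + 2 * (cmod (Y \<omega>))\<^sup>2)"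
    using assms by (auto simp: square_integrable_def)
  then have "integrable M (\<lambda>\<omega>. (cmod (X \<omega> + Y \<omega>))\<^sup>2)"
    by (rule Bochner_Integration.integrable_bound)
      (use cmod_add_sq_le in \<open>auto intro!: AE_I2\<close>)
  then show ?thesis by (simp add: square_integrable_def)
qed

lemma square_integrable_mult_left:
  "square_integrable M X \<Longrightarrow> square_integrable M (\<lambda>\<omega>. c * X \<omega>)"
  by (auto simp: square_integrable_def norm_mult power_mult_distrib)

lemma square_integrable_uminus:
  "square_integrable M X \<Longrightarrow> square_integrable M (\<lambda>\<omega>. - X \<omega>)"
  by (auto simp: square_integrable_def)

lemma square_integrable_diff:
  "square_integrable M X \<Longrightarrow> square_integrable M Y \<Longrightarrow> square_integrable M (\<lambda>\<omega>. X \<omega> - Y \<omega>)"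
  using square_integrable_add[OF _ square_integrable_uminus, of M X Y] by simp

lemma square_integrable_sum:
  "(\<And>i. i \<in> I \<Longrightarrow> square_integrable M (X i)) \<Longrightarrow> square_integrable M (\<lambda>\<omega>. \<Sum>i\<in>I. X i \<omega>)"
  by (induction I rule: infinite_finite_induct) (auto intro: square_integrable_add)

lemma square_integrable_inner:
  assumes "square_integrable M X" "square_integrable M Y"
  shows "integrable M (\<lambda>\<omega>. X \<omega> * cnj (Y \<omega>))"
proof -
  have [measurable]: "X \<in> borel_measurable M" "Y \<in> borel_measurable M"
    using assms by (auto simp: square_integrable_def)
  have "integrable M (\<lambda>\<omega>. (cmod (X \<omega>))\<^sup>2 + (cmod (Y \<omega>))\<^sup>2)"
    using assms by (auto simp: square_integrable_def)
  then show ?thesis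
  proof (rule Bochner_Integration.integrable_bound)
    show "AE \<omega> in M. cmod (X \<omega> * cnj (Y \<omega>)) \<le> norm ((cmod (X \<omega>))\<^sup>2 + (cmod (Y \<omega>))\<^sup>2)"
    proof (intro AE_I2)
      fix \<omega>
      have "2 * (cmod (X \<omega>) * cmod (Y \<omega>)) \<le> (cmod (X \<omega>))\<^sup>2 + (cmod (Y \<omega>))\<^sup>2"
        using zero_le_power2[of "cmod (X \<omega>) - cmod (Y \<omega>)"]
        by (simp add: power2_eq_square algebra_simps)
      moreover have "0 \<le> cmod (X \<omega>) * cmod (Y \<omega>)" by simp
      ultimately show "cmod (X \<omega> * cnj (Y \<omega>)) \<le> norm ((cmod (X \<omega>))\<^sup>2 + (cmod (Y \<omega>))\<^sup>2)"
        unfolding norm_mult complex_mod_cnj real_norm_def by linarith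
    qed
  qed simp
qed

lemma L2_imp_integrable:
  assumes "finite_measure M" "square_integrable M X" shows "integrable M X"
  using square_integrable_inner[of M X "\<lambda>_. 1"] assms
  by (auto simp: square_integrable_def finite_measure.integrable_const)

lemma integral_cmod_sq_eq:
  "complex_of_real (\<integral>\<omega>. (cmod (X \<omega>))\<^sup>2 \<partial>M) = (\<integral>\<omega>. X \<omega> * cnj (X \<omega>) \<partial>M)"
  unfolding integral_complex_of_real[symmetric]
  by (intro Bochner_Integration.integral_cong) (simp_all add: complex_norm_square[symmetric])

lemma mean_sqdist_eq_integral:
  assumes "square_integrable M (\<lambda>\<omega>. X \<omega> - Y \<omega>)"
  shows "mean_sqdist M X Y = ennreal (\<integral>\<omega>. (cmod (X \<omega> - Y \<omega>))\<^sup>2 \<partial>M)"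
  unfolding mean_sqdist_def using assms
  by (intro nn_integral_eq_integral) (auto simp: square_integrable_def)

lemma mean_sqdist_commute: "mean_sqdist M X Y = mean_sqdist M Y X"
  by (simp add: mean_sqdist_def norm_minus_commute)

lemma mean_sqdist_triangle:
  assumes [measurable]: "X \<in> borel_measurable M" "Y \<in> borel_measurable M" "Z \<in> borel_measurable M"
  shows "mean_sqdist M X Z \<le> 2 * mean_sqdist M X Y + 2 * mean_sqdist M Y Z"
proof -
  have "mean_sqdist M X Z \<le>
      (\<integral>\<^sup>+\<omega>. 2 * ennreal ((cmod (X \<omega> - Y \<omega>))\<^sup>2) + 2 * ennreal ((cmod (Y \<omega> - Z \<omega>))\<^sup>2) \<partial>M)"
    unfolding mean_sqdist_def
  proof (intro nn_integral_mono)
    fix \<omega>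
    have "ennreal ((cmod (X \<omega> - Z \<omega>))\<^sup>2) \<le>
        ennreal (2 * (cmod (X \<omega> - Y \<omega>))\<^sup>2 + 2 * (cmod (Y \<omega> - Z \<omega>))\<^sup>2)"
      by (intro ennreal_leI cmod_diff_sq_le)
    also have "\<dots> = 2 * ennreal ((cmod (X \<omega> - Y \<omega>))\<^sup>2) + 2 * ennreal ((cmod (Y \<omega> - Z \<omega>))\<^sup>2)"
      by (subst ennreal_plus) (simp_all add: ennreal_mult)
    finally show "ennreal ((cmod (X \<omega> - Z \<omega>))\<^sup>2) \<le> \<dots>" .
  qed
  also have "\<dots> = 2 * mean_sqdist M X Y + 2 * mean_sqdist M Y Z"
    unfolding mean_sqdist_def by (subst nn_integral_add) (auto simp: nn_integral_cmult)
  finally show ?thesis .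
qed

lemma square_integrable_if_close:
  assumes Y: "square_integrable M Y" and [measurable]: "X \<in> borel_measurable M"
    and fin: "mean_sqdist M X Y < \<infinity>"
  shows "square_integrable M X"
proof -
  have [measurable]: "Y \<in> borel_measurable M" using Y by (simp add: square_integrable_def)
  have "integrable M (\<lambda>\<omega>. (cmod (X \<omega> - Y \<omega>))\<^sup>2)"
    using fin by (intro integrableI_bounded) (auto simp: mean_sqdist_def)
  then have "square_integrable M (\<lambda>\<omega>. X \<omega> - Y \<omega>)" by (simp add: square_integrable_def)
  from square_integrable_add[OF this Y] show ?thesis by simp
qed

lemma L2_Cauchy_Schwarz:
  assumes X: "square_integrable M X" and Y: "square_integrable M Y"
  shows "cmod (\<integral>\<omega>. X \<omega> * cnj (Y \<omega>) \<partial>M) \<le>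
    sqrt (\<integral>\<omega>. (cmod (X \<omega>))\<^sup>2 \<partial>M) * sqrt (\<integral>\<omega>. (cmod (Y \<omega>))\<^sup>2 \<partial>M)" (is "_ \<le> sqrt ?A * sqrt ?B")
proof -
  have [measurable]: "X \<in> borel_measurable M" "Y \<in> borel_measurable M"
    using assms by (auto simp: square_integrable_def)
  define I where "I = (\<integral>\<omega>. cmod (X \<omega>) * cmod (Y \<omega>) \<partial>M)"
  have int: "integrable M (\<lambda>\<omega>. cmod (X \<omega>) * cmod (Y \<omega>))"
    using integrable_norm[OF square_integrable_inner[OF X Y]] by (simp add: norm_mult)
  have "cmod (\<integral>\<omega>. X \<omega> * cnj (Y \<omega>) \<partial>M) \<le> I"
    using integral_norm_bound[of M "\<lambda>\<omega>. X \<omega> * cnj (Y \<omega>)"] by (simp add: I_def norm_mult)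
  moreover have "I\<^sup>2 \<le> ?A * ?B"
  proof -
    have "(\<integral>\<^sup>+\<omega>. ennreal (cmod (X \<omega>)) * ennreal (cmod (Y \<omega>)) \<partial>M)\<^sup>2 \<le>
        (\<integral>\<^sup>+\<omega>. (ennreal (cmod (X \<omega>)))\<^sup>2 \<partial>M) * (\<integral>\<^sup>+\<omega>. (ennreal (cmod (Y \<omega>)))\<^sup>2 \<partial>M)"
      by (rule Cauchy_Schwarz_nn_integral) auto
    also have "(\<integral>\<^sup>+\<omega>. ennreal (cmod (X \<omega>)) * ennreal (cmod (Y \<omega>)) \<partial>M) = ennreal I"
      unfolding I_def using int
      by (subst nn_integral_eq_integral[symmetric]) (auto simp: ennreal_mult)
    also have "(\<integral>\<^sup>+\<omega>. (ennreal (cmod (X \<omega>)))\<^sup>2 \<partial>M) = ennreal ?A"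
      using X by (subst nn_integral_eq_integral[symmetric])
        (auto simp: ennreal_power square_integrable_def)
    also have "(\<integral>\<^sup>+\<omega>. (ennreal (cmod (Y \<omega>)))\<^sup>2 \<partial>M) = ennreal ?B"
      using Y by (subst nn_integral_eq_integral[symmetric])
        (auto simp: ennreal_power square_integrable_def)
    finally show ?thesis
      by (simp add: ennreal_power ennreal_mult[symmetric] I_def)
  qed
  then have "I \<le> sqrt (?A * ?B)" by (rule real_le_rsqrt)
  ultimately show ?thesis by (simp add: real_sqrt_mult)
qed

text \<open>The inner product is continuous by the Cauchy-Schwarz inequality, applied to
  \<open>X\<^sub>j Y\<^sub>j\<^sup>* - X Y\<^sup>*\<close> after expanding it in the differences \<open>X - X\<^sub>j\<close> and \<open>Y - Y\<^sub>j\<close>.\<close>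

lemma tendsto_L2_inner:
  assumes X: "square_integrable M X" and Y: "square_integrable M Y"
    and Xj: "\<And>j. square_integrable M (Xs j)" and Yj: "\<And>j. square_integrable M (Ys j)"
    and limX: "(\<lambda>j::nat. mean_sqdist M X (Xs j)) \<longlonglongrightarrow> 0"
    and limY: "(\<lambda>j. mean_sqdist M Y (Ys j)) \<longlonglongrightarrow> 0"
  shows "(\<lambda>j. \<integral>\<omega>. Xs j \<omega> * cnj (Ys j \<omega>) \<partial>M) \<longlonglongrightarrow> (\<integral>\<omega>. X \<omega> * cnj (Y \<omega>) \<partial>M)"
proof -
  define a where "a j = (\<integral>\<omega>. (cmod (X \<omega> - Xs j \<omega>))\<^sup>2 \<partial>M)" for j
  define b where "b j = (\<integral>\<omega>. (cmod (Y \<omega> - Ys j \<omega>))\<^sup>2 \<partial>M)" for j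
  define A where "A = (\<integral>\<omega>. (cmod (X \<omega>))\<^sup>2 \<partial>M)"
  define B where "B = (\<integral>\<omega>. (cmod (Y \<omega>))\<^sup>2 \<partial>M)"
  have dX: "square_integrable M (\<lambda>\<omega>. X \<omega> - Xs j \<omega>)" for j by (rule square_integrable_diff[OF X Xj])
  have dY: "square_integrable M (\<lambda>\<omega>. Y \<omega> - Ys j \<omega>)" for j by (rule square_integrable_diff[OF Y Yj])
  have a: "a \<longlonglongrightarrow> 0"
    using limX tendsto_ennreal_iff[of a sequentially 0]
    by (simp add: mean_sqdist_eq_integral[OF dX] a_def)
  have b: "b \<longlonglongrightarrow> 0"
    using limY tendsto_ennreal_iff[of b sequentially 0]
    by (simp add: mean_sqdist_eq_integral[OF dY] b_def)
  have "(\<lambda>j. (\<integral>\<omega>. Xs j \<omega> * cnj (Ys j \<omega>) \<partial>M) - (\<integral>\<omega>. X \<omega> * cnj (Y \<omega>) \<partial>M)) \<longlonglongrightarrow> 0"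
  proof (rule tendsto_norm_zero_cancel, rule Lim_null_comparison)
    show "(\<lambda>j. sqrt (a j) * sqrt (b j) + sqrt (a j) * sqrt B + sqrt A * sqrt (b j)) \<longlonglongrightarrow> 0"
      using tendsto_add[OF tendsto_add[OF
          tendsto_mult[OF tendsto_real_sqrt[OF a] tendsto_real_sqrt[OF b]]
          tendsto_mult[OF tendsto_real_sqrt[OF a] tendsto_const[of "sqrt B"]]]
          tendsto_mult[OF tendsto_const[of "sqrt A"] tendsto_real_sqrt[OF b]]]
      by simp
    show "\<forall>\<^sub>F j in sequentially.
        norm (cmod ((\<integral>\<omega>. Xs j \<omega> * cnj (Ys j \<omega>) \<partial>M) - (\<integral>\<omega>. X \<omega> * cnj (Y \<omega>) \<partial>M)))
        \<le> sqrt (a j) * sqrt (b j) + sqrt (a j) * sqrt B + sqrt A * sqrt (b j)"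
    proof (intro always_eventually allI)
      fix j
      let ?dX = "\<lambda>\<omega>. X \<omega> - Xs j \<omega>" and ?dY = "\<lambda>\<omega>. Y \<omega> - Ys j \<omega>"
      have "(\<integral>\<omega>. Xs j \<omega> * cnj (Ys j \<omega>) \<partial>M) =
          (\<integral>\<omega>. X \<omega> * cnj (Y \<omega>) - ?dX \<omega> * cnj (Y \<omega>) - X \<omega> * cnj (?dY \<omega>) + ?dX \<omega> * cnj (?dY \<omega>) \<partial>M)"
        by (intro Bochner_Integration.integral_cong) (auto simp: algebra_simps)
      also have "\<dots> = (\<integral>\<omega>. X \<omega> * cnj (Y \<omega>) \<partial>M) - (\<integral>\<omega>. ?dX \<omega> * cnj (Y \<omega>) \<partial>M)
          - (\<integral>\<omega>. X \<omega> * cnj (?dY \<omega>) \<partial>M) + (\<integral>\<omega>. ?dX \<omega> * cnj (?dY \<omega>) \<partial>M)"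
        using square_integrable_inner[OF X Y] square_integrable_inner[OF dX[of j] Y]
          square_integrable_inner[OF X dY[of j]] square_integrable_inner[OF dX[of j] dY[of j]]
        by (simp only: Bochner_Integration.integral_add Bochner_Integration.integral_diff
            Bochner_Integration.integrable_diff)
      finally have eq: "(\<integral>\<omega>. Xs j \<omega> * cnj (Ys j \<omega>) \<partial>M) - (\<integral>\<omega>. X \<omega> * cnj (Y \<omega>) \<partial>M) =
          (\<integral>\<omega>. ?dX \<omega> * cnj (?dY \<omega>) \<partial>M) - (\<integral>\<omega>. ?dX \<omega> * cnj (Y \<omega>) \<partial>M)
          - (\<integral>\<omega>. X \<omega> * cnj (?dY \<omega>) \<partial>M)" by simp
      show "norm (cmod ((\<integral>\<omega>. Xs j \<omega> * cnj (Ys j \<omega>) \<partial>M) - (\<integral>\<omega>. X \<omega> * cnj (Y \<omega>) \<partial>M)))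
          \<le> sqrt (a j) * sqrt (b j) + sqrt (a j) * sqrt B + sqrt A * sqrt (b j)"
        unfolding eq
        using L2_Cauchy_Schwarz[OF dX[of j] dY[of j]] L2_Cauchy_Schwarz[OF dX[of j] Y]
          L2_Cauchy_Schwarz[OF X dY[of j]]
          norm_triangle_ineq4[of "(\<integral>\<omega>. ?dX \<omega> * cnj (?dY \<omega>) \<partial>M) - (\<integral>\<omega>. ?dX \<omega> * cnj (Y \<omega>) \<partial>M)"
            "(\<integral>\<omega>. X \<omega> * cnj (?dY \<omega>) \<partial>M)"]
          norm_triangle_ineq4[of "(\<integral>\<omega>. ?dX \<omega> * cnj (?dY \<omega>) \<partial>M)" "(\<integral>\<omega>. ?dX \<omega> * cnj (Y \<omega>) \<partial>M)"]
        by (simp add: a_def b_def A_def B_def)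
    qed
  qed
  then show ?thesis by (simp add: LIM_zero_iff)
qed

text \<open>The argument of Riesz and Fischer: along a subsequence with
  \<open>\<integral>|X\<^sub>k\<^sub>+\<^sub>1 - X\<^sub>k|\<^sup>2 \<le> 4\<^sup>-\<^sup>k\<close> the sum of \<open>2\<^sup>k |X\<^sub>k\<^sub>+\<^sub>1 - X\<^sub>k|\<^sup>2\<close> is integrable, so the
  subsequence converges almost everywhere, and Fatou's lemma identifies the limit.\<close>

lemma L2_complete:
  assumes sq: "\<And>j::nat. square_integrable M (Xs j)"
    and Cauchy: "\<And>e. e > 0 \<Longrightarrow> \<exists>K. \<forall>i\<ge>K. \<forall>j\<ge>K. (\<integral>\<omega>. (cmod (Xs i \<omega> - Xs j \<omega>))\<^sup>2 \<partial>M) \<le> e"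
  obtains X where "square_integrable M X" "(\<lambda>j. mean_sqdist M X (Xs j)) \<longlonglongrightarrow> 0"
proof -
  have [measurable]: "Xs j \<in> borel_measurable M" for j using sq by (simp add: square_integrable_def)
  have sqd: "square_integrable M (\<lambda>\<omega>. Xs i \<omega> - Xs j \<omega>)" for i j
    by (intro square_integrable_diff sq)
  have "\<forall>k::nat. \<exists>K. \<forall>i\<ge>K. \<forall>j\<ge>K. (\<integral>\<omega>. (cmod (Xs i \<omega> - Xs j \<omega>))\<^sup>2 \<partial>M) \<le> (1/4)^k"
    using Cauchy by simp
  then obtain R where R: "\<And>k i j. i \<ge> R k \<Longrightarrow> j \<ge> R k \<Longrightarrow>
      (\<integral>\<omega>. (cmod (Xs i \<omega> - Xs j \<omega>))\<^sup>2 \<partial>M) \<le> (1/4)^k" by metis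
  \<comment> \<open>a monotone choice of indices that dominates both \<open>R\<close> and the identity\<close>
  define r where "r k = k + (\<Sum>i\<le>k. R i)" for k
  have r_ge: "r k \<ge> R k" for k
    unfolding r_def by (rule trans_le_add2) (simp add: member_le_sum)
  have r_Suc: "r (Suc k) \<ge> r k" for k by (simp add: r_def)
  have r_id: "r k \<ge> k" for k by (simp add: r_def)
  define D where "D k \<omega> = cmod (Xs (r (Suc k)) \<omega> - Xs (r k) \<omega>)" for k \<omega>
  have [measurable]: "D k \<in> borel_measurable M" for k unfolding D_def by measurable
  have "(\<integral>\<^sup>+\<omega>. (\<Sum>k. ennreal (2^k * (D k \<omega>)\<^sup>2)) \<partial>M) = (\<Sum>k. \<integral>\<^sup>+\<omega>. ennreal (2^k * (D k \<omega>)\<^sup>2) \<partial>M)"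
    by (rule nn_integral_suminf) auto
  also have "\<dots> \<le> (\<Sum>k. ennreal ((1/2)^k))"
  proof (rule suminf_le)
    fix k
    have "(\<integral>\<^sup>+\<omega>. ennreal (2^k * (D k \<omega>)\<^sup>2) \<partial>M) = ennreal (\<integral>\<omega>. 2^k * (D k \<omega>)\<^sup>2 \<partial>M)"
      using sqd[of "r (Suc k)" "r k"]
      by (intro nn_integral_eq_integral) (auto simp: D_def square_integrable_def)
    also have "(\<integral>\<omega>. 2^k * (D k \<omega>)\<^sup>2 \<partial>M) \<le> 2^k * (1/4)^k"
      unfolding D_def using R[of k "r (Suc k)" "r k"] r_ge[of k] r_Suc[of k] by simp
    also have "(2::real)^k * (1/4)^k = (1/2)^k" by (simp flip: power_mult_distrib)
    finally show "(\<integral>\<^sup>+\<omega>. ennreal (2^k * (D k \<omega>)\<^sup>2) \<partial>M) \<le> ennreal ((1/2)^k)"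
      by (simp add: ennreal_leI)
  qed auto
  also have "\<dots> < \<infinity>"
    unfolding infinity_ennreal_def less_top[symmetric]
    by (intro ennreal_suminf_neq_top summable_geometric) auto
  finally have "AE \<omega> in M. (\<Sum>k. ennreal (2^k * (D k \<omega>)\<^sup>2)) \<noteq> \<infinity>"
    by (intro nn_integral_PInf_AE) auto
  then have conv: "AE \<omega> in M. convergent (\<lambda>k. Xs (r k) \<omega>)"
  proof eventually_elim
    case (elim \<omega>)
    have s1: "summable (\<lambda>k. 2^k * (D k \<omega>)\<^sup>2)"
      using elim by (intro summable_suminf_not_top) auto
    have "summable (\<lambda>k. 2^k * (D k \<omega>)\<^sup>2 + (1/2)^k)"
      by (intro summable_add s1 summable_geometric) simp
    then have "summable (\<lambda>k. D k \<omega>)"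
    proof (rule summable_comparison_test'[where N=0])
      fix k
      \<comment> \<open>\<open>2x \<le> x\<^sup>2 + 1\<close> at \<open>x = 2\<^sup>k D\<^sub>k\<close> turns summable squares into a summable sequence\<close>
      have "0 \<le> (2^k * D k \<omega> - 1)\<^sup>2" by simp
      then have "2 * (2^k * D k \<omega>) \<le> (2^k * D k \<omega>)\<^sup>2 + 1"
        by (simp add: power2_eq_square algebra_simps)
      moreover have "0 \<le> 2^k * D k \<omega>" by (simp add: D_def)
      ultimately have "2^k * D k \<omega> \<le> (2^k * D k \<omega>)\<^sup>2 + 1" by linarith
      then have "D k \<omega> \<le> 2^k * (D k \<omega>)\<^sup>2 + (1/2)^k"
        by (simp add: field_simps power2_eq_square)
      then show "norm (D k \<omega>) \<le> 2^k * (D k \<omega>)\<^sup>2 + (1/2)^k" by (simp add: D_def)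
    qed
    then have "summable (\<lambda>k. Xs (r (Suc k)) \<omega> - Xs (r k) \<omega>)"
      unfolding D_def by (rule summable_norm_cancel)
    then have "convergent (\<lambda>n. \<Sum>k<n. Xs (r (Suc k)) \<omega> - Xs (r k) \<omega>)"
      by (simp add: summable_iff_convergent)
    then have "convergent (\<lambda>n. Xs (r n) \<omega> - Xs (r 0) \<omega>)"
      by (simp add: sum_lessThan_telescope[of "\<lambda>k. Xs (r k) \<omega>"])
    then have "convergent (\<lambda>n. (Xs (r n) \<omega> - Xs (r 0) \<omega>) + Xs (r 0) \<omega>)"
      by (intro convergent_add convergent_const)
    then show ?case by simp
  qed
  define X where "X \<omega> = lim (\<lambda>k. Xs (r k) \<omega>)" for \<omega>
  have [measurable]: "X \<in> borel_measurable M" unfolding X_def by measurable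
  have limX: "AE \<omega> in M. (\<lambda>k. Xs (r k) \<omega>) \<longlonglongrightarrow> X \<omega>"
    using conv by eventually_elim (simp add: X_def convergent_LIMSEQ_iff)
  have bound: "mean_sqdist M X (Xs j) \<le> ennreal e"
    if K: "\<forall>i\<ge>K. \<forall>j\<ge>K. (\<integral>\<omega>. (cmod (Xs i \<omega> - Xs j \<omega>))\<^sup>2 \<partial>M) \<le> e" and "j \<ge> K" for e K j
  proof -
    have "mean_sqdist M X (Xs j) =
        (\<integral>\<^sup>+\<omega>. liminf (\<lambda>k. ennreal ((cmod (Xs (r k) \<omega> - Xs j \<omega>))\<^sup>2)) \<partial>M)"
      unfolding mean_sqdist_def
    proof (rule nn_integral_cong_AE)
      show "AE \<omega> in M. ennreal ((cmod (X \<omega> - Xs j \<omega>))\<^sup>2) =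
          liminf (\<lambda>k. ennreal ((cmod (Xs (r k) \<omega> - Xs j \<omega>))\<^sup>2))"
        using limX
      proof eventually_elim
        case (elim \<omega>)
        have "(\<lambda>k. ennreal ((cmod (Xs (r k) \<omega> - Xs j \<omega>))\<^sup>2)) \<longlonglongrightarrow> ennreal ((cmod (X \<omega> - Xs j \<omega>))\<^sup>2)"
          by (intro tendsto_ennrealI tendsto_power tendsto_norm tendsto_diff elim tendsto_const)
        then show ?case by (rule lim_imp_Liminf[OF sequentially_bot, symmetric])
      qed
    qed
    also have "\<dots> \<le> liminf (\<lambda>k. mean_sqdist M (Xs (r k)) (Xs j))"
      unfolding mean_sqdist_def by (rule nn_integral_liminf) auto
    also have "\<dots> \<le> ennreal e"
    proof -
      have "\<forall>\<^sub>F k in sequentially. mean_sqdist M (Xs (r k)) (Xs j) \<le> ennreal e"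
        unfolding mean_sqdist_eq_integral[OF sqd] eventually_sequentially
        using K \<open>j \<ge> K\<close> r_id by (intro exI[of _ K]) (meson ennreal_leI order_trans)
      then have "liminf (\<lambda>k. mean_sqdist M (Xs (r k)) (Xs j)) \<le> liminf (\<lambda>k::nat. ennreal e)"
        by (rule Liminf_mono)
      then show ?thesis by (simp add: Liminf_const)
    qed
    finally show ?thesis .
  qed
  have lim0: "(\<lambda>j. mean_sqdist M X (Xs j)) \<longlonglongrightarrow> 0"
  proof (rule tendsto_zero_ennreal)
    fix e :: real assume "0 < e"
    then obtain K where "\<forall>i\<ge>K. \<forall>j\<ge>K. (\<integral>\<omega>. (cmod (Xs i \<omega> - Xs j \<omega>))\<^sup>2 \<partial>M) \<le> e / 2"
      using Cauchy[of "e/2"] by auto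
    from bound[OF this] have "mean_sqdist M X (Xs j) \<le> ennreal (e/2)" if "j \<ge> K" for j
      using that by simp
    moreover have "ennreal (e/2) < ennreal e" using \<open>0 < e\<close> by (simp add: ennreal_less_iff)
    ultimately show "\<forall>\<^sub>F j in sequentially. mean_sqdist M X (Xs j) < ennreal e"
      unfolding eventually_sequentially by (meson le_less_trans)
  qed
  obtain K where K: "\<forall>i\<ge>K. \<forall>j\<ge>K. (\<integral>\<omega>. (cmod (Xs i \<omega> - Xs j \<omega>))\<^sup>2 \<partial>M) \<le> 1"
    using Cauchy[of 1] by auto
  have "mean_sqdist M X (Xs K) < \<infinity>"
    using bound[OF K, of K] by (simp add: le_less_trans[of _ 1])
  then have "square_integrable M X"
    by (intro square_integrable_if_close[OF sq[of K]]) auto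
  from that[OF this lim0] show thesis .
qed

text \<open>Dominated convergence, with a pointwise approximation by simple functions of modulus at most
  \<open>2|X|\<close>.\<close>

lemma L2_simple_approximation:
  assumes X: "square_integrable M X"
  shows "\<exists>s. (\<forall>j::nat. simple_function M (s j) \<and> square_integrable M (s j)) \<and>
    (\<lambda>j. mean_sqdist M X (s j)) \<longlonglongrightarrow> 0"
proof -
  have [measurable]: "X \<in> borel_measurable M" using X by (simp add: square_integrable_def)
  obtain s where s: "\<And>i. simple_function M (s i)"
      "\<And>x. x \<in> space M \<Longrightarrow> (\<lambda>i. s i x) \<longlonglongrightarrow> X x"
      "\<And>i x. x \<in> space M \<Longrightarrow> norm (s i x) \<le> 2 * norm (X x)"
    using borel_measurable_implies_sequence_metric[of X M 0] unfolding norm_conv_dist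
    by (metis \<open>X \<in> borel_measurable M\<close>)
  have [measurable]: "s j \<in> borel_measurable M" for j
    using s(1) by (rule borel_measurable_simple_function)
  have int: "integrable M (\<lambda>\<omega>. (cmod (X \<omega>))\<^sup>2)" using X by (simp add: square_integrable_def)
  have sq: "square_integrable M (s j)" for j
    unfolding square_integrable_def
  proof
    show "integrable M (\<lambda>\<omega>. (cmod (s j \<omega>))\<^sup>2)"
    proof (rule Bochner_Integration.integrable_bound[of _ "\<lambda>\<omega>. 4 * (cmod (X \<omega>))\<^sup>2"])
      show "integrable M (\<lambda>\<omega>. 4 * (cmod (X \<omega>))\<^sup>2)" using int by simp
      show "AE \<omega> in M. norm ((cmod (s j \<omega>))\<^sup>2) \<le> norm (4 * (cmod (X \<omega>))\<^sup>2)"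
        using power_mono[OF s(3), of _ j 2] by (intro AE_I2) (simp add: power_mult_distrib)
    qed auto
  qed simp
  have "(\<lambda>j. \<integral>\<^sup>+\<omega>. ennreal ((cmod (X \<omega> - s j \<omega>))\<^sup>2) \<partial>M) \<longlonglongrightarrow> (\<integral>\<^sup>+\<omega>. 0 \<partial>M)"
  proof (rule nn_integral_dominated_convergence[where w="\<lambda>\<omega>. ennreal (10 * (cmod (X \<omega>))\<^sup>2)"])
    show "(\<integral>\<^sup>+\<omega>. ennreal (10 * (cmod (X \<omega>))\<^sup>2) \<partial>M) < \<infinity>"
      using int by (subst nn_integral_eq_integral) auto
    show "AE \<omega> in M. ennreal ((cmod (X \<omega> - s j \<omega>))\<^sup>2) \<le> ennreal (10 * (cmod (X \<omega>))\<^sup>2)" for j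
    proof (intro AE_I2 ennreal_leI)
      fix \<omega> assume "\<omega> \<in> space M"
      then have "(cmod (s j \<omega>))\<^sup>2 \<le> 4 * (cmod (X \<omega>))\<^sup>2"
        using power_mono[OF s(3), of \<omega> j 2] by (simp add: power_mult_distrib)
      then show "(cmod (X \<omega> - s j \<omega>))\<^sup>2 \<le> 10 * (cmod (X \<omega>))\<^sup>2"
        using cmod_add_sq_le[of "X \<omega>" "- s j \<omega>"] by simp
    qed
    show "AE \<omega> in M. (\<lambda>j. ennreal ((cmod (X \<omega> - s j \<omega>))\<^sup>2)) \<longlonglongrightarrow> 0"
    proof (intro AE_I2)
      fix \<omega> assume "\<omega> \<in> space M"
      have "(\<lambda>j. ennreal ((cmod (X \<omega> - s j \<omega>))\<^sup>2)) \<longlonglongrightarrow> ennreal ((cmod (X \<omega> - X \<omega>))\<^sup>2)"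
        using s(2)[OF \<open>\<omega> \<in> space M\<close>]
        by (intro tendsto_ennrealI tendsto_power tendsto_norm tendsto_diff tendsto_const)
      then show "(\<lambda>j. ennreal ((cmod (X \<omega> - s j \<omega>))\<^sup>2)) \<longlonglongrightarrow> 0" by simp
    qed
  qed auto
  then have "(\<lambda>j. mean_sqdist M X (s j)) \<longlonglongrightarrow> 0" by (simp add: mean_sqdist_def)
  with s(1) sq show ?thesis by blast
qed

lemma L2_inner_sum_sum:
  assumes "finite I" "finite J"
    and "\<And>i. i \<in> I \<Longrightarrow> square_integrable M (X i)" "\<And>j. j \<in> J \<Longrightarrow> square_integrable M (Y j)"
  shows "(\<integral>\<omega>. (\<Sum>i\<in>I. c i * X i \<omega>) * cnj (\<Sum>j\<in>J. d j * Y j \<omega>) \<partial>M) =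
    (\<Sum>i\<in>I. \<Sum>j\<in>J. c i * cnj (d j) * (\<integral>\<omega>. X i \<omega> * cnj (Y j \<omega>) \<partial>M))"
proof -
  have "(\<Sum>i\<in>I. c i * X i \<omega>) * cnj (\<Sum>j\<in>J. d j * Y j \<omega>) =
      (\<Sum>i\<in>I. \<Sum>j\<in>J. c i * cnj (d j) * (X i \<omega> * cnj (Y j \<omega>)))" for \<omega>
    by (simp add: sum_product cnj_sum algebra_simps)
  then have "(\<integral>\<omega>. (\<Sum>i\<in>I. c i * X i \<omega>) * cnj (\<Sum>j\<in>J. d j * Y j \<omega>) \<partial>M) =
      (\<integral>\<omega>. (\<Sum>i\<in>I. \<Sum>j\<in>J. c i * cnj (d j) * (X i \<omega> * cnj (Y j \<omega>))) \<partial>M)" by simp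
  also have "\<dots> = (\<Sum>i\<in>I. \<integral>\<omega>. (\<Sum>j\<in>J. c i * cnj (d j) * (X i \<omega> * cnj (Y j \<omega>))) \<partial>M)"
    using assms by (intro Bochner_Integration.integral_sum Bochner_Integration.integrable_sum
        integrable_mult_right square_integrable_inner) auto
  also have "\<dots> = (\<Sum>i\<in>I. \<Sum>j\<in>J. \<integral>\<omega>. c i * cnj (d j) * (X i \<omega> * cnj (Y j \<omega>)) \<partial>M)"
    using assms by (intro sum.cong refl Bochner_Integration.integral_sum
        integrable_mult_right square_integrable_inner) auto
  finally show ?thesis by simp
qed

section \<open>Isometry of the stochastic integral\<close>

text \<open>The measure \<open>f(t) dt\<close> on \<open>[-\<pi>, \<pi>]\<close>, so that \<open>spectral_sqdist\<close> is a case of \<open>mean_sqdist\<close> and one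
  theory of square integrable functions serves random variables and spectral characteristics.\<close>

definition spectral_measure :: "(real \<Rightarrow> real) \<Rightarrow> real measure" where
  "spectral_measure f = density lborel (\<lambda>t. ennreal (indicator {-pi..pi} t * f t))"

lemma sets_spectral_measure [simp, measurable_cong]: "sets (spectral_measure f) = sets borel"
  and space_spectral_measure [simp]: "space (spectral_measure f) = UNIV"
  by (simp_all add: spectral_measure_def)

lemma borel_measurable_spectral_measure [simp]:
  "borel_measurable (spectral_measure f) = borel_measurable borel"
  by (rule measurable_cong_sets) simp_all

lemma simple_function_spectral_measure: "simple_function (spectral_measure f) s \<longleftrightarrow> simple_function borel s"
  by (rule simple_function_cong_algebra) auto

lemma density_fun_integrable: "density_fun f \<Longrightarrow> integrable lborel (\<lambda>t. indicator {-pi..pi} t * f t)"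
  by (simp add: density_fun_def set_integrable_def)

lemma density_fun_measurable:
  "density_fun f \<Longrightarrow> (\<lambda>t. indicator {-pi..pi} t * f t) \<in> borel_measurable borel"
  using borel_measurable_integrable[OF density_fun_integrable, of f] by simp

lemma density_fun_nonneg: "density_fun f \<Longrightarrow> 0 \<le> indicator {-pi..pi} t * f t"
  by (simp add: density_fun_def indicator_def)

lemma spectral_sqdist_eq_mean_sqdist:
  assumes f: "density_fun f" and [measurable]: "g \<in> borel_measurable borel" "h \<in> borel_measurable borel"
  shows "spectral_sqdist f g h = mean_sqdist (spectral_measure f) g h"
proof -
  note [measurable] = density_fun_measurable[OF f]
  have "mean_sqdist (spectral_measure f) g h =
      (\<integral>\<^sup>+t. ennreal (indicator {-pi..pi} t * f t) * ennreal ((cmod (g t - h t))\<^sup>2) \<partial>lborel)"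
    unfolding mean_sqdist_def spectral_measure_def by (subst nn_integral_density) auto
  also have "\<dots> = spectral_sqdist f g h"
    unfolding spectral_sqdist_def using f
    by (intro nn_integral_cong)
      (auto simp: indicator_def density_fun_def ennreal_mult[symmetric] mult.commute)
  finally show ?thesis by simp
qed

lemma integrable_spectral_measure:
  fixes g :: "real \<Rightarrow> 'b::{banach, second_countable_topology}"
  assumes f: "density_fun f" and [measurable]: "g \<in> borel_measurable borel"
  shows "integrable (spectral_measure f) g \<longleftrightarrow>
    integrable lborel (\<lambda>t. (indicator {-pi..pi} t * f t) *\<^sub>R g t)"
  unfolding spectral_measure_def using density_fun_measurable[OF f] density_fun_nonneg[OF f]
  by (intro integrable_density) auto

lemma integral_spectral_measure:
  fixes g :: "real \<Rightarrow> 'b::{banach, second_countable_topology}"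
  assumes f: "density_fun f" and [measurable]: "g \<in> borel_measurable borel"
  shows "(\<integral>t. g t \<partial>spectral_measure f) = (\<integral>t. (indicator {-pi..pi} t * f t) *\<^sub>R g t \<partial>lborel)"
  unfolding spectral_measure_def using density_fun_measurable[OF f] density_fun_nonneg[OF f]
  by (intro integral_density) auto

lemma finite_spectral_measure:
  assumes f: "density_fun f" shows "finite_measure (spectral_measure f)"
proof
  have lb: "borel_measurable lborel = (borel_measurable borel :: (real \<Rightarrow> ennreal) set)"
    by (rule measurable_cong_sets) simp_all
  have m: "(\<lambda>t. ennreal (indicator {-pi..pi} t * f t)) \<in> borel_measurable lborel"
    using measurable_compose[OF density_fun_measurable[OF f] measurable_ennreal] unfolding lb .
  have "emeasure (spectral_measure f) UNIV =
      (\<integral>\<^sup>+t. ennreal (indicator {-pi..pi} t * f t) * indicator UNIV t \<partial>lborel)"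
    unfolding spectral_measure_def by (rule emeasure_density[OF m]) simp
  then have "emeasure (spectral_measure f) (space (spectral_measure f)) =
      (\<integral>\<^sup>+t. ennreal (indicator {-pi..pi} t * f t) \<partial>lborel)"
    by (simp only: indicator_UNIV mult_1_right space_spectral_measure)
  also have "\<dots> < \<infinity>"
    using density_fun_integrable[OF f] density_fun_nonneg[OF f]
    by (subst nn_integral_eq_integral) auto
  finally show "emeasure (spectral_measure f) (space (spectral_measure f)) \<noteq> \<infinity>" by simp
qed

lemma AE_spectral_measure_interval:
  assumes f: "density_fun f" shows "AE t in spectral_measure f. t \<in> {-pi..pi}"
proof -
  have lb: "borel_measurable lborel = (borel_measurable borel :: (real \<Rightarrow> ennreal) set)"
    by (rule measurable_cong_sets) simp_all
  have m: "(\<lambda>t. ennreal (indicator {-pi..pi} t * f t)) \<in> borel_measurable lborel"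
    using measurable_compose[OF density_fun_measurable[OF f] measurable_ennreal] unfolding lb .
  show ?thesis unfolding spectral_measure_def AE_density[OF m] by (auto simp: indicator_def)
qed

lemma measure_spectral_measure:
  assumes f: "density_fun f" and A: "A \<in> sets borel" "A \<subseteq> {-pi..pi}"
  shows "measure (spectral_measure f) A = (LINT t:A|lborel. f t)"
proof -
  interpret finite_measure "spectral_measure f" by (rule finite_spectral_measure[OF f])
  have "measure (spectral_measure f) A = (\<integral>t. indicator A t \<partial>spectral_measure f)"
    using A by simp
  also have "\<dots> = (\<integral>t. (indicator {-pi..pi} t * f t) *\<^sub>R indicator A t \<partial>lborel)"
    using A by (intro integral_spectral_measure f) simp
  also have "\<dots> = (LINT t:A|lborel. f t)"
    unfolding set_lebesgue_integral_def using A
    by (intro Bochner_Integration.integral_cong) (auto simp: indicator_def)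
  finally show ?thesis .
qed

lemma square_integrable_bounded_spectral:
  assumes f: "density_fun f" and [measurable]: "g \<in> borel_measurable borel" and C: "\<And>t. cmod (g t) \<le> C"
  shows "square_integrable (spectral_measure f) g"
proof -
  interpret finite_measure "spectral_measure f" by (rule finite_spectral_measure[OF f])
  have "integrable (spectral_measure f) (\<lambda>t. (cmod (g t))\<^sup>2)"
  proof (rule integrable_const_bound[where B="C\<^sup>2"])
    show "AE t in spectral_measure f. norm ((cmod (g t))\<^sup>2) \<le> C\<^sup>2"
      using power_mono[OF C norm_ge_zero, of _ 2] by simp
  qed simp
  then show ?thesis by (simp add: square_integrable_def)
qed

lemma simple_function_bounded:
  assumes "simple_function borel (s :: real \<Rightarrow> complex)" obtains C where "\<And>t. cmod (s t) \<le> C"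
proof -
  have "finite (cmod ` range s)" using assms by (simp add: simple_function_def)
  then have "cmod (s t) \<le> Max (cmod ` range s)" for t by (intro Max_ge) auto
  then show thesis using that by blast
qed

lemma square_integrable_simple_spectral:
  assumes f: "density_fun f" and s: "simple_function borel s"
  shows "square_integrable (spectral_measure f) s"
proof -
  obtain C where "\<And>t. cmod (s t) \<le> C" using simple_function_bounded[OF s] by blast
  then show ?thesis
    using s by (intro square_integrable_bounded_spectral[OF f]) (auto dest: borel_measurable_simple_function)
qed

locale orthogonal_integral = prob_space M for M :: "'w measure" +
  fixes f :: "real \<Rightarrow> real" and Z :: "real set \<Rightarrow> 'w \<Rightarrow> complex"
  assumes density: "density_fun f" and orthogonal: "orthogonal_stochastic_measure M f Z"
begin

abbreviation \<nu> where "\<nu> \<equiv> spectral_measure f"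

definition level :: "(real \<Rightarrow> complex) \<Rightarrow> complex \<Rightarrow> real set" where
  "level s y = {t\<in>{-pi..pi}. s t = y}"

lemma simple_integral_level: 
  "simple_stochastic_integral Z s \<omega> = (\<Sum>y\<in>s ` {-pi..pi}. y * Z (level s y) \<omega>)"
  by (simp add: simple_stochastic_integral_def level_def)

lemma level_sets: assumes "simple_function borel s" shows "level s y \<in> sets borel" "level s y \<subseteq> {-pi..pi}"
proof -
  have "level s y = (s -` {y} \<inter> space borel) \<inter> {-pi..pi}" by (auto simp: level_def)
  then show "level s y \<in> sets borel"
    using simple_functionD(2)[OF assms, of "{y}"] by auto
qed (auto simp: level_def)

lemma finite_levels: "simple_function borel s \<Longrightarrow> finite (s ` {-pi..pi})"
  by (rule finite_subset[of _ "range s"]) (auto simp: simple_function_def)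

lemma square_integrable_Z:
  "A \<in> sets borel \<Longrightarrow> A \<subseteq> {-pi..pi} \<Longrightarrow> square_integrable M (Z A)"
  using orthogonal by (simp add: orthogonal_stochastic_measure_def square_integrable_def)

lemma square_integrable_simple:
  "simple_function borel s \<Longrightarrow> square_integrable M (simple_stochastic_integral Z s)"
  unfolding simple_integral_level[abs_def]
  by (intro square_integrable_sum square_integrable_mult_left square_integrable_Z level_sets)

lemma expectation_simple:
  assumes s: "simple_function borel s"
  shows "expectation (simple_stochastic_integral Z s) = 0"
proof -
  have "expectation (\<lambda>\<omega>. y * Z (level s y) \<omega>) = 0" for y
    using orthogonal level_sets[OF s] by (simp add: orthogonal_stochastic_measure_def)
  moreover have "integrable M (\<lambda>\<omega>. y * Z (level s y) \<omega>)" for y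
    by (rule L2_imp_integrable[OF finite_measure_axioms])
      (intro square_integrable_mult_left square_integrable_Z level_sets s)
  ultimately show ?thesis unfolding simple_integral_level[abs_def]
    by (subst Bochner_Integration.integral_sum) (auto intro!: sum.neutral)
qed

text \<open>On indicators the isometry is the defining identity of \<open>Z\<close>; simple functions follow by
  sesquilinearity.\<close>

lemma inner_simple:
  assumes s: "simple_function borel s" and s': "simple_function borel s'"
  shows "expectation (\<lambda>\<omega>. simple_stochastic_integral Z s \<omega> * cnj (simple_stochastic_integral Z s' \<omega>)) =
    (1 / (2 * pi)) *\<^sub>R (\<integral>t. s t * cnj (s' t) \<partial>\<nu>)"
proof -
  note lev = level_sets[OF s] and lev' = level_sets[OF s']
  let ?m = "\<lambda>y y'. measure \<nu> (level s y \<inter> level s' y')"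
  have "expectation (\<lambda>\<omega>. simple_stochastic_integral Z s \<omega> * cnj (simple_stochastic_integral Z s' \<omega>)) =
      (\<Sum>y\<in>s ` {-pi..pi}. \<Sum>y'\<in>s' ` {-pi..pi}. y * cnj y' *
         expectation (\<lambda>\<omega>. Z (level s y) \<omega> * cnj (Z (level s' y') \<omega>)))"
    unfolding simple_integral_level
    by (intro L2_inner_sum_sum finite_levels s s' square_integrable_Z level_sets)
  also have "\<dots> = (\<Sum>y\<in>s ` {-pi..pi}. \<Sum>y'\<in>s' ` {-pi..pi}. y * cnj y' *
      complex_of_real (1 / (2 * pi) * ?m y y'))"
  proof (intro sum.cong refl arg_cong2[where f="(*)"])
    fix y y'
    have "level s y \<inter> level s' y' \<in> sets borel" "level s y \<inter> level s' y' \<subseteq> {-pi..pi}"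
      using lev[of y] lev'[of y'] by auto
    from measure_spectral_measure[OF density this]
    show "expectation (\<lambda>\<omega>. Z (level s y) \<omega> * cnj (Z (level s' y') \<omega>)) =
        complex_of_real (1 / (2 * pi) * ?m y y')"
      using orthogonal lev[of y] lev'[of y'] by (simp add: orthogonal_stochastic_measure_def)
  qed
  also have "\<dots> = (1 / (2 * pi)) *\<^sub>R
      (\<Sum>y\<in>s ` {-pi..pi}. \<Sum>y'\<in>s' ` {-pi..pi}. y * cnj y' * complex_of_real (?m y y'))"
    by (simp add: scaleR_conv_of_real sum_distrib_left algebra_simps)
  also have "(\<Sum>y\<in>s ` {-pi..pi}. \<Sum>y'\<in>s' ` {-pi..pi}. y * cnj y' * complex_of_real (?m y y')) =
      (\<Sum>y\<in>s ` {-pi..pi}. \<Sum>y'\<in>s' ` {-pi..pi}. y * cnj y' *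
        (\<integral>t. indicator (level s y) t * cnj (indicator (level s' y') t) \<partial>\<nu>))"
  proof (intro sum.cong refl arg_cong2[where f="(*)"])
    fix y y'
    have "(\<integral>t. indicator (level s y) t * cnj (indicator (level s' y') t) \<partial>\<nu>) =
        (\<integral>t. complex_of_real (indicator (level s y \<inter> level s' y') t) \<partial>\<nu>)"
      by (intro Bochner_Integration.integral_cong refl) (simp add: indicator_def)
    also have "\<dots> = complex_of_real (?m y y')"
      unfolding integral_complex_of_real using lev[of y] lev'[of y'] by simp
    finally show "complex_of_real (?m y y') =
        (\<integral>t. indicator (level s y) t * cnj (indicator (level s' y') t) \<partial>\<nu>)" by simp
  qed
  also have "\<dots> = (\<integral>t. (\<Sum>y\<in>s ` {-pi..pi}. y * indicator (level s y) t) *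
      cnj (\<Sum>y'\<in>s' ` {-pi..pi}. y' * indicator (level s' y') t) \<partial>\<nu>)"
    by (intro L2_inner_sum_sum[symmetric] finite_levels s s' borel_measurable_indicator lev lev'
        square_integrable_bounded_spectral[OF density, where C=1]) (auto simp: indicator_def)
  also have "\<dots> = (\<integral>t. s t * cnj (s' t) \<partial>\<nu>)"
  proof (rule Bochner_Integration.integral_cong_AE)
    have eq: "(\<Sum>y\<in>r ` {-pi..pi}. y * indicator (level r y) t) = r t"
      if "t \<in> {-pi..pi}" "simple_function borel r" for r t
      using that finite_levels[OF that(2)]
      by (subst sum.remove[of _ "r t"]) (auto simp: level_def indicator_def intro!: sum.neutral)
    show "AE t in \<nu>. (\<Sum>y\<in>s ` {-pi..pi}. y * indicator (level s y) t) *
      cnj (\<Sum>y'\<in>s' ` {-pi..pi}. y' * indicator (level s' y') t) = s t * cnj (s' t)"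
      using AE_spectral_measure_interval[OF density]
      by eventually_elim (simp only: eq s s')
    have [measurable]: "s \<in> borel_measurable borel" "s' \<in> borel_measurable borel"
      using s s' by (auto dest: borel_measurable_simple_function)
    note [measurable] = lev lev'
    show "(\<lambda>t. (\<Sum>y\<in>s ` {-pi..pi}. y * indicator (level s y) t) *
      cnj (\<Sum>y'\<in>s' ` {-pi..pi}. y' * indicator (level s' y') t)) \<in> borel_measurable \<nu>" by measurable
    show "(\<lambda>t. s t * cnj (s' t)) \<in> borel_measurable \<nu>" by measurable
  qed
  finally show ?thesis .
qed

lemma dist_simple:
  assumes s: "simple_function borel s" and s': "simple_function borel s'"
  shows "expectation (\<lambda>\<omega>. (cmod (simple_stochastic_integral Z s \<omega> - simple_stochastic_integral Z s' \<omega>))\<^sup>2) =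
    1 / (2 * pi) * (\<integral>t. (cmod (s t - s' t))\<^sup>2 \<partial>\<nu>)"
proof -
  let ?I = "simple_stochastic_integral Z"
  let ?S = "\<lambda>b::bool. if b then s else s'" and ?c = "\<lambda>b::bool. if b then 1 else -1 :: complex"
  have S: "simple_function borel (?S b)" for b using s s' by simp
  have 1: "expectation (\<lambda>\<omega>. (\<Sum>b\<in>UNIV. ?c b * ?I (?S b) \<omega>) * cnj (\<Sum>b\<in>UNIV. ?c b * ?I (?S b) \<omega>)) =
    (\<Sum>b\<in>UNIV. \<Sum>b'\<in>UNIV. ?c b * cnj (?c b') * expectation (\<lambda>\<omega>. ?I (?S b) \<omega> * cnj (?I (?S b') \<omega>)))"
    by (intro L2_inner_sum_sum square_integrable_simple S) auto
  have 2: "(\<integral>t. (\<Sum>b\<in>UNIV. ?c b * ?S b t) * cnj (\<Sum>b\<in>UNIV. ?c b * ?S b t) \<partial>\<nu>) =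
    (\<Sum>b\<in>UNIV. \<Sum>b'\<in>UNIV. ?c b * cnj (?c b') * (\<integral>t. ?S b t * cnj (?S b' t) \<partial>\<nu>))"
    by (intro L2_inner_sum_sum square_integrable_simple_spectral[OF density] S) auto
  have eq1: "(\<Sum>b\<in>UNIV. ?c b * ?I (?S b) \<omega>) = ?I s \<omega> - ?I s' \<omega>" for \<omega> by (simp add: UNIV_bool)
  have eq2: "(\<Sum>b\<in>UNIV. ?c b * ?S b t) = s t - s' t" for t by (simp add: UNIV_bool)
  have "complex_of_real (expectation (\<lambda>\<omega>. (cmod (?I s \<omega> - ?I s' \<omega>))\<^sup>2)) =
      expectation (\<lambda>\<omega>. (?I s \<omega> - ?I s' \<omega>) * cnj (?I s \<omega> - ?I s' \<omega>))"
    by (rule integral_cmod_sq_eq)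
  also have "\<dots> = (\<Sum>b\<in>UNIV. \<Sum>b'\<in>UNIV. ?c b * cnj (?c b') *
      ((1 / (2 * pi)) *\<^sub>R (\<integral>t. ?S b t * cnj (?S b' t) \<partial>\<nu>)))"
    using 1 unfolding eq1 inner_simple[OF S S] .
  also have "\<dots> = (1 / (2 * pi)) *\<^sub>R
      (\<Sum>b\<in>UNIV. \<Sum>b'\<in>UNIV. ?c b * cnj (?c b') * (\<integral>t. ?S b t * cnj (?S b' t) \<partial>\<nu>))"
    unfolding scaleR_sum_right mult_scaleR_right ..
  also have "\<dots> = (1 / (2 * pi)) *\<^sub>R (\<integral>t. (s t - s' t) * cnj (s t - s' t) \<partial>\<nu>)"
    using 2 unfolding eq2 by simp
  also have "\<dots> = complex_of_real (1 / (2 * pi) * (\<integral>t. (cmod (s t - s' t))\<^sup>2 \<partial>\<nu>))"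
    unfolding integral_cmod_sq_eq[symmetric] scaleR_conv_of_real of_real_mult ..
  finally have "complex_of_real (expectation (\<lambda>\<omega>. (cmod (?I s \<omega> - ?I s' \<omega>))\<^sup>2)) =
      complex_of_real (1 / (2 * pi) * (\<integral>t. (cmod (s t - s' t))\<^sup>2 \<partial>\<nu>))" .
  then show ?thesis by (simp only: of_real_eq_iff)
qed

lemma has_integral_square_integrable:
  assumes "has_stochastic_integral M f Z g X"
  shows "square_integrable \<nu> g" "square_integrable M X"
proof -
  obtain s where g: "g \<in> borel_measurable borel" and X: "X \<in> borel_measurable M"
    and s: "\<And>j. simple_function borel (s j)" "(\<lambda>j. spectral_sqdist f g (s j)) \<longlonglongrightarrow> 0"
      "(\<lambda>j::nat. mean_sqdist M X (simple_stochastic_integral Z (s j))) \<longlonglongrightarrow> 0"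
    using assms unfolding has_stochastic_integral_def by auto
  have ms: "s j \<in> borel_measurable borel" for j using s(1) by (rule borel_measurable_simple_function)
  have "\<forall>\<^sub>F j in sequentially. spectral_sqdist f g (s j) < \<infinity>"
    using s(2) by (rule order_tendstoD) simp
  then obtain j where "spectral_sqdist f g (s j) < \<infinity>" by (auto simp: eventually_sequentially)
  then have "mean_sqdist \<nu> g (s j) < \<infinity>"
    by (simp add: spectral_sqdist_eq_mean_sqdist[OF density g ms])
  then show "square_integrable \<nu> g"
    using g by (intro square_integrable_if_close[OF square_integrable_simple_spectral[OF density s(1)]]) auto
  have "\<forall>\<^sub>F j in sequentially. mean_sqdist M X (simple_stochastic_integral Z (s j)) < \<infinity>"
    using s(3) by (rule order_tendstoD) simp
  then obtain j where "mean_sqdist M X (simple_stochastic_integral Z (s j)) < \<infinity>"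
    by (auto simp: eventually_sequentially)
  then show "square_integrable M X"
    using X by (intro square_integrable_if_close[OF square_integrable_simple[OF s(1)]]) auto
qed

lemma has_integral_approx:
  assumes "has_stochastic_integral M f Z g X"
  shows "\<exists>s. (\<forall>j::nat. simple_function borel (s j)) \<and> (\<lambda>j. mean_sqdist \<nu> g (s j)) \<longlonglongrightarrow> 0 \<and>
    (\<lambda>j. mean_sqdist M X (simple_stochastic_integral Z (s j))) \<longlonglongrightarrow> 0"
proof -
  obtain s where g: "g \<in> borel_measurable borel"
    and s: "\<And>j. simple_function borel (s j)" "(\<lambda>j. spectral_sqdist f g (s j)) \<longlonglongrightarrow> 0"
      "(\<lambda>j::nat. mean_sqdist M X (simple_stochastic_integral Z (s j))) \<longlonglongrightarrow> 0"
    using assms unfolding has_stochastic_integral_def by auto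
  have "spectral_sqdist f g (s j) = mean_sqdist \<nu> g (s j)" for j
    using s(1) by (intro spectral_sqdist_eq_mean_sqdist[OF density g] borel_measurable_simple_function)
  then show ?thesis using s by (intro exI[of _ s]) simp
qed

lemma has_integral_inner:
  assumes X: "has_stochastic_integral M f Z g X" and Y: "has_stochastic_integral M f Z h Y"
  shows "expectation (\<lambda>\<omega>. X \<omega> * cnj (Y \<omega>)) = (1 / (2 * pi)) *\<^sub>R (\<integral>t. g t * cnj (h t) \<partial>\<nu>)"
proof -
  obtain s where s: "\<And>j::nat. simple_function borel (s j)" "(\<lambda>j. mean_sqdist \<nu> g (s j)) \<longlonglongrightarrow> 0"
    "(\<lambda>j. mean_sqdist M X (simple_stochastic_integral Z (s j))) \<longlonglongrightarrow> 0"
    using has_integral_approx[OF X] by (elim exE conjE) (rule that, auto)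
  obtain r where r: "\<And>j::nat. simple_function borel (r j)" "(\<lambda>j. mean_sqdist \<nu> h (r j)) \<longlonglongrightarrow> 0"
    "(\<lambda>j. mean_sqdist M Y (simple_stochastic_integral Z (r j))) \<longlonglongrightarrow> 0"
    using has_integral_approx[OF Y] by (elim exE conjE) (rule that, auto)
  have "(\<lambda>j. expectation (\<lambda>\<omega>. simple_stochastic_integral Z (s j) \<omega> * cnj (simple_stochastic_integral Z (r j) \<omega>)))
      \<longlonglongrightarrow> expectation (\<lambda>\<omega>. X \<omega> * cnj (Y \<omega>))"
    by (intro tendsto_L2_inner has_integral_square_integrable(2)[OF X] has_integral_square_integrable(2)[OF Y]
        square_integrable_simple s r)
  moreover have "(\<lambda>j. (1 / (2 * pi)) *\<^sub>R (\<integral>t. s j t * cnj (r j t) \<partial>\<nu>))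
      \<longlonglongrightarrow> (1 / (2 * pi)) *\<^sub>R (\<integral>t. g t * cnj (h t) \<partial>\<nu>)"
    by (intro tendsto_scaleR tendsto_const tendsto_L2_inner has_integral_square_integrable(1)[OF X]
        has_integral_square_integrable(1)[OF Y] square_integrable_simple_spectral[OF density] s r)
  ultimately show ?thesis
    unfolding inner_simple[OF s(1) r(1)] by (rule LIMSEQ_unique)
qed

lemma has_integral_expectation:
  assumes X: "has_stochastic_integral M f Z g X" shows "expectation X = 0"
proof -
  obtain s where s: "\<And>j::nat. simple_function borel (s j)" "(\<lambda>j. mean_sqdist \<nu> g (s j)) \<longlonglongrightarrow> 0"
    "(\<lambda>j. mean_sqdist M X (simple_stochastic_integral Z (s j))) \<longlonglongrightarrow> 0"
    using has_integral_approx[OF X] by (elim exE conjE) (rule that, auto)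
  have one: "square_integrable M (\<lambda>_. 1)" by (simp add: square_integrable_def)
  have "(\<lambda>j. expectation (\<lambda>\<omega>. simple_stochastic_integral Z (s j) \<omega> * cnj 1))
      \<longlonglongrightarrow> expectation (\<lambda>\<omega>. X \<omega> * cnj 1)"
    by (intro tendsto_L2_inner has_integral_square_integrable(2)[OF X] one square_integrable_simple s)
      (simp add: mean_sqdist_def)
  then show ?thesis using expectation_simple[OF s(1)] LIMSEQ_unique[OF _ tendsto_const] by fastforce
qed

text \<open>The error of an estimate is a finite combination of stochastic integrals, so this is the
  form of the isometry that evaluates it.\<close>

lemma has_integral_combination:
  assumes fin: "finite I" and X: "\<And>i. i \<in> I \<Longrightarrow> has_stochastic_integral M f Z (g i) (X i)"
  shows "square_integrable M (\<lambda>\<omega>. \<Sum>i\<in>I. c i * X i \<omega>)"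
    "square_integrable \<nu> (\<lambda>t. \<Sum>i\<in>I. c i * g i t)"
    "expectation (\<lambda>\<omega>. (cmod (\<Sum>i\<in>I. c i * X i \<omega>))\<^sup>2) =
      1 / (2 * pi) * (\<integral>t. (cmod (\<Sum>i\<in>I. c i * g i t))\<^sup>2 \<partial>\<nu>)"
proof -
  note sq = has_integral_square_integrable[OF X]
  show "square_integrable M (\<lambda>\<omega>. \<Sum>i\<in>I. c i * X i \<omega>)" "square_integrable \<nu> (\<lambda>t. \<Sum>i\<in>I. c i * g i t)"
    using sq by (auto intro!: square_integrable_sum square_integrable_mult_left)
  have "complex_of_real (expectation (\<lambda>\<omega>. (cmod (\<Sum>i\<in>I. c i * X i \<omega>))\<^sup>2)) =
      (\<Sum>i\<in>I. \<Sum>j\<in>I. c i * cnj (c j) * expectation (\<lambda>\<omega>. X i \<omega> * cnj (X j \<omega>)))"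
    unfolding integral_cmod_sq_eq using fin sq by (intro L2_inner_sum_sum) auto
  also have "\<dots> = (1 / (2 * pi)) *\<^sub>R
      (\<Sum>i\<in>I. \<Sum>j\<in>I. c i * cnj (c j) * (\<integral>t. g i t * cnj (g j t) \<partial>\<nu>))"
    by (simp add: has_integral_inner[OF X X] scaleR_conv_of_real sum_distrib_left algebra_simps)
  also have "(\<Sum>i\<in>I. \<Sum>j\<in>I. c i * cnj (c j) * (\<integral>t. g i t * cnj (g j t) \<partial>\<nu>)) =
      complex_of_real (\<integral>t. (cmod (\<Sum>i\<in>I. c i * g i t))\<^sup>2 \<partial>\<nu>)"
    unfolding integral_cmod_sq_eq using fin sq by (intro L2_inner_sum_sum[symmetric]) auto
  finally have "complex_of_real (expectation (\<lambda>\<omega>. (cmod (\<Sum>i\<in>I. c i * X i \<omega>))\<^sup>2)) =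
      complex_of_real (1 / (2 * pi) * (\<integral>t. (cmod (\<Sum>i\<in>I. c i * g i t))\<^sup>2 \<partial>\<nu>))"
    by (simp add: scaleR_conv_of_real)
  then show "expectation (\<lambda>\<omega>. (cmod (\<Sum>i\<in>I. c i * X i \<omega>))\<^sup>2) =
      1 / (2 * pi) * (\<integral>t. (cmod (\<Sum>i\<in>I. c i * g i t))\<^sup>2 \<partial>\<nu>)"
    by (simp only: of_real_eq_iff)
qed

text \<open>Every function in \<open>L\<^sub>2(f)\<close> can be integrated: the integrals of approximating simple
  functions form a Cauchy sequence by the isometry.\<close>

lemma has_integral_exists:
  assumes g: "square_integrable \<nu> g"
  obtains X where "has_stochastic_integral M f Z g X"
proof -
  obtain s where s: "\<And>j::nat. simple_function \<nu> (s j)" "\<And>j. square_integrable \<nu> (s j)"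
    "(\<lambda>j. mean_sqdist \<nu> g (s j)) \<longlonglongrightarrow> 0" using L2_simple_approximation[OF g] by (elim exE conjE) (rule that, auto)
  have s': "simple_function borel (s j)" for j using s(1) by (simp add: simple_function_spectral_measure)
  have mg [measurable]: "g \<in> borel_measurable borel" using g by (simp add: square_integrable_def)
  have ms [measurable]: "s j \<in> borel_measurable borel" for j using s' by (rule borel_measurable_simple_function)
  have "\<exists>K. \<forall>i\<ge>K. \<forall>j\<ge>K. expectation (\<lambda>\<omega>. (cmod (simple_stochastic_integral Z (s i) \<omega> -
      simple_stochastic_integral Z (s j) \<omega>))\<^sup>2) \<le> e" if "e > 0" for e
  proof -
    have "\<forall>\<^sub>F j in sequentially. mean_sqdist \<nu> g (s j) < ennreal (e / 2)"
      using s(3) that by (intro order_tendstoD) auto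
    then obtain K where K: "\<And>j. j \<ge> K \<Longrightarrow> mean_sqdist \<nu> g (s j) < ennreal (e / 2)"
      by (auto simp: eventually_sequentially)
    have "expectation (\<lambda>\<omega>. (cmod (simple_stochastic_integral Z (s i) \<omega> -
      simple_stochastic_integral Z (s j) \<omega>))\<^sup>2) \<le> e" if ij: "i \<ge> K" "j \<ge> K" for i j
    proof -
      have "ennreal (\<integral>t. (cmod (s i t - s j t))\<^sup>2 \<partial>\<nu>) = mean_sqdist \<nu> (s i) (s j)"
        by (intro mean_sqdist_eq_integral[symmetric] square_integrable_diff s)
      also have "\<dots> \<le> 2 * mean_sqdist \<nu> (s i) g + 2 * mean_sqdist \<nu> g (s j)"
        by (intro mean_sqdist_triangle) auto
      also have "\<dots> \<le> 2 * ennreal (e / 2) + 2 * ennreal (e / 2)"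
        using K[OF ij(1)] K[OF ij(2)]
        by (intro add_mono mult_left_mono) (auto simp: mean_sqdist_commute[of _ "s i"])
      also have "\<dots> = ennreal (2 * e)"
      proof -
        have "2 * ennreal (e / 2) = ennreal e"
          using \<open>e > 0\<close> ennreal_mult[of 2 "e/2"] by simp
        then show ?thesis using \<open>e > 0\<close> by (simp flip: ennreal_plus)
      qed
      finally have "(\<integral>t. (cmod (s i t - s j t))\<^sup>2 \<partial>\<nu>) \<le> 2 * e"
        using \<open>e > 0\<close> by (subst (asm) ennreal_le_iff) auto
      then have "1 / (2 * pi) * (\<integral>t. (cmod (s i t - s j t))\<^sup>2 \<partial>\<nu>) \<le> 1 / (2 * pi) * (2 * e)"
        by (intro mult_left_mono) auto
      also have "\<dots> \<le> e" using \<open>e > 0\<close> pi_gt3 by (simp add: field_simps)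
      finally show ?thesis by (simp only: dist_simple[OF s' s'])
    qed
    then show ?thesis by blast
  qed
  then obtain X where X: "square_integrable M X"
      "(\<lambda>j. mean_sqdist M X (simple_stochastic_integral Z (s j))) \<longlonglongrightarrow> 0"
    by (rule L2_complete[OF square_integrable_simple[OF s']])
  have "has_stochastic_integral M f Z g X"
    unfolding has_stochastic_integral_def
    using X s(3) s' mg by (auto intro!: exI[of _ s] simp: square_integrable_def spectral_sqdist_eq_mean_sqdist[OF density mg ms])
  then show thesis by (rule that)
qed

end

section \<open>A sequence with a given spectral density\<close>

lemma cmod_one_minus_cis_le: "cmod (1 - cis x) \<le> \<bar>x\<bar>"
proof -
  have "cmod (1 - cis x) = 2 * \<bar>sin (x / 2)\<bar>"
    using dist_exp_i_1[of x] by (simp add: cis_conv_exp norm_minus_commute mult.commute)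
  also have "\<dots> \<le> \<bar>x\<bar>" using abs_sin_x_le_abs_x[of "x / 2"] by simp
  finally show ?thesis .
qed

lemma borel_measurable_cis [measurable (raw)]:
  "g \<in> borel_measurable M \<Longrightarrow> (\<lambda>x. cis (g x)) \<in> borel_measurable M"
  by (rule borel_measurable_continuous_on[OF continuous_on_cis[OF continuous_on_id]])

lemma cis_inner: "cis (of_int k * t) * cnj (cis (of_int l * t)) = cis (of_int (k - l) * t)"
  by (simp add: cis_cnj cis_mult algebra_simps)

lemma increment_kernel_measurable [measurable]: "increment_kernel n \<mu> \<in> borel_measurable borel"
  unfolding increment_kernel_def[abs_def] by measurable

lemma cmod_increment_kernel_le: "cmod (increment_kernel n \<mu> t) \<le> (of_int \<bar>\<mu>\<bar>) ^ n"
proof (cases "t = 0")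
  case False
  have "cmod (1 - cis (- (of_int \<mu> * t))) \<le> of_int \<bar>\<mu>\<bar> * \<bar>t\<bar>"
    using cmod_one_minus_cis_le[of "- (of_int \<mu> * t)"] by (simp add: abs_mult)
  then have "cmod (1 - cis (- (of_int \<mu> * t))) / \<bar>t\<bar> \<le> of_int \<bar>\<mu>\<bar>"
    using False by (simp add: field_simps)
  then have "(cmod (1 - cis (- (of_int \<mu> * t))) / \<bar>t\<bar>) ^ n \<le> (of_int \<bar>\<mu>\<bar>) ^ n"
    by (intro power_mono) auto
  then show ?thesis
    by (simp add: increment_kernel_def norm_divide norm_power norm_mult power_divide)
qed (cases "n = 0"; simp add: increment_kernel_def)

lemma increment_kernel_square_integrable:
  assumes "density_fun f"
  shows "square_integrable (spectral_measure f) (\<lambda>t. cis (of_int m * t) * increment_kernel n \<mu> t)"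
  using cmod_increment_kernel_le[of n \<mu>]
  by (intro square_integrable_bounded_spectral[OF assms, where C="(of_int \<bar>\<mu>\<bar>) ^ n"])
    (auto simp: norm_mult)

text \<open>A concrete process with a given spectral density: the frequency \<open>T\<close> is uniform on
  \<open>[-\<pi>, \<pi>]\<close>, an independent random sign makes everything centred, and \<open>\<integral> H dZ\<close> is the
  single wave \<open>\<plusminus>H(T) \<surd>f(T)\<close>.  Both are read off a point of \<open>[-2\<pi>, 2\<pi>]\<close>.\<close>

definition wave_space :: "real measure" where
  "wave_space = density lborel (\<lambda>\<omega>. ennreal (indicator {-(2*pi)..2*pi} \<omega> / (4 * pi)))"

definition wave_frequency :: "real \<Rightarrow> real" where
  "wave_frequency \<omega> = \<bar>\<omega>\<bar> - pi"

definition wave :: "(real \<Rightarrow> real) \<Rightarrow> (real \<Rightarrow> complex) \<Rightarrow> real \<Rightarrow> complex" where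
  "wave f H \<omega> = complex_of_real (sgn \<omega>) * (H (wave_frequency \<omega>) *
     complex_of_real (sqrt (indicator {-pi..pi} (wave_frequency \<omega>) * f (wave_frequency \<omega>))))"

lemma sets_wave_space [simp, measurable_cong]: "sets wave_space = sets borel"
  and space_wave_space [simp]: "space wave_space = UNIV"
  by (simp_all add: wave_space_def)

lemma borel_measurable_wave_space [simp]: "borel_measurable wave_space = borel_measurable borel"
  by (rule measurable_cong_sets) simp_all

lemma wave_frequency_measurable [measurable]: "wave_frequency \<in> borel_measurable borel"
  unfolding wave_frequency_def[abs_def] by measurable

text \<open>The two halves of \<open>[-2\<pi>, 2\<pi>]\<close> are mapped onto \<open>[-\<pi>, \<pi>]\<close> by translation and reflection,
  each with half of the mass.\<close>

lemma nn_integral_wave_frequency: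
  assumes [measurable]: "h \<in> borel_measurable borel"
  shows "(\<integral>\<^sup>+\<omega>. h (wave_frequency \<omega>) \<partial>wave_space) =
    (\<integral>\<^sup>+t. ennreal (indicator {-pi..pi} t / (2 * pi)) * h t \<partial>lborel)"
proof -
  let ?e = "ennreal (1 / (4 * pi))"
  let ?J = "\<integral>\<^sup>+x. ?e * (h x * indicator {-pi<..pi} x) \<partial>lborel"
  have "(\<integral>\<^sup>+\<omega>. h (wave_frequency \<omega>) \<partial>wave_space) =
      (\<integral>\<^sup>+\<omega>. ennreal (indicator {-(2*pi)..2*pi} \<omega> / (4 * pi)) * h (wave_frequency \<omega>) \<partial>lborel)"
    unfolding wave_space_def by (subst nn_integral_density) auto
  also have "\<dots> = (\<integral>\<^sup>+\<omega>. ?e * (h (\<omega> - pi) * indicator {0<..2*pi} \<omega>) +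
      ?e * (h (- \<omega> - pi) * indicator {-(2*pi)..<0} \<omega>) \<partial>lborel)"
  proof (rule nn_integral_cong_AE)
    show "AE \<omega> in lborel. ennreal (indicator {-(2*pi)..2*pi} \<omega> / (4 * pi)) * h (wave_frequency \<omega>) =
      ?e * (h (\<omega> - pi) * indicator {0<..2*pi} \<omega>) + ?e * (h (- \<omega> - pi) * indicator {-(2*pi)..<0} \<omega>)"
      using AE_lborel_singleton[of "0::real"]
    proof eventually_elim
      case (elim \<omega>)
      then show ?case
        by (cases "\<omega> > 0") (auto simp: wave_frequency_def indicator_def)
    qed
  qed
  also have "\<dots> = (\<integral>\<^sup>+\<omega>. ?e * (h (\<omega> - pi) * indicator {0<..2*pi} \<omega>) \<partial>lborel) +
      (\<integral>\<^sup>+\<omega>. ?e * (h (- \<omega> - pi) * indicator {-(2*pi)..<0} \<omega>) \<partial>lborel)"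
    by (rule nn_integral_add) auto
  also have "(\<integral>\<^sup>+\<omega>. ?e * (h (\<omega> - pi) * indicator {0<..2*pi} \<omega>) \<partial>lborel) = ?J"
    by (subst nn_integral_real_affine[where c=1 and t=pi])
      (auto intro!: nn_integral_cong simp: indicator_def)
  also have "(\<integral>\<^sup>+\<omega>. ?e * (h (- \<omega> - pi) * indicator {-(2*pi)..<0} \<omega>) \<partial>lborel) = ?J"
    by (subst nn_integral_real_affine[where c="-1" and t="-pi"])
      (auto intro!: nn_integral_cong simp: indicator_def)
  also have "?J + ?J = (\<integral>\<^sup>+x. ?e * (h x * indicator {-pi<..pi} x) + ?e * (h x * indicator {-pi<..pi} x) \<partial>lborel)"
    by (rule nn_integral_add[symmetric]) auto
  also have "\<dots> = (\<integral>\<^sup>+t. ennreal (indicator {-pi..pi} t / (2 * pi)) * h t \<partial>lborel)"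
  proof (rule nn_integral_cong_AE)
    have e2: "?e + ?e = ennreal (1 / (2 * pi))" by (simp flip: ennreal_plus)
    show "AE x in lborel. ?e * (h x * indicator {-pi<..pi} x) + ?e * (h x * indicator {-pi<..pi} x) =
      ennreal (indicator {-pi..pi} x / (2 * pi)) * h x"
      using AE_lborel_singleton[of "-pi"]
    proof eventually_elim
      case (elim x)
      have "?e * (h x * indicator {-pi<..pi} x) + ?e * (h x * indicator {-pi<..pi} x) =
          ennreal (1 / (2 * pi)) * (h x * indicator {-pi<..pi} x)"
        by (simp only: e2 flip: distrib_right)
      then show ?case using elim by (auto simp: indicator_def)
    qed
  qed
  finally show ?thesis .
qed

lemma distr_wave_frequency:
  "distr wave_space borel wave_frequency = density lborel (\<lambda>t. ennreal (indicator {-pi..pi} t / (2 * pi)))"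
proof (rule measure_eqI)
  fix A assume "A \<in> sets (distr wave_space borel wave_frequency)"
  then have A [measurable]: "A \<in> sets borel" by simp
  have "emeasure (distr wave_space borel wave_frequency) A =
      (\<integral>\<^sup>+t. indicator A t \<partial>distr wave_space borel wave_frequency)" by simp
  also have "\<dots> = (\<integral>\<^sup>+\<omega>. indicator A (wave_frequency \<omega>) \<partial>wave_space)"
    by (rule nn_integral_distr) auto
  also have "\<dots> = emeasure (density lborel (\<lambda>t. ennreal (indicator {-pi..pi} t / (2 * pi)))) A"
    by (subst nn_integral_wave_frequency) (auto simp: emeasure_density)
  finally show "emeasure (distr wave_space borel wave_frequency) A =
    emeasure (density lborel (\<lambda>t. ennreal (indicator {-pi..pi} t / (2 * pi)))) A" .
qed simp

lemma prob_space_wave_space: "prob_space wave_space"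
proof
  have "emeasure wave_space (space wave_space) = (\<integral>\<^sup>+\<omega>. 1 \<partial>wave_space)" by simp
  also have "\<dots> = (\<integral>\<^sup>+t. ennreal (indicator {-pi..pi} t / (2 * pi)) * 1 \<partial>lborel)"
    by (rule nn_integral_wave_frequency) simp
  also have "\<dots> = (\<integral>\<^sup>+t. ennreal (1 / (2 * pi)) * indicator {-pi..pi} t \<partial>lborel)"
    by (intro nn_integral_cong) (simp add: indicator_def)
  also have "\<dots> = ennreal (1 / (2 * pi)) * ennreal (2 * pi)"
    by (subst nn_integral_cmult_indicator) auto
  also have "\<dots> = 1" by (simp flip: ennreal_mult)
  finally show "emeasure wave_space (space wave_space) = 1" .
qed

lemma wave_odd_expectation:
  fixes G :: "real \<Rightarrow> complex"
  assumes [measurable]: "G \<in> borel_measurable borel"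
  shows "(\<integral>\<omega>. complex_of_real (sgn \<omega>) * G (wave_frequency \<omega>) \<partial>wave_space) = 0"
proof -
  let ?F = "\<lambda>\<omega>. (indicator {-(2*pi)..2*pi} \<omega> / (4 * pi)) *\<^sub>R (complex_of_real (sgn \<omega>) * G (wave_frequency \<omega>))"
  have I: "(\<integral>\<omega>. complex_of_real (sgn \<omega>) * G (wave_frequency \<omega>) \<partial>wave_space) = (\<integral>\<omega>. ?F \<omega> \<partial>lborel)"
    unfolding wave_space_def by (rule integral_density) (auto simp: indicator_def)
  have odd: "?F (0 + (-1) * \<omega>) = - ?F \<omega>" for \<omega>
  proof -
    have "indicator {-(2*pi)..2*pi} (0 + (-1) * \<omega>) = (indicator {-(2*pi)..2*pi} \<omega> :: real)"
    proof -
      have "(- (2*pi) \<le> 0 + (-1) * \<omega> \<and> 0 + (-1) * \<omega> \<le> 2*pi) = (- (2*pi) \<le> \<omega> \<and> \<omega> \<le> 2*pi)" by linarith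
      then show ?thesis by (simp only: indicator_def atLeastAtMost_iff)
    qed
    moreover have "wave_frequency (0 + (-1) * \<omega>) = wave_frequency \<omega>" by (simp add: wave_frequency_def)
    moreover have "sgn (0 + (-1) * \<omega>) = - sgn \<omega>" by (simp add: sgn_minus)
    ultimately show ?thesis by (simp only: of_real_minus mult_minus_left scaleR_minus_right)
  qed
  have "(\<integral>\<omega>. ?F \<omega> \<partial>lborel) = (\<integral>\<omega>. ?F (0 + (-1) * \<omega>) \<partial>lborel)"
    using lborel_integral_real_affine[of "-1" ?F 0] by (simp only: abs_minus_cancel abs_one scaleR_one)
  also have "\<dots> = (\<integral>\<omega>. - ?F \<omega> \<partial>lborel)" by (simp only: odd)
  also have "\<dots> = - (\<integral>\<omega>. ?F \<omega> \<partial>lborel)" by (rule Bochner_Integration.integral_minus)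
  finally have neg: "(\<integral>\<omega>. ?F \<omega> \<partial>lborel) = - (\<integral>\<omega>. ?F \<omega> \<partial>lborel)" .
  have "x = - x \<Longrightarrow> x = 0" for x :: complex by (simp add: complex_eq_iff)
  from this[OF neg] show ?thesis unfolding I .
qed

context
  fixes f assumes density: "density_fun f"
begin

interpretation W: prob_space wave_space by (rule prob_space_wave_space)

abbreviation amp where "amp t \<equiv> sqrt (indicator {-pi..pi} t * f t)"

lemma amp_measurable: "amp \<in> borel_measurable borel"
  using density_fun_measurable[OF density] by measurable

lemma wave_measurable:
  assumes [measurable]: "H \<in> borel_measurable borel" shows "wave f H \<in> borel_measurable borel"
proof -
  note [measurable] = amp_measurable
  have [measurable]: "(\<lambda>\<omega>. amp (wave_frequency \<omega>)) \<in> borel_measurable borel"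
    by (rule measurable_compose[OF wave_frequency_measurable amp_measurable])
  show ?thesis unfolding wave_def[abs_def] by measurable
qed

lemma wave_expectation:
  assumes [measurable]: "H \<in> borel_measurable borel" shows "W.expectation (wave f H) = 0"
proof -
  note [measurable] = amp_measurable
  have "(\<lambda>t. H t * complex_of_real (amp t)) \<in> borel_measurable borel" by measurable
  from wave_odd_expectation[OF this] show ?thesis unfolding wave_def[abs_def] .
qed

lemma AE_wave_space_nonzero: "AE \<omega> in wave_space. \<omega> \<noteq> 0"
  unfolding wave_space_def using AE_lborel_singleton[of "0::real"] by (subst AE_density) auto

lemma mean_sqdist_wave:
  assumes [measurable]: "H \<in> borel_measurable borel" "K \<in> borel_measurable borel"
  shows "mean_sqdist wave_space (wave f H) (wave f K) =
    ennreal (1 / (2 * pi)) * mean_sqdist (spectral_measure f) H K"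
proof -
  note [measurable] = density_fun_measurable[OF density]
  let ?h = "\<lambda>t. ennreal (indicator {-pi..pi} t * f t) * ennreal ((cmod (H t - K t))\<^sup>2)"
  have "mean_sqdist wave_space (wave f H) (wave f K) = (\<integral>\<^sup>+\<omega>. ?h (wave_frequency \<omega>) \<partial>wave_space)"
    unfolding mean_sqdist_def
  proof (rule nn_integral_cong_AE)
    show "AE \<omega> in wave_space. ennreal ((cmod (wave f H \<omega> - wave f K \<omega>))\<^sup>2) = ?h (wave_frequency \<omega>)"
      using AE_wave_space_nonzero
    proof eventually_elim
      case (elim \<omega>)
      let ?t = "wave_frequency \<omega>"
      have "wave f H \<omega> - wave f K \<omega> = complex_of_real (sgn \<omega>) * ((H ?t - K ?t) * complex_of_real (amp ?t))"
        by (simp add: wave_def algebra_simps)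
      then have "(cmod (wave f H \<omega> - wave f K \<omega>))\<^sup>2 = (indicator {-pi..pi} ?t * f ?t) * (cmod (H ?t - K ?t))\<^sup>2"
        using elim density_fun_nonneg[OF density, of ?t]
        by (simp only: norm_mult power_mult_distrib norm_of_real power2_abs real_sqrt_pow2)
          (simp add: sgn_if)
      then show ?case using density_fun_nonneg[OF density, of ?t] by (simp only: ennreal_mult zero_le_power2)
    qed
  qed
  also have "\<dots> = (\<integral>\<^sup>+t. ennreal (indicator {-pi..pi} t / (2 * pi)) * ?h t \<partial>lborel)"
    by (rule nn_integral_wave_frequency) measurable
  also have "\<dots> = (\<integral>\<^sup>+t. ennreal (1 / (2 * pi)) * ?h t \<partial>lborel)"
    by (intro nn_integral_cong) (simp add: indicator_def)
  also have "\<dots> = ennreal (1 / (2 * pi)) * (\<integral>\<^sup>+t. ?h t \<partial>lborel)"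
    by (rule nn_integral_cmult) measurable
  also have "(\<integral>\<^sup>+t. ?h t \<partial>lborel) = mean_sqdist (spectral_measure f) H K"
    unfolding mean_sqdist_def spectral_measure_def by (rule nn_integral_density[symmetric]) auto
  finally show ?thesis .
qed

lemma square_integrable_wave:
  assumes H: "square_integrable (spectral_measure f) H" shows "square_integrable wave_space (wave f H)"
proof -
  have m: "H \<in> borel_measurable borel" using H by (simp add: square_integrable_def)
  have 0: "wave f (\<lambda>_. 0) = (\<lambda>_. 0)" by (simp add: wave_def[abs_def])
  have "mean_sqdist (spectral_measure f) H (\<lambda>_. 0) < \<infinity>"
    using H by (subst mean_sqdist_eq_integral) auto
  then have "mean_sqdist wave_space (wave f H) (\<lambda>_. 0) < \<infinity>"
    using mean_sqdist_wave[OF m, of "\<lambda>_. 0"] by (simp add: 0 ennreal_mult_less_top)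
  then show ?thesis
    using wave_measurable[OF m] square_integrable_if_close[OF square_integrable_zero, of "wave f H" wave_space]
    by simp
qed

lemma wave_inner:
  assumes [measurable]: "H \<in> borel_measurable borel" "K \<in> borel_measurable borel"
  shows "W.expectation (\<lambda>\<omega>. wave f H \<omega> * cnj (wave f K \<omega>)) =
    (1 / (2 * pi)) *\<^sub>R (\<integral>t. H t * cnj (K t) \<partial>spectral_measure f)"
proof -
  note [measurable] = density_fun_measurable[OF density] wave_measurable
  let ?h = "\<lambda>t. (indicator {-pi..pi} t * f t) *\<^sub>R (H t * cnj (K t))"
  have [measurable]: "?h \<in> borel_measurable borel" by measurable
  have "W.expectation (\<lambda>\<omega>. wave f H \<omega> * cnj (wave f K \<omega>)) = W.expectation (\<lambda>\<omega>. ?h (wave_frequency \<omega>))"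
  proof (rule Bochner_Integration.integral_cong_AE)
    show "AE \<omega> in wave_space. wave f H \<omega> * cnj (wave f K \<omega>) = ?h (wave_frequency \<omega>)"
      using AE_wave_space_nonzero
    proof eventually_elim
      case (elim \<omega>)
      let ?t = "wave_frequency \<omega>"
      have s: "complex_of_real (sgn \<omega>) * complex_of_real (sgn \<omega>) = 1" using elim by (simp add: sgn_if)
      have r: "complex_of_real (amp ?t) * complex_of_real (amp ?t) = complex_of_real (indicator {-pi..pi} ?t * f ?t)"
        using density_fun_nonneg[OF density, of ?t] by (simp only: real_sqrt_mult_self abs_of_nonneg flip: of_real_mult)
      have "wave f H \<omega> * cnj (wave f K \<omega>) =
          (complex_of_real (sgn \<omega>) * complex_of_real (sgn \<omega>)) *
          (complex_of_real (amp ?t) * complex_of_real (amp ?t)) * (H ?t * cnj (K ?t))"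
        unfolding wave_def complex_cnj_mult complex_cnj_complex_of_real by (simp only: mult_ac)
      then show ?case by (simp only: s r scaleR_conv_of_real mult_1_left)
    qed
    show "(\<lambda>\<omega>. ?h (wave_frequency \<omega>)) \<in> borel_measurable wave_space"
      by (rule measurable_compose[of _ _ borel]) (auto cong: measurable_cong_sets)
  qed (auto cong: measurable_cong_sets)
  also have "\<dots> = (\<integral>t. ?h t \<partial>distr wave_space borel wave_frequency)"
    by (rule integral_distr[symmetric]) auto
  also have "\<dots> = (\<integral>t. (indicator {-pi..pi} t / (2 * pi)) *\<^sub>R ?h t \<partial>lborel)"
    unfolding distr_wave_frequency by (rule integral_density) auto
  also have "\<dots> = (\<integral>t. (1 / (2 * pi)) *\<^sub>R ?h t \<partial>lborel)"
    by (intro Bochner_Integration.integral_cong) (auto simp: indicator_def)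
  also have "\<dots> = (1 / (2 * pi)) *\<^sub>R (\<integral>t. H t * cnj (K t) \<partial>spectral_measure f)"
  proof -
    have "(\<lambda>t. H t * cnj (K t)) \<in> borel_measurable borel" by measurable
    then show ?thesis by (simp only: integral_scaleR_right integral_spectral_measure[OF density])
  qed
  finally show ?thesis .
qed

definition wave_measure :: "real set \<Rightarrow> real \<Rightarrow> complex" where
  "wave_measure A = wave f (indicator A)"

definition wave_process :: "nat \<Rightarrow> int \<Rightarrow> real \<Rightarrow> complex" where
  "wave_process n m = wave f (\<lambda>t. cis (of_int m * t) / (\<i> * of_real t) ^ n)"

text \<open>Differencing in \<open>m\<close> acts on \<open>e\<^bsup>imt\<^esup>\<close> as multiplication by \<open>(1 - e\<^bsup>-i\<mu>t\<^esup>)\<^sup>n\<close>, by the binomial theorem.\<close>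

lemma increment_wave_process:
  "increment n (wave_process n) m \<mu> = wave f (\<lambda>t. cis (of_int m * t) * increment_kernel n \<mu> t)"
proof
  fix \<omega>
  have key: "(\<Sum>l\<le>n. (-1) ^ l * of_nat (n choose l) * cis (of_int (m - int l * \<mu>) * t)) =
      cis (of_int m * t) * (1 - cis (- (of_int \<mu> * t))) ^ n" for t
  proof -
    define c where "c = cis (- (of_int \<mu> * t))"
    have e: "cis (of_int (m - int l * \<mu>) * t) = cis (of_int m * t) * c ^ l" for l
      unfolding c_def Complex.DeMoivre cis_mult by (simp add: algebra_simps)
    have "(1 - c) ^ n = (- c + 1) ^ n" by simp
    also have "\<dots> = (\<Sum>l\<le>n. of_nat (n choose l) * (- c) ^ l)"
      unfolding binomial_ring by simp
    also have "\<dots> = (\<Sum>l\<le>n. (-1) ^ l * of_nat (n choose l) * c ^ l)"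
      unfolding power_minus[of c] by (simp only: mult_ac)
    finally have "cis (of_int m * t) * (1 - c) ^ n =
        (\<Sum>l\<le>n. cis (of_int m * t) * ((-1) ^ l * of_nat (n choose l) * c ^ l))"
      by (simp only: sum_distrib_left)
    then show ?thesis unfolding e c_def[symmetric] by (simp only: mult_ac)
  qed
  let ?t = "wave_frequency \<omega>"
  have "increment n (wave_process n) m \<mu> \<omega> =
      (\<Sum>l\<le>n. (-1) ^ l * of_nat (n choose l) * cis (of_int (m - int l * \<mu>) * ?t)) *
      (complex_of_real (sgn \<omega>) * complex_of_real (amp ?t) / (\<i> * of_real ?t) ^ n)"
    unfolding increment_def wave_process_def wave_def sum_distrib_right
    by (intro sum.cong refl) (simp add: field_simps)
  also have "\<dots> = wave f (\<lambda>t. cis (of_int m * t) * increment_kernel n \<mu> t) \<omega>"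
    unfolding key by (simp add: wave_def increment_kernel_def)
  finally show "increment n (wave_process n) m \<mu> \<omega> = wave f (\<lambda>t. cis (of_int m * t) * increment_kernel n \<mu> t) \<omega>" .
qed

lemma simple_integral_wave_measure:
  assumes s: "simple_function borel s"
  shows "simple_stochastic_integral wave_measure s = wave f s"
proof
  fix \<omega>
  let ?t = "wave_frequency \<omega>" let ?L = "\<lambda>y. {t \<in> {-pi..pi}. s t = y}"
  have fin: "finite (s ` {-pi..pi})"
    using s by (intro finite_subset[of "s ` {-pi..pi}" "range s"]) (auto simp: simple_function_def)
  have "simple_stochastic_integral wave_measure s \<omega> =
      (complex_of_real (sgn \<omega>) * complex_of_real (amp ?t)) * (\<Sum>y\<in>s ` {-pi..pi}. y * indicator (?L y) ?t)"
    unfolding simple_stochastic_integral_def wave_measure_def wave_def sum_distrib_left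
    by (intro sum.cong refl) (simp only: mult_ac)
  also have "\<dots> = wave f s \<omega>"
  proof (cases "?t \<in> {-pi..pi}")
    case True
    then have "(\<Sum>y\<in>s ` {-pi..pi}. y * indicator (?L y) ?t) = s ?t"
      using fin by (subst sum.remove[of _ "s ?t"]) (auto simp: indicator_def intro!: sum.neutral)
    then show ?thesis by (simp only: wave_def mult_ac)
  qed (simp add: wave_def)
  finally show "simple_stochastic_integral wave_measure s \<omega> = wave f s \<omega>" .
qed

lemma has_integral_wave:
  assumes H: "square_integrable (spectral_measure f) H"
  shows "has_stochastic_integral wave_space f wave_measure H (wave f H)"
proof -
  have mH: "H \<in> borel_measurable borel" using H by (simp add: square_integrable_def)
  obtain s where s: "\<And>j::nat. simple_function (spectral_measure f) (s j)"
    "(\<lambda>j. mean_sqdist (spectral_measure f) H (s j)) \<longlonglongrightarrow> 0"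
    using L2_simple_approximation[OF H] by (elim exE conjE) (rule that, auto)
  have s': "simple_function borel (s j)" for j
    using s(1)[of j] by (simp only: simple_function_spectral_measure)
  have ms: "s j \<in> borel_measurable borel" for j using s' by (rule borel_measurable_simple_function)
  have "(\<lambda>j. ennreal (1 / (2 * pi)) * mean_sqdist (spectral_measure f) H (s j)) \<longlonglongrightarrow> ennreal (1 / (2 * pi)) * 0"
    by (intro ennreal_tendsto_cmult s(2)) simp
  then show ?thesis
    unfolding has_stochastic_integral_def
    using s' s(2) mH wave_measurable[OF mH]
    by (auto intro!: exI[of _ s] cong: measurable_cong_sets
        simp: spectral_sqdist_eq_mean_sqdist[OF density mH ms] simple_integral_wave_measure mean_sqdist_wave[OF mH ms])
qed

lemma wave_spectral_representation:
  "spectral_representation wave_space n (wave_process n) f wave_measure"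
proof -
  have ind: "square_integrable (spectral_measure f) (indicator A)" if "A \<in> sets borel" for A
    using that by (intro square_integrable_bounded_spectral[OF density, where C=1]) (auto simp: indicator_def)
  have osm: "orthogonal_stochastic_measure wave_space f wave_measure"
    unfolding orthogonal_stochastic_measure_def
  proof (intro conjI ballI impI)
    fix A :: "real set" assume A: "A \<in> sets borel" "A \<subseteq> {-pi..pi}"
    have mi: "(indicator A :: real \<Rightarrow> complex) \<in> borel_measurable borel" using A by simp
    show "wave_measure A \<in> borel_measurable wave_space"
      "integrable wave_space (\<lambda>\<omega>. (cmod (wave_measure A \<omega>))\<^sup>2)"
      using square_integrable_wave[OF ind[OF A(1)]] by (auto simp: square_integrable_def wave_measure_def)
    show "W.expectation (wave_measure A) = 0" unfolding wave_measure_def by (rule wave_expectation[OF mi])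
    fix B :: "real set" assume B: "B \<in> sets borel" "B \<subseteq> {-pi..pi}"
    have mi': "(indicator B :: real \<Rightarrow> complex) \<in> borel_measurable borel" using B by simp
    have AB: "A \<inter> B \<in> sets borel" "A \<inter> B \<subseteq> {-pi..pi}" using A B by auto
    have "(\<integral>t. indicator A t * cnj (indicator B t) \<partial>spectral_measure f) =
        (\<integral>t. complex_of_real (indicator (A \<inter> B) t) \<partial>spectral_measure f)"
      by (intro Bochner_Integration.integral_cong refl) (simp add: indicator_def)
    also have "\<dots> = complex_of_real (LINT t:A \<inter> B|lborel. f t)"
      unfolding integral_complex_of_real measure_spectral_measure[OF density AB, symmetric] using AB by simp
    finally show "W.expectation (\<lambda>\<omega>. wave_measure A \<omega> * cnj (wave_measure B \<omega>)) =
        complex_of_real (1 / (2 * pi) * (LINT t:A \<inter> B|lborel. f t))"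
      unfolding wave_measure_def wave_inner[OF mi mi'] by (simp add: scaleR_conv_of_real)
  qed
  have k: "square_integrable wave_space (increment n (wave_process n) m \<mu>)" for m \<mu>
    unfolding increment_wave_process
    by (intro square_integrable_wave increment_kernel_square_integrable density)
  have "stationary_increments wave_space n (wave_process n)"
    unfolding stationary_increments_def
  proof (intro conjI allI)
    fix m \<mu> \<mu>1 \<mu>2
    show "wave_process n m \<in> borel_measurable wave_space"
      using wave_measurable[of "\<lambda>t. cis (of_int m * t) / (\<i> * of_real t) ^ n"]
      by (simp add: wave_process_def cong: measurable_cong_sets)
    show "integrable wave_space (increment n (wave_process n) m \<mu>)"
      by (rule L2_imp_integrable[OF W.finite_measure_axioms k])
    show "W.expectation (increment n (wave_process n) m \<mu>) = 0"
      unfolding increment_wave_process by (rule wave_expectation) measurable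
    show "integrable wave_space (\<lambda>\<omega>. increment n (wave_process n) (m0 + m) \<mu>1 \<omega> *
        cnj (increment n (wave_process n) m0 \<mu>2 \<omega>))" for m0
      by (rule square_integrable_inner[OF k k])
    have "W.expectation (\<lambda>\<omega>. increment n (wave_process n) (m0 + m) \<mu>1 \<omega> * cnj (increment n (wave_process n) m0 \<mu>2 \<omega>)) =
        (1 / (2 * pi)) *\<^sub>R (\<integral>t. cis (of_int m * t) * increment_kernel n \<mu>1 t * cnj (increment_kernel n \<mu>2 t)
          \<partial>spectral_measure f)" for m0
    proof -
      have eq: "cis (of_int (m0 + m) * t) * increment_kernel n \<mu>1 t * cnj (cis (of_int m0 * t) * increment_kernel n \<mu>2 t) =
          cis (of_int m * t) * increment_kernel n \<mu>1 t * cnj (increment_kernel n \<mu>2 t)" for t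
      proof -
        have "cis (of_int (m0 + m) * t) * cnj (cis (of_int m0 * t)) = cis (of_int m * t)"
          unfolding cis_inner by simp
        then show ?thesis unfolding complex_cnj_mult by (metis (no_types, lifting) mult.assoc mult.commute)
      qed
      have "(\<lambda>t. cis (of_int k * t) * increment_kernel n \<mu> t) \<in> borel_measurable borel" for k \<mu> by measurable
      from wave_inner[OF this this] show ?thesis unfolding increment_wave_process by (simp only: eq)
    qed
    then show "\<exists>C. \<forall>m0. W.expectation (\<lambda>\<omega>. increment n (wave_process n) (m0 + m) \<mu>1 \<omega> *
        cnj (increment n (wave_process n) m0 \<mu>2 \<omega>)) = C" by blast
  qed
  then show ?thesis
    unfolding spectral_representation_def
    using osm density has_integral_wave[OF increment_kernel_square_integrable[OF density]]
    by (simp add: increment_wave_process)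
qed

end

section \<open>The mean square error as a spectral integral\<close>

lemma of_nat_d_coeff:
  "complex_of_nat (d_coeff n \<mu> k) = fps_nth (Abs_fps (\<lambda>i. if \<mu> dvd i then 1 else 0) ^ n) k"
proof (induction n arbitrary: k)
  case (Suc n)
  then show ?case
    by (auto simp: d_coeff_def fps_mult_nth intro!: sum.cong)
qed (simp add: d_coeff_def fps_one_def)

lemma one_minus_X_power_mult:
  assumes "\<mu> > 0"
  shows "(1 - fps_X ^ \<mu>) * Abs_fps (\<lambda>i. if \<mu> dvd i then 1 else 0 :: complex) = 1"
  using assms by (auto simp: fps_eq_iff fps_X_power_mult_nth left_diff_distrib dvd_minus_self dvd_imp_le
      not_less)

text \<open>Compare coefficients in \<open>(1 - x\<^sup>\<mu>)\<^sup>n \<Sum>\<^sub>k d\<^sub>\<mu>(k) x\<^sup>k = 1\<close>: summation with the weights \<open>d\<^sub>\<mu>\<close>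
  inverts the \<open>n\<close>-th difference with step \<open>\<mu>\<close>.\<close>

lemma difference_d_coeff:
  assumes "\<mu> > 0"
  shows "(\<Sum>l\<le>n. (-1) ^ l * of_nat (n choose l) * (if l * \<mu> \<le> p then complex_of_nat (d_coeff n \<mu> (p - l * \<mu>)) else 0)) =
    (if p = 0 then 1 else 0)"
proof -
  let ?D = "Abs_fps (\<lambda>i. if \<mu> dvd i then 1 else 0 :: complex)"
  have "(1 - fps_X ^ \<mu>) ^ n * ?D ^ n = 1"
    unfolding power_mult_distrib[symmetric] one_minus_X_power_mult[OF assms] by simp
  moreover have "(1 - fps_X ^ \<mu>) ^ n = (\<Sum>l\<le>n. fps_const ((-1) ^ l * of_nat (n choose l)) * (fps_X :: complex fps) ^ (\<mu> * l))"
  proof -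
    have "(1 - fps_X ^ \<mu>) ^ n = (- (fps_X ^ \<mu>) + 1 :: complex fps) ^ n" by simp
    also have "\<dots> = (\<Sum>l\<le>n. of_nat (n choose l) * (- (fps_X ^ \<mu>)) ^ l)"
      unfolding binomial_ring by simp
    also have "\<dots> = (\<Sum>l\<le>n. fps_const ((-1) ^ l * of_nat (n choose l)) * (fps_X :: complex fps) ^ (\<mu> * l))"
    proof (intro sum.cong refl)
      fix l
      have "(- (fps_X ^ \<mu>)) ^ l = ((-1) ^ l * fps_X ^ (\<mu> * l) :: complex fps)"
        by (subst power_minus) (simp add: power_mult)
      moreover have "fps_const ((-1) ^ l * of_nat (n choose l)) = ((-1) ^ l * of_nat (n choose l) :: complex fps)"
        by (simp only: fps_const_mult[symmetric] fps_const_power[symmetric] fps_const_neg[symmetric]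
            fps_const_1_eq_1 fps_of_nat)
      ultimately show "of_nat (n choose l) * (- (fps_X ^ \<mu>)) ^ l =
          fps_const ((-1) ^ l * of_nat (n choose l)) * (fps_X :: complex fps) ^ (\<mu> * l)"
        by (simp add: mult_ac)
    qed
    finally show ?thesis .
  qed
  ultimately have "fps_nth ((\<Sum>l\<le>n. fps_const ((-1) ^ l * of_nat (n choose l)) * fps_X ^ (\<mu> * l)) * ?D ^ n) p = fps_nth 1 p"
    by simp
  then have "(\<Sum>l\<le>n. (-1) ^ l * of_nat (n choose l) * (if p < \<mu> * l then 0 else fps_nth (?D ^ n) (p - \<mu> * l))) = fps_nth 1 p"
    unfolding sum_distrib_right fps_sum_nth mult.assoc fps_mult_left_const_nth fps_X_power_mult_nth .
  moreover have "(if l * \<mu> \<le> p then complex_of_nat (d_coeff n \<mu> (p - l * \<mu>)) else 0) =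
      (if p < \<mu> * l then 0 else fps_nth (?D ^ n) (p - \<mu> * l))" for l
    by (simp add: of_nat_d_coeff mult.commute[of \<mu>] not_less)
  ultimately show ?thesis by (simp only: fps_one_nth)
qed

text \<open>With \<open>b\<close> continued by zero, one and the same difference of it is \<open>a\<close> at the indices
  \<open>0,\<dots>,N\<close> and \<open>v\<close> at the negative ones.\<close>

definition b_ext :: "nat \<Rightarrow> nat \<Rightarrow> nat \<Rightarrow> (nat \<Rightarrow> complex) \<Rightarrow> int \<Rightarrow> complex" where
  "b_ext n \<mu> N a p = (if 0 \<le> p \<and> p \<le> int N then b_coeff n \<mu> N a (nat p) else 0)"

lemma difference_b_ext_nonneg:
  assumes "\<mu> > 0" "j \<le> N"
  shows "(\<Sum>l\<le>n. (-1) ^ l * of_nat (n choose l) * b_ext n \<mu> N a (int j + int (l * \<mu>))) = a j"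
proof -
  let ?d = "\<lambda>l m. if l * \<mu> \<le> m - j then complex_of_nat (d_coeff n \<mu> (m - j - l * \<mu>)) else 0"
  have b: "b_ext n \<mu> N a (int j + int (l * \<mu>)) = (\<Sum>m=j..N. a m * ?d l m)" for l
  proof -
    have "b_ext n \<mu> N a (int j + int (l * \<mu>)) =
        (\<Sum>m=j + l * \<mu>..N. a m * complex_of_nat (d_coeff n \<mu> (m - (j + l * \<mu>))))"
      by (auto simp: b_ext_def b_coeff_def nat_int_add simp flip: of_nat_add of_nat_mult)
    also have "\<dots> = (\<Sum>m=j..N. a m * ?d l m)"
      by (rule sum.mono_neutral_cong_left) (auto simp: le_diff_conv2 add.commute)
    finally show ?thesis .
  qed
  have "(\<Sum>l\<le>n. (-1) ^ l * of_nat (n choose l) * b_ext n \<mu> N a (int j + int (l * \<mu>))) =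
      (\<Sum>m=j..N. a m * (\<Sum>l\<le>n. (-1) ^ l * of_nat (n choose l) * ?d l m))"
    unfolding b sum_distrib_left by (subst sum.swap) (simp only: mult_ac)
  also have "\<dots> = (\<Sum>m=j..N. a m * (if m - j = 0 then 1 else 0))"
    by (simp only: difference_d_coeff[OF assms(1)])
  also have "\<dots> = (\<Sum>m\<in>{j}. a m)"
    using assms(2) by (intro sum.mono_neutral_cong_right) auto
  finally show ?thesis by simp
qed

lemma difference_b_ext_neg:
  assumes "\<mu> > 0" "j < 0"
  shows "(\<Sum>l\<le>n. (-1) ^ l * of_nat (n choose l) * b_ext n \<mu> N a (j + int (l * \<mu>))) = v_coeff n \<mu> N a j"
proof -
  have lower: "nat \<lceil>real_of_int (- j) / real \<mu>\<rceil> \<le> l \<longleftrightarrow> 0 \<le> j + int (l * \<mu>)" for l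
  proof -
    have "nat \<lceil>real_of_int (- j) / real \<mu>\<rceil> \<le> l \<longleftrightarrow> real_of_int (- j) / real \<mu> \<le> real l"
      by (simp add: nat_le_iff ceiling_le_iff)
    also have "\<dots> \<longleftrightarrow> real_of_int (- j) \<le> real_of_int (int (l * \<mu>))"
      using assms(1) by (simp add: field_simps)
    also have "\<dots> \<longleftrightarrow> 0 \<le> j + int (l * \<mu>)" by (subst of_int_le_iff) linarith
    finally show ?thesis .
  qed
  have upper: "l \<le> nat \<lfloor>real_of_int (int N - j) / real \<mu>\<rfloor> \<longleftrightarrow> j + int (l * \<mu>) \<le> int N" for l
  proof -
    have "l \<le> nat \<lfloor>real_of_int (int N - j) / real \<mu>\<rfloor> \<longleftrightarrow> real l \<le> real_of_int (int N - j) / real \<mu>"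
      using assms by (simp add: le_nat_iff le_floor_iff)
    also have "\<dots> \<longleftrightarrow> real_of_int (int (l * \<mu>)) \<le> real_of_int (int N - j)"
      using assms(1) by (simp add: field_simps)
    also have "\<dots> \<longleftrightarrow> j + int (l * \<mu>) \<le> int N" by (subst of_int_le_iff) linarith
    finally show ?thesis .
  qed
  show ?thesis
    unfolding v_coeff_def
  proof (rule sum.mono_neutral_cong_right)
    show "{nat \<lceil>real_of_int (- j) / real \<mu>\<rceil>..min (nat \<lfloor>real_of_int (int N - j) / real \<mu>\<rfloor>) n} \<subseteq> {..n}" by auto
    show "\<forall>l\<in>{..n} - {nat \<lceil>real_of_int (- j) / real \<mu>\<rceil>..min (nat \<lfloor>real_of_int (int N - j) / real \<mu>\<rfloor>) n}.
        (-1) ^ l * of_nat (n choose l) * b_ext n \<mu> N a (j + int (l * \<mu>)) = 0"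
      using lower upper unfolding b_ext_def by auto
    fix l assume "l \<in> {nat \<lceil>real_of_int (- j) / real \<mu>\<rceil>..min (nat \<lfloor>real_of_int (int N - j) / real \<mu>\<rfloor>) n}"
    then have "0 \<le> j + int (l * \<mu>)" "j + int (l * \<mu>) \<le> int N"
      using lower upper by auto
    then show "(-1) ^ l * of_nat (n choose l) * b_ext n \<mu> N a (j + int (l * \<mu>)) =
        (-1) ^ l * of_nat (n choose l) * b_coeff n \<mu> N a (nat (int (l * \<mu>) + j))"
      unfolding b_ext_def by (simp add: add.commute)
  qed simp
qed

text \<open>Summation by parts moves the differences from \<open>\<xi>\<close> to \<open>b\<close>, where they produce the weights of
  \<open>A\<close> and of \<open>V\<close>.\<close>

lemma A_plus_V_functional:
  assumes mu: "\<mu> > 0"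
  shows "A_functional N a \<xi> \<omega> + V_functional n \<mu> N a \<xi> \<omega> =
    (\<Sum>k\<le>N. b_coeff n \<mu> N a k * increment n \<xi> (int k) (int \<mu>) \<omega>)"
proof -
  let ?c = "\<lambda>l. (-1) ^ l * complex_of_nat (n choose l)"
  let ?J = "{- int (\<mu> * n)..int N}"
  have inner: "(\<Sum>k\<le>N. b_coeff n \<mu> N a k * \<xi> (int k - int l * int \<mu>) \<omega>) =
      (\<Sum>j\<in>?J. b_ext n \<mu> N a (j + int (l * \<mu>)) * \<xi> j \<omega>)" if "l \<le> n" for l
  proof -
    have le: "int l * int \<mu> \<le> int (\<mu> * n)"
      using mult_le_mono1[OF that, of \<mu>] by (simp add: mult.commute flip: of_nat_mult)
    have sub: "(\<lambda>k. int k - int l * int \<mu>) ` {..N} \<subseteq> ?J"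
    proof
      fix j assume "j \<in> (\<lambda>k. int k - int l * int \<mu>) ` {..N}"
      then obtain k where "k \<le> N" "j = int k - int l * int \<mu>" by auto
      moreover have "0 \<le> int l * int \<mu>" by simp
      ultimately show "j \<in> ?J" using le unfolding atLeastAtMost_iff by linarith
    qed
    have inj: "inj_on (\<lambda>k. int k - int l * int \<mu>) {..N}" by (auto simp: inj_on_def)
    have "(\<Sum>j\<in>?J. b_ext n \<mu> N a (j + int (l * \<mu>)) * \<xi> j \<omega>) =
        (\<Sum>j\<in>(\<lambda>k. int k - int l * int \<mu>) ` {..N}. b_ext n \<mu> N a (j + int (l * \<mu>)) * \<xi> j \<omega>)"
    proof (rule sum.mono_neutral_right[OF _ sub])
      show "\<forall>j\<in>?J - (\<lambda>k. int k - int l * int \<mu>) ` {..N}. b_ext n \<mu> N a (j + int (l * \<mu>)) * \<xi> j \<omega> = 0"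
      proof
        fix j assume j: "j \<in> ?J - (\<lambda>k. int k - int l * int \<mu>) ` {..N}"
        have "\<not> (0 \<le> j + int (l * \<mu>) \<and> j + int (l * \<mu>) \<le> int N)"
        proof
          assume "0 \<le> j + int (l * \<mu>) \<and> j + int (l * \<mu>) \<le> int N"
          then have "j = int (nat (j + int (l * \<mu>))) - int l * int \<mu>" "nat (j + int (l * \<mu>)) \<in> {..N}" by auto
          then show False using j by blast
        qed
        then show "b_ext n \<mu> N a (j + int (l * \<mu>)) * \<xi> j \<omega> = 0" by (auto simp: b_ext_def)
      qed
    qed simp
    also have "\<dots> = (\<Sum>k\<le>N. b_coeff n \<mu> N a k * \<xi> (int k - int l * int \<mu>) \<omega>)"
      unfolding sum.reindex[OF inj] by (intro sum.cong refl) (simp add: b_ext_def)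
    finally show ?thesis by simp
  qed
  have "(\<Sum>k\<le>N. b_coeff n \<mu> N a k * increment n \<xi> (int k) (int \<mu>) \<omega>) =
      (\<Sum>l\<le>n. ?c l * (\<Sum>k\<le>N. b_coeff n \<mu> N a k * \<xi> (int k - int l * int \<mu>) \<omega>))"
    unfolding increment_def sum_distrib_left by (subst sum.swap) (simp only: mult_ac)
  also have "\<dots> = (\<Sum>l\<le>n. ?c l * (\<Sum>j\<in>?J. b_ext n \<mu> N a (j + int (l * \<mu>)) * \<xi> j \<omega>))"
    by (intro sum.cong refl) (simp only: inner atMost_iff)
  also have "\<dots> = (\<Sum>j\<in>?J. (\<Sum>l\<le>n. ?c l * b_ext n \<mu> N a (j + int (l * \<mu>))) * \<xi> j \<omega>)"
    unfolding sum_distrib_left sum_distrib_right by (subst sum.swap) (simp only: mult_ac)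
  also have "?J = {- int (\<mu> * n)..-1} \<union> int ` {..N}"
  proof -
    have "int ` {..N} = {0..int N}" by (simp add: atMost_atLeast0 image_int_atLeastAtMost)
    moreover have "{- x..y} = {- x..-1} \<union> {0..y}" if "0 \<le> x" "0 \<le> y" for x y :: int
      using that by auto
    ultimately show ?thesis by (simp only: of_nat_0_le_iff)
  qed
  also have "(\<Sum>j\<in>{- int (\<mu> * n)..-1} \<union> int ` {..N}. (\<Sum>l\<le>n. ?c l * b_ext n \<mu> N a (j + int (l * \<mu>))) * \<xi> j \<omega>) =
      (\<Sum>j\<in>{- int (\<mu> * n)..-1}. (\<Sum>l\<le>n. ?c l * b_ext n \<mu> N a (j + int (l * \<mu>))) * \<xi> j \<omega>) +
      (\<Sum>j\<in>int ` {..N}. (\<Sum>l\<le>n. ?c l * b_ext n \<mu> N a (j + int (l * \<mu>))) * \<xi> j \<omega>)"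
    by (rule sum.union_disjoint) auto
  also have "(\<Sum>j\<in>{- int (\<mu> * n)..-1}. (\<Sum>l\<le>n. ?c l * b_ext n \<mu> N a (j + int (l * \<mu>))) * \<xi> j \<omega>) =
      V_functional n \<mu> N a \<xi> \<omega>"
    unfolding V_functional_def by (intro sum.cong refl) (simp add: difference_b_ext_neg[OF mu] del: of_nat_mult)
  also have "(\<Sum>j\<in>int ` {..N}. (\<Sum>l\<le>n. ?c l * b_ext n \<mu> N a (j + int (l * \<mu>))) * \<xi> j \<omega>) = A_functional N a \<xi> \<omega>"
    unfolding A_functional_def
    by (subst sum.reindex) (auto simp: difference_b_ext_nonneg[OF mu] simp del: of_nat_mult)
  finally show ?thesis by simp
qed

definition B_poly :: "nat \<Rightarrow> nat \<Rightarrow> nat \<Rightarrow> (nat \<Rightarrow> complex) \<Rightarrow> real \<Rightarrow> complex" where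
  "B_poly n \<mu> N a t = (\<Sum>k\<le>N. b_coeff n \<mu> N a k * cis (of_nat k * t))"

lemma B_poly_measurable [measurable]: "B_poly n \<mu> N a \<in> borel_measurable borel"
  unfolding B_poly_def[abs_def] by measurable

lemma trig_kernel_bounded:
  "cmod (\<Sum>k\<in>K. c k * (cis (of_int k * t) * increment_kernel n \<mu> t)) \<le> (\<Sum>k\<in>K. cmod (c k)) * (of_int \<bar>\<mu>\<bar>) ^ n"
proof -
  have "cmod (\<Sum>k\<in>K. c k * (cis (of_int k * t) * increment_kernel n \<mu> t)) \<le>
      (\<Sum>k\<in>K. cmod (c k * (cis (of_int k * t) * increment_kernel n \<mu> t)))" by (rule norm_sum)
  also have "\<dots> \<le> (\<Sum>k\<in>K. cmod (c k) * (of_int \<bar>\<mu>\<bar>) ^ n)"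
    using cmod_increment_kernel_le by (intro sum_mono) (simp add: norm_mult mult_left_mono)
  finally show ?thesis by (simp add: sum_distrib_right)
qed

lemma trig_kernel_square_integrable:
  assumes "density_fun f"
  shows "square_integrable (spectral_measure f) (\<lambda>t. \<Sum>k\<in>K. c k * (cis (of_int k * t) * increment_kernel n \<mu> t))"
  by (rule square_integrable_bounded_spectral[OF assms _ trig_kernel_bounded]) measurable

lemma L2_minus_square_integrable:
  assumes f: "density_fun f" and g: "g \<in> L2_minus n \<mu> f" shows "square_integrable (spectral_measure f) g"
proof -
  let ?p = "\<lambda>K c t. \<Sum>k\<in>K. c k * (cis (of_int k * t) * increment_kernel n (int \<mu>) t)"
  have m: "g \<in> borel_measurable borel" using g by (simp add: L2_minus_def)
  have m2: "?p K c \<in> borel_measurable borel" for K c by measurable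
  have "\<exists>(K :: int set) c. finite K \<and> K \<subseteq> {..-1} \<and> spectral_sqdist f g (?p K c) < 1"
    using g by (auto simp: L2_minus_def)
  then obtain K c where "spectral_sqdist f g (?p K c) < 1" by auto
  then have "mean_sqdist (spectral_measure f) g (?p K c) < 1"
    by (simp only: spectral_sqdist_eq_mean_sqdist[OF f m m2])
  then have "mean_sqdist (spectral_measure f) g (?p K c) < \<infinity>" by (rule less_trans) simp
  then show ?thesis
    using m by (intro square_integrable_if_close[OF trig_kernel_square_integrable[OF f, where K=K and c=c and n=n and \<mu>="int \<mu>"]]) auto
qed

lemma spectral_characteristic_square_integrable:
  "density_fun f \<Longrightarrow> spectral_characteristic n \<mu> f h \<Longrightarrow>
    square_integrable (spectral_measure f) (\<lambda>t. h t * increment_kernel n (int \<mu>) t)"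
  unfolding spectral_characteristic_def by (rule L2_minus_square_integrable)

text \<open>The isometry shows that the error has the same value for all sequences with density \<open>f\<close>, and
  the wave process shows that there is one; hence the definite description denotes this value.\<close>

lemma mean_square_error_eq:
  assumes mu: "\<mu> > 0" and f: "density_fun f" and h: "spectral_characteristic n \<mu> f h"
  shows "mean_square_error n \<mu> N a h f = 1 / (2 * pi) *
    (\<integral>t. (cmod (B_poly n \<mu> N a t * increment_kernel n (int \<mu>) t - h t * increment_kernel n (int \<mu>) t))\<^sup>2
      \<partial>spectral_measure f)" (is "_ = ?v")
proof -
  note hk = spectral_characteristic_square_integrable[OF f h]
  let ?hk = "\<lambda>t. h t * increment_kernel n (int \<mu>) t"
  have unique: "prob_space.expectation M
       (\<lambda>\<omega>. (cmod (A_functional N a \<xi> \<omega> - (- V_functional n \<mu> N a \<xi> \<omega> + Y \<omega>)))\<^sup>2) = ?v"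
    if M: "prob_space M" and rep: "spectral_representation M n \<xi> f Z" and Y: "has_stochastic_integral M f Z ?hk Y"
    for M :: "real measure" and \<xi> Z Y
  proof -
    interpret orthogonal_integral M f Z
      using M rep by (auto simp: orthogonal_integral_def orthogonal_integral_axioms_def spectral_representation_def)
    let ?X = "\<lambda>k. if k \<le> N then increment n \<xi> (int k) (int \<mu>) else Y"
    let ?g = "\<lambda>k. if k \<le> N then (\<lambda>t. cis (of_int (int k) * t) * increment_kernel n (int \<mu>) t) else ?hk"
    let ?c = "\<lambda>k. if k \<le> N then b_coeff n \<mu> N a k else -1"
    have int: "has_stochastic_integral M f Z (?g k) (?X k)" for k
    proof (cases "k \<le> N")
      case True
      have "has_stochastic_integral M f Z (\<lambda>t. cis (of_int (int k) * t) * increment_kernel n (int \<mu>) t)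
          (increment n \<xi> (int k) (int \<mu>))"
        using rep unfolding spectral_representation_def by blast
      then show ?thesis using True by simp
    qed (use Y in simp)
    have X: "(\<Sum>k\<in>{..Suc N}. ?c k * ?X k \<omega>) =
        A_functional N a \<xi> \<omega> - (- V_functional n \<mu> N a \<xi> \<omega> + Y \<omega>)" for \<omega>
      using A_plus_V_functional[OF mu, of N a \<xi> \<omega> n] by (simp add: algebra_simps)
    have G: "(\<Sum>k\<in>{..Suc N}. ?c k * ?g k t) = B_poly n \<mu> N a t * increment_kernel n (int \<mu>) t - ?hk t" for t
      by (simp add: B_poly_def sum_distrib_right mult.assoc)
    show ?thesis
      using has_integral_combination(3)[of "{..Suc N}" ?g ?X ?c, OF _ int] unfolding X G by simp
  qed
  show ?thesis
    unfolding mean_square_error_def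
  proof (rule the_equality)
    show "\<exists>(M :: real measure) \<xi> Z Y. prob_space M \<and> spectral_representation M n \<xi> f Z \<and>
        has_stochastic_integral M f Z ?hk Y \<and>
        ?v = prob_space.expectation M
          (\<lambda>\<omega>. (cmod (A_functional N a \<xi> \<omega> - (- V_functional n \<mu> N a \<xi> \<omega> + Y \<omega>)))\<^sup>2)"
      using unique[OF prob_space_wave_space wave_spectral_representation[OF f] has_integral_wave[OF f hk]]
        prob_space_wave_space wave_spectral_representation[OF f] has_integral_wave[OF f hk] by metis
  qed (use unique in blast)
qed

section \<open>Parseval on the circle\<close>

abbreviation circ :: "real measure" where "circ \<equiv> spectral_measure (\<lambda>_. 1)"

lemma density_fun_one: "density_fun (\<lambda>_. 1)"
  by (auto simp: density_fun_def set_integrable_def)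

lemma integral_circ:
  fixes g :: "real \<Rightarrow> 'b::{banach, second_countable_topology}"
  assumes "g \<in> borel_measurable borel"
  shows "(\<integral>t. g t \<partial>circ) = (LINT t:{-pi..pi}|lborel. g t)"
  using integral_spectral_measure[OF density_fun_one assms] by (simp add: set_lebesgue_integral_def)

interpretation circ: finite_measure circ by (rule finite_spectral_measure[OF density_fun_one])

lemma integrable_circ_bounded:
  fixes g :: "real \<Rightarrow> 'b::{banach, second_countable_topology}"
  assumes "g \<in> borel_measurable borel" "\<And>t. norm (g t) \<le> C"
  shows "integrable circ g"
  by (rule circ.integrable_const_bound[where B=C]) (use assms in auto)

lemma integral_cis:
  "(\<integral>t. cis (of_int k * t) \<partial>circ) = (if k = 0 then 2 * of_real pi else 0)"
proof -
  have I: "(\<integral>t. cis (of_int k * t) \<partial>circ) = (\<integral>t. indicator {-pi..pi} t *\<^sub>R cis (of_int k * t) \<partial>lborel)"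
    by (subst integral_circ) (auto simp: set_lebesgue_integral_def)
  show ?thesis
  proof (cases "k = 0")
    case True
    then show ?thesis unfolding I by (simp add: scaleR_conv_of_real)
  next
    case False
    define F where "F t = cis (of_int k * t) / (\<i> * of_int k)" for t
    have F: "(F has_vector_derivative cis (of_int k * t)) (at t within S)" for t S
    proof -
      let ?c = "\<i> * of_int k"
      have "((\<lambda>z. exp (?c * z) / ?c) has_field_derivative exp (?c * of_real t)) (at (of_real t))"
        using False by (auto intro!: derivative_eq_intros)
      then have "((\<lambda>x. exp (?c * of_real x) / ?c) has_vector_derivative exp (?c * of_real t)) (at t within S)"
        by (rule has_vector_derivative_real_field)
      then show ?thesis by (simp add: F_def[abs_def] cis_conv_exp mult.assoc)
    qed
    have "(\<integral>t. indicator {-pi..pi} t *\<^sub>R cis (of_int k * t) \<partial>lborel) = F pi - F (-pi)"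
      by (rule integral_FTC_Icc) (auto intro!: F continuous_intros)
    also have "\<dots> = 0"
    proof -
      have "cis (of_int k * pi) = cis (of_int k * (-pi))"
        using sin_npi_int[of k] by (intro complex_eqI) (simp_all add: mult.commute)
      then show ?thesis by (simp add: F_def)
    qed
    finally show ?thesis using False unfolding I by simp
  qed
qed

lemma square_integrable_cis: "square_integrable circ (\<lambda>t. cis (of_int k * t))"
  by (rule square_integrable_bounded_spectral[OF density_fun_one, where C=1]) auto

lemma Parseval_finite:
  assumes "finite K"
  shows "(\<integral>t. (cmod (\<Sum>k\<in>K. c k * cis (of_int k * t)))\<^sup>2 \<partial>circ) = 2 * pi * (\<Sum>k\<in>K. (cmod (c k))\<^sup>2)"
proof -
  have "complex_of_real (\<integral>t. (cmod (\<Sum>k\<in>K. c k * cis (of_int k * t)))\<^sup>2 \<partial>circ) =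
      (\<Sum>k\<in>K. \<Sum>l\<in>K. c k * cnj (c l) * (\<integral>t. cis (of_int k * t) * cnj (cis (of_int l * t)) \<partial>circ))"
    unfolding integral_cmod_sq_eq by (intro L2_inner_sum_sum assms square_integrable_cis)
  also have "\<dots> = (\<Sum>k\<in>K. \<Sum>l\<in>K. if l = k then 2 * of_real pi * (c k * cnj (c k)) else 0)"
    unfolding cis_inner integral_cis by (intro sum.cong refl) (auto simp: mult_ac)
  also have "\<dots> = (\<Sum>k\<in>K. 2 * of_real pi * (c k * cnj (c k)))"
    using assms by (intro sum.cong refl) (simp add: sum.delta)
  also have "\<dots> = complex_of_real (2 * pi * (\<Sum>k\<in>K. (cmod (c k))\<^sup>2))"
    by (simp add: sum_distrib_left complex_norm_square[symmetric])
  finally show ?thesis by (simp only: of_real_eq_iff)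
qed

lemma Parseval_nat:
  assumes "finite K"
  shows "(\<integral>t. (cmod (\<Sum>k\<in>K. c k * cis (of_nat k * t)))\<^sup>2 \<partial>circ) = 2 * pi * (\<Sum>k\<in>K. (cmod (c k))\<^sup>2)" (is ?plus)
    and "(\<integral>t. (cmod (\<Sum>k\<in>K. c k * cis (- (of_nat k * t))))\<^sup>2 \<partial>circ) = 2 * pi * (\<Sum>k\<in>K. (cmod (c k))\<^sup>2)" (is ?minus)
proof -
  have inj: "inj_on int K" "inj_on (\<lambda>k. - int k) K" by (auto simp: inj_on_def)
  show ?plus
    using Parseval_finite[of "int ` K" "\<lambda>k. c (nat k)"] assms by (simp add: sum.reindex[OF inj(1)])
  show ?minus
    using Parseval_finite[of "(\<lambda>k. - int k) ` K" "\<lambda>k. c (nat (- k))"] assms by (simp add: sum.reindex[OF inj(2)])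
qed

lemma summable_trig:
  assumes "summable (\<lambda>k. cmod (c k))"
  shows "summable (\<lambda>k. c k * cis (x k))" and "cmod (\<Sum>k. c k * cis (x k)) \<le> (\<Sum>k. cmod (c k))"
    and "cmod (\<Sum>k<m. c k * cis (x k)) \<le> (\<Sum>k. cmod (c k))"
proof -
  have n: "summable (\<lambda>k. cmod (c k * cis (x k)))" using assms by (simp add: norm_mult)
  then show "summable (\<lambda>k. c k * cis (x k))" by (rule summable_norm_cancel)
  show "cmod (\<Sum>k. c k * cis (x k)) \<le> (\<Sum>k. cmod (c k))"
    using summable_norm[OF n] by (simp add: norm_mult)
  have "cmod (\<Sum>k<m. c k * cis (x k)) \<le> (\<Sum>k<m. cmod (c k * cis (x k)))" by (rule norm_sum)
  also have "\<dots> \<le> (\<Sum>k. cmod (c k))"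
    using sum_le_suminf[OF assms, of "{..<m}"] by (simp add: norm_mult)
  finally show "cmod (\<Sum>k<m. c k * cis (x k)) \<le> (\<Sum>k. cmod (c k))" .
qed

text \<open>Partial sums satisfy it by orthogonality of the exponentials, and they converge boundedly.\<close>

lemma Parseval_trig_series:
  assumes sum: "summable (\<lambda>k. cmod (c k))"
  shows "(\<lambda>k. 2 * pi * (cmod (c k))\<^sup>2) sums (\<integral>t. (cmod (\<Sum>k. c k * cis (- (of_nat k * t))))\<^sup>2 \<partial>circ)"
proof -
  let ?S = "\<Sum>k. cmod (c k)"
  have "(\<lambda>m. \<integral>t. (cmod (\<Sum>k<m. c k * cis (- (of_nat k * t))))\<^sup>2 \<partial>circ)
      \<longlonglongrightarrow> (\<integral>t. (cmod (\<Sum>k. c k * cis (- (of_nat k * t))))\<^sup>2 \<partial>circ)"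
  proof (rule integral_dominated_convergence[where w="\<lambda>_. ?S\<^sup>2"])
    show "AE t in circ. (\<lambda>m. (cmod (\<Sum>k<m. c k * cis (- (of_nat k * t))))\<^sup>2)
        \<longlonglongrightarrow> (cmod (\<Sum>k. c k * cis (- (of_nat k * t))))\<^sup>2"
      using summable_LIMSEQ[OF summable_trig(1)[OF sum]] by (intro AE_I2 tendsto_power tendsto_norm)
    show "AE t in circ. norm ((cmod (\<Sum>k<m. c k * cis (- (of_nat k * t))))\<^sup>2) \<le> ?S\<^sup>2" for m
      using summable_trig(3)[OF sum] by (intro AE_I2) (simp add: power_mono)
  qed auto
  then show ?thesis by (simp add: Parseval_nat(2) sums_def sum_distrib_left)
qed

lemma Bessel_trig_series:
  assumes sum: "summable (\<lambda>k. cmod (c k))"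
  shows "2 * pi * (\<Sum>k<m. (cmod (c k))\<^sup>2) \<le> (\<integral>t. (cmod (\<Sum>k. c k * cis (- (of_nat k * t))))\<^sup>2 \<partial>circ)"
  unfolding sums_unique[OF Parseval_trig_series[OF sum]] sum_distrib_left
  by (rule sum_le_suminf[OF sums_summable[OF Parseval_trig_series[OF sum]]]) auto

lemma integral_trig_series:
  assumes sum: "summable (\<lambda>k. cmod (c k))"
  shows "(\<integral>t. (\<Sum>k. c k * cis (of_nat k * t)) \<partial>circ) = 2 * of_real pi * c 0"
proof -
  let ?S = "\<Sum>k. cmod (c k)"
  have "(\<lambda>m. \<integral>t. (\<Sum>k<m. c k * cis (of_nat k * t)) \<partial>circ) \<longlonglongrightarrow> (\<integral>t. (\<Sum>k. c k * cis (of_nat k * t)) \<partial>circ)"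
  proof (rule integral_dominated_convergence[where w="\<lambda>_. ?S"])
    show "AE t in circ. (\<lambda>m. \<Sum>k<m. c k * cis (of_nat k * t)) \<longlonglongrightarrow> (\<Sum>k. c k * cis (of_nat k * t))"
      using summable_LIMSEQ[OF summable_trig(1)[OF sum]] by (intro AE_I2)
    show "AE t in circ. norm (\<Sum>k<m. c k * cis (of_nat k * t)) \<le> ?S" for m
      using summable_trig(3)[OF sum] by (intro AE_I2) simp
  qed auto
  moreover have "(\<integral>t. (\<Sum>k<m. c k * cis (of_nat k * t)) \<partial>circ) = 2 * of_real pi * c 0" if "m > 0" for m
  proof -
    have "(\<integral>t. (\<Sum>k<m. c k * cis (of_nat k * t)) \<partial>circ) = (\<Sum>k<m. \<integral>t. c k * cis (of_nat k * t) \<partial>circ)"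
      by (intro Bochner_Integration.integral_sum integrable_mult_right integrable_circ_bounded[where C=1]) auto
    also have "\<dots> = (\<Sum>k<m. if k = 0 then 2 * of_real pi * c 0 else 0)"
      using integral_cis[of "int _"] by (intro sum.cong refl) auto
    also have "\<dots> = 2 * of_real pi * c 0" using that by (simp add: sum.delta)
    finally show ?thesis .
  qed
  then have "(\<lambda>m. \<integral>t. (\<Sum>k<m. c k * cis (of_nat k * t)) \<partial>circ) \<longlonglongrightarrow> 2 * of_real pi * c 0"
    by (intro tendsto_eventually eventually_sequentiallyI[of 1]) auto
  ultimately show ?thesis by (rule LIMSEQ_unique)
qed

text \<open>Each value of \<open>cis\<close> is taken on a countable set, so a property that fails only for
  finitely many values of \<open>cis\<close> holds almost everywhere.\<close>

lemma countable_cis_fiber: "countable {t. cis t = a}"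
proof (cases "\<exists>s. cis s = a")
  case True
  then obtain s where s: "cis s = a" by blast
  have "{t. cis t = a} \<subseteq> range (\<lambda>k::int. s + 2 * of_int k * pi)"
  proof
    fix t assume "t \<in> {t. cis t = a}"
    then have "cis t = cis s" using s by simp
    then have "sin t = sin s \<and> cos t = cos s" by (metis cis.simps)
    then obtain k :: int where "t = s + 2 * of_int k * pi"
      using sin_cos_eq_iff[of t s] by auto
    then show "t \<in> range (\<lambda>k::int. s + 2 * of_int k * pi)" by blast
  qed
  then show ?thesis by (rule countable_subset) simp
qed simp

lemma AE_countable_not_in:
  assumes "countable A" "density_fun f" shows "AE t in spectral_measure f. t \<notin> A"
proof -
  have "AE t in lborel. t \<notin> A" using assms(1) by (intro AE_not_in countable_imp_null_set_lborel)
  moreover have "(\<lambda>t. ennreal (indicator {-pi..pi} t * f t)) \<in> borel_measurable lborel"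
    using measurable_compose[OF density_fun_measurable[OF assms(2)] measurable_ennreal]
    by (simp cong: measurable_cong_sets)
  ultimately show ?thesis unfolding spectral_measure_def by (subst AE_density) auto
qed

lemma countable_scaled: "c \<noteq> 0 \<Longrightarrow> countable A \<Longrightarrow> countable {t::real. c * t \<in> A}"
  by (rule countable_subset[of _ "(\<lambda>x. x / c) ` A"]) (auto simp: image_iff intro!: bexI[of _ "c * _"])

lemma countable_poly_cis_zero:
  assumes "p \<noteq> 0" shows "countable {t. poly p (cis (- t)) = 0}"
proof -
  have "{t. poly p (cis (- t)) = 0} \<subseteq> (\<Union>a\<in>{z. poly p z = 0}. {t. - 1 * t \<in> {s. cis s = a}})" by auto
  moreover have "countable (\<Union>a\<in>{z. poly p z = 0}. {t. - 1 * t \<in> {s. cis s = a}})"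
    by (intro countable_UN countable_finite poly_roots_finite assms countable_scaled countable_cis_fiber) simp
  ultimately show ?thesis by (rule countable_subset)
qed

section \<open>Extremal vectors of a Hankel matrix\<close>

definition hankel :: "nat \<Rightarrow> (nat \<Rightarrow> complex) \<Rightarrow> (nat \<Rightarrow> complex) \<Rightarrow> nat \<Rightarrow> complex" where
  "hankel N e x k = (\<Sum>j\<le>N. e (k + j) * x j)"

definition sqnorm :: "nat \<Rightarrow> (nat \<Rightarrow> complex) \<Rightarrow> real" where
  "sqnorm N x = (\<Sum>k\<le>N. (cmod (x k))\<^sup>2)"

definition cinner :: "nat \<Rightarrow> (nat \<Rightarrow> complex) \<Rightarrow> (nat \<Rightarrow> complex) \<Rightarrow> complex" where
  "cinner N x y = (\<Sum>k\<le>N. x k * cnj (y k))"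

lemma sqnorm_nonneg [simp]: "0 \<le> sqnorm N x"
  by (simp add: sqnorm_def sum_nonneg)

lemma cinner_self: "cinner N x x = of_real (sqnorm N x)"
  by (simp add: cinner_def sqnorm_def complex_norm_square[symmetric])

lemma cinner_cnj: "cnj (cinner N x y) = cinner N y x"
  by (simp add: cinner_def cnj_sum mult.commute)

lemma cinner_simps:
  "cinner N (\<lambda>k. x k + y k) z = cinner N x z + cinner N y z"
  "cinner N (\<lambda>k. x k - y k) z = cinner N x z - cinner N y z"
  "cinner N (\<lambda>k. c * x k) z = c * cinner N x z"
  "cinner N z (\<lambda>k. x k + y k) = cinner N z x + cinner N z y"
  "cinner N z (\<lambda>k. x k - y k) = cinner N z x - cinner N z y"
  "cinner N z (\<lambda>k. c * x k) = cnj c * cinner N z x"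
  by (simp_all add: cinner_def sum.distrib sum_subtractf sum_distrib_left algebra_simps)

lemma hankel_linear:
  "hankel N e (\<lambda>j. x j + y j) = (\<lambda>k. hankel N e x k + hankel N e y k)"
  "hankel N e (\<lambda>j. x j - y j) = (\<lambda>k. hankel N e x k - hankel N e y k)"
  "hankel N e (\<lambda>j. c * x j) = (\<lambda>k. c * hankel N e x k)"
  by (auto simp: hankel_def sum.distrib sum_subtractf sum_distrib_left algebra_simps)

lemma sqnorm_scale: "sqnorm N (\<lambda>k. c * x k) = (cmod c)\<^sup>2 * sqnorm N x"
  by (simp add: sqnorm_def norm_mult power_mult_distrib sum_distrib_left)

lemma sqnorm_cong: "(\<And>k. k \<le> N \<Longrightarrow> x k = y k) \<Longrightarrow> sqnorm N x = sqnorm N y"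
  by (simp add: sqnorm_def)

lemma hankel_cong: "(\<And>k. k \<le> N \<Longrightarrow> x k = y k) \<Longrightarrow> hankel N e x = hankel N e y"
  by (auto simp: hankel_def)

lemma sqnorm_eq_0: "sqnorm N x = 0 \<longleftrightarrow> (\<forall>k\<le>N. x k = 0)"
  by (auto simp: sqnorm_def sum_nonneg_eq_0_iff)

lemma sqnorm_add:
  "sqnorm N (\<lambda>k. x k + c * y k) = sqnorm N x + 2 * Re (c * cinner N y x) + (cmod c)\<^sup>2 * sqnorm N y"
proof -
  have "complex_of_real (sqnorm N (\<lambda>k. x k + c * y k)) =
      of_real (sqnorm N x) + (c * cinner N y x + cnj (c * cinner N y x)) + of_real ((cmod c)\<^sup>2 * sqnorm N y)"
    unfolding cinner_self[symmetric] cinner_simps complex_cnj_mult cinner_cnj of_real_mult complex_norm_square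
    by (simp add: algebra_simps)
  also have "c * cinner N y x + cnj (c * cinner N y x) = of_real (2 * Re (c * cinner N y x))"
    by (rule complex_add_cnj)
  finally have "complex_of_real (sqnorm N (\<lambda>k. x k + c * y k)) =
      of_real (sqnorm N x + 2 * Re (c * cinner N y x) + (cmod c)\<^sup>2 * sqnorm N y)" by simp
  then show ?thesis by (simp only: of_real_eq_iff)
qed

text \<open>The norms are squared: a bound \<open>\<sigma>\<close> that is attained at some \<open>x \<noteq> 0\<close> is the square of the
  largest singular value.\<close>

definition is_norm_bound :: "nat \<Rightarrow> (nat \<Rightarrow> complex) \<Rightarrow> real \<Rightarrow> bool" where
  "is_norm_bound N e \<sigma> \<longleftrightarrow> (\<forall>x. sqnorm N (hankel N e x) \<le> \<sigma> * sqnorm N x)"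

definition extremal :: "nat \<Rightarrow> (nat \<Rightarrow> complex) \<Rightarrow> real \<Rightarrow> (nat \<Rightarrow> complex) \<Rightarrow> bool" where
  "extremal N e \<sigma> x \<longleftrightarrow> sqnorm N (hankel N e x) = \<sigma> * sqnorm N x"

text \<open>Compactness of the unit sphere.  Sequences are cut off after \<open>N\<close>, which makes the sphere a
  closed subset of a compact product.\<close>

lemma hankel_norm_attained:
  shows "\<exists>\<sigma> x. 0 \<le> \<sigma> \<and> is_norm_bound N e \<sigma> \<and> extremal N e \<sigma> x \<and> (\<forall>k>N. x k = 0) \<and> sqnorm N x = 1"
proof -
  let ?S = "\<lambda>i. if i \<le> N then cball 0 1 else {0 :: complex}"
  let ?K = "PiE UNIV ?S \<inter> {x. sqnorm N x = 1}"
  have cont: "continuous_on UNIV (\<lambda>x :: nat \<Rightarrow> complex. sqnorm N x)"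
    unfolding sqnorm_def by (intro continuous_intros continuous_on_product_coordinates)
  have conth: "continuous_on UNIV (\<lambda>x :: nat \<Rightarrow> complex. sqnorm N (hankel N e x))"
    unfolding sqnorm_def hankel_def by (intro continuous_intros continuous_on_product_coordinates)
  have "compactin (product_topology (\<lambda>_. euclidean) UNIV) (PiE UNIV ?S)"
    unfolding compactin_PiE by auto
  then have "compact (PiE UNIV ?S)" by (simp add: euclidean_product_topology)
  then have comp: "compact ?K"
    by (intro compact_Int_closed closed_Collect_eq cont continuous_on_const)
  have "(\<lambda>i. if i = 0 then 1 else 0) \<in> ?K"
    by (auto simp: PiE_def sqnorm_def if_distrib[of cmod] if_distrib[of "\<lambda>x. x\<^sup>2"] sum.delta cong: if_cong)
  then have ne: "?K \<noteq> {}" by blast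
  obtain x where x: "x \<in> ?K" and max: "\<And>y. y \<in> ?K \<Longrightarrow> sqnorm N (hankel N e y) \<le> sqnorm N (hankel N e x)"
    using continuous_attains_sup[OF comp ne continuous_on_subset[OF conth]] by auto
  let ?\<sigma> = "sqnorm N (hankel N e x)"
  have "sqnorm N (hankel N e y) \<le> ?\<sigma> * sqnorm N y" for y
  proof (cases "sqnorm N y = 0")
    case True
    then have "hankel N e y = (\<lambda>_. 0)" by (auto simp: hankel_def sqnorm_eq_0)
    then show ?thesis using True by (simp add: sqnorm_def)
  next
    case False
    then have pos: "sqnorm N y > 0" using sqnorm_nonneg[of N y] by linarith
    define c where "c = complex_of_real (1 / sqrt (sqnorm N y))"
    have c: "(cmod c)\<^sup>2 = 1 / sqnorm N y"
      unfolding c_def norm_of_real power2_abs using pos by (simp add: power_divide)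
    define z where "z k = (if k \<le> N then c * y k else 0)" for k
    have z1: "sqnorm N z = 1"
      using sqnorm_scale[of N c y] pos by (simp add: c z_def cong: sqnorm_cong)
    have "cmod (z i) \<le> 1" if "i \<le> N" for i
    proof -
      have "(cmod (z i))\<^sup>2 \<le> sqnorm N z"
        unfolding sqnorm_def using that by (intro member_le_sum) auto
      then show ?thesis unfolding z1 using power2_le_imp_le[of "cmod (z i)" 1] by simp
    qed
    then have "z \<in> ?K" using z1 by (auto simp: PiE_def z_def)
    from max[OF this] have "sqnorm N (hankel N e z) \<le> ?\<sigma>" .
    moreover have "hankel N e z = (\<lambda>k. c * hankel N e y k)"
      using hankel_linear(3)[of N e c y] hankel_cong[of N z "\<lambda>j. c * y j" e] by (simp add: z_def)
    ultimately have "(1 / sqnorm N y) * sqnorm N (hankel N e y) \<le> ?\<sigma>" by (simp add: sqnorm_scale c)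
    then show ?thesis using pos by (simp add: field_simps)
  qed
  then have "is_norm_bound N e ?\<sigma>" by (simp add: is_norm_bound_def)
  moreover have "extremal N e ?\<sigma> x" using x by (simp add: extremal_def)
  moreover have "x k = 0" if "k > N" for k using x that by (auto simp: PiE_def Pi_def dest: spec[of _ k])
  moreover have "sqnorm N x = 1" using x by simp
  ultimately show ?thesis using sqnorm_nonneg[of N "hankel N e x"] by blast
qed

text \<open>The quadratic form \<open>\<sigma> \<parallel>v\<parallel>\<^sup>2 - \<parallel>Hv\<parallel>\<^sup>2\<close> is nonnegative and vanishes at \<open>x\<close>, so its first variation
  at \<open>x\<close> vanishes in every direction.\<close>

lemma extremal_variation:
  assumes bound: "is_norm_bound N e \<sigma>" and ext: "extremal N e \<sigma> x"
  shows "cinner N (hankel N e v) (hankel N e x) = \<sigma> * cinner N v x"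
proof -
  define d where "d = \<sigma> * cinner N v x - cinner N (hankel N e v) (hankel N e x)"
  define D where "D = \<sigma> * sqnorm N v - sqnorm N (hankel N e v)"
  have D: "D \<ge> 0" using bound by (simp add: D_def is_norm_bound_def)
  have quad: "0 \<le> 2 * Re (c * d) + (cmod c)\<^sup>2 * D" for c
  proof -
    have "sqnorm N (hankel N e (\<lambda>k. x k + c * v k)) \<le> \<sigma> * sqnorm N (\<lambda>k. x k + c * v k)"
      using bound by (simp only: is_norm_bound_def)
    moreover have "hankel N e (\<lambda>k. x k + c * v k) = (\<lambda>k. hankel N e x k + c * hankel N e v k)"
      by (simp only: hankel_linear)
    ultimately have "sqnorm N (hankel N e x) + 2 * Re (c * cinner N (hankel N e v) (hankel N e x)) +
        (cmod c)\<^sup>2 * sqnorm N (hankel N e v) \<le>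
        \<sigma> * (sqnorm N x + 2 * Re (c * cinner N v x) + (cmod c)\<^sup>2 * sqnorm N v)"
      by (simp only: sqnorm_add)
    then show ?thesis using ext by (simp add: extremal_def d_def D_def algebra_simps)
  qed
  \<comment> \<open>a step against \<open>d\<close>, so short that the linear term outweighs the quadratic one\<close>
  define s where "s = 1 / (D + 1)"
  have s: "s > 0" "s * D < 1" using D by (auto simp: s_def field_simps)
  have "0 \<le> 2 * Re (- of_real s * cnj d * d) + (cmod (- of_real s * cnj d))\<^sup>2 * D" by (rule quad)
  moreover have "Re (- of_real s * cnj d * d) = - s * (cmod d)\<^sup>2"
    unfolding mult.assoc mult.commute[of "cnj d"] by (simp add: complex_norm_square[symmetric] flip: of_real_mult of_real_power)
  moreover have "(cmod (- of_real s * cnj d))\<^sup>2 * D = s * (cmod d)\<^sup>2 * (s * D)"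
    by (simp add: norm_mult power2_eq_square)
  ultimately have "0 \<le> s * (cmod d)\<^sup>2 * (s * D - 2)" by (simp add: algebra_simps)
  moreover have "s * (cmod d)\<^sup>2 * (s * D - 2) < 0" if "d \<noteq> 0"
    using s that by (intro mult_pos_neg) auto
  ultimately have "d = 0" by fastforce
  then show ?thesis by (simp add: d_def)
qed

text \<open>A double sum sorted by the distance \<open>s\<close> from the diagonal; for \<open>g k l = x\<^sub>k x\<^sub>l\<^sup>*\<close> this produces the
  autocorrelations of \<open>x\<close>.\<close>

lemma sum_square_symmetric:
  fixes g :: "nat \<Rightarrow> nat \<Rightarrow> complex"
  shows "(\<Sum>k\<le>N. \<Sum>l\<le>N. g k l) = (\<Sum>k\<le>N. g k k) + (\<Sum>s\<in>{1..N}. \<Sum>k\<in>{s..N}. g k (k - s) + g (k - s) k)"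
proof (induction N)
  case (Suc N)
  have "(\<Sum>k\<le>Suc N. \<Sum>l\<le>Suc N. g k l) = (\<Sum>k\<le>N. \<Sum>l\<le>N. g k l) + (\<Sum>l\<le>N. g (Suc N) l + g l (Suc N)) + g (Suc N) (Suc N)"
    by (simp add: sum.distrib algebra_simps)
  also have "(\<Sum>l\<le>N. g (Suc N) l + g l (Suc N)) = (\<Sum>s\<in>{1..Suc N}. g (Suc N) (Suc N - s) + g (Suc N - s) (Suc N))"
    by (rule sum.reindex_bij_witness[of _ "\<lambda>s. Suc N - s" "\<lambda>l. Suc N - l"]) auto
  also have "(\<Sum>k\<le>N. \<Sum>l\<le>N. g k l) = (\<Sum>k\<le>N. g k k) + (\<Sum>s\<in>{1..Suc N}. \<Sum>k\<in>{s..N}. g k (k - s) + g (k - s) k)"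
    unfolding Suc by simp
  also have "(\<Sum>k\<le>N. g k k) + (\<Sum>s\<in>{1..Suc N}. \<Sum>k\<in>{s..N}. g k (k - s) + g (k - s) k) +
      (\<Sum>s\<in>{1..Suc N}. g (Suc N) (Suc N - s) + g (Suc N - s) (Suc N)) + g (Suc N) (Suc N) =
      (\<Sum>k\<le>Suc N. g k k) + (\<Sum>s\<in>{1..Suc N}. (\<Sum>k\<in>{s..N}. g k (k - s) + g (k - s) k) +
        (g (Suc N) (Suc N - s) + g (Suc N - s) (Suc N)))"
    unfolding sum.distrib[of _ _ "{1..Suc N}"] by (simp only: sum.atMost_Suc add_ac)
  also have "(\<Sum>s\<in>{1..Suc N}. (\<Sum>k\<in>{s..N}. g k (k - s) + g (k - s) k) +
        (g (Suc N) (Suc N - s) + g (Suc N - s) (Suc N))) =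
      (\<Sum>s\<in>{1..Suc N}. \<Sum>k\<in>{s..Suc N}. g k (k - s) + g (k - s) k)"
    by (intro sum.cong refl) (auto simp: add_ac)
  finally show ?case .
qed simp

text \<open>The modulus of a polynomial on the circle depends on its coefficients only through their
  autocorrelations.\<close>

lemma cmod_sq_trig_poly:
  assumes u: "cmod u = 1"
  shows "(cmod (\<Sum>k\<le>N. x k * u ^ k))\<^sup>2 =
    sqnorm N x + 2 * Re (\<Sum>s\<in>{1..N}. u ^ s * (\<Sum>k\<in>{s..N}. x k * cnj (x (k - s))))"
proof -
  have uu: "u ^ k * cnj (u ^ k) = 1" for k
    using complex_norm_square[of "u ^ k"] u by (simp add: norm_power)
  let ?g = "\<lambda>k l. x k * u ^ k * cnj (x l * u ^ l)"
  have g1: "?g k (k - s) = u ^ s * (x k * cnj (x (k - s)))" if "s \<le> k" for k s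
  proof -
    have "u ^ k = u ^ s * u ^ (k - s)" using that by (simp flip: power_add)
    then have "?g k (k - s) = u ^ s * (x k * cnj (x (k - s))) * (u ^ (k - s) * cnj (u ^ (k - s)))"
      by (simp only: complex_cnj_mult mult_ac)
    then show ?thesis by (simp only: uu mult_1_right)
  qed
  have g2: "?g l k = cnj (?g k l)" for k l by simp
  have "complex_of_real ((cmod (\<Sum>k\<le>N. x k * u ^ k))\<^sup>2) = (\<Sum>k\<le>N. \<Sum>l\<le>N. ?g k l)"
    unfolding complex_norm_square cnj_sum sum_product ..
  also have "\<dots> = (\<Sum>k\<le>N. ?g k k) + (\<Sum>s\<in>{1..N}. \<Sum>k\<in>{s..N}. ?g k (k - s) + ?g (k - s) k)"
    by (rule sum_square_symmetric)
  also have "(\<Sum>k\<le>N. ?g k k) = of_real (sqnorm N x)"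
    unfolding sqnorm_def of_real_sum complex_norm_square
  proof (intro sum.cong refl)
    fix k
    have "?g k k = x k * cnj (x k) * (u ^ k * cnj (u ^ k))" by (simp only: complex_cnj_mult mult_ac)
    then show "?g k k = x k * cnj (x k)" by (simp only: uu mult_1_right)
  qed
  also have "(\<Sum>s\<in>{1..N}. \<Sum>k\<in>{s..N}. ?g k (k - s) + ?g (k - s) k) =
      (\<Sum>s\<in>{1..N}. u ^ s * (\<Sum>k\<in>{s..N}. x k * cnj (x (k - s))) +
        cnj (u ^ s * (\<Sum>k\<in>{s..N}. x k * cnj (x (k - s)))))"
  proof (intro sum.cong refl)
    fix s
    have "(\<Sum>k\<in>{s..N}. ?g k (k - s) + ?g (k - s) k) = (\<Sum>k\<in>{s..N}. ?g k (k - s)) + cnj (\<Sum>k\<in>{s..N}. ?g k (k - s))"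
      unfolding cnj_sum sum.distrib g2[of "_ - s"] ..
    also have "(\<Sum>k\<in>{s..N}. ?g k (k - s)) = u ^ s * (\<Sum>k\<in>{s..N}. x k * cnj (x (k - s)))"
      unfolding sum_distrib_left by (intro sum.cong refl g1) simp
    finally show "(\<Sum>k\<in>{s..N}. ?g k (k - s) + ?g (k - s) k) =
        u ^ s * (\<Sum>k\<in>{s..N}. x k * cnj (x (k - s))) + cnj (u ^ s * (\<Sum>k\<in>{s..N}. x k * cnj (x (k - s))))" .
  qed
  also have "\<dots> = of_real (2 * Re (\<Sum>s\<in>{1..N}. u ^ s * (\<Sum>k\<in>{s..N}. x k * cnj (x (k - s)))))"
    unfolding sum.distrib cnj_sum[symmetric] by (rule complex_add_cnj)
  finally have "complex_of_real ((cmod (\<Sum>k\<le>N. x k * u ^ k))\<^sup>2) =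
      of_real (sqnorm N x + 2 * Re (\<Sum>s\<in>{1..N}. u ^ s * (\<Sum>k\<in>{s..N}. x k * cnj (x (k - s)))))" by simp
  then show ?thesis by (simp only: of_real_eq_iff)
qed

text \<open>A Hankel matrix turns the forward shift into the backward shift.  Together with the
  variational identity this makes the autocorrelations of \<open>Hx\<close> and of \<open>x\<close> proportional,
  hence also the moduli of the two trigonometric polynomials.\<close>

lemma hankel_beyond:
  assumes "\<And>p. p > N \<Longrightarrow> e p = 0" "k > N" shows "hankel N e x k = 0"
  using assms by (auto simp: hankel_def)

lemma extremal_cmod_eq:
  assumes e0: "\<And>p. p > N \<Longrightarrow> e p = 0"
    and bound: "is_norm_bound N e \<sigma>" and ext: "extremal N e \<sigma> x" and u: "cmod u = 1"
  shows "(cmod (\<Sum>k\<le>N. hankel N e x k * u ^ k))\<^sup>2 = \<sigma> * (cmod (\<Sum>k\<le>N. x k * cnj u ^ k))\<^sup>2"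
proof -
  let ?\<psi> = "hankel N e x"
  have corr: "(\<Sum>k\<in>{s..N}. ?\<psi> k * cnj (?\<psi> (k - s))) = of_real \<sigma> * cnj (\<Sum>k\<in>{s..N}. x k * cnj (x (k - s)))"
    if "s \<in> {1..N}" for s
  proof -
    define v where "v j = (if s \<le> j then x (j - s) else 0)" for j
    have Hv: "hankel N e v k = ?\<psi> (k + s)" for k
    proof -
      have "hankel N e v k = (\<Sum>j\<in>{s..N}. e (k + j) * x (j - s))"
        unfolding hankel_def v_def by (rule sum.mono_neutral_cong_right) auto
      also have "\<dots> = (\<Sum>i\<in>{..N - s}. e (k + s + i) * x i)"
        by (rule sum.reindex_bij_witness[of _ "\<lambda>i. i + s" "\<lambda>j. j - s"]) (use that in \<open>auto simp: add_ac\<close>)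
      also have "\<dots> = ?\<psi> (k + s)"
        unfolding hankel_def by (rule sum.mono_neutral_left) (auto simp: e0)
      finally show ?thesis .
    qed
    have "(\<Sum>k\<in>{s..N}. ?\<psi> k * cnj (?\<psi> (k - s))) = (\<Sum>k\<in>{..N - s}. ?\<psi> (k + s) * cnj (?\<psi> k))"
      by (rule sum.reindex_bij_witness[of _ "\<lambda>i. i + s" "\<lambda>j. j - s"]) (use that in auto)
    also have "\<dots> = cinner N (hankel N e v) ?\<psi>"
      unfolding cinner_def Hv by (rule sum.mono_neutral_left) (auto simp: hankel_beyond[OF e0])
    also have "\<dots> = \<sigma> * cinner N v x" by (rule extremal_variation[OF bound ext])
    also have "cinner N v x = (\<Sum>k\<in>{s..N}. x (k - s) * cnj (x k))"
      unfolding cinner_def v_def by (rule sum.mono_neutral_cong_right) auto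
    also have "\<dots> = cnj (\<Sum>k\<in>{s..N}. x k * cnj (x (k - s)))" by (simp add: cnj_sum mult.commute)
    finally show ?thesis .
  qed
  have "Re (\<Sum>s\<in>{1..N}. u ^ s * (\<Sum>k\<in>{s..N}. ?\<psi> k * cnj (?\<psi> (k - s)))) =
      Re (\<Sum>s\<in>{1..N}. of_real \<sigma> * cnj (cnj u ^ s * (\<Sum>k\<in>{s..N}. x k * cnj (x (k - s)))))"
    by (intro arg_cong[where f=Re] sum.cong refl) (simp only: corr complex_cnj_mult complex_cnj_power complex_cnj_cnj mult_ac)
  also have "\<dots> = \<sigma> * Re (\<Sum>s\<in>{1..N}. cnj u ^ s * (\<Sum>k\<in>{s..N}. x k * cnj (x (k - s))))"
  proof -
    have "Re (\<Sum>s\<in>S. of_real \<sigma> * cnj (T s)) = \<sigma> * Re (\<Sum>s\<in>S. T s)" for S and T :: "nat \<Rightarrow> complex"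
      by (simp add: sum_distrib_left)
    then show ?thesis .
  qed
  finally have corr_sum: "Re (\<Sum>s\<in>{1..N}. u ^ s * (\<Sum>k\<in>{s..N}. ?\<psi> k * cnj (?\<psi> (k - s)))) =
      \<sigma> * Re (\<Sum>s\<in>{1..N}. cnj u ^ s * (\<Sum>k\<in>{s..N}. x k * cnj (x (k - s))))" .
  have u': "cmod (cnj u) = 1" using u by simp
  show ?thesis
    unfolding cmod_sq_trig_poly[OF u] cmod_sq_trig_poly[OF u'] corr_sum ext[unfolded extremal_def] distrib_left
    by (simp only: mult.left_commute)
qed

lemma coeff_linear_factor:
  "coeff ([:-a, 1:] * q) j = coeff (pCons 0 q) j - a * coeff q j" for a :: complex
  by (cases j) (simp_all add: coeff_pCons)

text \<open>Let \<open>p = (z - a)q\<close> be extremal with \<open>|a| \<le> 1\<close>, \<open>X = Hq\<close> and \<open>Y = H(zq)\<close>, the backward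
  shift of \<open>X\<close>.  The variational identities in the directions \<open>q\<close> and \<open>zq\<close> combine to
  \<open>\<parallel>Y\<parallel>\<^sup>2 - |a|\<^sup>2 \<parallel>X\<parallel>\<^sup>2 = \<sigma>(1 - |a|\<^sup>2)\<parallel>q\<parallel>\<^sup>2\<close>.  For \<open>|a| < 1\<close> this forces \<open>\<parallel>X\<parallel>\<^sup>2 \<ge> \<sigma>\<parallel>q\<parallel>\<^sup>2\<close>; for \<open>|a| = 1\<close>
  it forces \<open>X\<^sub>0 = 0\<close>, and the common factor cancels from the moduli on the circle.\<close>

lemma extremal_remove_root:
  assumes e0: "\<And>p. p > N \<Longrightarrow> e p = 0" and bound: "is_norm_bound N e \<sigma>"
    and ext: "extremal N e \<sigma> (coeff ([:-a, 1:] * q))"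
    and deg: "degree ([:-a, 1:] * q) \<le> N" and q: "q \<noteq> 0" and a: "cmod a \<le> 1"
  shows "extremal N e \<sigma> (coeff q)"
proof -
  let ?p = "[:-a, 1:] * q" and ?y = "coeff (pCons 0 q)" and ?x = "coeff q"
  let ?X = "hankel N e ?x" and ?Y = "hankel N e ?y"
  have "degree ?p = Suc (degree q)" using q by (subst degree_mult_eq) auto
  then have dq: "degree q < N" using deg by simp
  then have qN: "coeff q N = 0" by (simp add: coeff_eq_0)
  have pxy: "coeff ?p = (\<lambda>j. ?y j - a * ?x j)" using coeff_linear_factor by blast
  have Y: "?Y k = ?X (Suc k)" for k
  proof -
    have "?Y k = (\<Sum>j\<in>{1..N}. e (k + j) * coeff q (j - 1))"
      unfolding hankel_def by (rule sum.mono_neutral_cong_right) (auto simp: coeff_pCons split: nat.splits)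
    also have "\<dots> = (\<Sum>i\<in>{..<N}. e (Suc k + i) * coeff q i)"
      by (rule sum.reindex_bij_witness[of _ Suc "\<lambda>j. j - 1"]) auto
    also have "\<dots> = ?X (Suc k)"
      unfolding hankel_def lessThan_Suc_atMost[symmetric] sum.lessThan_Suc by (simp add: qN)
    finally show ?thesis .
  qed
  have XN: "?X (Suc N) = 0" by (rule hankel_beyond[OF e0]) auto
  have YX: "sqnorm N ?X = (cmod (?X 0))\<^sup>2 + sqnorm N ?Y"
  proof -
    have "(\<Sum>k\<le>Suc N. (cmod (?X k))\<^sup>2) = (cmod (?X 0))\<^sup>2 + (\<Sum>k\<le>N. (cmod (?X (Suc k)))\<^sup>2)"
      by (rule sum.atMost_Suc_shift)
    then show ?thesis using XN by (simp add: sqnorm_def Y)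
  qed
  have yx: "sqnorm N ?y = sqnorm N ?x"
  proof -
    have "sqnorm N ?y = (\<Sum>k\<in>{1..N}. (cmod (coeff q (k - 1)))\<^sup>2)"
      unfolding sqnorm_def by (rule sum.mono_neutral_cong_right) (auto simp: coeff_pCons split: nat.splits)
    also have "\<dots> = (\<Sum>k\<in>{..<N}. (cmod (coeff q k))\<^sup>2)"
      by (rule sum.reindex_bij_witness[of _ Suc "\<lambda>j. j - 1"]) auto
    also have "\<dots> = sqnorm N ?x"
      unfolding sqnorm_def lessThan_Suc_atMost[symmetric] sum.lessThan_Suc by (simp add: qN)
    finally show ?thesis .
  qed
  have Hp: "hankel N e (coeff ?p) = (\<lambda>k. ?Y k - a * ?X k)"
    unfolding pxy by (simp only: hankel_linear)
  note var = extremal_variation[OF bound ext, unfolded Hp, unfolded pxy]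
  have eq1: "cinner N ?Y ?Y - cnj a * cinner N ?Y ?X = \<sigma> * (cinner N ?y ?y - cnj a * cinner N ?y ?x)"
    using var[of ?y] by (simp only: cinner_simps)
  have eq2: "cinner N ?X ?Y - cnj a * cinner N ?X ?X = \<sigma> * (cinner N ?x ?y - cnj a * cinner N ?x ?x)"
    using var[of ?x] by (simp only: cinner_simps)
  have eq2': "cinner N ?Y ?X - a * cinner N ?X ?X = \<sigma> * (cinner N ?y ?x - a * cinner N ?x ?x)"
    using arg_cong[OF eq2, of cnj] by (simp add: cinner_cnj)
  have "cinner N ?Y ?Y - (cnj a * a) * cinner N ?X ?X = \<sigma> * (cinner N ?y ?y - (cnj a * a) * cinner N ?x ?x)"
  proof -
    have "cinner N ?Y ?Y - (cnj a * a) * cinner N ?X ?X =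
      (cinner N ?Y ?Y - cnj a * cinner N ?Y ?X) + cnj a * (cinner N ?Y ?X - a * cinner N ?X ?X)"
      by (simp add: algebra_simps)
    then show ?thesis unfolding eq1 eq2' by (simp add: algebra_simps)
  qed
  then have "complex_of_real (sqnorm N ?Y - (cmod a)\<^sup>2 * sqnorm N ?X) = of_real (\<sigma> * (sqnorm N ?y - (cmod a)\<^sup>2 * sqnorm N ?x))"
    by (simp only: cinner_self mult.commute[of "cnj a"] complex_norm_square[symmetric] of_real_mult of_real_diff)
  then have key: "sqnorm N ?Y - (cmod a)\<^sup>2 * sqnorm N ?X = \<sigma> * (1 - (cmod a)\<^sup>2) * sqnorm N ?x"
    unfolding of_real_eq_iff yx by (simp add: algebra_simps)
  show ?thesis
  proof (cases "cmod a < 1")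
    case True
    then have a1: "0 < 1 - (cmod a)\<^sup>2" by (simp add: power_less_one_iff)
    have "(1 - (cmod a)\<^sup>2) * (\<sigma> * sqnorm N ?x) = sqnorm N ?Y - (cmod a)\<^sup>2 * sqnorm N ?X"
      unfolding key by (simp only: mult_ac)
    also have "\<dots> \<le> sqnorm N ?X - (cmod a)\<^sup>2 * sqnorm N ?X" using YX by simp
    also have "\<dots> = (1 - (cmod a)\<^sup>2) * sqnorm N ?X" by (simp add: left_diff_distrib)
    finally have "(1 - (cmod a)\<^sup>2) * (\<sigma> * sqnorm N ?x) \<le> (1 - (cmod a)\<^sup>2) * sqnorm N ?X" .
    then have "\<sigma> * sqnorm N ?x \<le> sqnorm N ?X" using a1 by (simp add: mult_le_cancel_left_pos)
    moreover have "sqnorm N ?X \<le> \<sigma> * sqnorm N ?x" using bound by (simp add: is_norm_bound_def)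
    ultimately show ?thesis by (simp add: extremal_def)
  next
    case False
    then have a1: "cmod a = 1" using a by simp
    then have X0: "?X 0 = 0" using key YX by simp
    have mod: "(cmod (\<Sum>k\<le>N. ?X k * cis t ^ k))\<^sup>2 = \<sigma> * (cmod (\<Sum>k\<le>N. ?x k * cis (- t) ^ k))\<^sup>2"
      if t: "- 1 * t \<notin> {s. cis s = a}" for t
    proof -
      let ?u = "cis t"
      have ne: "cnj ?u - a \<noteq> 0" using t by (simp add: cis_cnj)
      have uu: "?u * cnj ?u = 1" by (simp add: cis_cnj cis_mult)
      have shift: "(\<Sum>k\<le>N. ?Y k * ?u ^ k) = cnj ?u * (\<Sum>k\<le>N. ?X k * ?u ^ k)"
      proof -
        have "(\<Sum>k\<le>Suc N. ?X k * ?u ^ k) = ?X 0 + (\<Sum>k\<le>N. ?X (Suc k) * ?u ^ Suc k)"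
          by (subst sum.atMost_Suc_shift) simp
        then have "(\<Sum>k\<le>N. ?X k * ?u ^ k) = ?u * (\<Sum>k\<le>N. ?Y k * ?u ^ k)"
          using XN X0 by (simp add: Y sum_distrib_left mult_ac)
        then have "cnj ?u * (\<Sum>k\<le>N. ?X k * ?u ^ k) = (?u * cnj ?u) * (\<Sum>k\<le>N. ?Y k * ?u ^ k)"
          by (simp only: mult_ac)
        then show ?thesis by (simp only: uu mult_1_left)
      qed
      have "(\<Sum>k\<le>N. hankel N e (coeff ?p) k * ?u ^ k) = (cnj ?u - a) * (\<Sum>k\<le>N. ?X k * ?u ^ k)"
        unfolding Hp left_diff_distrib sum_subtractf shift by (simp add: sum_distrib_left algebra_simps)
      moreover have "(\<Sum>k\<le>N. coeff ?p k * cnj ?u ^ k) = (cnj ?u - a) * (\<Sum>k\<le>N. ?x k * cnj ?u ^ k)"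
      proof -
        have "poly r z = (\<Sum>k\<le>N. coeff r k * z ^ k)" if "degree r \<le> N" for r and z :: complex
          unfolding poly_altdef by (rule sum.mono_neutral_left) (use that in \<open>auto simp: coeff_eq_0\<close>)
        from this[of ?p "cnj ?u"] this[of q "cnj ?u"] deg dq show ?thesis by (simp add: algebra_simps)
      qed
      ultimately have "(cmod (cnj ?u - a))\<^sup>2 * (cmod (\<Sum>k\<le>N. ?X k * ?u ^ k))\<^sup>2 =
          \<sigma> * ((cmod (cnj ?u - a))\<^sup>2 * (cmod (\<Sum>k\<le>N. ?x k * cnj ?u ^ k))\<^sup>2)"
        using extremal_cmod_eq[OF e0 bound ext, of ?u] by (simp add: norm_mult power_mult_distrib)
      then show ?thesis using ne by (simp add: cis_cnj)
    qed
    have "(\<integral>t. (cmod (\<Sum>k\<le>N. ?X k * cis t ^ k))\<^sup>2 \<partial>circ) = (\<integral>t. \<sigma> * (cmod (\<Sum>k\<le>N. ?x k * cis (- t) ^ k))\<^sup>2 \<partial>circ)"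
    proof (rule Bochner_Integration.integral_cong_AE)
      have "AE t in circ. t \<notin> {t. - 1 * t \<in> {s. cis s = a}}"
        by (intro AE_countable_not_in countable_scaled countable_cis_fiber density_fun_one) simp
      then show "AE t in circ. (cmod (\<Sum>k\<le>N. ?X k * cis t ^ k))\<^sup>2 = \<sigma> * (cmod (\<Sum>k\<le>N. ?x k * cis (- t) ^ k))\<^sup>2"
        by eventually_elim (rule mod, simp)
    qed (simp_all, measurable)
    moreover have "(\<integral>t. (cmod (\<Sum>k\<le>N. ?X k * cis t ^ k))\<^sup>2 \<partial>circ) = 2 * pi * sqnorm N ?X"
      using Parseval_nat(1)[of "{..N}" ?X] by (simp add: sqnorm_def Complex.DeMoivre)
    moreover have "(\<integral>t. (cmod (\<Sum>k\<le>N. ?x k * cis (- t) ^ k))\<^sup>2 \<partial>circ) = 2 * pi * sqnorm N ?x"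
      using Parseval_nat(2)[of "{..N}" ?x] by (simp add: sqnorm_def Complex.DeMoivre)
    ultimately show ?thesis by (simp add: extremal_def)
  qed
qed

text \<open>In an extremal polynomial of least degree no root in the closed disc is left to be divided
  out.\<close>

lemma extremal_zero_free:
  assumes e0: "\<And>p. p > N \<Longrightarrow> e p = 0"
  shows "\<exists>\<sigma> p. 0 \<le> \<sigma> \<and> is_norm_bound N e \<sigma> \<and> extremal N e \<sigma> (coeff p) \<and> degree p \<le> N \<and>
    (\<forall>z. cmod z \<le> 1 \<longrightarrow> poly p z \<noteq> 0)"
proof -
  obtain \<sigma> x where s: "0 \<le> \<sigma>" "is_norm_bound N e \<sigma>" "extremal N e \<sigma> x" "\<And>k. k > N \<Longrightarrow> x k = 0" "sqnorm N x = 1"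
    using hankel_norm_attained[of N e] by (elim exE conjE) (rule that, auto)
  define E where "E p \<longleftrightarrow> p \<noteq> 0 \<and> degree p \<le> N \<and> extremal N e \<sigma> (coeff p)" for p :: "complex poly"
  define p0 where "p0 = Poly (map x [0..<Suc N])"
  have cp0: "coeff p0 = x" by (auto simp: p0_def coeff_Poly_eq nth_default_def s(4) simp del: upt_Suc)
  have "E p0"
    using s by (auto simp: E_def cp0 sqnorm_def intro!: degree_le)
      (metis (no_types, lifting) cp0 coeff_0 norm_zero power_zero_numeral sum.neutral zero_neq_one)
  then have "\<exists>m. \<exists>p. E p \<and> degree p = m" by blast
  then obtain m where m: "\<exists>p. E p \<and> degree p = m" and least: "\<And>k. k < m \<Longrightarrow> \<not> (\<exists>p. E p \<and> degree p = k)"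
    using exists_least_iff[of "\<lambda>m. \<exists>p. E p \<and> degree p = m"] by auto
  then obtain p where p: "E p" "degree p = m" by blast
  have "poly p a \<noteq> 0" if a: "cmod a \<le> 1" for a
  proof
    assume "poly p a = 0"
    then obtain q where q: "p = [:-a, 1:] * q" by (auto simp: poly_eq_0_iff_dvd)
    then have q0: "q \<noteq> 0" using p(1) by (auto simp: E_def)
    have "degree p = Suc (degree q)" unfolding q using q0 by (subst degree_mult_eq) auto
    moreover have "E q"
      using extremal_remove_root[OF e0 s(2), of a q] p(1) q q0 a \<open>degree p = Suc (degree q)\<close> by (auto simp: E_def)
    ultimately show False using least[of "degree q"] p(2) by auto
  qed
  with s(1,2) p(1) show ?thesis unfolding E_def by blast
qed

section \<open>Herglotz integrals and outer functions\<close>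

text \<open>On the circle the real part of the Herglotz integral is \<open>2\<pi> L\<close>, by the Poisson formula, so
  \<open>outer L\<close> is zero-free and has boundary modulus \<open>exp (L / 2)\<close>.\<close>

definition herglotz :: "(real \<Rightarrow> real) \<Rightarrow> complex \<Rightarrow> complex" where
  "herglotz L z = (\<integral>s. (cis s + z) / (cis s - z) * of_real (L s) \<partial>circ)"

definition outer :: "(real \<Rightarrow> real) \<Rightarrow> complex \<Rightarrow> complex" where
  "outer L z = exp (complex_of_real (1 / (4 * pi)) * herglotz L z)"

definition poisson :: "complex \<Rightarrow> real \<Rightarrow> real" where
  "poisson z s = (1 - (cmod z)\<^sup>2) / (cmod (cis s - z))\<^sup>2"

lemma cis_diff_bound: "1 - cmod z \<le> cmod (cis s - z)"
  using norm_triangle_ineq2[of "cis s" z] by simp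

lemma poisson_nonneg: "cmod z < 1 \<Longrightarrow> 0 \<le> poisson z s"
  by (simp add: poisson_def abs_square_le_1 power_le_one)

lemma poisson_measurable [measurable]: "poisson z \<in> borel_measurable borel"
  unfolding poisson_def[abs_def] by measurable

lemma Re_herglotz_kernel: "cmod z < 1 \<Longrightarrow> Re ((cis s + z) / (cis s - z)) = poisson z s"
proof -
  assume z: "cmod z < 1"
  have "(cis s + z) / (cis s - z) = (cis s + z) * cnj (cis s - z) / of_real ((cmod (cis s - z))\<^sup>2)"
    by (rule trans[OF complex_div_cnj]) simp
  also have "Re \<dots> = Re ((cis s + z) * cnj (cis s - z)) / (cmod (cis s - z))\<^sup>2"
    by (rule Re_divide_of_real)
  also have "Re ((cis s + z) * cnj (cis s - z)) = 1 - (cmod z)\<^sup>2"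
  proof -
    have "Re ((cis s + z) * cnj (cis s - z)) = ((cos s)\<^sup>2 + (sin s)\<^sup>2) - ((Re z)\<^sup>2 + (Im z)\<^sup>2)"
      by (simp add: power2_eq_square algebra_simps)
    then show ?thesis by (simp add: cmod_power2)
  qed
  finally show ?thesis by (simp add: poisson_def)
qed

lemma herglotz_kernel_bound:
  assumes "cmod z < 1" shows "cmod ((cis s + z) / (cis s - z)) \<le> 2 / (1 - cmod z)"
proof -
  have "cmod (cis s + z) \<le> 2" using norm_triangle_ineq[of "cis s" z] assms by simp
  moreover have "0 < 1 - cmod z" "1 - cmod z \<le> cmod (cis s - z)" using assms cis_diff_bound[of z s] by auto
  ultimately show ?thesis unfolding norm_divide by (intro frac_le) auto
qed

lemma poisson_bound:
  assumes "cmod z < 1" shows "poisson z s \<le> 2 / (1 - cmod z)"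
  using complex_Re_le_cmod[of "(cis s + z) / (cis s - z)"] herglotz_kernel_bound[OF assms, of s]
  by (simp add: Re_herglotz_kernel[OF assms])

lemma integrable_bounded_mult:
  fixes g L :: "_ \<Rightarrow> 'b :: {real_normed_field, banach, second_countable_topology}"
  assumes L: "integrable M L" and g: "g \<in> borel_measurable M" "\<And>s. norm (g s) \<le> C"
  shows "integrable M (\<lambda>s. g s * L s)"
proof (rule Bochner_Integration.integrable_bound)
  show "integrable M (\<lambda>s. C * norm (L s))" using L by simp
  have "0 \<le> C" using g(2) norm_ge_zero order_trans by blast
  then show "AE s in M. norm (g s * L s) \<le> norm (C * norm (L s))"
    using g(2) by (intro AE_I2) (simp add: norm_mult mult_right_mono)
  show "(\<lambda>s. g s * L s) \<in> borel_measurable M" using g(1) L by measurable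
qed

lemma herglotz_integrable:
  assumes "integrable circ L" "cmod z < 1"
  shows "integrable circ (\<lambda>s. (cis s + z) / (cis s - z) * complex_of_real (L s))"
  by (rule integrable_bounded_mult[where C="2 / (1 - cmod z)"])
    (use assms herglotz_kernel_bound in auto)

lemma Re_herglotz:
  assumes "integrable circ L" "cmod z < 1"
  shows "Re (herglotz L z) = (\<integral>s. poisson z s * L s \<partial>circ)"
proof -
  have "Re (herglotz L z) = (\<integral>s. Re ((cis s + z) / (cis s - z) * complex_of_real (L s)) \<partial>circ)"
    unfolding herglotz_def by (rule integral_Re[OF herglotz_integrable[OF assms], symmetric])
  also have "\<dots> = (\<integral>s. poisson z s * L s \<partial>circ)"
    by (intro Bochner_Integration.integral_cong refl)
      (simp only: times_complex.sel Re_complex_of_real Im_complex_of_real Re_herglotz_kernel[OF assms(2)] mult_zero_right diff_zero)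
  finally show ?thesis .
qed

definition herglotz_coeff :: "(real \<Rightarrow> real) \<Rightarrow> nat \<Rightarrow> complex" where
  "herglotz_coeff L k = (if k = 0 then 1 else 2) * (\<integral>s. cis (- s) ^ k * of_real (L s) \<partial>circ)"

lemma herglotz_kernel_sums:
  assumes "cmod z < 1"
  shows "(\<lambda>k. (if k = 0 then 1 else 2) * (z * cis (- s)) ^ k) sums ((cis s + z) / (cis s - z))"
proof -
  define q where "q = z * cis (- s)"
  have q: "cmod q < 1" using assms by (simp add: q_def norm_mult)
  have q1: "1 - q \<noteq> 0" using q by auto
  have z: "z = q * cis s" by (simp add: q_def cis_mult mult.assoc)
  have "(\<lambda>k. 2 * q ^ k - (if k = 0 then 1 else 0)) sums (2 * (1 / (1 - q)) - 1)"
    by (intro sums_diff sums_mult geometric_sums q sums_single[of 0 "\<lambda>_. 1"])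
  moreover have "(\<lambda>k. 2 * q ^ k - (if k = 0 then 1 else 0)) = (\<lambda>k. (if k = 0 then 1 else 2) * q ^ k)"
    by auto
  moreover have "2 * (1 / (1 - q)) - 1 = (cis s + z) / (cis s - z)"
  proof -
    have "(cis s + z) / (cis s - z) = (cis s * (1 + q)) / (cis s * (1 - q))"
      unfolding z by (simp add: algebra_simps)
    also have "\<dots> = (1 + q) / (1 - q)" by simp
    finally show ?thesis using q1 by (simp add: field_simps)
  qed
  ultimately show ?thesis by (simp add: q_def)
qed

lemma herglotz_sums:
  assumes L: "integrable circ L" and z: "cmod z < 1"
  shows "(\<lambda>k. herglotz_coeff L k * z ^ k) sums herglotz L z"
proof -
  define f where "f k s = (if k = 0 then 1 else 2) * (z * cis (- s)) ^ k * complex_of_real (L s)" for k s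
  have nf: "norm (f k s) \<le> 2 * (cmod z ^ k * \<bar>L s\<bar>)" for k s
    by (simp add: f_def norm_mult norm_power)
  have int: "integrable circ (f k)" for k
    unfolding f_def by (rule integrable_bounded_mult[where C="2 * cmod z ^ k"])
      (use L in \<open>auto simp: norm_mult norm_power\<close>)
  have geo: "summable (\<lambda>k. 2 * (cmod z ^ k * x))" for x
    using z by (intro summable_mult summable_mult2 summable_geometric) simp
  have "(\<lambda>k. \<integral>s. f k s \<partial>circ) sums (\<integral>s. (\<Sum>k. f k s) \<partial>circ)"
  proof (rule sums_integral[OF int])
    show "AE s in circ. summable (\<lambda>k. norm (f k s))"
      using nf by (intro AE_I2 summable_comparison_test'[OF geo, of 0]) auto
    show "summable (\<lambda>k. \<integral>s. norm (f k s) \<partial>circ)"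
    proof (rule summable_comparison_test'[OF geo, of 0])
      fix k
      have "(\<integral>s. norm (f k s) \<partial>circ) \<le> (\<integral>s. 2 * (cmod z ^ k * \<bar>L s\<bar>) \<partial>circ)"
        using nf int L by (intro integral_mono) auto
      then show "norm (\<integral>s. norm (f k s) \<partial>circ) \<le> 2 * (cmod z ^ k * (\<integral>s. \<bar>L s\<bar> \<partial>circ))" by simp
    qed
  qed
  moreover have "(\<integral>s. f k s \<partial>circ) = herglotz_coeff L k * z ^ k" for k
  proof -
    have "f k s = ((if k = 0 then 1 else 2) * z ^ k) * (cis (- s) ^ k * of_real (L s))" for s
      by (simp add: f_def power_mult_distrib mult_ac)
    then show ?thesis by (simp add: herglotz_coeff_def mult_ac)
  qed
  moreover have "(\<Sum>k. f k s) = (cis s + z) / (cis s - z) * of_real (L s)" for s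
    unfolding f_def by (rule sums_unique[symmetric], rule sums_mult2, rule herglotz_kernel_sums[OF z])
  ultimately show ?thesis by (simp add: herglotz_def)
qed

lemma herglotz_holomorphic:
  assumes "integrable circ L" shows "herglotz L holomorphic_on ball 0 1"
  by (rule power_series_holomorphic[where a="herglotz_coeff L"]) (use herglotz_sums[OF assms] in auto)

lemma outer_holomorphic:
  assumes "integrable circ L" shows "outer L holomorphic_on ball 0 1"
  unfolding outer_def by (intro holomorphic_intros herglotz_holomorphic assms)

lemma outer_nonzero [simp]: "outer L z \<noteq> 0"
  by (simp add: outer_def)

lemma cmod_outer:
  assumes "integrable circ L" "cmod z < 1"
  shows "cmod (outer L z) = exp (1 / (4 * pi) * (\<integral>s. poisson z s * L s \<partial>circ))"
  unfolding outer_def norm_exp_eq_Re by (simp add: Re_herglotz[OF assms])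

lemma integral_poisson:
  assumes "cmod z < 1" shows "(\<integral>s. poisson z s \<partial>circ) = 2 * pi"
proof -
  have one: "integrable circ (\<lambda>_. 1::real)" by (intro integrable_circ_bounded[where C=1]) auto
  have h: "herglotz_coeff (\<lambda>_. 1) k = (if k = 0 then 2 * of_real pi else 0)" for k
    using integral_cis[of "- int k"] by (auto simp: herglotz_coeff_def Complex.DeMoivre)
  have "(\<lambda>k. herglotz_coeff (\<lambda>_. 1) k * z ^ k) sums (2 * of_real pi)"
    using sums_single[of 0 "\<lambda>_. 2 * complex_of_real pi"] by (simp add: h if_distrib[of "\<lambda>x. x * _"] cong: if_cong)
  then have "herglotz (\<lambda>_. 1) z = 2 * of_real pi"
    using herglotz_sums[OF one assms] sums_unique2 by blast
  then show ?thesis using Re_herglotz[OF one assms] by simp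
qed

lemma poisson_integrable:
  assumes "integrable circ L" "cmod z < 1" shows "integrable circ (\<lambda>s. poisson z s * L s)"
  by (rule integrable_bounded_mult[where C="2 / (1 - cmod z)"])
    (use assms poisson_bound[OF assms(2)] poisson_nonneg[OF assms(2)] in \<open>auto\<close>)

text \<open>The Poisson kernel is a probability density up to the factor \<open>2\<pi>\<close>, so bounds on \<open>L\<close> pass to the
  outer function.\<close>

lemma cmod_outer_le:
  assumes L: "integrable circ L" and z: "cmod z < 1" and C: "\<And>s. L s \<le> C"
  shows "cmod (outer L z) \<le> exp (C / 2)"
proof -
  have "(\<integral>s. poisson z s * L s \<partial>circ) \<le> (\<integral>s. poisson z s * C \<partial>circ)"
    using C poisson_nonneg[OF z] poisson_integrable[OF _ z, of "\<lambda>_. C"] integrable_circ_bounded[of "\<lambda>_. C" "\<bar>C\<bar>"]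
    by (intro integral_mono poisson_integrable L z mult_left_mono) auto
  then have "(\<integral>s. poisson z s * L s \<partial>circ) \<le> 2 * pi * C" by (simp add: integral_poisson[OF z])
  then have "1 / (4 * pi) * (\<integral>s. poisson z s * L s \<partial>circ) \<le> 1 / (4 * pi) * (2 * pi * C)"
    by (intro mult_left_mono) auto
  then show ?thesis unfolding cmod_outer[OF L z] by (simp add: field_simps)
qed

lemma cmod_outer_ge:
  assumes L: "integrable circ L" and z: "cmod z < 1" and C: "\<And>s. C \<le> L s"
  shows "exp (C / 2) \<le> cmod (outer L z)"
proof -
  have "(\<integral>s. poisson z s * C \<partial>circ) \<le> (\<integral>s. poisson z s * L s \<partial>circ)"
    using C poisson_nonneg[OF z] poisson_integrable[OF _ z, of "\<lambda>_. C"] integrable_circ_bounded[of "\<lambda>_. C" "\<bar>C\<bar>"]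
    by (intro integral_mono poisson_integrable L z mult_left_mono) auto
  then have "2 * pi * C \<le> (\<integral>s. poisson z s * L s \<partial>circ)" by (simp add: integral_poisson[OF z])
  then have "1 / (4 * pi) * (2 * pi * C) \<le> 1 / (4 * pi) * (\<integral>s. poisson z s * L s \<partial>circ)"
    by (intro mult_left_mono) auto
  then show ?thesis unfolding cmod_outer[OF L z] by (simp add: field_simps)
qed

lemma cis_inj_interval:
  assumes "cis s = cis t" "s \<in> {-pi..pi}" "t \<in> {-pi<..<pi}" shows "s = t"
proof -
  have "sin s = sin t \<and> cos s = cos t" using assms(1) by (metis cis.simps)
  then obtain k :: int where k: "s = t + 2 * of_int k * pi" using sin_cos_eq_iff[of s t] by auto
  have "\<bar>2 * of_int k * pi\<bar> < 2 * pi" using assms(2,3) k by auto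
  then have "\<bar>of_int k :: real\<bar> < 1" by (simp add: abs_mult)
  then have "k = 0" by linarith
  then show ?thesis using k by simp
qed

text \<open>The Poisson integral tends to the boundary value at points of continuity: near \<open>t\<close> the
  density oscillates little, and away from \<open>t\<close> the kernel is \<open>O(1 - r)\<close>.\<close>

lemma poisson_limit:
  assumes L: "integrable circ L" and t: "t \<in> {-pi<..<pi}" and cont: "isCont L t"
    and r: "\<And>j::nat. 0 \<le> r j" "\<And>j. r j < 1" "r \<longlonglongrightarrow> 1"
  shows "(\<lambda>j. \<integral>s. poisson (of_real (r j) * cis t) s * L s \<partial>circ) \<longlonglongrightarrow> 2 * pi * L t"
proof -
  let ?z = "\<lambda>j. complex_of_real (r j) * cis t"
  have z: "cmod (?z j) = r j" "cmod (?z j) < 1" for j using r(1,2)[of j] by (auto simp: norm_mult)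
  have const: "integrable circ (\<lambda>_. c :: real)" for c by (intro integrable_circ_bounded[where C="\<bar>c\<bar>"]) auto
  define D where "D = (\<integral>s. \<bar>L s - L t\<bar> \<partial>circ)"
  have D: "D \<ge> 0" by (simp add: D_def)
  have diff: "integrable circ (\<lambda>s. L s - L t)" using L const by auto
  have eq: "(\<integral>s. poisson (?z j) s * L s \<partial>circ) - 2 * pi * L t = (\<integral>s. poisson (?z j) s * (L s - L t) \<partial>circ)" for j
  proof -
    have "(\<integral>s. poisson (?z j) s * (L s - L t) \<partial>circ) =
        (\<integral>s. poisson (?z j) s * L s \<partial>circ) - (\<integral>s. poisson (?z j) s * L t \<partial>circ)"
      unfolding right_diff_distrib
      by (intro Bochner_Integration.integral_diff poisson_integrable L const z)
    then show ?thesis by (simp add: integral_poisson[OF z(2)])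
  qed
  show ?thesis
  proof (rule LIMSEQ_I)
    fix e :: real assume e: "0 < e"
    define \<epsilon> where "\<epsilon> = e / (4 * pi)"
    have eps: "\<epsilon> > 0" using e by (simp add: \<epsilon>_def)
    obtain d where d: "d > 0" "\<And>s. \<bar>s - t\<bar> < d \<Longrightarrow> \<bar>L s - L t\<bar> < \<epsilon>"
      using cont eps unfolding continuous_at_eps_delta by (auto simp: dist_real_def)
    let ?K = "{-pi..pi} \<inter> {s. d \<le> \<bar>s - t\<bar>}"
    obtain m where m: "m > 0" "\<And>s. s \<in> ?K \<Longrightarrow> m \<le> cmod (cis s - cis t)"
    proof (cases "?K = {}")
      case False
      have "closed {s. d \<le> \<bar>s - t\<bar>}" by (intro closed_Collect_le continuous_intros)
      then have comp: "compact ?K" by (intro compact_Int_closed) auto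
      have "continuous_on ?K (\<lambda>s. cmod (cis s - cis t))" by (intro continuous_intros)
      from continuous_attains_inf[OF comp False this]
      obtain s0 where s0: "s0 \<in> ?K" "\<forall>s\<in>?K. cmod (cis s0 - cis t) \<le> cmod (cis s - cis t)"
        by (elim bexE) (rule that)
      have "cis s0 \<noteq> cis t" using cis_inj_interval[of s0 t] s0(1) t d(1) by auto
      then show ?thesis by (intro that[of "cmod (cis s0 - cis t)"] bspec[OF s0(2)]) auto
    qed (use that[of 1] in auto)
    have far: "poisson (?z j) s \<le> 8 * (1 - r j) / m\<^sup>2" if "1 - r j < m / 2" "s \<in> ?K" for j s
    proof -
      have "cmod (cis s - cis t) \<le> cmod (cis s - ?z j) + cmod (?z j - cis t)"
        using norm_triangle_ineq[of "cis s - ?z j" "?z j - cis t"] by simp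
      also have "cmod (?z j - cis t) = 1 - r j"
      proof -
        have "?z j - cis t = of_real (r j - 1) * cis t" by (simp add: algebra_simps)
        then show ?thesis using r(2)[of j] by (simp only: norm_mult norm_cis norm_of_real) simp
      qed
      finally have "m / 2 \<le> cmod (cis s - ?z j)" using m(2)[OF that(2)] that(1) by linarith
      then have "(m / 2)\<^sup>2 \<le> (cmod (cis s - ?z j))\<^sup>2" using m(1) by (intro power_mono) auto
      then have "poisson (?z j) s \<le> (1 - (r j)\<^sup>2) / (m / 2)\<^sup>2"
        unfolding poisson_def z(1) using m(1) r(1,2)[of j] by (intro frac_le) (auto simp: power_le_one)
      also have "\<dots> \<le> 8 * (1 - r j) / m\<^sup>2"
      proof -
        have "1 - (r j)\<^sup>2 = (1 - r j) * (1 + r j)" by (simp add: power2_eq_square algebra_simps)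
        also have "\<dots> \<le> (1 - r j) * 2" using r(2)[of j] by (intro mult_left_mono) auto
        finally have "(1 - (r j)\<^sup>2) / (m / 2)\<^sup>2 \<le> (1 - r j) * 2 / (m / 2)\<^sup>2" by (intro divide_right_mono) auto
        then show ?thesis by (simp add: power_divide mult_ac)
      qed
      finally show ?thesis .
    qed
    have "(\<lambda>j. 8 * (1 - r j) / m\<^sup>2 * D) \<longlonglongrightarrow> 8 * (1 - 1) / m\<^sup>2 * D"
      using m(1) by (intro tendsto_intros r(3)) auto
    then have ev1: "\<forall>\<^sub>F j in sequentially. 8 * (1 - r j) / m\<^sup>2 * D < e / 2"
      using e by (intro order_tendstoD(2)) auto
    have "(\<lambda>j. 1 - r j) \<longlonglongrightarrow> 1 - 1" by (intro tendsto_intros r(3))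
    then have ev2: "\<forall>\<^sub>F j in sequentially. 1 - r j < m / 2"
      using m(1) by (intro order_tendstoD(2)) auto
    from eventually_conj[OF ev1 ev2] obtain J where
      J: "\<And>j. j \<ge> J \<Longrightarrow> 8 * (1 - r j) / m\<^sup>2 * D < e / 2 \<and> 1 - r j < m / 2"
      by (auto simp: eventually_sequentially)
    have "norm ((\<integral>s. poisson (?z j) s * L s \<partial>circ) - 2 * pi * L t) < e" if "j \<ge> J" for j
    proof -
      have "norm (\<integral>s. poisson (?z j) s * (L s - L t) \<partial>circ) \<le> (\<integral>s. norm (poisson (?z j) s * (L s - L t)) \<partial>circ)"
        by (rule integral_norm_bound)
      also have "\<dots> \<le> (\<integral>s. poisson (?z j) s * \<epsilon> + 8 * (1 - r j) / m\<^sup>2 * \<bar>L s - L t\<bar> \<partial>circ)"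
      proof (rule integral_mono_AE)
        show "integrable circ (\<lambda>s. norm (poisson (?z j) s * (L s - L t)))" by (intro integrable_norm poisson_integrable diff z)
        show "integrable circ (\<lambda>s. poisson (?z j) s * \<epsilon> + 8 * (1 - r j) / m\<^sup>2 * \<bar>L s - L t\<bar>)"
          by (intro Bochner_Integration.integrable_add poisson_integrable const z integrable_mult_right integrable_abs diff)
        show "AE s in circ. norm (poisson (?z j) s * (L s - L t)) \<le> poisson (?z j) s * \<epsilon> + 8 * (1 - r j) / m\<^sup>2 * \<bar>L s - L t\<bar>"
          using AE_spectral_measure_interval[OF density_fun_one]
        proof eventually_elim
          case (elim s)
          have P: "0 \<le> poisson (?z j) s" by (rule poisson_nonneg[OF z(2)])
          have n: "norm (poisson (?z j) s * (L s - L t)) = poisson (?z j) s * \<bar>L s - L t\<bar>" using P by (simp add: abs_mult)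
          show ?case
          proof (cases "\<bar>s - t\<bar> < d")
            case True
            then have "poisson (?z j) s * \<bar>L s - L t\<bar> \<le> poisson (?z j) s * \<epsilon>"
              using d(2)[OF True] P by (intro mult_left_mono) auto
            moreover have "0 \<le> 8 * (1 - r j) / m\<^sup>2 * \<bar>L s - L t\<bar>" using r(2)[of j] by simp
            ultimately show ?thesis unfolding n by linarith
          next
            case False
            then have "poisson (?z j) s * \<bar>L s - L t\<bar> \<le> 8 * (1 - r j) / m\<^sup>2 * \<bar>L s - L t\<bar>"
              using elim J[OF that] by (intro mult_right_mono far) auto
            moreover have "0 \<le> poisson (?z j) s * \<epsilon>" using P eps by simp
            ultimately show ?thesis unfolding n by linarith
          qed
        qed
      qed
      also have "\<dots> = 2 * pi * \<epsilon> + 8 * (1 - r j) / m\<^sup>2 * D"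
      proof -
        have "(\<integral>s. poisson (?z j) s * \<epsilon> + 8 * (1 - r j) / m\<^sup>2 * \<bar>L s - L t\<bar> \<partial>circ) =
          (\<integral>s. poisson (?z j) s * \<epsilon> \<partial>circ) + (\<integral>s. 8 * (1 - r j) / m\<^sup>2 * \<bar>L s - L t\<bar> \<partial>circ)"
          by (intro Bochner_Integration.integral_add poisson_integrable const z integrable_mult_right integrable_abs diff)
        then show ?thesis
          by (simp only: integral_mult_left_zero integral_mult_right_zero integral_poisson[OF z(2)] D_def)
      qed
      also have "\<dots> < e" using J[OF that] by (simp add: \<epsilon>_def)
      finally show ?thesis unfolding eq .
    qed
    then show "\<exists>no. \<forall>j\<ge>no. norm ((\<integral>s. poisson (?z j) s * L s \<partial>circ) - 2 * pi * L t) < e" by blast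
  qed
qed

lemma cmod_outer_limit:
  assumes L: "integrable circ L" and t: "t \<in> {-pi<..<pi}" and cont: "isCont L t"
    and r: "\<And>j::nat. 0 \<le> r j" "\<And>j. r j < 1" "r \<longlonglongrightarrow> 1"
  shows "(\<lambda>j. cmod (outer L (of_real (r j) * cis t))) \<longlonglongrightarrow> exp (L t / 2)"
proof -
  have z: "cmod (of_real (r j) * cis t) < 1" for j using r(1,2)[of j] by (simp add: norm_mult)
  have "(\<lambda>j. exp (1 / (4 * pi) * (\<integral>s. poisson (of_real (r j) * cis t) s * L s \<partial>circ)))
      \<longlonglongrightarrow> exp (1 / (4 * pi) * (2 * pi * L t))"
    by (intro tendsto_exp tendsto_mult tendsto_const poisson_limit[OF L t cont r])
  then show ?thesis by (simp add: cmod_outer[OF L z])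
qed

definition outer_coeff :: "(real \<Rightarrow> real) \<Rightarrow> nat \<Rightarrow> complex" where
  "outer_coeff L k = (deriv ^^ k) (outer L) 0 / fact k"

lemma outer_sums:
  assumes "integrable circ L" "cmod z < 1"
  shows "(\<lambda>k. outer_coeff L k * z ^ k) sums outer L z"
  using holomorphic_power_series[OF outer_holomorphic[OF assms(1)], of z] assms(2)
  by (simp add: outer_coeff_def)

lemma outer_abs_summable:
  assumes "integrable circ L" "cmod z < 1"
  shows "summable (\<lambda>k. cmod (outer_coeff L k * z ^ k))"
proof -
  obtain x where x: "cmod z < x" "x < 1" using dense[OF assms(2)] by blast
  then have "0 < x" using norm_ge_zero[of z] by linarith
  then have "cmod (complex_of_real x) < 1" "cmod z < cmod (complex_of_real x)"
    using x by auto
  then show ?thesis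
    using powser_insidea[of "outer_coeff L" "complex_of_real x" z] outer_sums[OF assms(1)] sums_summable by blast
qed

section \<open>The logarithm of the kernel\<close>

abbreviation kern :: "nat \<Rightarrow> nat \<Rightarrow> real \<Rightarrow> complex" where
  "kern n \<mu> \<equiv> increment_kernel n (int \<mu>)"

text \<open>By this choice \<open>outer (kernel_log n \<mu>)\<close> is \<open>w\<^sub>\<mu>\<close>.\<close>

definition kernel_log :: "nat \<Rightarrow> nat \<Rightarrow> real \<Rightarrow> real" where
  "kernel_log n \<mu> t = 2 * ln (cmod (kern n \<mu> t))"

lemma cmod_kern: "cmod (kern n \<mu> t) = (cmod (1 - cis (- (t * real \<mu>))) / \<bar>t\<bar>) ^ n"
  by (simp add: increment_kernel_def norm_divide norm_power norm_mult power_divide mult.commute)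

lemma kernel_log_measurable [measurable]: "kernel_log n \<mu> \<in> borel_measurable borel"
  unfolding kernel_log_def[abs_def] by measurable

lemma w_fun_eq_outer: "w_fun n \<mu> = outer (kernel_log n \<mu>)"
proof
  fix z
  have ln: "ln ((cmod (1 - cis (- (t * real \<mu>)))) ^ (2 * n) / t ^ (2 * n)) = kernel_log n \<mu> t" for t
  proof -
    have "(cmod (1 - cis (- (t * real \<mu>)))) ^ (2 * n) / t ^ (2 * n) = (cmod (kern n \<mu> t)) ^ 2"
      using power_even_abs[of "2 * n" t]
      by (simp add: cmod_kern power_divide mult.commute[of 2] flip: power_mult)
    then show ?thesis by (simp add: kernel_log_def ln_realpow)
  qed
  show "w_fun n \<mu> z = outer (kernel_log n \<mu>) z"
    unfolding w_fun_def outer_def herglotz_def ln by (subst integral_circ) auto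
qed

lemma w_coeff_eq_outer_coeff: "w_coeff n \<mu> = outer_coeff (kernel_log n \<mu>)"
  by (simp add: fun_eq_iff w_coeff_def outer_coeff_def w_fun_eq_outer)

text \<open>Off the zeros of the kernel, and off \<open>0\<close> where the quotient defining it has the value \<open>0 / 0 = 0\<close>
  for \<open>n > 0\<close>, its logarithm is continuous; this is all of \<open>[-\<pi>, \<pi>]\<close> up to a countable set.\<close>

definition regular_point :: "nat \<Rightarrow> nat \<Rightarrow> real \<Rightarrow> bool" where
  "regular_point n \<mu> t \<longleftrightarrow> t \<in> {-pi<..<pi} \<and> t \<noteq> 0 \<and> kern n \<mu> t \<noteq> 0"

lemma countable_cis_one: "\<mu> > 0 \<Longrightarrow> countable {t. cis (real \<mu> * t) = 1}"
  using countable_scaled[OF _ countable_cis_fiber[of 1], of "real \<mu>"] by simp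

lemma cnj_kern: "kern n \<mu> (- t) = cnj (kern n \<mu> t)"
  by (simp add: increment_kernel_def cis_cnj)

lemma AE_regular_point:
  assumes "\<mu> > 0" "density_fun f" shows "AE t in spectral_measure f. regular_point n \<mu> t"
proof -
  have "AE t in spectral_measure f. t \<notin> {-pi, pi, 0} \<union> {t. cis (real \<mu> * t) = 1}"
    by (intro AE_countable_not_in assms countable_Un countable_cis_one countable_finite) simp
  then show ?thesis using AE_spectral_measure_interval[OF assms(2)]
  proof eventually_elim
    case (elim t)
    then have "cis (- (real \<mu> * t)) \<noteq> 1"
      by (metis (mono_tags, lifting) UnCI cis_cnj complex_cnj_one_iff mem_Collect_eq)
    with elim show ?case by (auto simp: regular_point_def increment_kernel_def)
  qed
qed

lemma regular_point_uminus: "regular_point n \<mu> t \<Longrightarrow> regular_point n \<mu> (- t)"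
  by (auto simp: regular_point_def cnj_kern)

lemma kernel_log_even: "kernel_log n \<mu> (- t) = kernel_log n \<mu> t"
  by (simp add: kernel_log_def cnj_kern)

lemma exp_kernel_log: "regular_point n \<mu> t \<Longrightarrow> exp (kernel_log n \<mu> t / 2) = cmod (kern n \<mu> t)"
  by (simp add: kernel_log_def regular_point_def)

lemma kernel_log_isCont:
  assumes "regular_point n \<mu> t" shows "isCont (kernel_log n \<mu>) t"
proof -
  have "continuous_on (- {0}) (\<lambda>t. kern n \<mu> t)"
    unfolding increment_kernel_def by (intro continuous_intros) auto
  then have "isCont (kern n \<mu>) t"
    using assms by (simp add: continuous_on_eq_continuous_at regular_point_def open_Compl)
  then show ?thesis
    unfolding kernel_log_def[abs_def] using assms
    by (intro continuous_intros) (auto simp: regular_point_def)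
qed

lemma kernel_log_le:
  assumes "\<mu> > 0" shows "kernel_log n \<mu> t \<le> 2 * (real n * ln (real \<mu>))"
proof (cases "kern n \<mu> t = 0")
  case False
  have "cmod (kern n \<mu> t) \<le> real \<mu> ^ n" using cmod_increment_kernel_le[of n "int \<mu>" t] by simp
  then have "ln (cmod (kern n \<mu> t)) \<le> ln (real \<mu> ^ n)" using False assms by (subst ln_le_cancel_iff) auto
  then show ?thesis by (simp add: kernel_log_def ln_realpow)
next
  case True
  have "0 \<le> ln (real \<mu>)" using assms by simp
  then show ?thesis using True by (simp add: kernel_log_def)
qed

text \<open>The mean value property of the harmonic function \<open>ln |1 - z\<^sup>\<mu>|\<close>, which vanishes at \<open>0\<close>.\<close>

lemma mean_value_ln:
  assumes mu: "\<mu> > 0" and r: "0 \<le> r" "r < 1"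
  shows "integrable circ (\<lambda>s. ln (cmod (1 - (of_real r * cis s) ^ \<mu>)))"
    and "(\<integral>s. ln (cmod (1 - (of_real r * cis s) ^ \<mu>)) \<partial>circ) = 0"
proof -
  define F where "F z = Ln (1 - z ^ \<mu>)" for z
  have pos: "0 < Re (1 - z ^ \<mu>)" if "cmod z < 1" for z
  proof -
    have "cmod (z ^ \<mu>) < 1" using that mu by (simp add: norm_power power_less_one_iff)
    then show ?thesis using complex_Re_le_cmod[of "z ^ \<mu>"] by simp
  qed
  have holo: "F holomorphic_on ball 0 1"
    unfolding F_def using pos by (intro holomorphic_intros) (auto simp: complex_nonpos_Reals_iff not_le)
  define a where "a k = (deriv ^^ k) F 0 / fact k" for k
  have sums: "(\<lambda>k. a k * z ^ k) sums F z" if "cmod z < 1" for z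
    using holomorphic_power_series[OF holo, of z] that by (simp add: a_def)
  define c where "c k = a k * of_real r ^ k" for k
  have c: "summable (\<lambda>k. cmod (c k))"
  proof -
    obtain x where x: "r < x" "x < 1" using dense[OF r(2)] by blast
    then have "cmod (complex_of_real x) < 1" "cmod (complex_of_real r) < cmod (complex_of_real x)" using r by auto
    then show ?thesis unfolding c_def
      using powser_insidea[of a "complex_of_real x" "complex_of_real r"] sums sums_summable by blast
  qed
  have F: "F (of_real r * cis s) = (\<Sum>k. c k * cis (of_nat k * s))" for s
  proof -
    have "(\<lambda>k. a k * (of_real r * cis s) ^ k) sums F (of_real r * cis s)"
      using r by (intro sums) (simp add: norm_mult)
    then show ?thesis
      by (simp add: sums_iff c_def power_mult_distrib Complex.DeMoivre mult.assoc)
  qed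
  have Fint: "integrable circ (\<lambda>s. F (of_real r * cis s))"
    unfolding F using summable_trig(2)[OF c] by (intro integrable_circ_bounded[where C="\<Sum>k. cmod (c k)"]) auto
  have "(\<integral>s. F (of_real r * cis s) \<partial>circ) = 2 * of_real pi * c 0"
    unfolding F by (rule integral_trig_series[OF c])
  also have "c 0 = 0" using mu by (simp add: c_def a_def F_def power_0_left)
  finally have F0: "(\<integral>s. F (of_real r * cis s) \<partial>circ) = 0" by simp
  have Re: "Re (F (of_real r * cis s)) = ln (cmod (1 - (of_real r * cis s) ^ \<mu>))" for s
  proof -
    have "0 < Re (1 - (of_real r * cis s) ^ \<mu>)" using r by (intro pos) (simp add: norm_mult)
    then have "1 - (of_real r * cis s) ^ \<mu> \<noteq> 0" by (metis less_irrefl zero_complex.sel(1))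
    then show ?thesis unfolding F_def by (rule Re_Ln)
  qed
  show "integrable circ (\<lambda>s. ln (cmod (1 - (of_real r * cis s) ^ \<mu>)))"
    using integrable_Re[OF Fint] unfolding Re .
  show "(\<integral>s. ln (cmod (1 - (of_real r * cis s) ^ \<mu>)) \<partial>circ) = 0"
    using integral_Re[OF Fint] unfolding Re F0 by simp
qed

text \<open>The radii start at \<open>1/2\<close> to keep \<open>1/z\<close> bounded by \<open>2\<close> on all circles.\<close>

definition radii :: "nat \<Rightarrow> real" where "radii j = 1 - 1 / (real j + 2)"

lemma radii: "0 \<le> radii j" "radii j < 1" "1 / 2 \<le> radii j" "radii \<longlonglongrightarrow> 1"
proof -
  show "0 \<le> radii j" "radii j < 1" "1 / 2 \<le> radii j" by (auto simp: radii_def field_simps)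
  have "(\<lambda>j. 1 - inverse (real (Suc (Suc j)))) \<longlonglongrightarrow> 1 - 0"
    by (intro tendsto_intros LIMSEQ_Suc[OF LIMSEQ_inverse_real_of_nat])
  then show "radii \<longlonglongrightarrow> 1" by (simp add: radii_def[abs_def] inverse_eq_divide add.commute)
qed

text \<open>Fatou's lemma applied to \<open>ln 2 - ln |1 - z\<^sup>\<mu>| \<ge> 0\<close> on the circles of radius \<open>r < 1\<close>, where the
  integral does not depend on \<open>r\<close>.\<close>

lemma integrable_ln_one_minus_cis:
  assumes mu: "\<mu> > 0" shows "integrable circ (\<lambda>s. ln (cmod (1 - cis (real \<mu> * s))))"
proof -
  let ?g = "\<lambda>s. ln 2 - ln (cmod (1 - cis (real \<mu> * s)))"
  let ?h = "\<lambda>j s. ln 2 - ln (cmod (1 - (of_real (radii j) * cis s) ^ \<mu>))"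
  have const: "integrable circ (\<lambda>_. ln 2 :: real)" by (intro integrable_circ_bounded[where C="ln 2"]) auto
  have one: "(\<integral>s. ln 2 \<partial>circ) = 2 * pi * ln (2::real)"
    using integral_cis[of 0] by (subst integral_circ) (auto simp: set_lebesgue_integral_def)
  have h_nonneg: "0 \<le> ?h j s" for j s
  proof -
    have "cmod ((of_real (radii j) * cis s) ^ \<mu>) \<le> 1"
      using radii(1-3)[of j] by (simp add: norm_power norm_mult power_le_one)
    then have "cmod (1 - (of_real (radii j) * cis s) ^ \<mu>) \<le> 2"
      using norm_triangle_ineq4[of 1 "(of_real (radii j) * cis s) ^ \<mu>"] by simp
    moreover have "cmod (1 - (of_real (radii j) * cis s) ^ \<mu>) > 0"
    proof -
      have "cmod ((of_real (radii j) * cis s) ^ \<mu>) < 1"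
        using radii(1-3)[of j] mu by (simp add: norm_power norm_mult power_less_one_iff)
      then have "(of_real (radii j) * cis s) ^ \<mu> \<noteq> 1" by (metis less_irrefl norm_one)
      then show ?thesis by simp
    qed
    ultimately show ?thesis by simp
  qed
  have int_h: "(\<integral>\<^sup>+s. ennreal (?h j s) \<partial>circ) = ennreal (2 * pi * ln 2)" for j
  proof -
    note m = mean_value_ln[OF mu radii(1,2), of j]
    have "(\<integral>\<^sup>+s. ennreal (?h j s) \<partial>circ) = ennreal (\<integral>s. ?h j s \<partial>circ)"
      using h_nonneg by (intro nn_integral_eq_integral Bochner_Integration.integrable_diff const m AE_I2)
    also have "(\<integral>s. ?h j s \<partial>circ) = 2 * pi * ln 2"
      using Bochner_Integration.integral_diff[OF const m(1)] m(2) one by simp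
    finally show ?thesis .
  qed
  have AE: "AE s in circ. (\<lambda>j. ?h j s) \<longlonglongrightarrow> ?g s"
    using AE_countable_not_in[OF countable_cis_one[OF mu] density_fun_one]
  proof eventually_elim
    case (elim s)
    then have "cmod (1 - cis (real \<mu> * s)) \<noteq> 0" by auto
    moreover have "(\<lambda>j. (of_real (radii j) * cis s) ^ \<mu>) \<longlonglongrightarrow> (of_real 1 * cis s) ^ \<mu>"
      by (intro tendsto_intros radii)
    ultimately show ?case by (intro tendsto_intros) (simp_all add: Complex.DeMoivre)
  qed
  have g_nonneg: "AE s in circ. 0 \<le> ?g s"
    using AE by eventually_elim (rule LIMSEQ_le_const, use h_nonneg in auto)
  have "(\<integral>\<^sup>+s. ennreal (?g s) \<partial>circ) = (\<integral>\<^sup>+s. liminf (\<lambda>j. ennreal (?h j s)) \<partial>circ)"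
    using AE by (intro nn_integral_cong_AE, eventually_elim)
      (rule lim_imp_Liminf[OF sequentially_bot, symmetric], rule tendsto_ennrealI)
  also have "\<dots> \<le> liminf (\<lambda>j. \<integral>\<^sup>+s. ennreal (?h j s) \<partial>circ)"
    by (rule nn_integral_liminf) measurable
  also have "\<dots> < \<infinity>" by (simp add: int_h Liminf_const)
  finally have fin: "(\<integral>\<^sup>+s. ennreal (?g s) \<partial>circ) < \<infinity>" .
  have "integrable circ ?g"
  proof (rule integrableI_bounded)
    have "(\<integral>\<^sup>+s. ennreal (norm (?g s)) \<partial>circ) = (\<integral>\<^sup>+s. ennreal (?g s) \<partial>circ)"
      using g_nonneg by (intro nn_integral_cong_AE, eventually_elim) simp
    then show "(\<integral>\<^sup>+s. ennreal (norm (?g s)) \<partial>circ) < \<infinity>" using fin by simp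
  qed measurable
  from Bochner_Integration.integrable_diff[OF const this] show ?thesis by simp
qed

text \<open>Besides \<open>ln |1 - e\<^bsup>i\<mu>s\<^esup>|\<close> the logarithm contains \<open>ln |s|\<close>, which lies between \<open>ln |1 - e\<^bsup>is\<^esup>|\<close> and \<open>ln \<pi>\<close>.\<close>

lemma kernel_log_integrable:
  assumes mu: "\<mu> > 0" shows "integrable circ (kernel_log n \<mu>)"
proof (rule Bochner_Integration.integrable_bound)
  let ?l1 = "\<lambda>s. ln (cmod (1 - cis (real \<mu> * s)))" and ?l2 = "\<lambda>s. ln (cmod (1 - cis (real 1 * s)))"
  have const: "integrable circ (\<lambda>_. ln pi :: real)" by (intro integrable_circ_bounded[where C="\<bar>ln pi\<bar>"]) auto
  show "integrable circ (\<lambda>s. 2 * real n * (\<bar>?l1 s\<bar> + \<bar>?l2 s\<bar> + ln pi))"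
    using integrable_ln_one_minus_cis[OF mu] integrable_ln_one_minus_cis[of 1] const
    by (intro integrable_mult_right Bochner_Integration.integrable_add integrable_abs) auto
  have lnpi: "0 \<le> ln pi" using pi_gt3 by simp
  show "AE s in circ. norm (kernel_log n \<mu> s) \<le> norm (2 * real n * (\<bar>?l1 s\<bar> + \<bar>?l2 s\<bar> + ln pi))"
    using AE_regular_point[OF mu density_fun_one, of n] AE_countable_not_in[OF countable_cis_one[of 1] density_fun_one, simplified]
      AE_countable_not_in[OF countable_cis_one[OF mu] density_fun_one]
  proof eventually_elim
    case (elim s)
    let ?x = "cmod (1 - cis (real \<mu> * s))" and ?y = "cmod (1 - cis s)"
    have s: "s \<noteq> 0" "\<bar>s\<bar> \<le> pi" using elim(1) by (auto simp: regular_point_def)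
    have x: "?x > 0" and y: "?y > 0" using elim(2,3) by auto
    have sym: "cmod (1 - cis (- (s * real \<mu>))) = ?x"
      by (metis cis_cnj complex_cnj_diff complex_cnj_one complex_mod_cnj mult.commute)
    have "ln (cmod (kern n \<mu> s)) = real n * (ln ?x - ln \<bar>s\<bar>)"
      unfolding cmod_kern sym ln_realpow using s x by (simp add: ln_div)
    then have k: "\<bar>kernel_log n \<mu> s\<bar> = 2 * real n * \<bar>ln ?x - ln \<bar>s\<bar>\<bar>"
      by (simp add: kernel_log_def abs_mult)
    have "?y \<le> \<bar>s\<bar>" by (rule cmod_one_minus_cis_le)
    then have "ln ?y \<le> ln \<bar>s\<bar>" using y s by (subst ln_le_cancel_iff) auto
    moreover have "ln \<bar>s\<bar> \<le> ln pi" using s by simp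
    ultimately have "\<bar>ln \<bar>s\<bar>\<bar> \<le> \<bar>ln ?y\<bar> + ln pi" using lnpi by linarith
    then have "\<bar>ln ?x - ln \<bar>s\<bar>\<bar> \<le> \<bar>ln ?x\<bar> + \<bar>ln ?y\<bar> + ln pi" by linarith
    then have "2 * real n * \<bar>ln ?x - ln \<bar>s\<bar>\<bar> \<le> 2 * real n * (\<bar>ln ?x\<bar> + \<bar>ln ?y\<bar> + ln pi)"
      by (intro mult_left_mono) auto
    then show ?case unfolding real_norm_def k using lnpi by simp
  qed
qed simp

text \<open>The outer function of the cut logarithm is bounded away from \<open>0\<close>, which \<open>w\<^sub>\<mu>\<close> need not be.\<close>

definition kernel_log_cut :: "nat \<Rightarrow> nat \<Rightarrow> nat \<Rightarrow> real \<Rightarrow> real" where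
  "kernel_log_cut n \<mu> k t = max (kernel_log n \<mu> t) (- real k)"

lemma kernel_log_cut_bounds:
  assumes "\<mu> > 0"
  shows "- real k \<le> kernel_log_cut n \<mu> k t" "kernel_log_cut n \<mu> k t \<le> 2 * (real n * ln (real \<mu>))"
proof -
  have "0 \<le> ln (real \<mu>)" using assms by simp
  then have "- real k \<le> 2 * (real n * ln (real \<mu>))" by (meson le_minus_iff mult_nonneg_nonneg neg_le_0_iff_le of_nat_0_le_iff order_trans zero_le_numeral)
  then show "kernel_log_cut n \<mu> k t \<le> 2 * (real n * ln (real \<mu>))"
    using kernel_log_le[OF assms, of n t] by (simp add: kernel_log_cut_def)
qed (simp add: kernel_log_cut_def)

lemma kernel_log_cut_integrable: "\<mu> > 0 \<Longrightarrow> integrable circ (kernel_log_cut n \<mu> k)"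
  unfolding kernel_log_cut_def[abs_def]
  by (intro integrable_max kernel_log_integrable integrable_circ_bounded[where C="real k"]) auto

lemma kernel_log_cut_isCont: "regular_point n \<mu> t \<Longrightarrow> isCont (kernel_log_cut n \<mu> k) t"
  unfolding kernel_log_cut_def[abs_def] by (intro continuous_intros kernel_log_isCont)

lemma kernel_log_cut_even: "kernel_log_cut n \<mu> k (- t) = kernel_log_cut n \<mu> k t"
  by (simp add: kernel_log_cut_def kernel_log_even)

text \<open>Mean convergence of the logarithms makes the Herglotz integrals converge uniformly on a smaller
  disc; by Weierstrass the Taylor coefficients of the exponentials converge.\<close>

lemma outer_coeff_tendsto:
  assumes L: "integrable circ L" and Ls: "\<And>k::nat. integrable circ (Ls k)"
    and lim: "(\<lambda>k. \<integral>s. \<bar>Ls k s - L s\<bar> \<partial>circ) \<longlonglongrightarrow> 0"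
  shows "(\<lambda>k. outer_coeff (Ls k) i) \<longlonglongrightarrow> outer_coeff L i"
proof -
  have h: "cmod (herglotz (Ls k) z - herglotz L z) \<le> 4 * (\<integral>s. \<bar>Ls k s - L s\<bar> \<partial>circ)" if z: "z \<in> ball 0 (1/2)" for k z
  proof -
    have z1: "cmod z < 1" using z by simp
    have "2 / (1 - cmod z) \<le> 4" using z by (simp add: field_simps)
    then have b: "cmod ((cis s + z) / (cis s - z)) \<le> 4" for s using herglotz_kernel_bound[OF z1, of s] by linarith
    have "herglotz (Ls k) z - herglotz L z =
        (\<integral>s. (cis s + z) / (cis s - z) * of_real (Ls k s) - (cis s + z) / (cis s - z) * of_real (L s) \<partial>circ)"
      unfolding herglotz_def
      by (rule Bochner_Integration.integral_diff[symmetric]) (intro herglotz_integrable L Ls z1)+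
    also have "cmod \<dots> \<le> (\<integral>s. 4 * \<bar>Ls k s - L s\<bar> \<partial>circ)"
    proof (rule Bochner_Integration.integral_norm_bound_integral)
      show "integrable circ (\<lambda>s. (cis s + z) / (cis s - z) * of_real (Ls k s) - (cis s + z) / (cis s - z) * complex_of_real (L s))"
        by (intro Bochner_Integration.integrable_diff herglotz_integrable L Ls z1)
      show "integrable circ (\<lambda>s. 4 * \<bar>Ls k s - L s\<bar>)"
        by (intro integrable_mult_right integrable_abs Bochner_Integration.integrable_diff L Ls)
      fix s
      have "cmod ((cis s + z) / (cis s - z) * of_real (Ls k s) - (cis s + z) / (cis s - z) * of_real (L s)) =
          cmod ((cis s + z) / (cis s - z)) * \<bar>Ls k s - L s\<bar>"
        unfolding right_diff_distrib[symmetric] of_real_diff[symmetric] norm_mult norm_of_real ..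
      also have "\<dots> \<le> 4 * \<bar>Ls k s - L s\<bar>" using b by (intro mult_right_mono) auto
      finally show "cmod ((cis s + z) / (cis s - z) * of_real (Ls k s) - (cis s + z) / (cis s - z) * of_real (L s)) \<le>
          4 * \<bar>Ls k s - L s\<bar>" .
    qed
    finally show ?thesis by simp
  qed
  have lim4: "(\<lambda>k. 4 * (\<integral>s. \<bar>Ls k s - L s\<bar> \<partial>circ)) \<longlonglongrightarrow> 0"
    using tendsto_mult[OF tendsto_const[of 4] lim] by simp
  have bound: "cmod (outer L z) \<le> exp (1 / (4 * pi) * (4 * (\<integral>s. \<bar>L s\<bar> \<partial>circ)))" if z: "z \<in> ball 0 (1/2)" for z
  proof -
    have z1: "cmod z < 1" using z by simp
    have "2 / (1 - cmod z) \<le> 4" using z by (simp add: field_simps)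
    then have b: "cmod ((cis s + z) / (cis s - z)) \<le> 4" for s using herglotz_kernel_bound[OF z1, of s] by linarith
    have "cmod (herglotz L z) \<le> (\<integral>s. 4 * \<bar>L s\<bar> \<partial>circ)"
      unfolding herglotz_def
    proof (rule Bochner_Integration.integral_norm_bound_integral[OF herglotz_integrable[OF L z1]])
      show "integrable circ (\<lambda>s. 4 * \<bar>L s\<bar>)" using L by simp
      show "cmod ((cis s + z) / (cis s - z) * of_real (L s)) \<le> 4 * \<bar>L s\<bar>" for s
        unfolding norm_mult norm_of_real by (intro mult_right_mono b) simp
    qed
    then have "Re (herglotz L z) \<le> 4 * (\<integral>s. \<bar>L s\<bar> \<partial>circ)" using complex_Re_le_cmod[of "herglotz L z"] by simp
    then have "1 / (4 * pi) * Re (herglotz L z) \<le> 1 / (4 * pi) * (4 * (\<integral>s. \<bar>L s\<bar> \<partial>circ))"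
      by (intro mult_left_mono) auto
    then show ?thesis unfolding outer_def norm_exp_eq_Re by simp
  qed
  have unif: "uniform_limit (ball 0 (1/2)) (\<lambda>k. outer (Ls k)) (outer L) sequentially"
  proof (rule uniform_limitI)
    fix e :: real assume e: "0 < e"
    let ?C = "exp (1 / (4 * pi) * (4 * (\<integral>s. \<bar>L s\<bar> \<partial>circ)))"
    have "isCont exp (0::complex)" by (rule isCont_exp)
    moreover have "0 < e / ?C" using e by simp
    ultimately obtain d where d: "d > 0" "\<And>x::complex. cmod x < d \<Longrightarrow> cmod (exp x - 1) < e / ?C"
      unfolding continuous_at_eps_delta by (auto simp: dist_norm)
    have "\<forall>\<^sub>F k in sequentially. 4 * (\<integral>s. \<bar>Ls k s - L s\<bar> \<partial>circ) < d"
      using lim4 d(1) by (rule order_tendstoD)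
    then show "\<forall>\<^sub>F k in sequentially. \<forall>z\<in>ball 0 (1/2). dist (outer (Ls k) z) (outer L z) < e"
    proof eventually_elim
      case (elim k)
      show ?case
      proof
        fix z :: complex assume z: "z \<in> ball 0 (1/2)"
        let ?d = "complex_of_real (1 / (4 * pi)) * (herglotz (Ls k) z - herglotz L z)"
        have "cmod ?d \<le> 1 * cmod (herglotz (Ls k) z - herglotz L z)"
        proof -
          have "0 \<le> 1 / (4 * pi)" "1 / (4 * pi) \<le> 1" using pi_gt3 by (simp_all add: divide_le_eq)
          then have "\<bar>1 / (4 * pi)\<bar> \<le> 1" by (simp only: abs_of_nonneg)
          then show ?thesis unfolding norm_mult norm_of_real by (intro mult_right_mono) auto
        qed
        then have "cmod ?d < d" using h[OF z, of k] elim by linarith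
        then have 1: "cmod (exp ?d - 1) < e / ?C" by (rule d(2))
        have "outer (Ls k) z - outer L z = outer L z * (exp ?d - 1)"
        proof -
          have "outer (Ls k) z = outer L z * exp ?d"
            unfolding outer_def exp_add[symmetric] distrib_left[symmetric] by simp
          then show ?thesis by (simp add: right_diff_distrib)
        qed
        then have "cmod (outer (Ls k) z - outer L z) = cmod (outer L z) * cmod (exp ?d - 1)" by (simp add: norm_mult)
        also have "\<dots> \<le> ?C * cmod (exp ?d - 1)" by (intro mult_right_mono bound z) auto
        also have "\<dots> < ?C * (e / ?C)" using 1 by (intro mult_strict_left_mono) auto
        also have "\<dots> = e" by simp
        finally show "dist (outer (Ls k) z) (outer L z) < e" by (simp add: dist_norm)
      qed
    qed
  qed
  have hol: "outer (Ls k) holomorphic_on ball 0 (1 / 2)" for k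
    by (rule holomorphic_on_subset[OF outer_holomorphic[OF Ls]]) (rule subset_ball, simp)
  have "(\<lambda>k. (deriv ^^ i) (outer (Ls k)) 0) \<longlonglongrightarrow> (deriv ^^ i) (outer L) 0"
    by (rule higher_deriv_complex_uniform_limit[OF unif]) (use hol in auto)
  then show ?thesis unfolding outer_coeff_def by (intro tendsto_divide tendsto_const) auto
qed

lemma outer_coeff_cut_tendsto:
  assumes mu: "\<mu> > 0"
  shows "(\<lambda>k. outer_coeff (kernel_log_cut n \<mu> k) i) \<longlonglongrightarrow> w_coeff n \<mu> i"
  unfolding w_coeff_eq_outer_coeff
proof (rule outer_coeff_tendsto[OF kernel_log_integrable[OF mu] kernel_log_cut_integrable[OF mu]])
  have "(\<lambda>k. \<integral>s. \<bar>kernel_log_cut n \<mu> k s - kernel_log n \<mu> s\<bar> \<partial>circ) \<longlonglongrightarrow> (\<integral>s. 0 \<partial>circ)"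
  proof (rule integral_dominated_convergence[where w="\<lambda>s. \<bar>kernel_log n \<mu> s\<bar>"])
    show "integrable circ (\<lambda>s. \<bar>kernel_log n \<mu> s\<bar>)" using kernel_log_integrable[OF mu] by simp
    show "AE s in circ. (\<lambda>k. \<bar>kernel_log_cut n \<mu> k s - kernel_log n \<mu> s\<bar>) \<longlonglongrightarrow> 0"
    proof (intro AE_I2 tendsto_eventually)
      fix s
      obtain K :: nat where K: "\<bar>kernel_log n \<mu> s\<bar> \<le> real K" using real_arch_simple by blast
      show "\<forall>\<^sub>F k in sequentially. \<bar>kernel_log_cut n \<mu> k s - kernel_log n \<mu> s\<bar> = 0"
        unfolding eventually_sequentially
      proof (intro exI[of _ K] allI impI)
        fix k assume "K \<le> k"
        then have "real K \<le> real k" by simp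
        then have "max (kernel_log n \<mu> s) (- real k) = kernel_log n \<mu> s" using K by (intro max_absorb1) linarith
        then show "\<bar>kernel_log_cut n \<mu> k s - kernel_log n \<mu> s\<bar> = 0" by (simp add: kernel_log_cut_def)
      qed
    qed
    show "AE s in circ. norm \<bar>kernel_log_cut n \<mu> k s - kernel_log n \<mu> s\<bar> \<le> \<bar>kernel_log n \<mu> s\<bar>" for k
      by (intro AE_I2) (auto simp: kernel_log_cut_def max_def)
    show "(\<lambda>s. \<bar>kernel_log_cut n \<mu> k s - kernel_log n \<mu> s\<bar>) \<in> borel_measurable circ" for k
      unfolding kernel_log_cut_def by measurable
  qed simp
  then show "(\<lambda>k. \<integral>s. \<bar>kernel_log_cut n \<mu> k s - kernel_log n \<mu> s\<bar> \<partial>circ) \<longlonglongrightarrow> 0" by simp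
qed

section \<open>Lower bound for the error\<close>

lemma LIMSEQ_poly: "f \<longlonglongrightarrow> a \<Longrightarrow> (\<lambda>j. poly p (f j)) \<longlonglongrightarrow> poly p a" for p :: "complex poly"
  using isCont_tendsto_compose[OF poly_isCont] .

lemma poly_bounded_cball:
  fixes p :: "complex poly"
  obtains C where "0 \<le> C" "\<And>z. cmod z \<le> R \<Longrightarrow> cmod (poly p z) \<le> C"
proof -
  have "compact (cball (0::complex) R)" by simp
  then have "compact (poly p ` cball 0 R)" by (intro compact_continuous_image continuous_intros)
  then have "bounded (poly p ` cball 0 R)" by (rule compact_imp_bounded)
  then obtain C where C: "C > 0" "\<forall>x\<in>poly p ` cball 0 R. norm x \<le> C" unfolding bounded_pos by blast
  show thesis by (rule that[of C]) (use C in auto)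
qed

lemma poly_eq_sum_atMost: "degree p \<le> N \<Longrightarrow> poly p z = (\<Sum>k\<le>N. coeff p k * z ^ k)" for p :: "complex poly"
  unfolding poly_altdef by (rule sum.mono_neutral_left) (auto simp: coeff_eq_0)

lemma poly_outer_series:
  assumes L: "integrable circ L" and z: "cmod z < 1"
  shows "summable (\<lambda>k. cmod (fps_nth (fps_of_poly P * Abs_fps (outer_coeff L)) k * z ^ k))"
    and "(\<Sum>k. fps_nth (fps_of_poly P * Abs_fps (outer_coeff L)) k * z ^ k) = poly P z * outer L z"
proof -
  let ?W = "Abs_fps (outer_coeff L)"
  have "conv_radius (outer_coeff L) \<ge> 1"
  proof (rule conv_radius_geI_ex')
    fix r :: real assume "0 < r" "ereal r < 1"
    then have "cmod (complex_of_real r) < 1" by (simp add: one_ereal_def)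
    from outer_sums[OF L this] show "summable (\<lambda>n. outer_coeff L n * complex_of_real r ^ n)"
      by (rule sums_summable)
  qed
  then have W: "fps_conv_radius ?W \<ge> 1" by (simp add: fps_conv_radius_def)
  have PW: "fps_conv_radius (fps_of_poly P * ?W) \<ge> 1"
    using fps_conv_radius_mult[of "fps_of_poly P" ?W] W by (simp add: min_def split: if_splits)
  have z': "ereal (cmod z) < 1" using z by (simp add: one_ereal_def)
  note r = less_le_trans[OF z' PW] less_le_trans[OF z' W]
  show "summable (\<lambda>k. cmod (fps_nth (fps_of_poly P * ?W) k * z ^ k))"
    using r(1) unfolding fps_conv_radius_def by (rule abs_summable_in_conv_radius)
  have "(\<Sum>k. fps_nth (fps_of_poly P * ?W) k * z ^ k) = eval_fps (fps_of_poly P * ?W) z"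
    by (simp add: eval_fps_def)
  also have "\<dots> = poly P z * eval_fps ?W z" using r(2) by (subst eval_fps_mult) auto
  also have "eval_fps ?W z = outer L z" using outer_sums[OF L z] by (simp add: eval_fps_def sums_iff)
  finally show "(\<Sum>k. fps_nth (fps_of_poly P * ?W) k * z ^ k) = poly P z * outer L z" .
qed

text \<open>The coefficient of \<open>z\<^bsup>-p\<^esup>\<close> in \<open>B(1/z) w(z)\<close> with \<open>B(z) = \<Sum> b\<^sub>k z\<^sup>k\<close>.\<close>

definition hankel_symbol :: "nat \<Rightarrow> (nat \<Rightarrow> complex) \<Rightarrow> (nat \<Rightarrow> complex) \<Rightarrow> nat \<Rightarrow> complex" where
  "hankel_symbol N b w p = (\<Sum>i\<le>N. if p + i \<le> N then b (p + i) * w i else 0)"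

lemma hankel_symbol_beyond: "p > N \<Longrightarrow> hankel_symbol N b w p = 0"
  by (auto simp: hankel_symbol_def)

text \<open>The polynomial \<open>z\<^sup>N B(1/z)\<close>.\<close>

definition reversed :: "nat \<Rightarrow> (nat \<Rightarrow> complex) \<Rightarrow> complex poly" where
  "reversed N b = (\<Sum>k\<le>N. monom (b k) (N - k))"

lemma coeff_reversed: "coeff (reversed N b) l = (if l \<le> N then b (N - l) else 0)"
proof -
  have "coeff (reversed N b) l = (\<Sum>k\<le>N. if k = N - l \<and> l \<le> N then b k else 0)"
    unfolding reversed_def coeff_sum coeff_monom by (intro sum.cong refl) auto
  also have "\<dots> = (if l \<le> N then b (N - l) else 0)"
    by (cases "l \<le> N") (auto simp: sum.delta)
  finally show ?thesis .
qed

lemma poly_reversed: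
  assumes "z \<noteq> 0" shows "poly (reversed N b) z = z ^ N * (\<Sum>k\<le>N. b k * inverse z ^ k)"
  unfolding reversed_def poly_sum poly_monom sum_distrib_left
proof (intro sum.cong refl)
  fix k assume "k \<in> {..N}"
  then have "z ^ N = z ^ (N - k) * z ^ k" by (simp flip: power_add)
  then show "b k * z ^ (N - k) = z ^ N * (b k * inverse z ^ k)"
    using assms by (simp add: field_simps)
qed

text \<open>For \<open>A = z\<^sup>N (B(1/z) - p)\<close> the first \<open>N + 1\<close> coefficients come from \<open>B\<close>, since \<open>p\<close> has only
  negative frequencies and starts at \<open>z\<^bsup>N+1\<^esup>\<close>.  The coefficients of nonnegative frequency in
  \<open>(B - p) \<phi> w\<close> are therefore those of \<open>H\<phi>\<close>, whatever \<open>p\<close> is.\<close>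

lemma nth_poly_outer:
  assumes A: "\<And>l. l \<le> N \<Longrightarrow> coeff A l = b (N - l)" and deg: "degree \<phi> \<le> N" and k: "k \<le> N"
  shows "fps_nth (fps_of_poly (A * \<phi>) * Abs_fps w) (N - k) = hankel N (hankel_symbol N b w) (coeff \<phi>) k"
proof -
  have inner: "coeff (A * \<phi>) m = (\<Sum>j\<le>N. if j \<le> m then b (N - (m - j)) * coeff \<phi> j else 0)" if "m \<le> N" for m
  proof -
    have "coeff (A * \<phi>) m = (\<Sum>j\<le>m. coeff \<phi> j * coeff A (m - j))"
      unfolding mult.commute[of A] coeff_mult ..
    also have "\<dots> = (\<Sum>j\<le>m. b (N - (m - j)) * coeff \<phi> j)"
      using that by (intro sum.cong refl) (simp add: A mult.commute)
    also have "\<dots> = (\<Sum>j\<le>N. if j \<le> m then b (N - (m - j)) * coeff \<phi> j else 0)"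
      using that by (intro sum.mono_neutral_cong_left) auto
    finally show ?thesis .
  qed
  have "fps_nth (fps_of_poly (A * \<phi>) * Abs_fps w) (N - k) = (\<Sum>i=0..N - k. w i * coeff (A * \<phi>) (N - k - i))"
    unfolding mult.commute[of "fps_of_poly _"] fps_mult_nth by simp
  also have "\<dots> = (\<Sum>i\<le>N. if i \<le> N - k then w i * coeff (A * \<phi>) (N - k - i) else 0)"
    by (intro sum.mono_neutral_cong_left) auto
  also have "\<dots> = (\<Sum>i\<le>N. \<Sum>j\<le>N. if k + j + i \<le> N then b (k + j + i) * w i * coeff \<phi> j else 0)"
  proof (intro sum.cong refl)
    fix i
    show "(if i \<le> N - k then w i * coeff (A * \<phi>) (N - k - i) else 0) =
        (\<Sum>j\<le>N. if k + j + i \<le> N then b (k + j + i) * w i * coeff \<phi> j else 0)"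
    proof (cases "i \<le> N - k")
      case True
      have "w i * coeff (A * \<phi>) (N - k - i) =
          (\<Sum>j\<le>N. w i * (if j \<le> N - k - i then b (N - (N - k - i - j)) * coeff \<phi> j else 0))"
        by (subst inner) (simp_all add: sum_distrib_left)
      also have "\<dots> = (\<Sum>j\<le>N. if k + j + i \<le> N then b (k + j + i) * w i * coeff \<phi> j else 0)"
      proof (intro sum.cong refl)
        fix j
        have "j \<le> N - k - i \<longleftrightarrow> k + j + i \<le> N" using True k by auto
        moreover have "N - (N - k - i - j) = k + j + i" if "k + j + i \<le> N" using that by simp
        ultimately show "w i * (if j \<le> N - k - i then b (N - (N - k - i - j)) * coeff \<phi> j else 0) =
            (if k + j + i \<le> N then b (k + j + i) * w i * coeff \<phi> j else 0)"
            by (simp add: ac_simps)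
      qed
      finally show ?thesis using True by simp
    next
      case False
      then have "\<not> k + j + i \<le> N" for j using k by auto
      then show ?thesis using False by simp
    qed
  qed
  also have "\<dots> = (\<Sum>j\<le>N. \<Sum>i\<le>N. if k + j + i \<le> N then b (k + j + i) * w i * coeff \<phi> j else 0)"
    by (rule sum.swap)
  also have "\<dots> = hankel N (hankel_symbol N b w) (coeff \<phi>) k"
    unfolding hankel_def hankel_symbol_def sum_distrib_right by (intro sum.cong refl) simp
  finally show ?thesis .
qed

definition past_poly :: "int set \<Rightarrow> (int \<Rightarrow> complex) \<Rightarrow> real \<Rightarrow> complex" where
  "past_poly K c t = (\<Sum>k\<in>K. c k * cis (of_int k * t))"

lemma past_poly_measurable [measurable]: "past_poly K c \<in> borel_measurable borel"
  unfolding past_poly_def[abs_def] by measurable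

lemma radial_limit:
  assumes L: "integrable circ L" and t: "t \<in> {-pi<..<pi}" and "isCont L (- t)" "L (- t) = L t"
  shows "(\<lambda>j. cmod (outer L (of_real (radii j) * cis (- t)))) \<longlonglongrightarrow> exp (L t / 2)"
  using cmod_outer_limit[OF L, of "- t" radii] assms radii by simp

lemma radial_point: "(\<lambda>j. complex_of_real (radii j) * cis s) \<longlonglongrightarrow> cis s"
proof -
  have "(\<lambda>j. complex_of_real (radii j) * cis s) \<longlonglongrightarrow> of_real 1 * cis s"
    by (intro tendsto_intros radii)
  then show ?thesis by simp
qed

lemma radial_norm: "cmod (complex_of_real (radii j) * cis s) = radii j" "cmod (complex_of_real (radii j) * cis s) < 1"
  using radii(1-3)[of j] by (auto simp: norm_mult)

text \<open>At radius \<open>r < 1\<close> Bessel's inequality bounds the integral from below by the coefficients of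
  nonnegative frequency.  As \<open>r \<rightarrow> 1\<close> the weight \<open>|w|\<close> stays bounded and tends to \<open>|\<kappa>|\<close>.\<close>

lemma error_lower_bound:
  assumes mu: "\<mu> > 0" and K: "finite K" "K \<subseteq> {..-1}" and deg: "degree \<phi> \<le> N"
  shows "2 * pi * sqnorm N (hankel N (hankel_symbol N (b_coeff n \<mu> N a) (w_coeff n \<mu>)) (coeff \<phi>)) \<le>
    (\<integral>t. (cmod (B_poly n \<mu> N a t - past_poly K c t))\<^sup>2 * (cmod (kern n \<mu> t))\<^sup>2 * (cmod (poly \<phi> (cis (- t))))\<^sup>2 \<partial>circ)"
proof -
  let ?L = "kernel_log n \<mu>" and ?b = "b_coeff n \<mu> N a"
  \<comment> \<open>on the circle, with \<open>z = e\<^bsup>-it\<^esup>\<close>, the past part is \<open>z q(z)\<close>\<close>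
  define q where "q = (\<Sum>k\<in>K. monom (c k) (nat (- k) - 1))"
  define A where "A = reversed N ?b - monom 1 (Suc N) * q"
  have cA: "coeff A l = ?b (N - l)" if "l \<le> N" for l
    using that by (simp add: A_def coeff_reversed coeff_monom_mult)
  have polyA: "poly A (cis (- t)) = cis (- t) ^ N * (B_poly n \<mu> N a t - past_poly K c t)" for t
  proof -
    have 1: "poly (reversed N ?b) (cis (- t)) = cis (- t) ^ N * B_poly n \<mu> N a t"
      by (simp add: poly_reversed B_poly_def Complex.DeMoivre)
    have "cis (- t) * poly q (cis (- t)) = past_poly K c t"
      unfolding q_def poly_sum poly_monom past_poly_def sum_distrib_left
    proof (intro sum.cong refl)
      fix k assume "k \<in> K"
      then have k: "k \<le> -1" using K(2) by auto
      then have "Suc (nat (- k) - 1) = nat (- k)" by simp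
      then have "cis (- t) * cis (- t) ^ (nat (- k) - 1) = cis (- t) ^ nat (- k)" by (metis power_Suc)
      also have "\<dots> = cis (of_int k * t)" using k by (simp add: Complex.DeMoivre)
      finally show "cis (- t) * (c k * cis (- t) ^ (nat (- k) - 1)) = c k * cis (of_int k * t)"
        by (simp add: mult.left_commute)
    qed
    then have "cis (- t) ^ N * (cis (- t) * poly q (cis (- t))) = cis (- t) ^ N * past_poly K c t" by simp
    then show ?thesis unfolding A_def using 1 by (simp add: poly_monom algebra_simps)
  qed
  let ?P = "A * \<phi>"
  let ?G = "fps_of_poly ?P * Abs_fps (outer_coeff ?L)"
  note L = kernel_log_integrable[OF mu, of n]
  obtain C where C: "0 \<le> C" "\<And>z. cmod z \<le> 1 \<Longrightarrow> cmod (poly ?P z) \<le> C" using poly_bounded_cball[of 1 ?P] by blast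
  let ?C2 = "exp (2 * (real n * ln (real \<mu>)) / 2)"
  let ?F = "\<lambda>r t. (cmod (poly ?P (of_real r * cis (- t)) * outer ?L (of_real r * cis (- t))))\<^sup>2"
  let ?z = "\<lambda>j t. complex_of_real (radii j) * cis (- t)"
  have series: "poly ?P (?z j t) * outer ?L (?z j t) = (\<Sum>k. fps_nth ?G k * of_real (radii j) ^ k * cis (- (of_nat k * t)))" for j t
    using poly_outer_series(2)[OF L radial_norm(2), of ?P j "- t"]
    by (simp add: power_mult_distrib Complex.DeMoivre mult.assoc)
  have summ: "summable (\<lambda>k. cmod (fps_nth ?G k * of_real (radii j) ^ k))" for j
    using poly_outer_series(1)[OF L radial_norm(2), of ?P j 0] by (simp add: cis_zero)
  have meas: "(\<lambda>t. ?F (radii j) t) \<in> borel_measurable borel" for j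
    unfolding series by measurable
  have step: "2 * pi * (\<Sum>k<Suc N. (cmod (fps_nth ?G k * of_real (radii j) ^ k))\<^sup>2) \<le> (\<integral>t. ?F (radii j) t \<partial>circ)" for j
    unfolding series by (rule Bessel_trig_series[OF summ])
  have lhs: "(\<lambda>j. 2 * pi * (\<Sum>k<Suc N. (cmod (fps_nth ?G k * of_real (radii j) ^ k))\<^sup>2)) \<longlonglongrightarrow>
      2 * pi * (\<Sum>k<Suc N. (cmod (fps_nth ?G k * of_real 1 ^ k))\<^sup>2)"
    by (intro tendsto_intros radii)
  have rhs: "(\<lambda>j. \<integral>t. ?F (radii j) t \<partial>circ) \<longlonglongrightarrow> (\<integral>t. (cmod (poly ?P (cis (- t))) * cmod (kern n \<mu> t))\<^sup>2 \<partial>circ)"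
  proof (rule integral_dominated_convergence[where w="\<lambda>_. (C * ?C2)\<^sup>2"])
    show "AE t in circ. (\<lambda>j. ?F (radii j) t) \<longlonglongrightarrow> (cmod (poly ?P (cis (- t))) * cmod (kern n \<mu> t))\<^sup>2"
      using AE_regular_point[OF mu density_fun_one, of n]
    proof eventually_elim
      case (elim t)
      have "(\<lambda>j. cmod (outer ?L (?z j t))) \<longlonglongrightarrow> cmod (kern n \<mu> t)"
        using radial_limit[OF L, of t] kernel_log_isCont[OF regular_point_uminus[OF elim]] kernel_log_even exp_kernel_log[OF elim] elim
        by (simp add: regular_point_def)
      then show ?case unfolding norm_mult
        by (intro tendsto_power tendsto_mult[OF tendsto_norm[OF LIMSEQ_poly[OF radial_point]]])
    qed
    show "AE t in circ. norm (?F (radii j) t) \<le> (C * ?C2)\<^sup>2" for j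
    proof (intro AE_I2)
      fix t
      have "cmod (poly ?P (?z j t)) * cmod (outer ?L (?z j t)) \<le> C * ?C2"
        using radial_norm[of j "- t"] C cmod_outer_le[OF L radial_norm(2) kernel_log_le[OF mu], of j "- t"]
        by (intro mult_mono) auto
      then have "(cmod (poly ?P (?z j t)) * cmod (outer ?L (?z j t)))\<^sup>2 \<le> (C * ?C2)\<^sup>2"
        by (rule power_mono) simp
      then show "norm (?F (radii j) t) \<le> (C * ?C2)\<^sup>2"
        unfolding real_norm_def abs_power2 norm_mult .
    qed
    show "(\<lambda>t. ?F (radii j) t) \<in> borel_measurable circ" for j using meas by simp
    show "(\<lambda>t. (cmod (poly ?P (cis (- t))) * cmod (kern n \<mu> t))\<^sup>2) \<in> borel_measurable circ"
      unfolding poly_altdef by measurable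
  qed simp
  have "2 * pi * (\<Sum>k<Suc N. (cmod (fps_nth ?G k))\<^sup>2) \<le> (\<integral>t. (cmod (poly ?P (cis (- t))) * cmod (kern n \<mu> t))\<^sup>2 \<partial>circ)"
    using LIMSEQ_le[OF lhs rhs] step by simp
  also have "(\<Sum>k<Suc N. (cmod (fps_nth ?G k))\<^sup>2) =
      sqnorm N (hankel N (hankel_symbol N ?b (w_coeff n \<mu>)) (coeff \<phi>))"
  proof -
    have "(\<Sum>k<Suc N. (cmod (fps_nth ?G k))\<^sup>2) = (\<Sum>k\<le>N. (cmod (fps_nth ?G (N - k)))\<^sup>2)"
      by (rule sum.reindex_bij_witness[of _ "\<lambda>k. N - k" "\<lambda>k. N - k"]) auto
    also have "\<dots> = sqnorm N (hankel N (hankel_symbol N ?b (w_coeff n \<mu>)) (coeff \<phi>))"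
      unfolding sqnorm_def w_coeff_eq_outer_coeff
      by (intro sum.cong refl) (simp add: nth_poly_outer[OF cA deg])
    finally show ?thesis .
  qed
  also have "(\<integral>t. (cmod (poly ?P (cis (- t))) * cmod (kern n \<mu> t))\<^sup>2 \<partial>circ) =
    (\<integral>t. (cmod (B_poly n \<mu> N a t - past_poly K c t))\<^sup>2 * (cmod (kern n \<mu> t))\<^sup>2 * (cmod (poly \<phi> (cis (- t))))\<^sup>2 \<partial>circ)"
    by (intro Bochner_Integration.integral_cong refl)
      (simp add: polyA norm_mult norm_power power_mult_distrib mult_ac)
  finally show ?thesis .
qed

section \<open>Upper bound for the error: bounded filters\<close>

lemma poly_sums: "(\<lambda>k. coeff p k * z ^ k) sums poly p z" for p :: "complex poly"
  unfolding poly_altdef by (rule sums_finite) (auto simp: coeff_eq_0)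

lemma tendsto_norm_perturb:
  fixes x y :: "nat \<Rightarrow> complex"
  assumes "x \<longlonglongrightarrow> 0" "(\<lambda>j. cmod (y j)) \<longlonglongrightarrow> l" shows "(\<lambda>j. cmod (x j + y j)) \<longlonglongrightarrow> l"
proof -
  have "(\<lambda>j. cmod (x j + y j) - cmod (y j)) \<longlonglongrightarrow> 0"
  proof (rule Lim_null_comparison)
    show "(\<lambda>j. cmod (x j)) \<longlonglongrightarrow> 0" using assms(1) by (rule tendsto_norm_zero)
    show "\<forall>\<^sub>F j in sequentially. norm (cmod (x j + y j) - cmod (y j)) \<le> cmod (x j)"
    proof (intro always_eventually allI)
      fix j show "norm (cmod (x j + y j) - cmod (y j)) \<le> cmod (x j)"
        using norm_triangle_ineq3[of "x j + y j" "y j"] by simp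
    qed
  qed
  from tendsto_add[OF this assms(2)] show ?thesis by simp
qed

text \<open>With a zero-free extremal \<open>\<phi>\<close>, the estimate
  \<open>h(z) = B(1/z) - \<Psi>(1/z) / (\<phi>(z) w(z))\<close>, where \<open>\<Psi>\<close> has the coefficients of \<open>H\<phi>\<close>, is analytic
  in the disc, vanishes at \<open>0\<close>, and has the weighted error \<open>|\<Psi>|\<^sup>2/|\<phi>|\<^sup>2 = \<sigma>\<close> on the circle.
  At radius \<open>r < 1\<close> it is a uniform limit of trigonometric polynomials of negative frequencies.\<close>

lemma error_upper_bound_regular:
  fixes n \<mu> N :: nat and a L
  defines "b \<equiv> b_coeff n \<mu> N a"
  assumes mu: "\<mu> > 0" and f: "density_fun f" and L: "integrable circ L" and C: "\<And>s. C1 \<le> L s" "\<And>s. L s \<le> C2"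
    and meas[measurable]: "L \<in> borel_measurable borel"
    and reg: "\<And>t. regular_point n \<mu> t \<Longrightarrow> isCont L (- t) \<and> L (- t) = L t"
    and bound: "is_norm_bound N (hankel_symbol N b (outer_coeff L)) \<sigma>"
    and ext: "extremal N (hankel_symbol N b (outer_coeff L)) \<sigma> (coeff \<phi>)"
    and deg: "degree \<phi> \<le> N" and zf: "\<And>z. cmod z \<le> 1 \<Longrightarrow> poly \<phi> z \<noteq> 0" and eps: "\<epsilon> > 0"
  shows "\<exists>M c. (\<integral>t. (cmod (B_poly n \<mu> N a t - past_poly {- int M..-1} c t))\<^sup>2 * exp (L t) \<partial>spectral_measure f) \<le>
    \<sigma> * measure (spectral_measure f) UNIV + \<epsilon>"
proof -
  interpret nu: finite_measure "spectral_measure f" by (rule finite_spectral_measure[OF f])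
  let ?w = "outer L" and ?e = "hankel_symbol N b (outer_coeff L)"
  define \<psi> where "\<psi> = hankel N ?e (coeff \<phi>)"
  define Q where "Q = reversed N b * \<phi>"
  define G where "G k = fps_nth (fps_of_poly Q * Abs_fps (outer_coeff L)) k - coeff (reversed N \<psi>) k" for k
  \<comment> \<open>the numerator \<open>z\<^sup>N (B(1/z) \<phi> w - \<Psi>(1/z))\<close> is divisible by \<open>z\<^bsup>N+1\<^esup>\<close>: \<open>\<Psi>\<close> is chosen for this\<close>
  have G0: "G m = 0" if "m \<le> N" for m
  proof -
    have "fps_nth (fps_of_poly Q * Abs_fps (outer_coeff L)) (N - (N - m)) = \<psi> (N - m)"
      unfolding Q_def \<psi>_def by (rule nth_poly_outer[OF _ deg]) (simp_all add: coeff_reversed)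
    then show ?thesis using that by (simp add: G_def coeff_reversed)
  qed
  have Gsums: "(\<lambda>k. G k * z ^ k) sums (poly Q z * ?w z - poly (reversed N \<psi>) z)" if "cmod z < 1" for z
  proof -
    have "(\<lambda>k. fps_nth (fps_of_poly Q * Abs_fps (outer_coeff L)) k * z ^ k) sums (poly Q z * ?w z)"
      using poly_outer_series[OF L that, of Q] summable_norm_cancel by (simp add: sums_iff)
    from sums_diff[OF this poly_sums] show ?thesis by (simp add: G_def left_diff_distrib)
  qed
  define R where "R m = G (m + Suc N)" for m
  have Rsums: "(\<lambda>m. R m * z ^ m) sums ((poly Q z * ?w z - poly (reversed N \<psi>) z) / z ^ Suc N)" if "cmod z < 1" "z \<noteq> 0" for z
  proof -
    have "(\<lambda>m. G (m + Suc N) * z ^ (m + Suc N)) sums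
        (poly Q z * ?w z - poly (reversed N \<psi>) z - (\<Sum>m<Suc N. G m * z ^ m))"
      by (rule sums_split_initial_segment[OF Gsums[OF that(1)]])
    moreover have "(\<Sum>m<Suc N. G m * z ^ m) = 0" by (intro sum.neutral) (simp add: G0)
    ultimately have "(\<lambda>m. G (m + Suc N) * z ^ (m + Suc N)) sums (poly Q z * ?w z - poly (reversed N \<psi>) z)" by simp
    from sums_divide[OF this, of "z ^ Suc N"] show ?thesis
      using that(2) by (simp add: R_def power_add)
  qed
  define Rf where "Rf z = (\<Sum>m. R m * z ^ m)" for z
  have Rf: "(\<lambda>m. R m * z ^ m) sums Rf z" if "cmod z < 1" for z
  proof (cases "z = 0")
    case True
    then show ?thesis unfolding Rf_def using powser_sums_zero[of R] by (simp add: sums_iff)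
  next
    case False
    then show ?thesis unfolding Rf_def using Rsums[OF that] by (simp add: sums_iff)
  qed
  have Rf_eq: "z ^ Suc N * Rf z = poly Q z * ?w z - poly (reversed N \<psi>) z" if "cmod z < 1" "z \<noteq> 0" for z
    using sums_unique2[OF Rf[OF that(1)] Rsums[OF that]] that(2) by simp
  define h1 where "h1 z = Rf z / (poly \<phi> z * ?w z)" for z
  have Rf_holo: "Rf holomorphic_on ball 0 1"
    by (rule power_series_holomorphic[where a=R]) (use Rf in auto)
  have h1_holo: "h1 holomorphic_on ball 0 1"
    unfolding h1_def using zf by (intro holomorphic_intros Rf_holo outer_holomorphic L) auto
  define d where "d k = (deriv ^^ k) h1 0 / fact k" for k
  have dsums: "(\<lambda>k. d k * z ^ k) sums h1 z" if "cmod z < 1" for z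
    using holomorphic_power_series[OF h1_holo, of z] that by (simp add: d_def)
  let ?z = "\<lambda>j t. complex_of_real (radii j) * cis (- t)"
  have rpos: "0 < radii j" for j using radii(3)[of j] by linarith
  have z0: "?z j t \<noteq> 0" for j t using rpos[of j] by simp
  have dsumm: "summable (\<lambda>k. cmod (d k * of_real (radii j) ^ Suc k))" for j
  proof -
    obtain x where x: "radii j < x" "x < 1" using dense[OF radii(2)] by blast
    then have "cmod (complex_of_real x) < 1" "cmod (complex_of_real (radii j)) < cmod (complex_of_real x)"
      using rpos[of j] by auto
    then have "summable (\<lambda>k. cmod (d k * of_real (radii j) ^ k))"
      using powser_insidea[of d "complex_of_real x" "complex_of_real (radii j)"] dsums sums_summable by blast
    from summable_mult2[OF this, of "radii j"] show ?thesis
      using rpos[of j] by (simp add: norm_mult norm_power mult_ac)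
  qed
  let ?c = "\<lambda>j k. d k * of_real (radii j) ^ Suc k"
  have series: "(\<lambda>k. ?c j k * cis (- (real (Suc k) * t))) sums (?z j t * h1 (?z j t))" for j t
  proof -
    have eq: "?z j t * (d k * ?z j t ^ k) = ?c j k * cis (- (real (Suc k) * t))" for k
    proof -
      have "?z j t * (d k * ?z j t ^ k) = d k * ?z j t ^ Suc k" by simp
      then show ?thesis by (simp only: power_mult_distrib Complex.DeMoivre mult_minus_right mult.assoc)
    qed
    show ?thesis using sums_mult[OF dsums[OF radial_norm(2)], of "?z j t" j "- t"] by (simp only: eq)
  qed
  have hmeas[measurable]: "(\<lambda>t. ?z j t * h1 (?z j t)) \<in> borel_measurable borel" for j
  proof -
    have "(\<lambda>t. ?z j t * h1 (?z j t)) = (\<lambda>t. \<Sum>k. ?c j k * cis (- (real (Suc k) * t)))"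
      using series by (auto simp: sums_iff)
    then show ?thesis by simp
  qed
  have hval: "?z j t * h1 (?z j t) = (\<Sum>k\<le>N. b k * inverse (?z j t) ^ k) -
      (\<Sum>k\<le>N. \<psi> k * inverse (?z j t) ^ k) / (poly \<phi> (?z j t) * ?w (?z j t))" (is "_ = ?Bz - ?Pz / ?D") for j t
  proof -
    let ?zz = "?z j t"
    have D: "?D \<noteq> 0" using zf[of ?zz] radial_norm(2)[of j "- t"] by auto
    have "?zz ^ Suc N * Rf ?zz = poly Q ?zz * ?w ?zz - poly (reversed N \<psi>) ?zz"
      by (rule Rf_eq[OF radial_norm(2) z0])
    also have "\<dots> = ?zz ^ N * (?Bz * ?D - ?Pz)"
      unfolding Q_def poly_mult poly_reversed[OF z0] by (simp only: right_diff_distrib mult.assoc)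
    finally have "?zz ^ N * (?zz * Rf ?zz) = ?zz ^ N * (?Bz * ?D - ?Pz)" by (simp only: power_Suc mult_ac)
    then have "?zz * Rf ?zz = ?Bz * ?D - ?Pz" using z0[of j t] by simp
    then have "?zz * h1 ?zz = (?Bz * ?D - ?Pz) / ?D" by (simp add: h1_def)
    then show ?thesis using D by (simp add: diff_divide_distrib)
  qed
  let ?B = "B_poly n \<mu> N a"
  have B_eq: "?B t = (\<Sum>k\<le>N. b k * cis t ^ k)" for t
    by (simp add: B_poly_def b_def Complex.DeMoivre)
  let ?E = "\<lambda>j t. ?B t - ?z j t * h1 (?z j t)"
  have inv_lim: "(\<lambda>j. inverse (?z j t)) \<longlonglongrightarrow> cis t" for t
    using tendsto_inverse[OF radial_point, of "- t"] by simp
  have lim: "(\<lambda>j. (cmod (?E j t))\<^sup>2 * exp (L t)) \<longlonglongrightarrow> \<sigma>" if t: "regular_point n \<mu> t" for t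
  proof -
    let ?l = "cmod (\<Sum>k\<le>N. \<psi> k * cis t ^ k) / (cmod (poly \<phi> (cis (- t))) * exp (L t / 2))"
    have x0: "(\<lambda>j. ?B t - (\<Sum>k\<le>N. b k * inverse (?z j t) ^ k)) \<longlonglongrightarrow> ?B t - (\<Sum>k\<le>N. b k * cis t ^ k)"
      by (intro tendsto_intros inv_lim)
    then have x: "(\<lambda>j. ?B t - (\<Sum>k\<le>N. b k * inverse (?z j t) ^ k)) \<longlonglongrightarrow> 0" unfolding B_eq by simp
    have phi0: "poly \<phi> (cis (- t)) \<noteq> 0" by (rule zf) simp
    have w: "(\<lambda>j. cmod (?w (?z j t))) \<longlonglongrightarrow> exp (L t / 2)"
      using t reg[OF t] by (intro radial_limit L) (auto simp: regular_point_def)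
    have "(\<lambda>j. cmod (\<Sum>k\<le>N. \<psi> k * inverse (?z j t) ^ k) / (cmod (poly \<phi> (?z j t)) * cmod (?w (?z j t)))) \<longlonglongrightarrow> ?l"
      using phi0 by (intro tendsto_intros inv_lim w tendsto_norm LIMSEQ_poly radial_point) auto
    then have y: "(\<lambda>j. cmod ((\<Sum>k\<le>N. \<psi> k * inverse (?z j t) ^ k) / (poly \<phi> (?z j t) * ?w (?z j t)))) \<longlonglongrightarrow> ?l"
      by (simp add: norm_divide norm_mult)
    have "(\<lambda>j. cmod (?E j t)) \<longlonglongrightarrow> ?l"
      using tendsto_norm_perturb[OF x y] unfolding hval by (simp add: algebra_simps)
    then have "(\<lambda>j. (cmod (?E j t))\<^sup>2 * exp (L t)) \<longlonglongrightarrow> ?l\<^sup>2 * exp (L t)" by (intro tendsto_intros)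
    also have "?l\<^sup>2 * exp (L t) = \<sigma>"
    proof -
      have "(cmod (\<Sum>k\<le>N. \<psi> k * cis t ^ k))\<^sup>2 = \<sigma> * (cmod (\<Sum>k\<le>N. coeff \<phi> k * cnj (cis t) ^ k))\<^sup>2"
        unfolding \<psi>_def by (rule extremal_cmod_eq[OF hankel_symbol_beyond bound ext]) auto
      also have "(\<Sum>k\<le>N. coeff \<phi> k * cnj (cis t) ^ k) = poly \<phi> (cis (- t))"
        by (simp add: poly_eq_sum_atMost[OF deg] cis_cnj)
      finally have 1: "(cmod (\<Sum>k\<le>N. \<psi> k * cis t ^ k))\<^sup>2 = \<sigma> * (cmod (poly \<phi> (cis (- t))))\<^sup>2" .
      have 2: "(exp (L t / 2))\<^sup>2 = exp (L t)" by (simp flip: exp_double)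
      have "?l\<^sup>2 * exp (L t) = (cmod (\<Sum>k\<le>N. \<psi> k * cis t ^ k))\<^sup>2 / ((cmod (poly \<phi> (cis (- t))))\<^sup>2 * (exp (L t / 2))\<^sup>2) * exp (L t)"
        by (simp only: power_divide power_mult_distrib)
      then show ?thesis unfolding 1 2 using phi0 by simp
    qed
    finally show ?thesis .
  qed
  obtain m0 where m0: "m0 > 0" "\<And>z. cmod z \<le> 1 \<Longrightarrow> m0 \<le> cmod (poly \<phi> z)"
  proof -
    have c1: "compact (cball (0::complex) 1)" by simp
    have c2: "continuous_on (cball 0 1) (\<lambda>z. cmod (poly \<phi> z))" by (intro continuous_intros)
    from continuous_attains_inf[OF c1 _ c2] obtain y where "y \<in> cball 0 1" "\<forall>z\<in>cball 0 1. cmod (poly \<phi> y) \<le> cmod (poly \<phi> z)"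
      by auto
    then show thesis using zf[of y] by (intro that[of "cmod (poly \<phi> y)"]) auto
  qed
  define SB where "SB = (\<Sum>k\<le>N. cmod (b k) * 2 ^ k)"
  define SP where "SP = (\<Sum>k\<le>N. cmod (\<psi> k) * 2 ^ k)"
  define D where "D = SB + (SB + SP / (m0 * exp (C1 / 2)))"
  have sum_le: "cmod (\<Sum>k\<le>N. x k * y ^ k) \<le> (\<Sum>k\<le>N. cmod (x k) * 2 ^ k)" if "cmod y \<le> 2" for x y
    using that by (intro sum_norm_le) (simp add: norm_mult norm_power mult_left_mono power_mono)
  have E_bound: "cmod (?E j t) \<le> D" for j t
  proof -
    have inv2: "cmod (inverse (?z j t)) \<le> 2"
      unfolding norm_inverse radial_norm using radii(3)[of j] rpos[of j] by (simp add: field_simps)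
    have "cmod (?B t) \<le> SB" unfolding B_eq SB_def by (rule sum_le) simp
    moreover have "cmod (?z j t * h1 (?z j t)) \<le> SB + SP / (m0 * exp (C1 / 2))"
    proof -
      have "cmod (?z j t * h1 (?z j t)) \<le> cmod (\<Sum>k\<le>N. b k * inverse (?z j t) ^ k) +
          cmod ((\<Sum>k\<le>N. \<psi> k * inverse (?z j t) ^ k) / (poly \<phi> (?z j t) * ?w (?z j t)))"
        unfolding hval by (rule norm_triangle_ineq4)
      also have "\<dots> \<le> SB + SP / (m0 * exp (C1 / 2))"
      proof (rule add_mono)
        show "cmod (\<Sum>k\<le>N. b k * inverse (?z j t) ^ k) \<le> SB" unfolding SB_def by (rule sum_le[OF inv2])
        have "m0 \<le> cmod (poly \<phi> (?z j t))" using radial_norm[of j "- t"] by (intro m0) auto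
        moreover have "exp (C1 / 2) \<le> cmod (?w (?z j t))" by (rule cmod_outer_ge[OF L radial_norm(2) C(1)])
        moreover have "cmod (\<Sum>k\<le>N. \<psi> k * inverse (?z j t) ^ k) \<le> SP" unfolding SP_def by (rule sum_le[OF inv2])
        ultimately show "cmod ((\<Sum>k\<le>N. \<psi> k * inverse (?z j t) ^ k) / (poly \<phi> (?z j t) * ?w (?z j t))) \<le> SP / (m0 * exp (C1 / 2))"
          unfolding norm_divide norm_mult using m0(1)
          by (intro frac_le mult_mono) (auto intro: order_trans[OF norm_ge_zero])
      qed
      finally show ?thesis .
    qed
    ultimately show ?thesis unfolding D_def using norm_triangle_ineq4[of "?B t" "?z j t * h1 (?z j t)"] by linarith
  qed
  have "(\<lambda>j. \<integral>t. (cmod (?E j t))\<^sup>2 * exp (L t) \<partial>spectral_measure f) \<longlonglongrightarrow> (\<integral>t. \<sigma> \<partial>spectral_measure f)"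
  proof (rule integral_dominated_convergence[where w="\<lambda>_. D\<^sup>2 * exp C2"])
    show "AE t in spectral_measure f. (\<lambda>j. (cmod (?E j t))\<^sup>2 * exp (L t)) \<longlonglongrightarrow> \<sigma>"
      using AE_regular_point[OF mu f, of n] by eventually_elim (rule lim)
    show "AE t in spectral_measure f. norm ((cmod (?E j t))\<^sup>2 * exp (L t)) \<le> D\<^sup>2 * exp C2" for j
      using E_bound C(2) by (intro AE_I2) (simp add: abs_mult mult_mono power_mono)
    show "(\<lambda>t. (cmod (?E j t))\<^sup>2 * exp (L t)) \<in> borel_measurable (spectral_measure f)" for j
      unfolding borel_measurable_spectral_measure by measurable
  qed auto
  then have "(\<lambda>j. \<integral>t. (cmod (?E j t))\<^sup>2 * exp (L t) \<partial>spectral_measure f) \<longlonglongrightarrow> \<sigma> * measure (spectral_measure f) UNIV"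
    by (simp add: mult.commute)
  then have "\<forall>\<^sub>F j in sequentially. (\<integral>t. (cmod (?E j t))\<^sup>2 * exp (L t) \<partial>spectral_measure f) < \<sigma> * measure (spectral_measure f) UNIV + \<epsilon>"
    using eps by (intro order_tendstoD(2)) auto
  then obtain j where j: "(\<integral>t. (cmod (?E j t))\<^sup>2 * exp (L t) \<partial>spectral_measure f) < \<sigma> * measure (spectral_measure f) UNIV + \<epsilon>"
    by (auto simp: eventually_sequentially)
  \<comment> \<open>truncation of the power series at the radius just chosen\<close>
  let ?T = "\<lambda>M t. \<Sum>k<M. ?c j k * cis (- (real (Suc k) * t))"
  let ?S = "\<Sum>k. cmod (?c j k)"
  have "(\<lambda>M. \<integral>t. (cmod (?B t - ?T M t))\<^sup>2 * exp (L t) \<partial>spectral_measure f) \<longlonglongrightarrow>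
      (\<integral>t. (cmod (?E j t))\<^sup>2 * exp (L t) \<partial>spectral_measure f)"
  proof (rule integral_dominated_convergence[where w="\<lambda>_. (SB + ?S)\<^sup>2 * exp C2"])
    show "AE t in spectral_measure f. (\<lambda>M. (cmod (?B t - ?T M t))\<^sup>2 * exp (L t)) \<longlonglongrightarrow> (cmod (?E j t))\<^sup>2 * exp (L t)"
      using series[of j, unfolded sums_def] by (intro AE_I2 tendsto_intros) auto
    show "AE t in spectral_measure f. norm ((cmod (?B t - ?T M t))\<^sup>2 * exp (L t)) \<le> (SB + ?S)\<^sup>2 * exp C2" for M
    proof (intro AE_I2)
      fix t
      have "cmod (?B t) \<le> SB" unfolding B_eq SB_def by (rule sum_le) simp
      then have "cmod (?B t - ?T M t) \<le> SB + ?S"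
        using norm_triangle_ineq4[of "?B t" "?T M t"] summable_trig(3)[OF dsumm, of j "\<lambda>k. - (real (Suc k) * t)" M] by linarith
      then show "norm ((cmod (?B t - ?T M t))\<^sup>2 * exp (L t)) \<le> (SB + ?S)\<^sup>2 * exp C2"
        using C(2)[of t] by (simp add: abs_mult mult_mono power_mono)
    qed
    show "(\<lambda>t. (cmod (?B t - ?T M t))\<^sup>2 * exp (L t)) \<in> borel_measurable (spectral_measure f)" for M
      unfolding borel_measurable_spectral_measure by measurable
    show "(\<lambda>t. (cmod (?E j t))\<^sup>2 * exp (L t)) \<in> borel_measurable (spectral_measure f)"
      unfolding borel_measurable_spectral_measure by measurable
  qed auto
  then have "\<forall>\<^sub>F M in sequentially. (\<integral>t. (cmod (?B t - ?T M t))\<^sup>2 * exp (L t) \<partial>spectral_measure f) < \<sigma> * measure (spectral_measure f) UNIV + \<epsilon>"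
    using j by (rule order_tendstoD)
  then obtain M where M: "(\<integral>t. (cmod (?B t - ?T M t))\<^sup>2 * exp (L t) \<partial>spectral_measure f) < \<sigma> * measure (spectral_measure f) UNIV + \<epsilon>"
    by (auto simp: eventually_sequentially)
  define c where "c k = ?c j (nat (- k) - 1)" for k :: int
  have "?T M t = past_poly {- int M..-1} c t" for t
  proof -
    have img: "{- int M..-1} = (\<lambda>k. - int (Suc k)) ` {..<M}"
    proof (intro equalityI subsetI)
      fix k :: int assume "k \<in> {- int M..-1}"
      then have "k = - int (Suc (nat (- k) - 1))" "nat (- k) - 1 \<in> {..<M}" by auto
      then show "k \<in> (\<lambda>k. - int (Suc k)) ` {..<M}" by blast
    qed auto
    have inj: "inj_on (\<lambda>k. - int (Suc k)) {..<M}" by (auto simp: inj_on_def)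
    have c: "c (- int (Suc k)) = ?c j k" for k unfolding c_def by (simp only: minus_minus nat_int diff_Suc_1)
    have arg: "of_int (- int (Suc k)) * t = - (real (Suc k) * t)" for k
      by (simp only: of_int_minus of_int_of_nat_eq mult_minus_left)
    show ?thesis unfolding past_poly_def img sum.reindex[OF inj] o_def c arg ..
  qed
  then show ?thesis using M by (intro exI[of _ M] exI[of _ c]) simp
qed

section \<open>Upper bound for the error: arbitrary densities\<close>

text \<open>The free weight \<open>\<theta>\<close> keeps the constant at one of the two terms as close to \<open>1\<close> as desired.\<close>

lemma cmod_add_sq_weighted:
  assumes "\<theta> > 0"
  shows "(cmod (x + y))\<^sup>2 \<le> (1 + \<theta>) * (cmod x)\<^sup>2 + (1 + 1 / \<theta>) * (cmod y)\<^sup>2"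
proof -
  have "(cmod (x + y))\<^sup>2 \<le> (cmod x + cmod y)\<^sup>2" by (intro power_mono norm_triangle_ineq) auto
  also have "\<dots> = (cmod x)\<^sup>2 + (cmod y)\<^sup>2 + 2 * (cmod x * cmod y)" by (simp add: power2_eq_square algebra_simps)
  also have "2 * (cmod x * cmod y) \<le> \<theta> * (cmod x)\<^sup>2 + (1 / \<theta>) * (cmod y)\<^sup>2"
  proof -
    have "0 \<le> (\<theta> * cmod x - cmod y)\<^sup>2 / \<theta>" using assms by simp
    also have "(\<theta> * cmod x - cmod y)\<^sup>2 / \<theta> = \<theta> * (cmod x)\<^sup>2 + (1 / \<theta>) * (cmod y)\<^sup>2 - 2 * (cmod x * cmod y)"
      using assms by (simp add: power2_eq_square field_simps)
    finally show ?thesis by simp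
  qed
  finally show ?thesis by (simp add: algebra_simps)
qed

lemma sqnorm_add_weighted:
  assumes "\<theta> > 0"
  shows "sqnorm N (\<lambda>k. x k + y k) \<le> (1 + \<theta>) * sqnorm N x + (1 + 1 / \<theta>) * sqnorm N y"
  unfolding sqnorm_def sum_distrib_left sum.distrib[symmetric]
  by (intro sum_mono cmod_add_sq_weighted assms)

lemma sqnorm_hankel_le:
  "sqnorm N (hankel N d x) \<le> (\<Sum>k\<le>N. (\<Sum>j\<le>N. cmod (d (k + j)))\<^sup>2) * sqnorm N x"
  unfolding sqnorm_def[of N "hankel N d x"] sum_distrib_right
proof (intro sum_mono)
  fix k
  have x: "cmod (x j) \<le> sqrt (sqnorm N x)" if "j \<le> N" for j
  proof (rule real_le_rsqrt)
    show "(cmod (x j))\<^sup>2 \<le> sqnorm N x" unfolding sqnorm_def using that by (intro member_le_sum) auto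
  qed
  have "cmod (hankel N d x k) \<le> (\<Sum>j\<le>N. cmod (d (k + j)) * sqrt (sqnorm N x))"
    unfolding hankel_def using x by (intro sum_norm_le) (simp add: norm_mult mult_left_mono)
  also have "\<dots> = (\<Sum>j\<le>N. cmod (d (k + j))) * sqrt (sqnorm N x)" by (simp add: sum_distrib_right)
  finally have "(cmod (hankel N d x k))\<^sup>2 \<le> ((\<Sum>j\<le>N. cmod (d (k + j))) * sqrt (sqnorm N x))\<^sup>2"
    by (rule power_mono) simp
  then show "(cmod (hankel N d x k))\<^sup>2 \<le> (\<Sum>j\<le>N. cmod (d (k + j)))\<^sup>2 * sqnorm N x"
    by (simp add: power_mult_distrib)
qed

text \<open>The largest singular value is semicontinuous in the symbol, since \<open>H\<close> depends linearly on it.\<close>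

lemma norm_bound_perturb:
  assumes e: "is_norm_bound N e \<sigma>" and lim: "\<And>p. (\<lambda>k::nat. es k p) \<longlonglongrightarrow> e p"
    and ext: "\<And>k. extremal N (es k) (\<sigma>s k) (x k)" and x: "\<And>k. sqnorm N (x k) > 0" and \<eta>: "\<eta> > 0" and \<sigma>: "0 \<le> \<sigma>"
  shows "\<exists>k. \<sigma>s k \<le> \<sigma> + \<eta>"
proof -
  define \<theta> where "\<theta> = \<eta> / (2 * (\<sigma> + 1))"
  have th: "\<theta> > 0" "\<theta> * \<sigma> \<le> \<eta> / 2" using \<eta> \<sigma> by (auto simp: \<theta>_def field_simps)
  define \<delta> where "\<delta> k = (\<Sum>i\<le>N. (\<Sum>j\<le>N. cmod (es k (i + j) - e (i + j)))\<^sup>2)" for k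
  have "(\<lambda>k. (1 + 1 / \<theta>) * \<delta> k) \<longlonglongrightarrow> (1 + 1 / \<theta>) * (\<Sum>i\<le>N. (\<Sum>j\<le>N. cmod (e (i + j) - e (i + j)))\<^sup>2)"
    unfolding \<delta>_def by (intro tendsto_intros lim)
  then have "\<forall>\<^sub>F k in sequentially. (1 + 1 / \<theta>) * \<delta> k < \<eta> / 2" using \<eta> by (intro order_tendstoD(2)) auto
  then obtain k where k: "(1 + 1 / \<theta>) * \<delta> k < \<eta> / 2" by (auto simp: eventually_sequentially)
  let ?x = "x k"
  have "hankel N (es k) ?x = (\<lambda>i. hankel N e ?x i + hankel N (\<lambda>p. es k p - e p) ?x i)"
    by (simp add: hankel_def fun_eq_iff left_diff_distrib sum_subtractf)
  then have "\<sigma>s k * sqnorm N ?x = sqnorm N (\<lambda>i. hankel N e ?x i + hankel N (\<lambda>p. es k p - e p) ?x i)"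
    using ext[of k] by (simp add: extremal_def)
  also have "\<dots> \<le> (1 + \<theta>) * sqnorm N (hankel N e ?x) + (1 + 1 / \<theta>) * sqnorm N (hankel N (\<lambda>p. es k p - e p) ?x)"
    by (rule sqnorm_add_weighted[OF th(1)])
  also have "\<dots> \<le> (1 + \<theta>) * (\<sigma> * sqnorm N ?x) + (1 + 1 / \<theta>) * (\<delta> k * sqnorm N ?x)"
    using e th(1) sqnorm_hankel_le[of N "\<lambda>p. es k p - e p" ?x]
    by (intro add_mono mult_left_mono) (auto simp: is_norm_bound_def \<delta>_def)
  also have "\<dots> = (\<sigma> + \<theta> * \<sigma> + (1 + 1 / \<theta>) * \<delta> k) * sqnorm N ?x" by (simp add: algebra_simps)
  finally have "\<sigma>s k \<le> \<sigma> + \<theta> * \<sigma> + (1 + 1 / \<theta>) * \<delta> k" using x[of k] by (simp add: mult_le_cancel_right_pos)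
  then have "\<sigma>s k \<le> \<sigma> + \<eta>" using th(2) k by linarith
  then show ?thesis by blast
qed

abbreviation symbol :: "nat \<Rightarrow> nat \<Rightarrow> nat \<Rightarrow> (nat \<Rightarrow> complex) \<Rightarrow> nat \<Rightarrow> complex" where
  "symbol n \<mu> N a \<equiv> hankel_symbol N (b_coeff n \<mu> N a) (w_coeff n \<mu>)"

lemma norm_bound_nonneg: assumes "is_norm_bound N e \<sigma>" shows "0 \<le> \<sigma>"
proof -
  let ?x = "\<lambda>k. if k = 0 then 1 else 0 :: complex"
  have "sqnorm N ?x = 1"
    by (simp add: sqnorm_def if_distrib[of cmod] if_distrib[of "\<lambda>x. x\<^sup>2"] sum.delta cong: if_cong)
  moreover have "sqnorm N (hankel N e ?x) \<le> \<sigma> * sqnorm N ?x" using assms by (simp only: is_norm_bound_def)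
  ultimately have "sqnorm N (hankel N e ?x) \<le> \<sigma>" by (simp only: mult_1_right)
  from order_trans[OF sqnorm_nonneg this] show ?thesis .
qed

lemma error_integrand_bounded:
  assumes "\<mu> > 0"
  shows "\<exists>C. \<forall>t. (cmod (B_poly n \<mu> N a t - past_poly K c t))\<^sup>2 * (cmod (kern n \<mu> t))\<^sup>2 \<le> C"
    and "\<exists>C. \<forall>t. (cmod (B_poly n \<mu> N a t - past_poly K c t))\<^sup>2 * exp (kernel_log_cut n \<mu> k t) \<le> C"
proof -
  let ?D = "(\<Sum>k\<le>N. cmod (b_coeff n \<mu> N a k)) + (\<Sum>k\<in>K. cmod (c k))"
  have D: "cmod (B_poly n \<mu> N a t - past_poly K c t) \<le> ?D" for t
  proof -
    have "cmod (B_poly n \<mu> N a t) \<le> (\<Sum>k\<le>N. cmod (b_coeff n \<mu> N a k))"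
      unfolding B_poly_def by (intro sum_norm_le) (simp add: norm_mult)
    moreover have "cmod (past_poly K c t) \<le> (\<Sum>k\<in>K. cmod (c k))"
      unfolding past_poly_def by (intro sum_norm_le) (simp add: norm_mult)
    ultimately show ?thesis using norm_triangle_ineq4[of "B_poly n \<mu> N a t" "past_poly K c t"] by linarith
  qed
  have D2: "(cmod (B_poly n \<mu> N a t - past_poly K c t))\<^sup>2 \<le> ?D\<^sup>2" for t by (rule power_mono[OF D]) simp
  have k: "(cmod (kern n \<mu> t))\<^sup>2 \<le> (real \<mu> ^ n)\<^sup>2" for t
    using cmod_increment_kernel_le[of n "int \<mu>" t] by (intro power_mono) auto
  show "\<exists>C. \<forall>t. (cmod (B_poly n \<mu> N a t - past_poly K c t))\<^sup>2 * (cmod (kern n \<mu> t))\<^sup>2 \<le> C"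
    by (rule exI[of _ "?D\<^sup>2 * (real \<mu> ^ n)\<^sup>2"]) (intro allI mult_mono[OF D2 k], auto)
  have k': "exp (kernel_log_cut n \<mu> k t) \<le> exp (2 * (real n * ln (real \<mu>)))" for t
    using kernel_log_cut_bounds(2)[OF assms] by simp
  show "\<exists>C. \<forall>t. (cmod (B_poly n \<mu> N a t - past_poly K c t))\<^sup>2 * exp (kernel_log_cut n \<mu> k t) \<le> C"
    by (rule exI[of _ "?D\<^sup>2 * exp (2 * (real n * ln (real \<mu>)))"]) (intro allI mult_mono[OF D2 k'], auto)
qed

lemma integrable_spectral_bounded:
  fixes g :: "real \<Rightarrow> real"
  assumes f: "density_fun f" and m: "g \<in> borel_measurable borel" and "\<exists>C. \<forall>t. g t \<le> C" and nonneg: "\<And>t. 0 \<le> g t"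
  shows "integrable (spectral_measure f) g"
proof -
  interpret finite_measure "spectral_measure f" by (rule finite_spectral_measure[OF f])
  obtain C where "\<And>t. g t \<le> C" using assms(3) by blast
  then show ?thesis using m nonneg by (intro integrable_const_bound[where B=C]) auto
qed

lemma error_integrable:
  assumes "\<mu> > 0" "density_fun f"
  shows "integrable (spectral_measure f) (\<lambda>t. (cmod (B_poly n \<mu> N a t - past_poly K c t))\<^sup>2 * (cmod (kern n \<mu> t))\<^sup>2)"
proof (rule integrable_spectral_bounded[OF assms(2) _ error_integrand_bounded(1)[OF assms(1)]])
  show "(\<lambda>t. (cmod (B_poly n \<mu> N a t - past_poly K c t))\<^sup>2 * (cmod (kern n \<mu> t))\<^sup>2) \<in> borel_measurable borel" by measurable
qed simp

text \<open>Cutting \<open>ln |w\<^sub>\<mu>|\<close> off from below only enlarges the weight, and the Hankel matrix of the cut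
  weight converges to the original one.\<close>

lemma error_upper_bound:
  assumes mu: "\<mu> > 0" and f: "density_fun f" and bound: "is_norm_bound N (symbol n \<mu> N a) \<sigma>" and eps: "\<epsilon> > 0"
  shows "\<exists>K c. finite K \<and> K \<subseteq> {..-1} \<and>
    (\<integral>t. (cmod (B_poly n \<mu> N a t - past_poly K c t))\<^sup>2 * (cmod (kern n \<mu> t))\<^sup>2 \<partial>spectral_measure f) \<le>
      \<sigma> * measure (spectral_measure f) UNIV + \<epsilon>"
proof -
  let ?m = "measure (spectral_measure f) UNIV"
  have m0: "0 \<le> ?m" by simp
  define m1 where "m1 = ?m + 1"
  have m1: "m1 > 0" "?m \<le> m1" using m0 by (auto simp: m1_def add_nonneg_pos)
  define \<eta> where "\<eta> = \<epsilon> / (2 * m1)"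
  have eta: "\<eta> > 0" "\<eta> * ?m \<le> \<epsilon> / 2"
  proof -
    show "\<eta> > 0" using eps m1 by (simp add: \<eta>_def)
    have "\<eta> * ?m \<le> \<eta> * m1" using \<open>\<eta> > 0\<close> m1(2) by (intro mult_left_mono) auto
    also have "\<dots> = \<epsilon> / 2" using m1(1) by (simp add: \<eta>_def)
    finally show "\<eta> * ?m \<le> \<epsilon> / 2" .
  qed
  let ?es = "\<lambda>k. hankel_symbol N (b_coeff n \<mu> N a) (outer_coeff (kernel_log_cut n \<mu> k))"
  have "\<forall>k. \<exists>\<sigma>k p. is_norm_bound N (?es k) \<sigma>k \<and> extremal N (?es k) \<sigma>k (coeff p) \<and> degree p \<le> N \<and>
      (\<forall>z. cmod z \<le> 1 \<longrightarrow> poly p z \<noteq> 0)"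
  proof
    fix k
    have "?es k p = 0" if "p > N" for p using that by (rule hankel_symbol_beyond)
    from extremal_zero_free[of N "?es k", OF this] show "\<exists>\<sigma>k p. is_norm_bound N (?es k) \<sigma>k \<and>
        extremal N (?es k) \<sigma>k (coeff p) \<and> degree p \<le> N \<and> (\<forall>z. cmod z \<le> 1 \<longrightarrow> poly p z \<noteq> 0)" by blast
  qed
  then obtain \<sigma>s ps where ps: "\<And>k. is_norm_bound N (?es k) (\<sigma>s k)" "\<And>k. extremal N (?es k) (\<sigma>s k) (coeff (ps k))"
    "\<And>k. degree (ps k) \<le> N" "\<And>k z. cmod z \<le> 1 \<Longrightarrow> poly (ps k) z \<noteq> 0" by metis
  have pos: "sqnorm N (coeff (ps k)) > 0" for k
  proof -
    have "coeff (ps k) 0 \<noteq> 0" using ps(4)[of 0 k] by (simp add: poly_0_coeff_0)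
    then have "sqnorm N (coeff (ps k)) \<noteq> 0" by (auto simp: sqnorm_eq_0)
    then show ?thesis using sqnorm_nonneg[of N "coeff (ps k)"] by linarith
  qed
  have lim: "(\<lambda>k. ?es k p) \<longlonglongrightarrow> symbol n \<mu> N a p" for p
    unfolding hankel_symbol_def
  proof (intro tendsto_sum)
    fix i show "(\<lambda>k. if p + i \<le> N then b_coeff n \<mu> N a (p + i) * outer_coeff (kernel_log_cut n \<mu> k) i else 0) \<longlonglongrightarrow>
        (if p + i \<le> N then b_coeff n \<mu> N a (p + i) * w_coeff n \<mu> i else 0)"
      using tendsto_mult[OF tendsto_const outer_coeff_cut_tendsto[OF mu]] by simp
  qed
  obtain k where k: "\<sigma>s k \<le> \<sigma> + \<eta>"
    using norm_bound_perturb[OF bound lim ps(2) pos eta(1) norm_bound_nonneg[OF bound]] by blast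
  let ?L = "kernel_log_cut n \<mu> k"
  have "?L \<in> borel_measurable borel" unfolding kernel_log_cut_def[abs_def] by measurable
  moreover have "isCont ?L (- t) \<and> ?L (- t) = ?L t" if "regular_point n \<mu> t" for t
    using kernel_log_cut_isCont[OF regular_point_uminus[OF that]] kernel_log_cut_even by simp
  moreover have "\<epsilon> / 2 > 0" using eps by simp
  ultimately obtain M c where M: "(\<integral>t. (cmod (B_poly n \<mu> N a t - past_poly {- int M..-1} c t))\<^sup>2 * exp (?L t) \<partial>spectral_measure f) \<le>
      \<sigma>s k * ?m + \<epsilon> / 2"
    using error_upper_bound_regular[OF mu f kernel_log_cut_integrable[OF mu] kernel_log_cut_bounds[OF mu] _ _ ps(1) ps(2) ps(3) ps(4)]
    by blast
  let ?K = "{- int M..-1}"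
  have "(\<integral>t. (cmod (B_poly n \<mu> N a t - past_poly ?K c t))\<^sup>2 * (cmod (kern n \<mu> t))\<^sup>2 \<partial>spectral_measure f) \<le>
      (\<integral>t. (cmod (B_poly n \<mu> N a t - past_poly ?K c t))\<^sup>2 * exp (?L t) \<partial>spectral_measure f)"
  proof (rule integral_mono_AE)
    show "integrable (spectral_measure f) (\<lambda>t. (cmod (B_poly n \<mu> N a t - past_poly ?K c t))\<^sup>2 * (cmod (kern n \<mu> t))\<^sup>2)"
      by (rule error_integrable[OF mu f])
    show "integrable (spectral_measure f) (\<lambda>t. (cmod (B_poly n \<mu> N a t - past_poly ?K c t))\<^sup>2 * exp (?L t))"
    proof (rule integrable_spectral_bounded[OF f _ error_integrand_bounded(2)[OF mu]])
      show "(\<lambda>t. (cmod (B_poly n \<mu> N a t - past_poly ?K c t))\<^sup>2 * exp (?L t)) \<in> borel_measurable borel"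
        unfolding kernel_log_cut_def by measurable
    qed simp
    show "AE t in spectral_measure f. (cmod (B_poly n \<mu> N a t - past_poly ?K c t))\<^sup>2 * (cmod (kern n \<mu> t))\<^sup>2 \<le>
        (cmod (B_poly n \<mu> N a t - past_poly ?K c t))\<^sup>2 * exp (?L t)"
      using AE_regular_point[OF mu f, of n]
    proof eventually_elim
      case (elim t)
      have "(cmod (kern n \<mu> t))\<^sup>2 = exp (kernel_log n \<mu> t)"
        unfolding exp_kernel_log[OF elim, symmetric] by (simp flip: exp_double)
      also have "\<dots> \<le> exp (?L t)" by (simp add: kernel_log_cut_def)
      finally show ?case by (intro mult_left_mono) auto
    qed
  qed
  also note M
  also have "\<sigma>s k * ?m + \<epsilon> / 2 \<le> \<sigma> * ?m + \<epsilon>"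
    using mult_right_mono[OF k m0] eta(2) by (simp add: distrib_right)
  finally show ?thesis by (intro exI[of _ ?K] exI[of _ c]) auto
qed

lemma past_poly_kernel:
  "(\<Sum>k\<in>K. c k * (cis (of_int k * t) * increment_kernel n \<mu> t)) = past_poly K c t * increment_kernel n \<mu> t"
  by (simp add: past_poly_def sum_distrib_right mult.assoc)

lemma spectral_sqdist_self [simp]: "spectral_sqdist f g g = 0"
  by (simp add: spectral_sqdist_def)

lemma past_poly_characteristic:
  assumes "finite K" "K \<subseteq> {..-1}" shows "spectral_characteristic n \<mu> f (past_poly K c)"
proof -
  have "(\<lambda>t. past_poly K c t * kern n \<mu> t) \<in> borel_measurable borel" by measurable
  then show ?thesis unfolding spectral_characteristic_def L2_minus_def past_poly_kernel
    using assms by (auto intro!: exI[of _ K] exI[of _ c])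
qed

lemma optimal_error_le:
  assumes mu: "\<mu> > 0" and f: "density_fun f" and bound: "is_norm_bound N (symbol n \<mu> N a) \<sigma>"
    and h: "optimal_characteristic n \<mu> N a f h"
  shows "mean_square_error n \<mu> N a h f \<le> \<sigma> * (measure (spectral_measure f) UNIV / (2 * pi))"
proof (rule field_le_epsilon)
  fix \<epsilon> :: real assume eps: "0 < \<epsilon>"
  then have "0 < 2 * pi * \<epsilon>" by simp
  from error_upper_bound[OF mu f bound this] obtain K c where K: "finite K" "K \<subseteq> {..-1}"
    and le: "(\<integral>t. (cmod (B_poly n \<mu> N a t - past_poly K c t))\<^sup>2 * (cmod (kern n \<mu> t))\<^sup>2 \<partial>spectral_measure f) \<le>
      \<sigma> * measure (spectral_measure f) UNIV + 2 * pi * \<epsilon>" by blast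
  have char: "spectral_characteristic n \<mu> f (past_poly K c)" by (rule past_poly_characteristic[OF K])
  have "mean_square_error n \<mu> N a h f \<le> mean_square_error n \<mu> N a (past_poly K c) f"
    using h char by (simp add: optimal_characteristic_def)
  also have "\<dots> = 1 / (2 * pi) * (\<integral>t. (cmod (B_poly n \<mu> N a t - past_poly K c t))\<^sup>2 * (cmod (kern n \<mu> t))\<^sup>2 \<partial>spectral_measure f)"
    unfolding mean_square_error_eq[OF mu f char] left_diff_distrib[symmetric] norm_mult power_mult_distrib ..
  also have "\<dots> \<le> 1 / (2 * pi) * (\<sigma> * measure (spectral_measure f) UNIV + 2 * pi * \<epsilon>)"
    by (intro mult_left_mono le) auto
  also have "\<dots> = \<sigma> * (measure (spectral_measure f) UNIV / (2 * pi)) + \<epsilon>" by (simp add: field_simps)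
  finally show "mean_square_error n \<mu> N a h f \<le> \<sigma> * (measure (spectral_measure f) UNIV / (2 * pi)) + \<epsilon>" .
qed

definition poly_density :: "complex poly \<Rightarrow> real \<Rightarrow> real" where
  "poly_density \<phi> t = (cmod (poly \<phi> (cis (- t))))\<^sup>2"

lemma poly_cis_measurable [measurable]: "(\<lambda>t. poly \<phi> (cis (- t))) \<in> borel_measurable borel" for \<phi> :: "complex poly"
  unfolding poly_altdef by measurable

lemma poly_cis_bounded: "\<exists>C. \<forall>t. cmod (poly \<phi> (cis (- t))) \<le> C" for \<phi> :: "complex poly"
  using poly_bounded_cball[of 1 \<phi>] by (metis norm_cis order_refl)

lemma poly_density_measurable [measurable]: "poly_density \<phi> \<in> borel_measurable borel"
  unfolding poly_density_def[abs_def] by measurable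

lemma poly_density_density_fun: "density_fun (poly_density \<phi>)"
proof -
  obtain C where C: "\<And>t. cmod (poly \<phi> (cis (- t))) \<le> C" using poly_cis_bounded by blast
  have "integrable circ (poly_density \<phi>)"
    using power_mono[OF C norm_ge_zero, where n=2]
    by (intro integrable_circ_bounded[where C="C\<^sup>2"]) (auto simp: poly_density_def)
  then have "integrable lborel (\<lambda>t. indicator {-pi..pi} t *\<^sub>R poly_density \<phi> t)"
    by (subst (asm) integrable_spectral_measure[OF density_fun_one]) auto
  then show ?thesis by (simp add: density_fun_def set_integrable_def poly_density_def)
qed

lemma integral_spectral_circ:
  fixes g :: "real \<Rightarrow> 'b::{banach, second_countable_topology}"
  assumes f: "density_fun f" "f \<in> borel_measurable borel" and g: "g \<in> borel_measurable borel"
  shows "(\<integral>t. g t \<partial>spectral_measure f) = (\<integral>t. f t *\<^sub>R g t \<partial>circ)"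
proof -
  have "(\<lambda>t. f t *\<^sub>R g t) \<in> borel_measurable borel" using f(2) g by measurable
  then show ?thesis
    unfolding integral_spectral_measure[OF f(1) g] by (subst integral_spectral_measure[OF density_fun_one]) auto
qed

lemma integral_poly_density:
  assumes "degree \<phi> \<le> N" shows "(\<integral>t. poly_density \<phi> t \<partial>circ) = 2 * pi * sqnorm N (coeff \<phi>)"
proof -
  have "poly \<phi> (cis (- t)) = (\<Sum>k\<le>N. coeff \<phi> k * cis (- (real k * t)))" for t
    by (simp add: poly_eq_sum_atMost[OF assms] Complex.DeMoivre)
  then show ?thesis using Parseval_nat(2)[of "{..N}" "coeff \<phi>"] by (simp add: poly_density_def sqnorm_def)
qed

lemma mass_poly_density:
  assumes "degree \<phi> \<le> N" shows "measure (spectral_measure (poly_density \<phi>)) UNIV = 2 * pi * sqnorm N (coeff \<phi>)"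
proof -
  interpret finite_measure "spectral_measure (poly_density \<phi>)"
    by (rule finite_spectral_measure[OF poly_density_density_fun])
  have "measure (spectral_measure (poly_density \<phi>)) UNIV = (\<integral>t. 1 \<partial>spectral_measure (poly_density \<phi>))" by simp
  also have "\<dots> = (\<integral>t. poly_density \<phi> t *\<^sub>R 1 \<partial>circ)"
    by (rule integral_spectral_circ[OF poly_density_density_fun]) auto
  finally show ?thesis by (simp add: integral_poly_density[OF assms])
qed

lemma error_lower_bound_density:
  assumes mu: "\<mu> > 0" and K: "finite K" "K \<subseteq> {..-1}" and deg: "degree \<phi> \<le> N"
  shows "2 * pi * sqnorm N (hankel N (symbol n \<mu> N a) (coeff \<phi>)) \<le>
    (\<integral>t. (cmod (B_poly n \<mu> N a t - past_poly K c t))\<^sup>2 * (cmod (kern n \<mu> t))\<^sup>2 \<partial>spectral_measure (poly_density \<phi>))"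
proof -
  have "(\<integral>t. (cmod (B_poly n \<mu> N a t - past_poly K c t))\<^sup>2 * (cmod (kern n \<mu> t))\<^sup>2 \<partial>spectral_measure (poly_density \<phi>)) =
    (\<integral>t. poly_density \<phi> t *\<^sub>R ((cmod (B_poly n \<mu> N a t - past_poly K c t))\<^sup>2 * (cmod (kern n \<mu> t))\<^sup>2) \<partial>circ)"
    by (rule integral_spectral_circ[OF poly_density_density_fun]) auto
  also have "\<dots> = (\<integral>t. (cmod (B_poly n \<mu> N a t - past_poly K c t))\<^sup>2 * (cmod (kern n \<mu> t))\<^sup>2 * (cmod (poly \<phi> (cis (- t))))\<^sup>2 \<partial>circ)"
    by (simp add: poly_density_def mult_ac)
  finally show ?thesis using error_lower_bound[OF mu K deg, of n a c] by simp
qed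

section \<open>Optimal characteristics and least favorable densities\<close>

lemma AE_kern_nonzero:
  assumes "\<mu> > 0" "density_fun f" shows "AE t in spectral_measure f. kern n \<mu> t \<noteq> 0"
  using AE_regular_point[OF assms, of n] by eventually_elim (simp add: regular_point_def)

lemma B_kern_square_integrable:
  assumes "density_fun f" shows "square_integrable (spectral_measure f) (\<lambda>t. B_poly n \<mu> N a t * kern n \<mu> t)"
proof -
  have "square_integrable (spectral_measure f)
      (\<lambda>t. \<Sum>k\<in>int ` {..N}. b_coeff n \<mu> N a (nat k) * (cis (of_int k * t) * kern n \<mu> t))"
    by (rule trig_kernel_square_integrable[OF assms])
  then show ?thesis by (simp add: sum.reindex B_poly_def sum_distrib_right mult.assoc)
qed

lemma past_kern_square_integrable:
  assumes "density_fun f" shows "square_integrable (spectral_measure f) (\<lambda>t. past_poly K c t * kern n \<mu> t)"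
  using trig_kernel_square_integrable[OF assms, where K=K and c=c and n=n and \<mu>="int \<mu>"] by (simp only: past_poly_kernel)

text \<open>Every admissible estimate is a limit of estimates by finitely many past increments, so the
  lower bound carries over.\<close>

lemma mean_square_error_lower_bound:
  assumes mu: "\<mu> > 0" and deg: "degree \<phi> \<le> N" and h: "spectral_characteristic n \<mu> (poly_density \<phi>) h"
  shows "sqnorm N (hankel N (symbol n \<mu> N a) (coeff \<phi>)) \<le> mean_square_error n \<mu> N a h (poly_density \<phi>)"
proof -
  note f = poly_density_density_fun[of \<phi>]
  let ?\<nu> = "spectral_measure (poly_density \<phi>)"
  let ?Bk = "\<lambda>t. B_poly n \<mu> N a t * kern n \<mu> t" and ?hk = "\<lambda>t. h t * kern n \<mu> t"
  let ?S = "2 * pi * sqnorm N (hankel N (symbol n \<mu> N a) (coeff \<phi>))"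
  note hk = spectral_characteristic_square_integrable[OF f h] and Bk = B_kern_square_integrable[OF f, of n \<mu> N a]
  define I where "I = (\<integral>t. (cmod (?Bk t - ?hk t))\<^sup>2 \<partial>?\<nu>)"
  have I0: "0 \<le> I" by (simp add: I_def)
  have mhk: "?hk \<in> borel_measurable borel" using hk by (simp add: square_integrable_def)
  have "?S \<le> I + \<eta>" if eta: "\<eta> > 0" for \<eta>
  proof -
    define \<theta> where "\<theta> = \<eta> / (2 * (I + 1))"
    have th: "\<theta> > 0" "\<theta> * I \<le> \<eta> / 2" using eta I0 by (auto simp: \<theta>_def field_simps)
    define \<delta> where "\<delta> = \<eta> / (2 * (1 + 1 / \<theta>))"
    have del: "\<delta> > 0" "(1 + 1 / \<theta>) * \<delta> = \<eta> / 2"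
    proof -
      define q where "q = 1 + 1 / \<theta>"
      have "q > 0" using th(1) by (simp add: q_def add_pos_pos)
      then show "\<delta> > 0" "(1 + 1 / \<theta>) * \<delta> = \<eta> / 2"
        using eta unfolding \<delta>_def q_def[symmetric] by simp_all
    qed
    have "ennreal \<delta> > 0" using del(1) by simp
    then have "\<exists>(K :: int set) c. finite K \<and> K \<subseteq> {..-1} \<and>
        spectral_sqdist (poly_density \<phi>) ?hk (\<lambda>t. past_poly K c t * kern n \<mu> t) < ennreal \<delta>"
      using h unfolding spectral_characteristic_def L2_minus_def past_poly_kernel by blast
    then obtain K :: "int set" and c where K: "finite K" "K \<subseteq> {..-1}"
      and close: "spectral_sqdist (poly_density \<phi>) ?hk (\<lambda>t. past_poly K c t * kern n \<mu> t) < ennreal \<delta>" by blast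
    let ?pk = "\<lambda>t. past_poly K c t * kern n \<mu> t"
    note pk = past_kern_square_integrable[OF f, of K c n \<mu>]
    have mpk: "?pk \<in> borel_measurable borel" by measurable
    have close': "(\<integral>t. (cmod (?hk t - ?pk t))\<^sup>2 \<partial>?\<nu>) \<le> \<delta>"
    proof -
      have "ennreal (\<integral>t. (cmod (?hk t - ?pk t))\<^sup>2 \<partial>?\<nu>) < ennreal \<delta>"
        using close unfolding spectral_sqdist_eq_mean_sqdist[OF f mhk mpk]
          mean_sqdist_eq_integral[OF square_integrable_diff[OF hk pk]] .
      then show ?thesis using del(1) by (simp add: ennreal_less_iff)
    qed
    have "?S \<le> (\<integral>t. (cmod (B_poly n \<mu> N a t - past_poly K c t))\<^sup>2 * (cmod (kern n \<mu> t))\<^sup>2 \<partial>?\<nu>)"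
      by (rule error_lower_bound_density[OF mu K deg])
    also have "\<dots> = (\<integral>t. (cmod ((?Bk t - ?hk t) + (?hk t - ?pk t)))\<^sup>2 \<partial>?\<nu>)"
      by (intro Bochner_Integration.integral_cong refl) (simp add: left_diff_distrib flip: norm_mult power_mult_distrib)
    also have "\<dots> \<le> (\<integral>t. (1 + \<theta>) * (cmod (?Bk t - ?hk t))\<^sup>2 + (1 + 1 / \<theta>) * (cmod (?hk t - ?pk t))\<^sup>2 \<partial>?\<nu>)"
    proof (rule integral_mono)
      show "integrable ?\<nu> (\<lambda>t. (cmod ((?Bk t - ?hk t) + (?hk t - ?pk t)))\<^sup>2)"
        using square_integrable_add[OF square_integrable_diff[OF Bk hk] square_integrable_diff[OF hk pk]]
        by (simp only: square_integrable_def)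
      show "integrable ?\<nu> (\<lambda>t. (1 + \<theta>) * (cmod (?Bk t - ?hk t))\<^sup>2 + (1 + 1 / \<theta>) * (cmod (?hk t - ?pk t))\<^sup>2)"
        using square_integrable_diff[OF Bk hk] square_integrable_diff[OF hk pk]
        by (intro Bochner_Integration.integrable_add integrable_mult_right) (simp_all only: square_integrable_def)
      show "(cmod ((?Bk t - ?hk t) + (?hk t - ?pk t)))\<^sup>2 \<le> (1 + \<theta>) * (cmod (?Bk t - ?hk t))\<^sup>2 + (1 + 1 / \<theta>) * (cmod (?hk t - ?pk t))\<^sup>2" for t
        by (rule cmod_add_sq_weighted[OF th(1)])
    qed
    also have "\<dots> = (1 + \<theta>) * I + (1 + 1 / \<theta>) * (\<integral>t. (cmod (?hk t - ?pk t))\<^sup>2 \<partial>?\<nu>)"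
      unfolding I_def using square_integrable_diff[OF Bk hk] square_integrable_diff[OF hk pk]
      by (subst Bochner_Integration.integral_add) (auto simp: square_integrable_def)
    also have "\<dots> \<le> (1 + \<theta>) * I + (1 + 1 / \<theta>) * \<delta>"
      using close' th(1) by (intro add_left_mono mult_left_mono) auto
    also have "\<dots> \<le> I + \<eta>" using th(2) unfolding del(2) by (simp add: distrib_right)
    finally show ?thesis .
  qed
  then have "?S \<le> I" by (rule field_le_epsilon)
  then have "1 / (2 * pi) * ?S \<le> 1 / (2 * pi) * I" by (intro mult_left_mono) auto
  then show ?thesis unfolding mean_square_error_eq[OF mu f h] I_def by simp
qed

text \<open>For an extremal \<open>\<phi>\<close> the two bounds agree.  Estimates whose errors approach the common value
  are then a Cauchy sequence, by the parallelogram law, and their limit is optimal.\<close>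

lemma optimal_characteristic_exists:
  assumes mu: "\<mu> > 0" and bound: "is_norm_bound N (symbol n \<mu> N a) \<sigma>" and ext: "extremal N (symbol n \<mu> N a) \<sigma> (coeff \<phi>)"
    and deg: "degree \<phi> \<le> N"
  shows "\<exists>h. optimal_characteristic n \<mu> N a (poly_density \<phi>) h \<and>
    mean_square_error n \<mu> N a h (poly_density \<phi>) = \<sigma> * sqnorm N (coeff \<phi>)"
proof -
  note f = poly_density_density_fun[of \<phi>]
  let ?\<nu> = "spectral_measure (poly_density \<phi>)"
  let ?B = "B_poly n \<mu> N a" and ?k = "kern n \<mu>"
  define d where "d = 2 * pi * (\<sigma> * sqnorm N (coeff \<phi>))"
  note Bk = B_kern_square_integrable[OF f, of n \<mu> N a]
  note pk = past_kern_square_integrable[OF f, of _ _ n \<mu>]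
  define J where "J K c = (\<integral>t. (cmod (?B t * ?k t - past_poly K c t * ?k t))\<^sup>2 \<partial>?\<nu>)" for K c
  have J_eq: "J K c = (\<integral>t. (cmod (?B t - past_poly K c t))\<^sup>2 * (cmod (?k t))\<^sup>2 \<partial>?\<nu>)" for K c
    unfolding J_def left_diff_distrib[symmetric] norm_mult power_mult_distrib ..
  have lower: "d \<le> J K c" if "finite K" "K \<subseteq> {..-1}" for K c
    using error_lower_bound_density[OF mu that deg, of n a c] ext by (simp add: J_eq d_def extremal_def)
  have "\<exists>K c. finite K \<and> K \<subseteq> {..-1} \<and> J K c \<le> d + 1 / real (Suc j)" for j
    using error_upper_bound[OF mu f bound, of "1 / real (Suc j)"]
    unfolding J_eq[symmetric] mass_poly_density[OF deg] by (simp add: d_def mult_ac)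
  then obtain Ks cs where K: "\<And>j. finite (Ks j)" "\<And>j. Ks j \<subseteq> {..-1}" and upper: "\<And>j. J (Ks j) (cs j) \<le> d + 1 / real (Suc j)"
    by metis
  let ?p = "\<lambda>j t. past_poly (Ks j) (cs j) t * ?k t"
  have parallelogram: "(\<integral>t. (cmod (?p i t - ?p j t))\<^sup>2 \<partial>?\<nu>) \<le> 2 / real (Suc i) + 2 / real (Suc j)" for i j
  proof -
    define c where "c k = ((if k \<in> Ks i then cs i k else 0) + (if k \<in> Ks j then cs j k else 0)) / 2" for k
    have mid: "past_poly (Ks i \<union> Ks j) c t = (past_poly (Ks i) (cs i) t + past_poly (Ks j) (cs j) t) / 2" for t
    proof -
      have "past_poly (Ks i) (cs i) t = (\<Sum>k\<in>Ks i \<union> Ks j. (if k \<in> Ks i then cs i k else 0) * cis (of_int k * t))"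
        unfolding past_poly_def using K by (intro sum.mono_neutral_cong_left) auto
      moreover have "past_poly (Ks j) (cs j) t = (\<Sum>k\<in>Ks i \<union> Ks j. (if k \<in> Ks j then cs j k else 0) * cis (of_int k * t))"
        unfolding past_poly_def using K by (intro sum.mono_neutral_cong_left) auto
      ultimately show ?thesis
        unfolding past_poly_def[of "Ks i \<union> Ks j"] c_def
        by (simp add: sum.distrib[symmetric] sum_divide_distrib add_divide_distrib distrib_right)
    qed
    let ?Ei = "\<lambda>t. ?B t * ?k t - ?p i t" and ?Ej = "\<lambda>t. ?B t * ?k t - ?p j t"
      and ?M = "\<lambda>t. ?B t * ?k t - past_poly (Ks i \<union> Ks j) c t * ?k t"
    have par: "(cmod (?p i t - ?p j t))\<^sup>2 = 2 * (cmod (?Ei t))\<^sup>2 + 2 * (cmod (?Ej t))\<^sup>2 - 4 * (cmod (?M t))\<^sup>2" for t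
    proof -
      have law: "(cmod (y - x))\<^sup>2 = 2 * (cmod x)\<^sup>2 + 2 * (cmod y)\<^sup>2 - 4 * (cmod ((x + y) / 2))\<^sup>2" for x y
      proof -
        have q: "4 * (cmod ((x + y) / 2))\<^sup>2 = (cmod (x + y))\<^sup>2" by (simp add: norm_divide power_divide)
        show ?thesis unfolding q unfolding cmod_power2 by (simp add: power2_eq_square algebra_simps)
      qed
      have M: "?M t = (?Ei t + ?Ej t) / 2" unfolding mid by (simp add: field_simps)
      have D: "?p i t - ?p j t = ?Ej t - ?Ei t" by simp
      show ?thesis unfolding M D by (rule law)
    qed
    have sq: "square_integrable ?\<nu> ?Ei" "square_integrable ?\<nu> ?Ej" "square_integrable ?\<nu> ?M"
      by (intro square_integrable_diff Bk pk)+
    have "(\<integral>t. (cmod (?p i t - ?p j t))\<^sup>2 \<partial>?\<nu>) = 2 * J (Ks i) (cs i) + 2 * J (Ks j) (cs j) - 4 * J (Ks i \<union> Ks j) c"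
      unfolding par J_def using sq
      by (subst Bochner_Integration.integral_diff, force simp: square_integrable_def, force simp: square_integrable_def)
        (subst Bochner_Integration.integral_add, auto simp: square_integrable_def)
    moreover have "d \<le> J (Ks i \<union> Ks j) c" using K by (intro lower) auto
    ultimately show ?thesis using upper[of i] upper[of j] by simp
  qed
  have Cauchy: "\<exists>m. \<forall>i\<ge>m. \<forall>j\<ge>m. (\<integral>t. (cmod (?p i t - ?p j t))\<^sup>2 \<partial>?\<nu>) \<le> e" if e: "e > 0" for e
  proof -
    obtain m where m: "inverse (real (Suc m)) < e / 4" using reals_Archimedean[of "e / 4"] e by auto
    have "(\<integral>t. (cmod (?p i t - ?p j t))\<^sup>2 \<partial>?\<nu>) \<le> e" if "i \<ge> m" "j \<ge> m" for i j
    proof -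
      have "1 / real (Suc i) \<le> inverse (real (Suc m))" "1 / real (Suc j) \<le> inverse (real (Suc m))"
        using that by (simp_all add: inverse_eq_divide frac_le)
      then show ?thesis using parallelogram[of i j] m by linarith
    qed
    then show ?thesis by blast
  qed
  obtain g where g: "square_integrable ?\<nu> g" and lim: "(\<lambda>j. mean_sqdist ?\<nu> g (?p j)) \<longlonglongrightarrow> 0"
    using L2_complete[OF pk Cauchy] by blast
  have mg[measurable]: "g \<in> borel_measurable borel" using g by (simp add: square_integrable_def)
  define h where "h t = g t / ?k t" for t
  have hk: "AE t in ?\<nu>. h t * ?k t = g t"
    using AE_kern_nonzero[OF mu f, of n] by eventually_elim (simp add: h_def)
  have mh: "(\<lambda>t. h t * ?k t) \<in> borel_measurable borel" unfolding h_def by measurable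
  have char: "spectral_characteristic n \<mu> (poly_density \<phi>) h"
    unfolding spectral_characteristic_def L2_minus_def past_poly_kernel
  proof (intro CollectI conjI mh allI impI)
    fix e :: ennreal assume "0 < e"
    then have "\<forall>\<^sub>F j in sequentially. mean_sqdist ?\<nu> g (?p j) < e" using lim by (intro order_tendstoD)
    then obtain j where "mean_sqdist ?\<nu> g (?p j) < e" by (auto simp: eventually_sequentially)
    moreover have "mean_sqdist ?\<nu> (\<lambda>t. h t * ?k t) (?p j) = mean_sqdist ?\<nu> g (?p j)"
      unfolding mean_sqdist_def using hk by (intro nn_integral_cong_AE, eventually_elim) simp
    moreover have "?p j \<in> borel_measurable borel" by measurable
    ultimately have "spectral_sqdist (poly_density \<phi>) (\<lambda>t. h t * ?k t) (?p j) < e"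
      by (simp add: spectral_sqdist_eq_mean_sqdist[OF f mh])
    then show "\<exists>(K :: int set) c. finite K \<and> K \<subseteq> {..-1} \<and>
        spectral_sqdist (poly_density \<phi>) (\<lambda>t. h t * ?k t) (\<lambda>t. past_poly K c t * ?k t) < e"
      using K by blast
  qed
  have mse: "mean_square_error n \<mu> N a h (poly_density \<phi>) = 1 / (2 * pi) * (\<integral>t. (cmod (?B t * ?k t - g t))\<^sup>2 \<partial>?\<nu>)"
    unfolding mean_square_error_eq[OF mu f char]
    using hk mh by (intro arg_cong2[where f="(*)"] refl Bochner_Integration.integral_cong_AE)
      (auto elim!: eventually_mono)
  have le_d: "(\<integral>t. (cmod (?B t * ?k t - g t))\<^sup>2 \<partial>?\<nu>) \<le> d"
  proof -
    let ?X = "\<lambda>t. ?B t * ?k t - g t" and ?Xs = "\<lambda>j t. ?B t * ?k t - ?p j t"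
    have "mean_sqdist ?\<nu> ?X (?Xs j) = mean_sqdist ?\<nu> g (?p j)" for j
      unfolding mean_sqdist_def by (simp add: norm_minus_commute)
    then have limX: "(\<lambda>j. mean_sqdist ?\<nu> ?X (?Xs j)) \<longlonglongrightarrow> 0" using lim by simp
    have "(\<lambda>j. \<integral>t. ?Xs j t * cnj (?Xs j t) \<partial>?\<nu>) \<longlonglongrightarrow> (\<integral>t. ?X t * cnj (?X t) \<partial>?\<nu>)"
      by (intro tendsto_L2_inner square_integrable_diff Bk g pk limX)
    then have "(\<lambda>j. J (Ks j) (cs j)) \<longlonglongrightarrow> (\<integral>t. (cmod (?X t))\<^sup>2 \<partial>?\<nu>)"
      unfolding integral_cmod_sq_eq[symmetric] J_def by (subst (asm) tendsto_of_real_iff)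
    moreover have "(\<lambda>j. d + 1 / real (Suc j)) \<longlonglongrightarrow> d + 0"
      by (intro tendsto_intros LIMSEQ_Suc[OF lim_1_over_n])
    ultimately show ?thesis using LIMSEQ_le[of _ _ "\<lambda>j. d + 1 / real (Suc j)" "d + 0"] upper by fastforce
  qed
  have le: "mean_square_error n \<mu> N a h (poly_density \<phi>) \<le> \<sigma> * sqnorm N (coeff \<phi>)"
  proof -
    have "1 / (2 * pi) * (\<integral>t. (cmod (?B t * ?k t - g t))\<^sup>2 \<partial>?\<nu>) \<le> 1 / (2 * pi) * d"
      by (intro mult_left_mono le_d) simp
    also have "\<dots> = \<sigma> * sqnorm N (coeff \<phi>)" by (simp add: d_def)
    finally show ?thesis unfolding mse .
  qed
  have ge: "\<sigma> * sqnorm N (coeff \<phi>) \<le> mean_square_error n \<mu> N a h' (poly_density \<phi>)"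
    if "spectral_characteristic n \<mu> (poly_density \<phi>) h'" for h'
    using mean_square_error_lower_bound[OF mu deg that, of a] ext by (simp add: extremal_def)
  have "optimal_characteristic n \<mu> N a (poly_density \<phi>) h"
    unfolding optimal_characteristic_def using char le ge by (meson order_trans)
  with le ge[OF char] show ?thesis by (intro exI[of _ h]) simp
qed

lemma poly_density_in_D0:
  assumes "degree \<phi> \<le> N" shows "poly_density \<phi> \<in> D0 P0 \<longleftrightarrow> sqnorm N (coeff \<phi>) \<le> P0"
  using integral_poly_density[OF assms] integral_circ[OF poly_density_measurable[of \<phi>]]
  by (simp add: D0_def poly_density_density_fun)

theorem extremal_least_favorable:
  assumes mu: "\<mu> > 0" and bound: "is_norm_bound N (symbol n \<mu> N a) \<sigma>" and ext: "extremal N (symbol n \<mu> N a) \<sigma> (coeff \<phi>)"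
    and deg: "degree \<phi> \<le> N" and P0: "sqnorm N (coeff \<phi>) = P0"
  shows "least_favorable n \<mu> N a (D0 P0) (poly_density \<phi>)"
proof -
  obtain h0 where h0: "optimal_characteristic n \<mu> N a (poly_density \<phi>) h0"
      "mean_square_error n \<mu> N a h0 (poly_density \<phi>) = \<sigma> * P0"
    using optimal_characteristic_exists[OF mu bound ext deg] P0 by blast
  have "mean_square_error n \<mu> N a h f \<le> \<sigma> * P0" if f: "f \<in> D0 P0" and h: "optimal_characteristic n \<mu> N a f h" for f h
  proof -
    have df: "density_fun f" and le: "1 / (2 * pi) * (LINT t:{-pi..pi}|lborel. f t) \<le> P0"
      using f by (auto simp: D0_def)
    have m: "measure (spectral_measure f) UNIV = (LINT t:{-pi..pi}|lborel. f t)"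
    proof -
      interpret finite_measure "spectral_measure f" by (rule finite_spectral_measure[OF df])
      have "measure (spectral_measure f) UNIV = (\<integral>t. 1 \<partial>spectral_measure f)" by simp
      also have "\<dots> = (\<integral>t. (indicator {-pi..pi} t * f t) *\<^sub>R 1 \<partial>lborel)" by (rule integral_spectral_measure[OF df]) simp
      finally show ?thesis by (simp add: set_lebesgue_integral_def)
    qed
    have "mean_square_error n \<mu> N a h f \<le> \<sigma> * (measure (spectral_measure f) UNIV / (2 * pi))"
      by (rule optimal_error_le[OF mu df bound h])
    also have "\<dots> \<le> \<sigma> * P0"
      using le norm_bound_nonneg[OF bound] by (intro mult_left_mono) (simp_all add: m)
    finally show ?thesis .
  qed
  then show ?thesis
    unfolding least_favorable_def using h0 poly_density_in_D0[OF deg] P0 by auto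
qed

section \<open>Boundary values of the filter\<close>

lemma AE_circ_imp_AE_spectral:
  assumes "AE t in circ. P t" "density_fun f" shows "AE t in spectral_measure f. P t"
proof -
  have m: "(\<lambda>t. ennreal (indicator {-pi..pi} t * g t)) \<in> borel_measurable lborel" if "density_fun g" for g
    using measurable_compose[OF density_fun_measurable[OF that] measurable_ennreal] by (simp cong: measurable_cong_sets)
  have "AE t in lborel. 0 < ennreal (indicator {-pi..pi} t * 1) \<longrightarrow> P t"
    using assms(1) unfolding spectral_measure_def AE_density[OF m[OF density_fun_one]] .
  then show ?thesis unfolding spectral_measure_def AE_density[OF m[OF assms(2)]]
    by eventually_elim (auto simp: indicator_def split: if_splits)
qed

lemma tail_sum_le:
  assumes "summable f" "\<And>k. 0 \<le> f k" shows "(\<Sum>k\<in>{K..<m}. f k) \<le> (\<Sum>k. f (k + K) :: real)"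
proof -
  have "(\<Sum>k\<in>{K..<m}. f k) = (\<Sum>k<m - K. f (k + K))"
    by (rule sum.reindex_bij_witness[of _ "\<lambda>k. k + K" "\<lambda>k. k - K"]) auto
  also have "\<dots> \<le> (\<Sum>k. f (k + K))"
    using assms by (intro sum_le_suminf summable_ignore_initial_segment) auto
  finally show ?thesis .
qed

text \<open>Since \<open>w\<^sub>\<mu>\<close> is bounded in the disc, Bessel's inequality on the circles of radius \<open>r < 1\<close> bounds
  the partial sums.\<close>

lemma w_coeff_square_summable:
  assumes mu: "\<mu> > 0" shows "summable (\<lambda>k. (cmod (w_coeff n \<mu> k))\<^sup>2)"
proof -
  let ?L = "kernel_log n \<mu>" and ?C = "exp (2 * (real n * ln (real \<mu>)) / 2)"
  note L = kernel_log_integrable[OF mu, of n]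
  have part: "(\<Sum>k<m. (cmod (w_coeff n \<mu> k))\<^sup>2) \<le> ?C\<^sup>2" for m
  proof -
    have "2 * pi * (\<Sum>k<m. (cmod (w_coeff n \<mu> k * of_real (radii j) ^ k))\<^sup>2) \<le> 2 * pi * ?C\<^sup>2" for j
    proof -
      let ?z = "\<lambda>t. complex_of_real (radii j) * cis (- t)"
      have eq: "outer ?L (?z t) = (\<Sum>k. w_coeff n \<mu> k * of_real (radii j) ^ k * cis (- (of_nat k * t)))" for t
        using outer_sums[OF L radial_norm(2), of j "- t"]
        by (simp add: sums_iff w_coeff_eq_outer_coeff power_mult_distrib Complex.DeMoivre mult.assoc)
      have summ: "summable (\<lambda>k. cmod (w_coeff n \<mu> k * of_real (radii j) ^ k))"
        using outer_abs_summable[OF L radial_norm(2), of j 0] by (simp add: w_coeff_eq_outer_coeff)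
      have meas: "(\<lambda>t. outer ?L (?z t)) \<in> borel_measurable borel" unfolding eq by measurable
      have b: "(cmod (outer ?L (?z t)))\<^sup>2 \<le> ?C\<^sup>2" for t
        by (intro power_mono cmod_outer_le[OF L radial_norm(2) kernel_log_le[OF mu]]) auto
      have "2 * pi * (\<Sum>k<m. (cmod (w_coeff n \<mu> k * of_real (radii j) ^ k))\<^sup>2) \<le> (\<integral>t. (cmod (outer ?L (?z t)))\<^sup>2 \<partial>circ)"
        unfolding eq by (rule Bessel_trig_series[OF summ])
      also have "\<dots> \<le> (\<integral>t. ?C\<^sup>2 \<partial>circ)"
        using b meas by (intro integral_mono integrable_circ_bounded[where C="?C\<^sup>2"]) auto
      also have "\<dots> = 2 * pi * ?C\<^sup>2" by (subst integral_circ) (auto simp: set_lebesgue_integral_def)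
      finally show ?thesis .
    qed
    moreover have "(\<lambda>j. 2 * pi * (\<Sum>k<m. (cmod (w_coeff n \<mu> k * of_real (radii j) ^ k))\<^sup>2)) \<longlonglongrightarrow>
        2 * pi * (\<Sum>k<m. (cmod (w_coeff n \<mu> k * of_real 1 ^ k))\<^sup>2)"
      by (intro tendsto_intros radii)
    ultimately have "2 * pi * (\<Sum>k<m. (cmod (w_coeff n \<mu> k * of_real 1 ^ k))\<^sup>2) \<le> 2 * pi * ?C\<^sup>2"
      by (meson LIMSEQ_le_const2)
    then show ?thesis by simp
  qed
  show ?thesis by (rule summableI_nonneg_bounded[where x="?C\<^sup>2"]) (use part in auto)
qed

abbreviation w_partial :: "nat \<Rightarrow> nat \<Rightarrow> nat \<Rightarrow> real \<Rightarrow> complex" where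
  "w_partial n \<mu> K \<equiv> \<lambda>t. \<Sum>j<K. w_coeff n \<mu> j * cis (- (of_nat j * t))"

lemma w_partial_square_integrable: "square_integrable circ (w_partial n \<mu> K)"
proof -
  have "cmod (w_partial n \<mu> K t) \<le> (\<Sum>j<K. cmod (w_coeff n \<mu> j))" for t
    by (intro sum_norm_le) (simp add: norm_mult)
  then show ?thesis by (intro square_integrable_bounded_spectral[OF density_fun_one]) auto
qed

text \<open>The partial sums converge in mean square to boundary values of \<open>w\<^sub>\<mu>\<close>; these are also the
  radial limits in mean square, so their modulus is that of the kernel.\<close>

lemma boundary_values:
  assumes mu: "\<mu> > 0"
  shows "\<exists>\<omega>. square_integrable circ \<omega> \<and> (AE t in circ. cmod (\<omega> t) = cmod (kern n \<mu> t)) \<and>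
    (\<lambda>K. mean_sqdist circ \<omega> (w_partial n \<mu> K)) \<longlonglongrightarrow> 0"
proof -
  let ?a = "w_coeff n \<mu>" and ?L = "kernel_log n \<mu>" and ?S = "w_partial n \<mu>"
  note L = kernel_log_integrable[OF mu, of n]
  define f where "f k = (cmod (?a k))\<^sup>2" for k
  have f: "summable f" "\<And>k. 0 \<le> f k" unfolding f_def using w_coeff_square_summable[OF mu] by auto
  define R where "R K = (\<Sum>k. f (k + K))" for K
  have R: "\<exists>K. \<forall>k\<ge>K. R k < e" if "e > 0" for e
    using suminf_exist_split[OF that f(1)] by (auto simp: R_def abs_less_iff)
  have Sdiff: "(\<integral>t. (cmod (?S i t - ?S j t))\<^sup>2 \<partial>circ) \<le> 2 * pi * R K" if "i \<ge> K" "j \<ge> K" for i j K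
  proof -
    let ?m = "max i j"
    let ?d = "\<lambda>k. (if k < i then ?a k else 0) - (if k < j then ?a k else 0)"
    have part: "?S l t = (\<Sum>k<?m. (if k < l then ?a k else 0) * cis (- (of_nat k * t)))" if "l \<le> ?m" for l t
      using that by (intro sum.mono_neutral_cong_left) auto
    have "?S i t - ?S j t = (\<Sum>k<?m. ?d k * cis (- (of_nat k * t)))" for t
      using part[of i t] part[of j t] by (simp only: max.cobounded1 max.cobounded2 left_diff_distrib sum_subtractf)
    then have "(\<integral>t. (cmod (?S i t - ?S j t))\<^sup>2 \<partial>circ) = 2 * pi * (\<Sum>k<?m. (cmod (?d k))\<^sup>2)"
      by (simp only: Parseval_nat(2)[OF finite_lessThan])
    also have "(\<Sum>k<?m. (cmod (?d k))\<^sup>2) \<le> (\<Sum>k\<in>{K..<?m}. f k)"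
    proof -
      have "(\<Sum>k<?m. (cmod (?d k))\<^sup>2) = (\<Sum>k\<in>{K..<?m}. (cmod (?d k))\<^sup>2)"
        using that by (intro sum.mono_neutral_right) auto
      also have "\<dots> \<le> (\<Sum>k\<in>{K..<?m}. f k)" by (intro sum_mono) (auto simp: f_def)
      finally show ?thesis .
    qed
    also have "\<dots> \<le> R K" unfolding R_def by (rule tail_sum_le[OF f])
    finally show ?thesis by simp
  qed
  have Cauchy: "\<exists>K. \<forall>i\<ge>K. \<forall>j\<ge>K. (\<integral>t. (cmod (?S i t - ?S j t))\<^sup>2 \<partial>circ) \<le> e" if e: "e > 0" for e
  proof -
    obtain K where "R K < e / (2 * pi)" using R[of "e / (2 * pi)"] e by auto
    then have "2 * pi * R K \<le> e" by (simp add: field_simps)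
    then show ?thesis using Sdiff order_trans by blast
  qed
  obtain \<omega> where om: "square_integrable circ \<omega>" and lim: "(\<lambda>K. mean_sqdist circ \<omega> (?S K)) \<longlonglongrightarrow> 0"
    by (rule L2_complete[OF w_partial_square_integrable Cauchy])
  let ?z = "\<lambda>j t. complex_of_real (radii j) * cis (- t)"
  let ?W = "\<lambda>j t. outer ?L (?z j t)"
  have mom[measurable]: "\<omega> \<in> borel_measurable borel" using om by (simp add: square_integrable_def)
  have series: "(\<lambda>k. ?a k * of_real (radii j) ^ k * cis (- (of_nat k * t))) sums ?W j t" for j t
    using outer_sums[OF L radial_norm(2), of j "- t"]
    by (simp add: w_coeff_eq_outer_coeff power_mult_distrib Complex.DeMoivre mult.assoc)
  have summ: "summable (\<lambda>k. cmod (?a k * of_real (radii j) ^ k))" for j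
    using outer_abs_summable[OF L radial_norm(2), of j 0] by (simp add: w_coeff_eq_outer_coeff)
  have mW[measurable]: "(\<lambda>t. ?W j t) \<in> borel_measurable borel" for j
  proof -
    have "(\<lambda>t. ?W j t) = (\<lambda>t. \<Sum>k. ?a k * of_real (radii j) ^ k * cis (- (of_nat k * t)))"
      using series by (auto simp: sums_iff)
    then show ?thesis by simp
  qed
  let ?C = "exp (2 * (real n * ln (real \<mu>)) / 2)"
  have Wb: "cmod (?W j t) \<le> ?C" for j t by (rule cmod_outer_le[OF L radial_norm(2) kernel_log_le[OF mu]])
  have sqW: "square_integrable circ (?W j)" for j
    by (rule square_integrable_bounded_spectral[OF density_fun_one mW Wb])
  have SW: "(\<integral>t. (cmod (?S K t - ?W j t))\<^sup>2 \<partial>circ) \<le> 2 * pi * ((\<Sum>k<K. (cmod (?a k * (1 - of_real (radii j) ^ k)))\<^sup>2) + R K)" for K j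
  proof -
    let ?r = "\<lambda>k. complex_of_real (radii j) ^ k"
    define c where "c k = (if k < K then ?a k else 0) - ?a k * ?r k" for k
    have fin: "summable (\<lambda>k. cmod (if k < K then ?a k else 0))"
      by (rule summable_finite[of "{..<K}"]) auto
    have c: "summable (\<lambda>k. cmod (c k))"
      unfolding c_def by (rule summable_comparison_test'[OF summable_add[OF fin summ], of 0])
        (unfold real_norm_def abs_norm_cancel, rule norm_triangle_ineq4)
    have "(\<lambda>k. (if k < K then ?a k else 0) * cis (- (of_nat k * t))) sums ?S K t" for t
    proof -
      have "(\<lambda>k. (if k < K then ?a k else 0) * cis (- (of_nat k * t))) sums
          (\<Sum>k<K. (if k < K then ?a k else 0) * cis (- (of_nat k * t)))"
        by (rule sums_finite) auto
      then show ?thesis by simp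
    qed
    from sums_diff[OF this series] have "(\<lambda>k. c k * cis (- (of_nat k * t))) sums (?S K t - ?W j t)" for t
      unfolding c_def left_diff_distrib .
    then have eq: "?S K t - ?W j t = (\<Sum>k. c k * cis (- (of_nat k * t)))" for t by (simp add: sums_iff)
    have P: "(\<lambda>k. 2 * pi * (cmod (c k))\<^sup>2) sums (\<integral>t. (cmod (?S K t - ?W j t))\<^sup>2 \<partial>circ)"
      unfolding eq by (rule Parseval_trig_series[OF c])
    have sc: "summable (\<lambda>k. (cmod (c k))\<^sup>2)"
      using summable_mult[OF sums_summable[OF P], of "1 / (2 * pi)"] by simp
    have I: "(\<integral>t. (cmod (?S K t - ?W j t))\<^sup>2 \<partial>circ) = 2 * pi * (\<Sum>k. (cmod (c k))\<^sup>2)"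
      using sums_unique[OF P] suminf_mult[OF sc, of "2 * pi"] by simp
    have "(\<Sum>k. (cmod (c k))\<^sup>2) = (\<Sum>k. (cmod (c (k + K)))\<^sup>2) + (\<Sum>k<K. (cmod (c k))\<^sup>2)"
      by (rule suminf_split_initial_segment[OF sc])
    also have "(\<Sum>k. (cmod (c (k + K)))\<^sup>2) \<le> R K"
      unfolding R_def
    proof (rule suminf_le)
      fix k
      have "cmod (?a (k + K) * ?r (k + K)) \<le> cmod (?a (k + K)) * 1"
        unfolding norm_mult using radii(1,2)[of j]
        by (intro mult_left_mono) (auto simp: norm_power intro!: power_le_one)
      then show "(cmod (c (k + K)))\<^sup>2 \<le> f (k + K)" by (simp add: c_def f_def power_mono)
    qed (use f sc in \<open>auto intro: summable_ignore_initial_segment\<close>)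
    finally have "(\<Sum>k. (cmod (c k))\<^sup>2) \<le> (\<Sum>k<K. (cmod (c k))\<^sup>2) + R K" by simp
    also have "(\<Sum>k<K. (cmod (c k))\<^sup>2) = (\<Sum>k<K. (cmod (?a k * (1 - ?r k)))\<^sup>2)"
      by (intro sum.cong refl) (simp add: c_def right_diff_distrib)
    finally show ?thesis unfolding I by (intro mult_left_mono) auto
  qed
  have WO: "(\<lambda>j. \<integral>t. (cmod (?W j t - \<omega> t))\<^sup>2 \<partial>circ) \<longlonglongrightarrow> 0"
  proof (rule LIMSEQ_I)
    fix e :: real assume e: "0 < e"
    define e' where "e' = e / (8 * pi + 4)"
    have e': "0 < e'" "2 * e' + 2 * (2 * pi * (e' + e')) \<le> e"
    proof -
      have pos: "0 < 8 * pi + 4" using pi_gt3 by simp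
      show "0 < e'" using e pos by (simp add: e'_def)
      have "e' * (8 * pi + 4) = e" unfolding e'_def using pos by simp
      then show "2 * e' + 2 * (2 * pi * (e' + e')) \<le> e" using \<open>0 < e'\<close> by (simp add: algebra_simps)
    qed
    have "\<forall>\<^sub>F K in sequentially. mean_sqdist circ \<omega> (?S K) < ennreal e'"
      using lim e'(1) by (intro order_tendstoD) auto
    moreover have "\<forall>\<^sub>F K in sequentially. R K < e'" using R[OF e'(1)] by (simp add: eventually_sequentially)
    ultimately have "\<forall>\<^sub>F K in sequentially. mean_sqdist circ \<omega> (?S K) < ennreal e' \<and> R K < e'"
      by (rule eventually_conj)
    then obtain K where K: "mean_sqdist circ \<omega> (?S K) < ennreal e'" "R K < e'"
      by (auto simp: eventually_sequentially)
    have sqd: "square_integrable circ (\<lambda>t. \<omega> t - ?S K t)" "square_integrable circ (\<lambda>t. ?S K t - ?W j t)"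
        "square_integrable circ (\<lambda>t. ?W j t - \<omega> t)" for j
      by (intro square_integrable_diff om w_partial_square_integrable sqW)+
    have K1: "(\<integral>t. (cmod (\<omega> t - ?S K t))\<^sup>2 \<partial>circ) < e'"
      using K(1) e'(1) unfolding mean_sqdist_eq_integral[OF sqd(1)] by (simp add: ennreal_less_iff)
    have "(\<lambda>j. \<Sum>k<K. (cmod (?a k * (1 - of_real (radii j) ^ k)))\<^sup>2) \<longlonglongrightarrow> (\<Sum>k<K. (cmod (?a k * (1 - of_real 1 ^ k)))\<^sup>2)"
      by (intro tendsto_intros radii)
    then have "\<forall>\<^sub>F j in sequentially. (\<Sum>k<K. (cmod (?a k * (1 - of_real (radii j) ^ k)))\<^sup>2) < e'"
      using e'(1) by (intro order_tendstoD(2)) auto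
    then obtain J where J: "\<And>j. j \<ge> J \<Longrightarrow> (\<Sum>k<K. (cmod (?a k * (1 - of_real (radii j) ^ k)))\<^sup>2) < e'"
      by (auto simp: eventually_sequentially)
    have "norm ((\<integral>t. (cmod (?W j t - \<omega> t))\<^sup>2 \<partial>circ) - 0) < e" if "j \<ge> J" for j
    proof -
      have "(\<integral>t. (cmod (?W j t - \<omega> t))\<^sup>2 \<partial>circ) \<le>
          (\<integral>t. 2 * (cmod (?S K t - ?W j t))\<^sup>2 + 2 * (cmod (\<omega> t - ?S K t))\<^sup>2 \<partial>circ)"
      proof (rule integral_mono)
        show "integrable circ (\<lambda>t. (cmod (?W j t - \<omega> t))\<^sup>2)" using sqd(3)[of j] by (simp add: square_integrable_def)
        show "integrable circ (\<lambda>t. 2 * (cmod (?S K t - ?W j t))\<^sup>2 + 2 * (cmod (\<omega> t - ?S K t))\<^sup>2)"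
          using sqd(1) sqd(2)[of j] by (intro Bochner_Integration.integrable_add integrable_mult_right) (simp_all only: square_integrable_def)
        show "(cmod (?W j t - \<omega> t))\<^sup>2 \<le> 2 * (cmod (?S K t - ?W j t))\<^sup>2 + 2 * (cmod (\<omega> t - ?S K t))\<^sup>2" for t
          using cmod_diff_sq_le[of "?W j t" "\<omega> t" "?S K t"] by (simp only: norm_minus_commute)
      qed
      also have "\<dots> = 2 * (\<integral>t. (cmod (?S K t - ?W j t))\<^sup>2 \<partial>circ) + 2 * (\<integral>t. (cmod (\<omega> t - ?S K t))\<^sup>2 \<partial>circ)"
        using sqd(1) sqd(2)[of j] by (subst Bochner_Integration.integral_add) (simp_all add: square_integrable_def)
      also have "\<dots> < 2 * (2 * pi * (e' + e')) + 2 * e'"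
      proof -
        have "(\<integral>t. (cmod (?S K t - ?W j t))\<^sup>2 \<partial>circ) \<le> 2 * pi * (e' + e')"
          using SW[of K j] J[OF that] K(2) by (elim order_trans) (intro mult_left_mono, auto)
        then show ?thesis using K1 by linarith
      qed
      also have "\<dots> \<le> e" using e'(2) by simp
      finally show ?thesis by simp
    qed
    then show "\<exists>no. \<forall>j\<ge>no. norm ((\<integral>t. (cmod (?W j t - \<omega> t))\<^sup>2 \<partial>circ) - 0) < e" by blast
  qed
  have WK: "(\<lambda>j. \<integral>t. (cmod (kern n \<mu> t) - cmod (?W j t))\<^sup>2 \<partial>circ) \<longlonglongrightarrow> (\<integral>t. 0 \<partial>circ)"
  proof (rule integral_dominated_convergence[where w="\<lambda>_. (real \<mu> ^ n + ?C)\<^sup>2"])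
    show "AE t in circ. (\<lambda>j. (cmod (kern n \<mu> t) - cmod (?W j t))\<^sup>2) \<longlonglongrightarrow> 0"
      using AE_regular_point[OF mu density_fun_one, of n]
    proof eventually_elim
      case (elim t)
      have "(\<lambda>j. cmod (?W j t)) \<longlonglongrightarrow> cmod (kern n \<mu> t)"
        using radial_limit[OF L, of t] kernel_log_isCont[OF regular_point_uminus[OF elim]] kernel_log_even exp_kernel_log[OF elim] elim
        by (simp add: regular_point_def)
      then have "(\<lambda>j. (cmod (kern n \<mu> t) - cmod (?W j t))\<^sup>2) \<longlonglongrightarrow> (cmod (kern n \<mu> t) - cmod (kern n \<mu> t))\<^sup>2"
        by (intro tendsto_power tendsto_diff tendsto_const)
      then show ?case by simp
    qed
    show "AE t in circ. norm ((cmod (kern n \<mu> t) - cmod (?W j t))\<^sup>2) \<le> (real \<mu> ^ n + ?C)\<^sup>2" for j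
    proof (intro AE_I2)
      fix t
      have "\<bar>cmod (kern n \<mu> t) - cmod (?W j t)\<bar> \<le> \<bar>real \<mu> ^ n + ?C\<bar>"
        using cmod_increment_kernel_le[of n "int \<mu>" t] Wb[of j t] norm_ge_zero[of "kern n \<mu> t"] norm_ge_zero[of "?W j t"]
        by (simp only: of_int_abs abs_of_nat of_int_of_nat_eq)
      then show "norm ((cmod (kern n \<mu> t) - cmod (?W j t))\<^sup>2) \<le> (real \<mu> ^ n + ?C)\<^sup>2"
        unfolding real_norm_def abs_power2 by (simp only: abs_le_square_iff)
    qed
  qed (auto simp del: borel_measurable_spectral_measure cong: measurable_cong_sets)
  have sum_sq_le: "(x + y)\<^sup>2 \<le> 2 * x\<^sup>2 + 2 * y\<^sup>2" for x y :: real
    using zero_le_power2[of "x - y"] by (simp add: power2_eq_square algebra_simps)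
  define D where "D = (\<integral>t. (cmod (kern n \<mu> t) - cmod (\<omega> t))\<^sup>2 \<partial>circ)"
  have kb: "square_integrable circ (kern n \<mu>)"
    using cmod_increment_kernel_le[of n "int \<mu>"] by (intro square_integrable_bounded_spectral[OF density_fun_one]) auto
  have intd: "integrable circ (\<lambda>t. (cmod (x t) - cmod (y t))\<^sup>2)" if "square_integrable circ x" "square_integrable circ y" for x y
  proof -
    have [measurable]: "x \<in> borel_measurable borel" "y \<in> borel_measurable borel"
      using that by (simp_all add: square_integrable_def)
    have i1: "integrable circ (\<lambda>t. (cmod (x t - y t))\<^sup>2)"
      using square_integrable_diff[OF that] by (simp add: square_integrable_def)
    have m1: "(\<lambda>t. (cmod (x t) - cmod (y t))\<^sup>2) \<in> borel_measurable circ"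
      unfolding borel_measurable_spectral_measure by measurable
    have b1: "norm ((cmod (x t) - cmod (y t))\<^sup>2) \<le> norm ((cmod (x t - y t))\<^sup>2)" for t
      using norm_triangle_ineq3[of "x t" "y t"] by (simp add: abs_le_square_iff[symmetric])
    show ?thesis by (rule Bochner_Integration.integrable_bound[OF i1 m1 AE_I2[OF b1]])
  qed
  have "D \<le> 2 * (\<integral>t. (cmod (kern n \<mu> t) - cmod (?W j t))\<^sup>2 \<partial>circ) + 2 * (\<integral>t. (cmod (?W j t - \<omega> t))\<^sup>2 \<partial>circ)" for j
  proof -
    have i2: "integrable circ (\<lambda>t. (cmod (?W j t - \<omega> t))\<^sup>2)"
      using square_integrable_diff[OF sqW[of j] om] by (simp add: square_integrable_def)
    have "D \<le> (\<integral>t. 2 * (cmod (kern n \<mu> t) - cmod (?W j t))\<^sup>2 + 2 * (cmod (?W j t - \<omega> t))\<^sup>2 \<partial>circ)"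
      unfolding D_def
    proof (rule integral_mono[OF intd[OF kb om]])
      show "integrable circ (\<lambda>t. 2 * (cmod (kern n \<mu> t) - cmod (?W j t))\<^sup>2 + 2 * (cmod (?W j t - \<omega> t))\<^sup>2)"
        by (intro Bochner_Integration.integrable_add integrable_mult_right intd kb sqW i2)
      fix t
      let ?x = "cmod (kern n \<mu> t) - cmod (?W j t)" and ?y = "cmod (?W j t) - cmod (\<omega> t)"
      have "(cmod (kern n \<mu> t) - cmod (\<omega> t))\<^sup>2 = (?x + ?y)\<^sup>2" by simp
      also have "\<dots> \<le> 2 * ?x\<^sup>2 + 2 * ?y\<^sup>2" by (rule sum_sq_le)
      also have "?y\<^sup>2 \<le> (cmod (?W j t - \<omega> t))\<^sup>2"
        using norm_triangle_ineq3[of "?W j t" "\<omega> t"] by (simp add: abs_le_square_iff[symmetric])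
      finally show "(cmod (kern n \<mu> t) - cmod (\<omega> t))\<^sup>2 \<le> 2 * ?x\<^sup>2 + 2 * (cmod (?W j t - \<omega> t))\<^sup>2" by simp
    qed
    also have "\<dots> = 2 * (\<integral>t. (cmod (kern n \<mu> t) - cmod (?W j t))\<^sup>2 \<partial>circ) + 2 * (\<integral>t. (cmod (?W j t - \<omega> t))\<^sup>2 \<partial>circ)"
      using intd[OF kb sqW[of j]] i2 by (subst Bochner_Integration.integral_add) simp_all
    finally show ?thesis .
  qed
  moreover have "(\<lambda>j. 2 * (\<integral>t. (cmod (kern n \<mu> t) - cmod (?W j t))\<^sup>2 \<partial>circ) + 2 * (\<integral>t. (cmod (?W j t - \<omega> t))\<^sup>2 \<partial>circ)) \<longlonglongrightarrow>
      2 * (\<integral>t. 0 \<partial>circ) + 2 * 0"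
    by (intro tendsto_intros WK WO)
  ultimately have "D \<le> 2 * (\<integral>t. 0 \<partial>circ) + 2 * 0" by (intro LIMSEQ_le_const) auto
  moreover have "0 \<le> D" unfolding D_def by (intro integral_nonneg_AE AE_I2 zero_le_power2)
  ultimately have "D = 0" by simp
  then have "AE t in circ. (cmod (kern n \<mu> t) - cmod (\<omega> t))\<^sup>2 = 0"
    unfolding D_def using integral_nonneg_eq_0_iff_AE[OF intd[OF kb om]] by simp
  then have "AE t in circ. cmod (\<omega> t) = cmod (kern n \<mu> t)" by eventually_elim simp
  with om lim show ?thesis by blast
qed

section \<open>Moving average representation\<close>

text \<open>The quotient \<open>u = \<kappa>/w\<close> of the kernel and the boundary values of the filter is a phase.  Therefore
  \<open>\<epsilon>\<^sub>m = \<integral> e\<^bsup>imt\<^esup> u/\<phi> dZ\<close> is white noise, \<open>\<eta>\<^sub>m = \<integral> e\<^bsup>imt\<^esup> u w/\<phi> dZ\<close> is its filtered version, and the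
  increments \<open>\<integral> e\<^bsup>imt\<^esup> \<kappa> dZ\<close> are obtained from \<open>\<eta>\<close> with the coefficients of \<open>\<phi>\<close>.\<close>

theorem moving_average_poly_density:
  fixes M :: "'w measure"
  assumes mu: "\<mu> > 0" and deg: "degree \<phi> \<le> N" and nz: "\<phi> \<noteq> 0" and M: "prob_space M"
    and dens: "has_spectral_density M n \<xi> (poly_density \<phi>)"
  shows "moving_average_increments M n \<mu> N \<xi>"
proof -
  let ?f = "poly_density \<phi>" and ?k = "kern n \<mu>"
  obtain Z where rep: "spectral_representation M n \<xi> ?f Z" using dens by (auto simp: has_spectral_density_def)
  interpret orthogonal_integral M ?f Z
    using M rep by (auto simp: orthogonal_integral_def orthogonal_integral_axioms_def spectral_representation_def)
  note f = poly_density_density_fun[of \<phi>]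
  obtain w where w: "square_integrable circ w" and mod: "AE t in circ. cmod (w t) = cmod (?k t)"
    and lim: "(\<lambda>K. mean_sqdist circ w (w_partial n \<mu> K)) \<longlonglongrightarrow> 0"
    using boundary_values[OF mu, of n] by blast
  have mw[measurable]: "w \<in> borel_measurable borel" using w by (simp add: square_integrable_def)
  \<comment> \<open>this is \<open>\<kappa>/w\<close> where \<open>|w| = |\<kappa>| \<noteq> 0\<close>, and at most \<open>1\<close> in modulus everywhere\<close>
  define u where "u t = sgn (?k t) * cnj (sgn (w t))" for t
  define v where "v t = u t / poly \<phi> (cis (- t))" for t
  have msgn: "(\<lambda>t. sgn (g t)) \<in> borel_measurable borel" if "g \<in> borel_measurable borel" for g :: "real \<Rightarrow> complex"
    unfolding sgn_div_norm using that by measurable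
  have mu'[measurable]: "u \<in> borel_measurable borel"
    unfolding u_def using msgn[of ?k] msgn[of w] by measurable
  have mv[measurable]: "v \<in> borel_measurable borel" unfolding v_def by measurable
  have u_le: "cmod (u t) \<le> 1" for t by (simp add: u_def norm_mult norm_sgn)
  have fv: "?f t * (cmod (v t))\<^sup>2 = (if poly \<phi> (cis (- t)) = 0 then 0 else (cmod (u t))\<^sup>2)" for t
    by (simp add: v_def poly_density_def norm_divide power_divide)
  have fv_le: "?f t * (cmod (v t))\<^sup>2 \<le> 1" for t using u_le[of t] by (simp add: fv power_le_one)
  have AE_u: "AE t in circ. cmod (u t) = 1 \<and> u t * w t = ?k t \<and> poly \<phi> (cis (- t)) \<noteq> 0"
    using mod AE_regular_point[OF mu density_fun_one, of n] AE_countable_not_in[OF countable_poly_cis_zero[OF nz] density_fun_one]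
  proof eventually_elim
    case (elim t)
    then have k0: "?k t \<noteq> 0" by (simp add: regular_point_def)
    then have w0: "w t \<noteq> 0" using elim(1) by auto
    have "cnj (sgn (w t)) * w t = of_real (cmod (w t))"
    proof -
      have "cnj (sgn (w t)) * w t = (w t * cnj (w t)) / of_real (cmod (w t))"
        by (simp add: sgn_div_norm scaleR_conv_of_real divide_inverse)
      also have "\<dots> = of_real (cmod (w t))" using w0 by (simp add: complex_norm_square[symmetric] power2_eq_square)
      finally show ?thesis .
    qed
    then have "u t * w t = sgn (?k t) * of_real (cmod (?k t))" using elim(1) by (simp add: u_def mult.assoc)
    also have "\<dots> = ?k t" using k0 by (simp add: sgn_div_norm scaleR_conv_of_real)
    finally show ?case using elim k0 w0 by (simp add: u_def norm_mult norm_sgn)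
  qed
  have int_f: "integrable \<nu> (\<lambda>t. (cmod (g t * v t))\<^sup>2)" if g: "square_integrable circ g" for g
  proof -
    have mg[measurable]: "g \<in> borel_measurable borel" using g by (simp add: square_integrable_def)
    have "integrable circ (\<lambda>t. ?f t * (cmod (g t * v t))\<^sup>2)"
    proof (rule Bochner_Integration.integrable_bound)
      show "integrable circ (\<lambda>t. (cmod (g t))\<^sup>2)" using g by (simp add: square_integrable_def)
      show "AE t in circ. norm (?f t * (cmod (g t * v t))\<^sup>2) \<le> norm ((cmod (g t))\<^sup>2)"
      proof (intro AE_I2)
        fix t
        have "?f t * (cmod (g t * v t))\<^sup>2 = (cmod (g t))\<^sup>2 * (?f t * (cmod (v t))\<^sup>2)"
          by (simp add: norm_mult power_mult_distrib)
        also have "\<dots> \<le> (cmod (g t))\<^sup>2 * 1" using fv_le by (intro mult_left_mono) auto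
        finally show "norm (?f t * (cmod (g t * v t))\<^sup>2) \<le> norm ((cmod (g t))\<^sup>2)"
          by (simp add: poly_density_def abs_mult)
      qed
      show "(\<lambda>t. ?f t * (cmod (g t * v t))\<^sup>2) \<in> borel_measurable circ"
        unfolding borel_measurable_spectral_measure by measurable
    qed
    then have "integrable lborel (\<lambda>t. (indicator {-pi..pi} t * 1) *\<^sub>R (?f t * (cmod (g t * v t))\<^sup>2))"
      by (subst (asm) integrable_spectral_measure[OF density_fun_one]) auto
    then show ?thesis by (subst integrable_spectral_measure[OF f]) (auto simp: mult_ac)
  qed
  have sq_f: "square_integrable \<nu> (\<lambda>t. g t * v t)" if g: "square_integrable circ g" for g
    unfolding square_integrable_def borel_measurable_spectral_measure
  proof
    have "g \<in> borel_measurable borel" using g by (simp add: square_integrable_def)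
    then show "(\<lambda>t. g t * v t) \<in> borel_measurable borel" using mv by (rule borel_measurable_times)
  qed (rule int_f[OF g])
  have int_le: "(\<integral>t. (cmod (g t * v t))\<^sup>2 \<partial>\<nu>) \<le> (\<integral>t. (cmod (g t))\<^sup>2 \<partial>circ)" if g: "square_integrable circ g" for g
  proof -
    have mg[measurable]: "g \<in> borel_measurable borel" using g by (simp add: square_integrable_def)
    have ig: "integrable circ (\<lambda>t. (cmod (g t))\<^sup>2)" using g by (simp add: square_integrable_def)
    have "(\<integral>t. (cmod (g t * v t))\<^sup>2 \<partial>\<nu>) = (\<integral>t. ?f t *\<^sub>R (cmod (g t * v t))\<^sup>2 \<partial>circ)"
      by (rule integral_spectral_circ[OF f]) auto
    also have "\<dots> \<le> (\<integral>t. (cmod (g t))\<^sup>2 \<partial>circ)"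
    proof (rule integral_mono'[OF ig])
      fix t
      have "?f t * (cmod (g t * v t))\<^sup>2 = (cmod (g t))\<^sup>2 * (?f t * (cmod (v t))\<^sup>2)"
        by (simp add: norm_mult power_mult_distrib)
      also have "\<dots> \<le> (cmod (g t))\<^sup>2 * 1" using fv_le by (intro mult_left_mono) auto
      finally show "?f t *\<^sub>R (cmod (g t * v t))\<^sup>2 \<le> (cmod (g t))\<^sup>2" by simp
      show "0 \<le> (cmod (g t))\<^sup>2" by simp
    qed
    finally show ?thesis .
  qed
  let ?e = "\<lambda>(m::int) t. cis (of_int m * t)"
  have cis_mult_sq: "square_integrable circ (\<lambda>t. ?e m t * g t)" if "square_integrable circ g" for m g
  proof -
    have [measurable]: "g \<in> borel_measurable borel" using that by (simp add: square_integrable_def)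
    have "(\<lambda>t. ?e m t * g t) \<in> borel_measurable circ"
      unfolding borel_measurable_spectral_measure by measurable
    then show ?thesis using that unfolding square_integrable_def norm_mult norm_cis mult_1_left by blast
  qed
  have "\<forall>m. \<exists>X. has_stochastic_integral M ?f Z (\<lambda>t. ?e m t * v t) X"
    using has_integral_exists[OF sq_f[OF square_integrable_cis]] by metis
  then obtain \<epsilon> where \<epsilon>: "\<And>m. has_stochastic_integral M ?f Z (\<lambda>t. ?e m t * v t) (\<epsilon> m)" by metis
  have "\<forall>m. \<exists>X. has_stochastic_integral M ?f Z (\<lambda>t. (?e m t * w t) * v t) X"
    using has_integral_exists[OF sq_f[OF cis_mult_sq[OF w]]] by metis
  then obtain \<eta> where \<eta>: "\<And>m. has_stochastic_integral M ?f Z (\<lambda>t. (?e m t * w t) * v t) (\<eta> m)" by metis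
  have noise: "white_noise M \<epsilon>"
    unfolding white_noise_def
  proof (intro conjI allI)
    fix m k
    show "\<epsilon> m \<in> borel_measurable M" "integrable M (\<lambda>\<omega>. (cmod (\<epsilon> m \<omega>))\<^sup>2)"
      using has_integral_square_integrable(2)[OF \<epsilon>[of m]] by (auto simp: square_integrable_def)
    show "expectation (\<epsilon> m) = 0" by (rule has_integral_expectation[OF \<epsilon>])
    have "(\<integral>t. (?e m t * v t) * cnj (?e k t * v t) \<partial>\<nu>) = (\<integral>t. ?f t *\<^sub>R ((?e m t * v t) * cnj (?e k t * v t)) \<partial>circ)"
      by (rule integral_spectral_circ[OF f]) auto
    also have "\<dots> = (\<integral>t. ?e (m - k) t \<partial>circ)"
    proof (rule Bochner_Integration.integral_cong_AE)
      show "AE t in circ. ?f t *\<^sub>R ((?e m t * v t) * cnj (?e k t * v t)) = ?e (m - k) t"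
        using AE_u
      proof eventually_elim
        case (elim t)
        have "?f t *\<^sub>R ((?e m t * v t) * cnj (?e k t * v t)) = (?e m t * cnj (?e k t)) * (of_real (?f t) * (v t * cnj (v t)))"
          unfolding scaleR_conv_of_real complex_cnj_mult by (simp only: mult_ac)
        also have "of_real (?f t) * (v t * cnj (v t)) = complex_of_real (?f t * (cmod (v t))\<^sup>2)"
          by (simp add: complex_norm_square[symmetric])
        also have "?f t * (cmod (v t))\<^sup>2 = 1" using elim by (simp add: fv)
        finally show ?case by (simp only: cis_inner of_real_1 mult_1_right)
      qed
    qed (unfold borel_measurable_spectral_measure, measurable)
    finally show "expectation (\<lambda>\<omega>. \<epsilon> m \<omega> * cnj (\<epsilon> k \<omega>)) = (if m = k then 1 else 0)"
      unfolding has_integral_inner[OF \<epsilon> \<epsilon>] integral_cis by (simp add: scaleR_conv_of_real)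
  qed
  have filt: "(\<lambda>K. mean_sqdist M (\<eta> m) (\<lambda>\<omega>. \<Sum>j<K. w_coeff n \<mu> j * \<epsilon> (m - int j) \<omega>)) \<longlonglongrightarrow> 0" for m
  proof (rule tendsto_sandwich[OF _ _ tendsto_const lim])
    show "\<forall>\<^sub>F K in sequentially. mean_sqdist M (\<eta> m) (\<lambda>\<omega>. \<Sum>j<K. w_coeff n \<mu> j * \<epsilon> (m - int j) \<omega>) \<le>
        mean_sqdist circ w (w_partial n \<mu> K)"
    proof (intro always_eventually allI)
      fix K
      let ?X = "\<lambda>i. if i < K then \<epsilon> (m - int i) else \<eta> m"
      let ?g = "\<lambda>i t. if i < K then ?e (m - int i) t * v t else (?e m t * w t) * v t"
      let ?c = "\<lambda>i. if i < K then - w_coeff n \<mu> i else 1"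
      have X: "has_stochastic_integral M ?f Z (?g i) (?X i)" for i
        using \<epsilon>[of "m - int i"] \<eta>[of m] by (cases "i < K") simp_all
      have sumX: "(\<Sum>i\<in>{..K}. ?c i * ?X i \<omega>) = \<eta> m \<omega> - (\<Sum>j<K. w_coeff n \<mu> j * \<epsilon> (m - int j) \<omega>)" for \<omega>
        unfolding lessThan_Suc_atMost[symmetric] sum.lessThan_Suc by (simp add: sum_negf)
      have sumg: "(\<Sum>i\<in>{..K}. ?c i * ?g i t) = (?e m t * (w t - w_partial n \<mu> K t)) * v t" for t
      proof -
        have "?e (m - int i) t = ?e m t * cis (- (of_nat i * t))" for i
          by (simp add: cis_mult algebra_simps)
        then show ?thesis unfolding lessThan_Suc_atMost[symmetric] sum.lessThan_Suc
          by (simp add: sum_negf sum_distrib_left sum_distrib_right right_diff_distrib left_diff_distrib mult_ac)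
      qed
      have sqd: "square_integrable circ (\<lambda>t. w t - w_partial n \<mu> K t)"
        by (intro square_integrable_diff w w_partial_square_integrable)
      note comb = has_integral_combination[of "{..K}" ?g ?X ?c, OF finite_atMost X, unfolded sumX sumg]
      have "expectation (\<lambda>\<omega>. (cmod (\<eta> m \<omega> - (\<Sum>j<K. w_coeff n \<mu> j * \<epsilon> (m - int j) \<omega>)))\<^sup>2) =
          1 / (2 * pi) * (\<integral>t. (cmod ((?e m t * (w t - w_partial n \<mu> K t)) * v t))\<^sup>2 \<partial>\<nu>)" by (rule comb(3))
      also have "\<dots> \<le> 1 * (\<integral>t. (cmod ((?e m t * (w t - w_partial n \<mu> K t)) * v t))\<^sup>2 \<partial>\<nu>)"
        using pi_gt3 by (intro mult_right_mono) (auto simp: field_simps)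
      also have "\<dots> \<le> (\<integral>t. (cmod (?e m t * (w t - w_partial n \<mu> K t)))\<^sup>2 \<partial>circ)"
        using int_le[OF cis_mult_sq[OF sqd]] by simp
      also have "\<dots> = (\<integral>t. (cmod (w t - w_partial n \<mu> K t))\<^sup>2 \<partial>circ)" by (simp add: norm_mult)
      finally show "mean_sqdist M (\<eta> m) (\<lambda>\<omega>. \<Sum>j<K. w_coeff n \<mu> j * \<epsilon> (m - int j) \<omega>) \<le> mean_sqdist circ w (w_partial n \<mu> K)"
        unfolding mean_sqdist_eq_integral[OF sqd] mean_sqdist_eq_integral[OF comb(1)] by (rule ennreal_leI)
    qed
  qed simp
  have rec: "AE \<omega> in M. increment n \<xi> m (int \<mu>) \<omega> = (\<Sum>k\<le>N. coeff \<phi> k * \<eta> (m - int k) \<omega>)" for m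
  proof -
    let ?X = "\<lambda>i. if i < Suc N then \<eta> (m - int i) else increment n \<xi> m (int \<mu>)"
    let ?g = "\<lambda>i t. if i < Suc N then (?e (m - int i) t * w t) * v t else ?e m t * ?k t"
    let ?c = "\<lambda>i. if i < Suc N then - coeff \<phi> i else 1"
    have inc: "has_stochastic_integral M ?f Z (\<lambda>t. ?e m t * ?k t) (increment n \<xi> m (int \<mu>))"
      using rep unfolding spectral_representation_def by blast
    have X: "has_stochastic_integral M ?f Z (?g i) (?X i)" for i
      using inc \<eta>[of "m - int i"] by (cases "i < Suc N") simp_all
    have sumX: "(\<Sum>i\<in>{..Suc N}. ?c i * ?X i \<omega>) = increment n \<xi> m (int \<mu>) \<omega> - (\<Sum>k\<le>N. coeff \<phi> k * \<eta> (m - int k) \<omega>)" for \<omega>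
      unfolding lessThan_Suc_atMost[symmetric] sum.lessThan_Suc[of _ "Suc N"] by (simp add: sum_negf)
    have sumg: "(\<Sum>i\<in>{..Suc N}. ?c i * ?g i t) = ?e m t * (?k t - poly \<phi> (cis (- t)) * (w t * v t))" for t
    proof -
      have "?e (m - int i) t = ?e m t * cis (- t) ^ i" for i
        by (simp add: cis_mult Complex.DeMoivre algebra_simps)
      then have 1: "(\<Sum>i<Suc N. ?c i * ?g i t) = - (\<Sum>i<Suc N. ?e m t * (coeff \<phi> i * cis (- t) ^ i) * (w t * v t))"
        by (simp add: sum_negf[symmetric] mult_ac del: sum.lessThan_Suc)
      have 2: "(\<Sum>i<Suc N. ?e m t * (coeff \<phi> i * cis (- t) ^ i) * (w t * v t)) = ?e m t * poly \<phi> (cis (- t)) * (w t * v t)"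
        unfolding poly_eq_sum_atMost[OF deg] lessThan_Suc_atMost sum_distrib_left sum_distrib_right ..
      show ?thesis
        unfolding lessThan_Suc_atMost[symmetric] sum.lessThan_Suc[of _ "Suc N"] 1 2 by (simp add: algebra_simps)
    qed
    note comb = has_integral_combination[of "{..Suc N}" ?g ?X ?c, OF finite_atMost X, unfolded sumX sumg]
    have "AE t in \<nu>. (cmod (?e m t * (?k t - poly \<phi> (cis (- t)) * (w t * v t))))\<^sup>2 = 0"
    proof (rule AE_circ_imp_AE_spectral[OF _ f])
      show "AE t in circ. (cmod (?e m t * (?k t - poly \<phi> (cis (- t)) * (w t * v t))))\<^sup>2 = 0"
        using AE_u
      proof eventually_elim
        case (elim t)
        then have "poly \<phi> (cis (- t)) * (w t * v t) = ?k t" by (simp add: v_def mult.commute)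
        then show ?case by simp
      qed
    qed
    then have "(\<integral>t. (cmod (?e m t * (?k t - poly \<phi> (cis (- t)) * (w t * v t))))\<^sup>2 \<partial>\<nu>) = 0"
      by (rule integral_eq_zero_AE)
    then have zero: "expectation (\<lambda>\<omega>. (cmod (increment n \<xi> m (int \<mu>) \<omega> - (\<Sum>k\<le>N. coeff \<phi> k * \<eta> (m - int k) \<omega>)))\<^sup>2) = 0"
      using comb(3) by simp
    have "AE \<omega> in M. (cmod (increment n \<xi> m (int \<mu>) \<omega> - (\<Sum>k\<le>N. coeff \<phi> k * \<eta> (m - int k) \<omega>)))\<^sup>2 = 0"
      using comb(1) zero by (subst (asm) integral_nonneg_eq_0_iff_AE) (auto simp: square_integrable_def)
    then show ?thesis by eventually_elim simp
  qed
  have \<eta>m: "\<eta> m \<in> borel_measurable M" for m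
    using has_integral_square_integrable(2)[OF \<eta>[of m]] by (simp add: square_integrable_def)
  let ?v = "vec (N + 1) (coeff \<phi>)"
  have "(\<Sum>k\<le>N. ?v $ k * \<eta> (m - int k) \<omega>) = (\<Sum>k\<le>N. coeff \<phi> k * \<eta> (m - int k) \<omega>)" for m \<omega>
    by (intro sum.cong refl) simp
  then show ?thesis
    unfolding moving_average_increments_def using noise \<eta>m filt rec
    by (intro bexI[of _ ?v] exI[of _ \<epsilon>] exI[of _ \<eta>]) auto
qed

section \<open>Extremal coefficient vectors\<close>

definition vec_poly :: "complex vec \<Rightarrow> complex poly" where
  "vec_poly \<phi> = (\<Sum>k<dim_vec \<phi>. monom (\<phi> $ k) k)"

lemma coeff_vec_poly: "coeff (vec_poly \<phi>) k = (if k < dim_vec \<phi> then \<phi> $ k else 0)"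
  by (simp add: vec_poly_def coeff_sum)

lemma degree_vec_poly:
  assumes "\<phi> \<in> carrier_vec (N + 1)" shows "degree (vec_poly \<phi>) \<le> N"
proof (rule degree_le, intro allI impI)
  fix i assume "N < i"
  then have "\<not> i < dim_vec \<phi>" using carrier_vecD[OF assms] by linarith
  then show "coeff (vec_poly \<phi>) i = 0" unfolding coeff_vec_poly by (rule if_not_P)
qed

lemma ma_density_vec_poly: "\<phi> \<in> carrier_vec (N + 1) \<Longrightarrow> ma_density \<phi> = poly_density (vec_poly \<phi>)"
proof
  fix t assume \<phi>: "\<phi> \<in> carrier_vec (N + 1)"
  have "(\<Sum>k<dim_vec \<phi>. \<phi> $ k * cis (- (t * real k))) = (\<Sum>k\<le>N. coeff (vec_poly \<phi>) k * cis (- t) ^ k)"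
    using \<phi> unfolding carrier_vec_def
    by (intro sum.cong) (auto simp: coeff_vec_poly Complex.DeMoivre mult.commute)
  then show "ma_density \<phi> t = poly_density (vec_poly \<phi>) t"
    by (simp add: ma_density_def poly_density_def poly_eq_sum_atMost[OF degree_vec_poly[OF \<phi>]])
qed

lemma euclidean_norm_sq: "\<phi> \<in> carrier_vec (N + 1) \<Longrightarrow> (euclidean_norm \<phi>)\<^sup>2 = sqnorm N (coeff (vec_poly \<phi>))"
proof -
  assume \<phi>: "\<phi> \<in> carrier_vec (N + 1)"
  have "(euclidean_norm \<phi>)\<^sup>2 = (\<Sum>i<dim_vec \<phi>. (cmod (\<phi> $ i))\<^sup>2)"
    by (simp add: euclidean_norm_def L2_set_def sum_nonneg)
  also have "\<dots> = sqnorm N (coeff (vec_poly \<phi>))"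
    using \<phi> unfolding sqnorm_def carrier_vec_def by (intro sum.cong) (auto simp: coeff_vec_poly)
  finally show ?thesis .
qed

lemma error_vec_carrier: "error_vec n \<mu> N a \<phi> \<in> carrier_vec (N + 1)"
  by (intro carrier_vecI) (simp add: error_vec_def D_mat_def)

text \<open>The product \<open>D A\<close> is the Hankel matrix of \<open>b\<close>, and a lower triangular Toeplitz factor on the
  right turns a Hankel matrix into a Hankel matrix, here with \<open>e(p) = \<Sum>\<^sub>i b(p + i) w\<^sub>\<mu>(i)\<close>.\<close>

lemma error_vec_eq_hankel:
  assumes \<phi>: "\<phi> \<in> carrier_vec (N + 1)" and k: "k \<le> N"
  shows "error_vec n \<mu> N a \<phi> $ k = hankel N (symbol n \<mu> N a) (coeff (vec_poly \<phi>)) k"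
proof -
  let ?w = "w_coeff n \<mu>" and ?d = "\<lambda>i. complex_of_nat (d_coeff n \<mu> i)" and ?b = "b_coeff n \<mu> N a"
  define x where "x = W_mat n \<mu> N *\<^sub>v \<phi>"
  have dim\<phi>: "dim_vec \<phi> = N + 1" by (rule carrier_vecD[OF \<phi>])
  have dimx: "dim_vec x = N + 1" by (simp add: x_def W_mat_def)
  have x: "x $ l = (\<Sum>j\<le>N. if j \<le> l then ?w (l - j) * \<phi> $ j else 0)" if "l \<le> N" for l
  proof -
    have "x $ l = (\<Sum>j\<in>{0..<N + 1}. (if j \<le> l then ?w (l - j) else 0) * \<phi> $ j)"
      using that dim\<phi> by (simp add: x_def W_mat_def scalar_prod_def)
    also have "\<dots> = (\<Sum>j\<le>N. if j \<le> l then ?w (l - j) * \<phi> $ j else 0)"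
      by (intro sum.cong) auto
    finally show ?thesis .
  qed
  define y where "y = A_mat N a *\<^sub>v x"
  have dimy: "dim_vec y = N + 1" by (simp add: y_def A_mat_def)
  have y: "y $ j = (\<Sum>l\<le>N. if j + l \<le> N then a (j + l) * x $ l else 0)" if "j \<le> N" for j
  proof -
    have "y $ j = (\<Sum>l\<in>{0..<N + 1}. (if j + l \<le> N then a (j + l) else 0) * x $ l)"
      using that dimx by (simp add: y_def A_mat_def scalar_prod_def)
    also have "\<dots> = (\<Sum>l\<le>N. if j + l \<le> N then a (j + l) * x $ l else 0)" by (intro sum.cong) auto
    finally show ?thesis .
  qed
  have "error_vec n \<mu> N a \<phi> $ k = (\<Sum>j\<in>{0..<N + 1}. (if k \<le> j then ?d (j - k) else 0) * y $ j)"
    using k dimy by (simp add: error_vec_def x_def[symmetric] y_def[symmetric] D_mat_def scalar_prod_def)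
  also have "\<dots> = (\<Sum>j\<le>N. if k \<le> j then ?d (j - k) * y $ j else 0)"
    by (intro sum.cong) auto
  also have "\<dots> = (\<Sum>j\<le>N. \<Sum>l\<le>N. if k \<le> j \<and> j + l \<le> N then ?d (j - k) * (a (j + l) * x $ l) else 0)"
    by (intro sum.cong refl) (simp add: y sum_distrib_left if_distrib cong: if_cong)
  also have "\<dots> = (\<Sum>l\<le>N. \<Sum>j\<le>N. if k \<le> j \<and> j + l \<le> N then ?d (j - k) * (a (j + l) * x $ l) else 0)"
    by (rule sum.swap)
  also have "\<dots> = (\<Sum>l\<le>N. (if k + l \<le> N then ?b (k + l) else 0) * x $ l)"
  proof (intro sum.cong refl)
    fix l
    have "(\<Sum>j\<le>N. if k \<le> j \<and> j + l \<le> N then ?d (j - k) * (a (j + l) * x $ l) else 0) =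
        (\<Sum>j\<in>{j. k \<le> j \<and> j + l \<le> N}. ?d (j - k) * (a (j + l) * x $ l))"
      by (intro sum.mono_neutral_cong_right) auto
    also have "\<dots> = (\<Sum>m\<in>{k + l..N}. a m * ?d (m - (k + l)) * x $ l)"
      by (rule sum.reindex_bij_witness[of _ "\<lambda>m. m - l" "\<lambda>j. j + l"]) auto
    also have "\<dots> = (if k + l \<le> N then ?b (k + l) else 0) * x $ l"
      by (auto simp: b_coeff_def sum_distrib_right)
    finally show "(\<Sum>j\<le>N. if k \<le> j \<and> j + l \<le> N then ?d (j - k) * (a (j + l) * x $ l) else 0) =
        (if k + l \<le> N then ?b (k + l) else 0) * x $ l" .
  qed
  also have "\<dots> = (\<Sum>l\<le>N. \<Sum>j\<le>N. if k + l \<le> N \<and> j \<le> l then ?b (k + l) * ?w (l - j) * \<phi> $ j else 0)"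
    by (intro sum.cong refl) (auto simp: x sum_distrib_left mult.assoc intro!: sum.cong)
  also have "\<dots> = (\<Sum>j\<le>N. \<Sum>l\<le>N. if k + l \<le> N \<and> j \<le> l then ?b (k + l) * ?w (l - j) * \<phi> $ j else 0)"
    by (rule sum.swap)
  also have "\<dots> = (\<Sum>j\<le>N. symbol n \<mu> N a (k + j) * coeff (vec_poly \<phi>) j)"
  proof (intro sum.cong refl)
    fix j assume j: "j \<in> {..N}"
    have "(\<Sum>l\<le>N. if k + l \<le> N \<and> j \<le> l then ?b (k + l) * ?w (l - j) * \<phi> $ j else 0) =
        (\<Sum>l\<in>{l. k + l \<le> N \<and> j \<le> l}. ?b (k + l) * ?w (l - j) * \<phi> $ j)"
      by (intro sum.mono_neutral_cong_right) auto
    also have "\<dots> = (\<Sum>i\<in>{i. k + j + i \<le> N}. ?b (k + j + i) * ?w i * \<phi> $ j)"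
      by (rule sum.reindex_bij_witness[of _ "\<lambda>i. i + j" "\<lambda>l. l - j"]) (auto simp: add_ac)
    also have "\<dots> = (\<Sum>i\<le>N. (if k + j + i \<le> N then ?b (k + j + i) * ?w i else 0) * \<phi> $ j)"
      by (intro sum.mono_neutral_cong_left) auto
    also have "\<dots> = symbol n \<mu> N a (k + j) * coeff (vec_poly \<phi>) j"
      using j dim\<phi> by (simp add: hankel_symbol_def sum_distrib_right coeff_vec_poly)
    finally show "(\<Sum>l\<le>N. if k + l \<le> N \<and> j \<le> l then ?b (k + l) * ?w (l - j) * \<phi> $ j else 0) =
        symbol n \<mu> N a (k + j) * coeff (vec_poly \<phi>) j" .
  qed
  finally show ?thesis by (simp add: hankel_def)
qed

lemma error_vec_norm_sq:
  assumes \<phi>: "\<phi> \<in> carrier_vec (N + 1)"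
  shows "(euclidean_norm (error_vec n \<mu> N a \<phi>))\<^sup>2 = sqnorm N (hankel N (symbol n \<mu> N a) (coeff (vec_poly \<phi>)))"
  unfolding euclidean_norm_sq[OF error_vec_carrier]
  using error_vec_carrier[of n \<mu> N a \<phi>]
  by (intro sqnorm_cong) (simp add: coeff_vec_poly error_vec_eq_hankel[OF \<phi>])

text \<open>The moduli of the polynomials of \<open>H\<phi>\<close> and \<open>\<phi>\<close> are proportional on the circle.\<close>

lemma F_density_eq:
  assumes \<phi>: "\<phi> \<in> carrier_vec (N + 1)" and bound: "is_norm_bound N (symbol n \<mu> N a) \<sigma>"
    and ext: "extremal N (symbol n \<mu> N a) \<sigma> (coeff (vec_poly \<phi>))"
  shows "F_density n \<mu> N a c \<phi> t = (cmod c)\<^sup>2 * \<sigma> * ma_density \<phi> t"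
proof -
  have "(cmod (\<Sum>k\<le>N. hankel N (symbol n \<mu> N a) (coeff (vec_poly \<phi>)) k * cis t ^ k))\<^sup>2 =
      \<sigma> * (cmod (\<Sum>k\<le>N. coeff (vec_poly \<phi>) k * cnj (cis t) ^ k))\<^sup>2"
    by (rule extremal_cmod_eq[OF hankel_symbol_beyond bound ext]) auto
  moreover have "(\<Sum>k\<le>N. error_vec n \<mu> N a \<phi> $ k * cis (t * real k)) =
      (\<Sum>k\<le>N. hankel N (symbol n \<mu> N a) (coeff (vec_poly \<phi>)) k * cis t ^ k)"
    by (intro sum.cong refl) (simp add: error_vec_eq_hankel[OF \<phi>] Complex.DeMoivre mult.commute)
  moreover have "(\<Sum>k\<le>N. coeff (vec_poly \<phi>) k * cnj (cis t) ^ k) = poly (vec_poly \<phi>) (cis (- t))"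
    by (simp add: poly_eq_sum_atMost[OF degree_vec_poly[OF \<phi>]] cis_cnj)
  ultimately show ?thesis
    by (simp add: F_density_def ma_density_vec_poly[OF \<phi>] poly_density_def norm_mult power_mult_distrib)
qed

lemma determines_factorization_iff:
  assumes \<phi>: "\<phi> \<in> carrier_vec (N + 1)"
  shows "determines_factorization \<phi> f \<longleftrightarrow>
    (\<forall>z. cmod z \<le> 1 \<longrightarrow> poly (vec_poly \<phi>) z \<noteq> 0) \<and> (\<forall>t\<in>{-pi..pi}. f t = ma_density \<phi> t)"
proof -
  have coeff: "(\<lambda>k. if k < dim_vec \<phi> then \<phi> $ k else 0) = coeff (vec_poly \<phi>)"
    by (simp add: fun_eq_iff coeff_vec_poly)
  have "fps_conv_radius (fps_of_poly (vec_poly \<phi>)) = \<infinity>" by simp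
  then have "conv_radius (coeff (vec_poly \<phi>)) = \<infinity>" unfolding fps_conv_radius_def by simp
  moreover have "(\<Sum>k. coeff (vec_poly \<phi>) k * z ^ k) = poly (vec_poly \<phi>) z" for z
    using poly_sums[of "vec_poly \<phi>" z] by (simp add: sums_iff)
  ultimately show ?thesis
    by (simp add: determines_factorization_def coeff canonical_factorization_def ma_density_vec_poly[OF \<phi>] poly_density_def)
qed

lemma ma_density_in_D0:
  "\<phi> \<in> carrier_vec (N + 1) \<Longrightarrow> ma_density \<phi> \<in> D0 P0 \<longleftrightarrow> (euclidean_norm \<phi>)\<^sup>2 \<le> P0"
  by (simp add: ma_density_vec_poly poly_density_in_D0[OF degree_vec_poly] euclidean_norm_sq)

lemma ma_density_integral:
  assumes \<phi>: "\<phi> \<in> carrier_vec (N + 1)"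
  shows "(LINT t:{-pi..pi}|lborel. ma_density \<phi> t) = 2 * pi * (euclidean_norm \<phi>)\<^sup>2"
  using integral_poly_density[OF degree_vec_poly[OF \<phi>]] integral_circ[OF poly_density_measurable[of "vec_poly \<phi>"]]
  by (simp add: ma_density_vec_poly[OF \<phi>] euclidean_norm_sq[OF \<phi>])

text \<open>Rescaling a zero-free extremal polynomial.  If \<open>\<sigma> > 0\<close>, the resulting vector is a candidate in
  the supremum \<open>nu_plus\<close>, which is then at least \<open>\<sigma>\<close>.\<close>

lemma extremal_vec_exists:
  assumes P0: "P0 > 0"
  shows "\<exists>\<sigma> \<phi>. is_norm_bound N (symbol n \<mu> N a) \<sigma> \<and> \<phi> \<in> carrier_vec (N + 1) \<and>
    extremal N (symbol n \<mu> N a) \<sigma> (coeff (vec_poly \<phi>)) \<and> (euclidean_norm \<phi>)\<^sup>2 = P0 \<and>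
    (\<forall>z. cmod z \<le> 1 \<longrightarrow> poly (vec_poly \<phi>) z \<noteq> 0)"
proof -
  have "symbol n \<mu> N a p = 0" if "p > N" for p using that by (rule hankel_symbol_beyond)
  from extremal_zero_free[of N "symbol n \<mu> N a", OF this] obtain \<sigma> p where
    p: "is_norm_bound N (symbol n \<mu> N a) \<sigma>" "extremal N (symbol n \<mu> N a) \<sigma> (coeff p)" "degree p \<le> N"
      "\<And>z. cmod z \<le> 1 \<Longrightarrow> poly p z \<noteq> 0" by blast
  have "coeff p 0 \<noteq> 0" using p(4)[of 0] by (simp add: poly_0_coeff_0)
  then have "sqnorm N (coeff p) \<noteq> 0" by (auto simp: sqnorm_eq_0)
  then have pos: "sqnorm N (coeff p) > 0" using sqnorm_nonneg[of N "coeff p"] by linarith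
  define s where "s = complex_of_real (sqrt (P0 / sqnorm N (coeff p)))"
  have s: "s \<noteq> 0" "(cmod s)\<^sup>2 = P0 / sqnorm N (coeff p)"
  proof -
    show "s \<noteq> 0" using P0 pos by (simp add: s_def)
    show "(cmod s)\<^sup>2 = P0 / sqnorm N (coeff p)" unfolding s_def norm_of_real power2_abs using P0 pos by simp
  qed
  define \<phi> where "\<phi> = vec (N + 1) (\<lambda>k. s * coeff p k)"
  have \<phi>: "\<phi> \<in> carrier_vec (N + 1)" by (simp add: \<phi>_def)
  have vp: "vec_poly \<phi> = Polynomial.smult s p"
    using p(3) by (intro poly_eqI) (auto simp: coeff_vec_poly \<phi>_def coeff_eq_0)
  have co: "coeff (vec_poly \<phi>) = (\<lambda>k. s * coeff p k)" by (simp add: vp fun_eq_iff)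
  have "extremal N (symbol n \<mu> N a) \<sigma> (coeff (vec_poly \<phi>))"
    unfolding extremal_def co hankel_linear sqnorm_scale using p(2) by (simp add: extremal_def)
  moreover have "(euclidean_norm \<phi>)\<^sup>2 = P0"
    unfolding euclidean_norm_sq[OF \<phi>] co sqnorm_scale s(2) using pos by simp
  moreover have "\<forall>z. cmod z \<le> 1 \<longrightarrow> poly (vec_poly \<phi>) z \<noteq> 0" using p(4) s(1) by (simp add: vp)
  ultimately show ?thesis using p(1) \<phi> by blast
qed

theorem theorem5p2:
  fixes n \<mu> N :: nat and P0 :: real and a :: "nat \<Rightarrow> complex"
  assumes "n \<ge> 1" and "\<mu> > 0" and "P0 > 0"
  shows
    "(\<forall>\<phi>0. (solves_E1 n \<mu> N a \<phi>0 \<or> solves_E2 n \<mu> N a \<phi>0) \<longrightarrow>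
        (euclidean_norm \<phi>0)\<^sup>2 = P0 \<longrightarrow>
        nu n \<mu> N a P0 * ereal P0 = nu_plus n \<mu> N a P0 * ereal P0 \<longrightarrow>
        nu_plus n \<mu> N a P0 * ereal P0 = ereal ((euclidean_norm (error_vec n \<mu> N a \<phi>0))\<^sup>2) \<longrightarrow>
        least_favorable n \<mu> N a (D0 P0) (ma_density \<phi>0) \<and>
        (\<forall>(M :: 'w measure) \<xi>. prob_space M \<longrightarrow> has_spectral_density M n \<xi> (ma_density \<phi>0) \<longrightarrow>
           moving_average_increments M n \<mu> N \<xi>)) \<and>
     (nu n \<mu> N a P0 < nu_plus n \<mu> N a P0 \<longrightarrow>
        (\<exists>\<phi> c. extremal_vec n \<mu> N a P0 \<phi> \<and>
           determines_factorization \<phi> (F_density n \<mu> N a c \<phi>) \<and>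
           (LINT t:{-pi..pi}|lborel. F_density n \<mu> N a c \<phi> t) = 2 * pi * P0) \<and>
        (\<forall>\<phi> c. extremal_vec n \<mu> N a P0 \<phi> \<longrightarrow>
           admits_canonical_factorization (F_density n \<mu> N a c \<phi>) \<longrightarrow>
           (LINT t:{-pi..pi}|lborel. F_density n \<mu> N a c \<phi> t) = 2 * pi * P0 \<longrightarrow>
           least_favorable n \<mu> N a (D0 P0) (F_density n \<mu> N a c \<phi>)))"
proof -
  note mu = assms(2) and P0 = assms(3)
  let ?e = "symbol n \<mu> N a" and ?C = "carrier_vec (N + 1) :: complex vec set"
  obtain \<sigma> \<psi> where bound: "is_norm_bound N ?e \<sigma>" and \<psi>: "\<psi> \<in> ?C" "extremal N ?e \<sigma> (coeff (vec_poly \<psi>))"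
    "(euclidean_norm \<psi>)\<^sup>2 = P0" "\<forall>z. cmod z \<le> 1 \<longrightarrow> poly (vec_poly \<psi>) z \<noteq> 0"
    using extremal_vec_exists[OF P0] by blast
  have s0: "0 \<le> \<sigma>" by (rule norm_bound_nonneg[OF bound])
  have err_le: "(euclidean_norm (error_vec n \<mu> N a \<phi>))\<^sup>2 \<le> \<sigma> * (euclidean_norm \<phi>)\<^sup>2" if "\<phi> \<in> ?C" for \<phi>
    using bound unfolding error_vec_norm_sq[OF that] euclidean_norm_sq[OF that] by (simp add: is_norm_bound_def)
  have ext_iff: "extremal N ?e \<sigma> (coeff (vec_poly \<phi>)) \<longleftrightarrow> (euclidean_norm (error_vec n \<mu> N a \<phi>))\<^sup>2 = \<sigma> * (euclidean_norm \<phi>)\<^sup>2"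
    if "\<phi> \<in> ?C" for \<phi>
    unfolding error_vec_norm_sq[OF that] euclidean_norm_sq[OF that] extremal_def ..
  have lf: "least_favorable n \<mu> N a (D0 P0) (ma_density \<phi>)"
    if \<phi>: "\<phi> \<in> ?C" and ext: "extremal N ?e \<sigma> (coeff (vec_poly \<phi>))" and P: "(euclidean_norm \<phi>)\<^sup>2 = P0" for \<phi>
    unfolding ma_density_vec_poly[OF \<phi>]
    using P by (intro extremal_least_favorable[OF mu bound ext degree_vec_poly[OF \<phi>]]) (simp add: euclidean_norm_sq[OF \<phi>])
  have F_\<psi>: "determines_factorization \<psi> (F_density n \<mu> N a (1 / sqrt \<sigma>) \<psi>)" if "\<sigma> > 0"
    unfolding determines_factorization_iff[OF \<psi>(1)] F_density_eq[OF \<psi>(1) bound \<psi>(2)]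
    using \<psi>(4) that by (simp add: norm_divide power_divide)
  have nu_ge: "ereal \<sigma> \<le> nu_plus n \<mu> N a P0" if pos: "\<sigma> > 0"
  proof -
    have "(euclidean_norm (error_vec n \<mu> N a \<psi>))\<^sup>2 / P0 = \<sigma>" using ext_iff[OF \<psi>(1)] \<psi>(2,3) P0 by simp
    moreover have "ereal ((euclidean_norm (error_vec n \<mu> N a \<psi>))\<^sup>2 / P0) \<le> nu_plus n \<mu> N a P0"
      unfolding nu_plus_def using \<psi>(1,3) F_\<psi>[OF pos] by (intro SUP_upper) auto
    ultimately show ?thesis by simp
  qed
  have part1: "least_favorable n \<mu> N a (D0 P0) (ma_density \<phi>0) \<and>
      (\<forall>(M :: 'w measure) \<xi>. prob_space M \<longrightarrow> has_spectral_density M n \<xi> (ma_density \<phi>0) \<longrightarrow>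
        moving_average_increments M n \<mu> N \<xi>)"
    if \<phi>0: "\<phi>0 \<in> ?C" and P: "(euclidean_norm \<phi>0)\<^sup>2 = P0"
      and max: "nu_plus n \<mu> N a P0 * ereal P0 = ereal ((euclidean_norm (error_vec n \<mu> N a \<phi>0))\<^sup>2)" for \<phi>0
  proof -
    have "\<sigma> * P0 \<le> (euclidean_norm (error_vec n \<mu> N a \<phi>0))\<^sup>2"
    proof (cases "\<sigma> > 0")
      case True
      have "ereal \<sigma> * ereal P0 \<le> nu_plus n \<mu> N a P0 * ereal P0"
        using nu_ge[OF True] P0 by (intro ereal_mult_right_mono) auto
      then show ?thesis unfolding max by simp
    next
      case False
      then show ?thesis using s0 by simp
    qed
    then have ext: "extremal N ?e \<sigma> (coeff (vec_poly \<phi>0))"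
      unfolding ext_iff[OF \<phi>0] using err_le[OF \<phi>0] P by simp
    have "vec_poly \<phi>0 \<noteq> 0"
    proof
      assume "vec_poly \<phi>0 = 0"
      then have "(euclidean_norm \<phi>0)\<^sup>2 = 0" unfolding euclidean_norm_sq[OF \<phi>0] by (simp add: sqnorm_def)
      then show False using P P0 by simp
    qed
    then show ?thesis
      using lf[OF \<phi>0 ext P] moving_average_poly_density[OF mu degree_vec_poly[OF \<phi>0]]
      unfolding ma_density_vec_poly[OF \<phi>0] by blast
  qed
  have part2: "(\<exists>\<phi> c. extremal_vec n \<mu> N a P0 \<phi> \<and> determines_factorization \<phi> (F_density n \<mu> N a c \<phi>) \<and>
        (LINT t:{-pi..pi}|lborel. F_density n \<mu> N a c \<phi> t) = 2 * pi * P0) \<and>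
      (\<forall>\<phi> c. extremal_vec n \<mu> N a P0 \<phi> \<longrightarrow>
        (LINT t:{-pi..pi}|lborel. F_density n \<mu> N a c \<phi> t) = 2 * pi * P0 \<longrightarrow>
        least_favorable n \<mu> N a (D0 P0) (F_density n \<mu> N a c \<phi>))"
    if less: "nu n \<mu> N a P0 < nu_plus n \<mu> N a P0"
  proof -
    have pos: "\<sigma> > 0"
    proof (rule ccontr)
      assume "\<not> \<sigma> > 0"
      then have sz: "\<sigma> = 0" using s0 by simp
      \<comment> \<open>then \<open>F_density\<close> vanishes identically, and \<open>nu_plus\<close> is the supremum of the empty set\<close>
      have "\<not> determines_factorization \<phi> (F_density n \<mu> N a c \<phi>)" if "\<phi> \<in> ?C" for \<phi> c
      proof
        assume det: "determines_factorization \<phi> (F_density n \<mu> N a c \<phi>)"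
        have "extremal N ?e 0 (coeff (vec_poly \<phi>))"
        proof -
          have "(euclidean_norm (error_vec n \<mu> N a \<phi>))\<^sup>2 \<le> 0" using err_le[OF that] sz by simp
          then show ?thesis using ext_iff[OF that] sz by simp
        qed
        then have "F_density n \<mu> N a c \<phi> 0 = 0" using F_density_eq[OF that, of n \<mu> a 0 c 0] bound sz by simp
        moreover have "F_density n \<mu> N a c \<phi> 0 = ma_density \<phi> 0" "poly (vec_poly \<phi>) 1 \<noteq> 0"
          using det unfolding determines_factorization_iff[OF that] by auto
        ultimately show False by (simp add: ma_density_vec_poly[OF that] poly_density_def)
      qed
      then have none: "{\<phi> \<in> ?C. (euclidean_norm \<phi>)\<^sup>2 = P0 \<and> (\<exists>c. determines_factorization \<phi> (F_density n \<mu> N a c \<phi>))} = {}"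
        by blast
      have "nu_plus n \<mu> N a P0 = - \<infinity>" unfolding nu_plus_def none by (simp add: bot_ereal_def)
      then show False using less by simp
    qed
    have ext\<psi>: "extremal_vec n \<mu> N a P0 \<psi>"
      unfolding extremal_vec_def
    proof (intro conjI ballI impI \<psi>(1))
      show "ma_density \<psi> \<in> D0 P0" using \<psi>(3) by (simp add: ma_density_in_D0[OF \<psi>(1)])
      fix \<phi> assume \<phi>: "\<phi> \<in> ?C" "ma_density \<phi> \<in> D0 P0"
      have "(euclidean_norm (error_vec n \<mu> N a \<phi>))\<^sup>2 \<le> \<sigma> * (euclidean_norm \<phi>)\<^sup>2" by (rule err_le[OF \<phi>(1)])
      also have "\<dots> \<le> \<sigma> * P0" using \<phi>(2) s0 by (intro mult_left_mono) (auto simp: ma_density_in_D0[OF \<phi>(1)])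
      also have "\<dots> = (euclidean_norm (error_vec n \<mu> N a \<psi>))\<^sup>2" using ext_iff[OF \<psi>(1)] \<psi>(2,3) by simp
      finally show "(euclidean_norm (error_vec n \<mu> N a \<phi>))\<^sup>2 \<le> (euclidean_norm (error_vec n \<mu> N a \<psi>))\<^sup>2" .
    qed
    have F_int: "(LINT t:{-pi..pi}|lborel. F_density n \<mu> N a c \<phi> t) = (cmod c)\<^sup>2 * \<sigma> * (2 * pi * (euclidean_norm \<phi>)\<^sup>2)"
      if "\<phi> \<in> ?C" "extremal N ?e \<sigma> (coeff (vec_poly \<phi>))" for \<phi> c
      unfolding F_density_eq[OF that(1) bound that(2)] ma_density_integral[OF that(1), symmetric] by simp
    have int\<psi>: "(LINT t:{-pi..pi}|lborel. F_density n \<mu> N a (1 / sqrt \<sigma>) \<psi> t) = 2 * pi * P0"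
      unfolding F_int[OF \<psi>(1,2)] \<psi>(3) using pos by (simp add: norm_divide power_divide)
    have "least_favorable n \<mu> N a (D0 P0) (F_density n \<mu> N a c \<phi>)"
      if ext: "extremal_vec n \<mu> N a P0 \<phi>" and int: "(LINT t:{-pi..pi}|lborel. F_density n \<mu> N a c \<phi> t) = 2 * pi * P0" for \<phi> c
    proof -
      have \<phi>: "\<phi> \<in> ?C" and D: "(euclidean_norm \<phi>)\<^sup>2 \<le> P0"
        using ext ma_density_in_D0 by (auto simp: extremal_vec_def)
      have "\<sigma> * P0 = (euclidean_norm (error_vec n \<mu> N a \<psi>))\<^sup>2" using ext_iff[OF \<psi>(1)] \<psi>(2,3) by simp
      also have "\<dots> \<le> (euclidean_norm (error_vec n \<mu> N a \<phi>))\<^sup>2"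
        using ext ext\<psi> by (auto simp: extremal_vec_def)
      finally have ge: "\<sigma> * P0 \<le> (euclidean_norm (error_vec n \<mu> N a \<phi>))\<^sup>2" .
      have "\<sigma> * P0 \<le> \<sigma> * (euclidean_norm \<phi>)\<^sup>2" using ge err_le[OF \<phi>] by linarith
      then have P: "(euclidean_norm \<phi>)\<^sup>2 = P0" using pos D by simp
      have ex: "extremal N ?e \<sigma> (coeff (vec_poly \<phi>))" unfolding ext_iff[OF \<phi>] P using ge err_le[OF \<phi>] P by simp
      have "(cmod c)\<^sup>2 * \<sigma> = 1" using int P0 unfolding F_int[OF \<phi> ex] P by simp
      then have "F_density n \<mu> N a c \<phi> = ma_density \<phi>"
        by (simp add: fun_eq_iff F_density_eq[OF \<phi> bound ex])
      then show ?thesis using lf[OF \<phi> ex P] by simp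
    qed
    then show ?thesis using ext\<psi> F_\<psi>[OF pos] int\<psi> by blast
  qed
  have "solves_E1 n \<mu> N a \<phi> \<or> solves_E2 n \<mu> N a \<phi> \<Longrightarrow> \<phi> \<in> ?C" for \<phi>
    by (auto simp: solves_E1_def solves_E2_def)
  with part1 part2 show ?thesis by blast
qed

end
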